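(* Let $\mathbb{k}=\mathbb{F}_{3^6}$, $\mathbb{W}=\mathbb{W}(\mathbb{k})$, and let $\tilde S^*_{\mathbb{k}}=(\mathbb{W}/9)[b_1^{\pm},s_3^{\pm}][[s_1,s_2]]$. With $M,\Delta,I$ as in the context, there is an isomorphism of $\tilde S^*_{\mathbb{k}}$-modules $$\hat H^*(C_9;(\Delta^{-1}M)^\wedge_I)\cong \tilde S^*_{\mathbb{k}}\{1,\bar c,\delta,\bar c\delta,f_0,\dots,f_5,F_0,\dots,F_5\}\big/(3s_1,3s_2,3\delta,3\bar c\delta,3f_i,3F_i).$$
   Context: $C_9=\langle\gamma\rangle$, $C_3=\langle\gamma^3\rangle$. $M=\mathbb{W}[x_0,\dots,x_8]/(x_0+x_3+x_6,\,x_1+x_4+x_7,\,x_2+x_5+x_8)$, graded with $|x_i|=-2$, with $\gamma x_i=x_{i+1}$ (indices mod $9$); $\Delta=\prod_{i=0}^8x_i$; $I=(3,x_0-x_1,x_1-x_2,\dots,x_7-x_8)$. Completions and power series rings are formed in the graded sense. $\hat H^*$ is Tate cohomology. $X\{g_1,\dots,g_r\}$ denotes the free $X$-module on the $g_i$; in the quotient, $3s_1$ and $3s_2$ annihilate every generator, and $3$ annihilates $\delta$, $\bar c\delta$, and all $f_i,F_i$ ($0\le i\le 5$). Meaning of the classes: $d_1=x_0x_3x_6$, $d_2=x_1x_4x_7$, $d_3=x_2x_5x_8$; $s_1,s_2,s_3$ are the elementary symmetric polynomials in $d_1,d_2,d_3$ (so $s_3=\Delta$), in cohomological degree $0$; $b_1$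 is the periodicity generator, $\hat H^*(C_9;\mathbb{W})=(\mathbb{W}/9)[b_1^\pm]$, $|b_1|=2$; $c_1$ generates $\hat H^1(C_3;\mathbb{W}\{x_0,x_3,x_6\}/(x_0+x_3+x_6))$, $c_2=\gamma c_1$, $c_3=\gamma c_2$. The other generators are detected, in the localized Serre spectral sequence $H^p(C_9/C_3;\hat H^q(C_3;(\Delta^{-1}M)^\wedge_I))\Rightarrow\hat H^{p+q}(C_9;(\Delta^{-1}M)^\wedge_I)$ in filtration $p=0$, by the following elements of $\hat H^*(C_3;M)^{C_9/C_3}$, where $\mathrm{tr}(X)=X+\gamma X+\gamma^2X$: $\bar c=c_1c_2c_3$, $\delta=(d_1-d_2)(d_2-d_3)(d_3-d_1)$, $f_0=\mathrm{tr}(c_1)$, $f_1=\mathrm{tr}(c_1d_1)$, $f_2=\mathrm{tr}(c_1d_2)$, $f_3=\mathrm{tr}(c_1d_1d_2)$, $f_4=\mathrm{tr}(c_1d_2d_3)$, $f_5=\mathrm{tr}(c_1d_1^2d_2)$, and $F_i$ is given by the same formula as $f_i$ with the factor $c_1$ replaced by $c_1c_2$. Cohomological degrees: $|\delta|=0$, $|f_i|=1$, $|F_i|=2$, $|\bar c|=|\bar c\delta|=3$. *)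

theory Defs
  imports
    "HOL-Library.Poly_Mapping"
    "HOL-Library.Numeral_Type"
    "HOL-Library.Product_Plus"
    "HOL-Library.Function_Algebras"
    "HOL-Computational_Algebra.Formal_Power_Series"
    "HOL-Algebra.Coset"
begin

section \<open>The coefficient ring\<close>

text \<open>
  For a perfect field \<open>k\<close> of characteristic \<open>p\<close>, the ring of Witt vectors \<open>W(k)\<close> is the strict
  \<open>p\<close>-ring with residue ring \<open>k\<close> (Serre, Local Fields, II.5--6): \<open>p\<close> is not a zero divisor, the
  ring is complete and Hausdorff for the \<open>p\<close>-adic topology, and its residue ring modulo \<open>p\<close> is
  \<open>k\<close>.  It is unique up to unique isomorphism over \<open>k\<close>.  The class below contains the
  conditions on the ring itself (for \<open>p = 3\<close>); the identification of the residue ring is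
  \<open>is_residue_map\<close>.
\<close>

class strict_3_ring = comm_ring_1 +
  assumes three_torsion_free: "3 * x = 0 \<Longrightarrow> x = 0"
    and three_complete: "(\<And>k. 3 ^ k dvd (a (Suc k) - a k)) \<Longrightarrow> \<exists>!l. \<forall>k. 3 ^ k dvd (a k - l)"

definition is_residue_map :: "('w::strict_3_ring \<Rightarrow> 'k::field) \<Rightarrow> bool" where
  "is_residue_map \<pi> \<longleftrightarrow>
     \<pi> 1 = 1 \<and> (\<forall>x y. \<pi> (x + y) = \<pi> x + \<pi> y) \<and> (\<forall>x y. \<pi> (x * y) = \<pi> x * \<pi> y) \<and>
     surj \<pi> \<and> (\<forall>x. \<pi> x = 0 \<longleftrightarrow> 3 dvd x)"

lemma three_not_dvd_one: "\<not> (3::'w::strict_3_ring) dvd 1"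
proof
  assume "(3::'w) dvd 1"
  hence *: "(3::'w) ^ k dvd x" for k x
    by (metis dvd_power_same dvd_trans one_dvd power_one)
  have "\<exists>!l::'w. \<forall>k. 3 ^ k dvd ((\<lambda>_. 0) k - l)"
    by (rule three_complete) simp
  with * show False by (metis zero_neq_one)
qed

lemma diff_diff_eq_diff: "(a - c) - (b - d) = (a - b) - (c - d)" for a b c d :: "'a::ab_group_add"
  by (simp add: algebra_simps)

lemma diff_eq_sum: "a - c = (a - b) + (b - c)" for a b c :: "'a::ab_group_add"
  by simp

lemma minus_diff_eq_minus: "- a - - b = - (a - b)" for a b :: "'a::ab_group_add"
  by simp

text \<open>The ring \<open>W/9\<close>.\<close>

quotient_type (overloaded) 'w W9 = "'w::strict_3_ring" / "\<lambda>x y. 9 dvd (x - y)"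
proof (rule equivpI)
  show "reflp (\<lambda>x y::'w. 9 dvd (x - y))" by (simp add: reflp_def)
  show "symp (\<lambda>x y::'w. 9 dvd (x - y))" by (rule sympI) (subst minus_diff_eq[symmetric], simp only: dvd_minus_iff)
  show "transp (\<lambda>x y::'w. 9 dvd (x - y))"
    by (rule transpI) (subst diff_eq_sum, rule dvd_add)
qed

instantiation W9 :: (strict_3_ring) comm_ring_1
begin

lift_definition zero_W9 :: "'a W9" is 0 .
lift_definition one_W9 :: "'a W9" is 1 .
lift_definition plus_W9 :: "'a W9 \<Rightarrow> 'a W9 \<Rightarrow> 'a W9" is "(+)"
  by (simp only: add_diff_add dvd_add)
lift_definition minus_W9 :: "'a W9 \<Rightarrow> 'a W9 \<Rightarrow> 'a W9" is "(-)"
  by (simp only: diff_diff_eq_diff dvd_diff)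
lift_definition uminus_W9 :: "'a W9 \<Rightarrow> 'a W9" is uminus
  by (simp only: minus_diff_eq_minus dvd_minus_iff)
lift_definition times_W9 :: "'a W9 \<Rightarrow> 'a W9 \<Rightarrow> 'a W9" is "(*)"
  by (simp add: mult_diff_mult)

instance
proof
  show "(0::'a W9) \<noteq> 1"
  proof (transfer, rule notI)
    assume "(9::'a) dvd 0 - 1"
    hence "(9::'a) dvd 1" by (metis diff_0 dvd_minus_iff)
    moreover have "(3::'a) dvd 9" by (rule dvdI[of _ _ 3]) simp
    ultimately show False using three_not_dvd_one dvd_trans by blast
  qed
qed (transfer; simp add: algebra_simps)+

end


section \<open>Ideals\<close>

definition ideal_gen :: "'a::comm_ring_1 set \<Rightarrow> 'a set" where
  "ideal_gen S = module.span (*) S"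

primrec ideal_pow :: "'a::comm_ring_1 set \<Rightarrow> nat \<Rightarrow> 'a set" where
  "ideal_pow I 0 = UNIV"
| "ideal_pow I (Suc k) = ideal_gen {a * b | a b. a \<in> I \<and> b \<in> ideal_pow I k}"

lemma module_mult: "module ((*) :: 'a::comm_ring_1 \<Rightarrow> 'a \<Rightarrow> 'a)"
  by unfold_locales (simp_all add: algebra_simps)

lemma ideal_gen_base: "x \<in> S \<Longrightarrow> x \<in> ideal_gen S"
  unfolding ideal_gen_def by (rule module.span_base[OF module_mult])

lemma ideal_gen_zero: "0 \<in> ideal_gen S"
  unfolding ideal_gen_def by (rule module.span_zero[OF module_mult])

lemma ideal_gen_add: "x \<in> ideal_gen S \<Longrightarrow> y \<in> ideal_gen S \<Longrightarrow> x + y \<in> ideal_gen S"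
  unfolding ideal_gen_def by (rule module.span_add[OF module_mult])

lemma ideal_gen_diff: "x \<in> ideal_gen S \<Longrightarrow> y \<in> ideal_gen S \<Longrightarrow> x - y \<in> ideal_gen S"
  unfolding ideal_gen_def by (rule module.span_diff[OF module_mult])

lemma ideal_gen_uminus: "x \<in> ideal_gen S \<Longrightarrow> - x \<in> ideal_gen S"
  unfolding ideal_gen_def by (rule module.span_neg[OF module_mult])

lemma ideal_gen_mult: "x \<in> ideal_gen S \<Longrightarrow> c * x \<in> ideal_gen S"
  unfolding ideal_gen_def by (rule module.span_scale[OF module_mult])

lemma ideal_gen_mult': "x \<in> ideal_gen S \<Longrightarrow> x * c \<in> ideal_gen S"
  by (metis ideal_gen_mult mult.commute)

lemma ideal_gen_induct [consumes 1, case_names zero step]: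
  assumes "x \<in> ideal_gen S" "P 0" "\<And>c x y. x \<in> S \<Longrightarrow> P y \<Longrightarrow> P (c * x + y)"
  shows "P x"
  using assms unfolding ideal_gen_def by (rule module.span_induct_alt[OF module_mult])

lemma ideal_gen_hom:
  assumes "x \<in> ideal_gen S" "\<And>x y. h (x + y) = h x + h y" "\<And>x y. h (x * y) = h x * h y"
    and "h 0 = 0" "\<And>x. x \<in> S \<Longrightarrow> h x \<in> ideal_gen T"
  shows "h x \<in> ideal_gen T"
  using assms(1)
proof (induction rule: ideal_gen_induct)
  case zero
  then show ?case using assms(4) ideal_gen_zero by metis
next
  case (step c x y)
  then show ?case by (simp add: assms ideal_gen_add ideal_gen_mult)
qed

lemma ideal_pow_zero_mem: "0 \<in> ideal_pow I k"
  by (cases k) (simp_all add: ideal_gen_zero)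
lemma ideal_pow_add: "x \<in> ideal_pow I k \<Longrightarrow> y \<in> ideal_pow I k \<Longrightarrow> x + y \<in> ideal_pow I k"
  by (cases k) (simp_all add: ideal_gen_add)
lemma ideal_pow_diff: "x \<in> ideal_pow I k \<Longrightarrow> y \<in> ideal_pow I k \<Longrightarrow> x - y \<in> ideal_pow I k"
  by (cases k) (simp_all add: ideal_gen_diff)
lemma ideal_pow_uminus: "x \<in> ideal_pow I k \<Longrightarrow> - x \<in> ideal_pow I k"
  by (cases k) (simp_all add: ideal_gen_uminus)
lemma ideal_pow_mult: "x \<in> ideal_pow I k \<Longrightarrow> c * x \<in> ideal_pow I k"
  by (cases k) (simp_all add: ideal_gen_mult)

lemma ideal_pow_hom:
  assumes "x \<in> ideal_pow I k" "\<And>x y. h (x + y) = h x + h y" "\<And>x y. h (x * y) = h x * h y"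
    and "h 0 = 0" "\<And>x. x \<in> I \<Longrightarrow> h x \<in> J"
  shows "h x \<in> ideal_pow J k"
  using assms(1)
proof (induction k arbitrary: x)
  case (Suc k)
  show ?case
    unfolding ideal_pow.simps
  proof (rule ideal_gen_hom[OF Suc.prems[unfolded ideal_pow.simps] assms(2-4)])
    fix x assume "x \<in> {a * b |a b. a \<in> I \<and> b \<in> ideal_pow I k}"
    thus "h x \<in> ideal_gen {a * b |a b. a \<in> J \<and> b \<in> ideal_pow J k}"
      using Suc.IH assms(3,5) by (fastforce intro!: ideal_gen_base)
  qed
qed simp


section \<open>Polynomials in \<open>x\<^sub>0, \<dots>, x\<^sub>8\<close>\<close>

text \<open>The index type \<open>9\<close> is the ring of integers modulo 9, so indices are cyclic.\<close>

type_synonym 'w poly9 = "(9 \<Rightarrow>\<^sub>0 nat) \<Rightarrow>\<^sub>0 'w"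

definition pvar :: "9 \<Rightarrow> 'w::comm_ring_1 poly9" where
  "pvar i = Poly_Mapping.single (Poly_Mapping.single i 1) 1"

definition pconst :: "'w::comm_ring_1 \<Rightarrow> 'w poly9" where
  "pconst w = Poly_Mapping.single 0 w"

definition poly9_subst :: "('w::comm_ring_1 \<Rightarrow> 'b::comm_ring_1) \<Rightarrow> (9 \<Rightarrow> 'b) \<Rightarrow> 'w poly9 \<Rightarrow> 'b" where
  "poly9_subst c f p =
     (\<Sum>e\<in>Poly_Mapping.keys p. c (Poly_Mapping.lookup p e) * (\<Prod>i\<in>UNIV. f i ^ Poly_Mapping.lookup e i))"

context
  fixes c :: "'w::comm_ring_1 \<Rightarrow> 'b::comm_ring_1" and f :: "9 \<Rightarrow> 'b"
  assumes c_add: "\<And>x y. c (x + y) = c x + c y" and c_mult: "\<And>x y. c (x * y) = c x * c y"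
    and c_one: "c 1 = 1"
begin

lemma c_zero: "c 0 = 0"
  using c_add[of 0 0] by simp

lemma poly9_subst_superset:
  assumes "finite A" "Poly_Mapping.keys p \<subseteq> A"
  shows "poly9_subst c f p =
     (\<Sum>e\<in>A. c (Poly_Mapping.lookup p e) * (\<Prod>i\<in>UNIV. f i ^ Poly_Mapping.lookup e i))"
  unfolding poly9_subst_def
  by (rule sum.mono_neutral_left) (use assms in \<open>auto simp: c_zero in_keys_iff\<close>)

lemma poly9_subst_zero: "poly9_subst c f 0 = 0"
  by (simp add: poly9_subst_def)

lemma poly9_subst_add: "poly9_subst c f (p + q) = poly9_subst c f p + poly9_subst c f q"
proof -
  let ?A = "Poly_Mapping.keys p \<union> Poly_Mapping.keys q"
  show ?thesis
    by (subst (1 2 3) poly9_subst_superset[where A = ?A])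
       (use Poly_Mapping.keys_add[of p q] in
         \<open>auto simp: lookup_add c_add algebra_simps sum.distrib\<close>)
qed

lemma poly9_subst_sum: "poly9_subst c f (\<Sum>i\<in>A. g i) = (\<Sum>i\<in>A. poly9_subst c f (g i))"
  by (induction A rule: infinite_finite_induct) (simp_all add: poly9_subst_zero poly9_subst_add)

lemma poly9_subst_single:
  "poly9_subst c f (Poly_Mapping.single e w) = c w * (\<Prod>i\<in>UNIV. f i ^ Poly_Mapping.lookup e i)"
  by (subst poly9_subst_superset[where A = "{e}"]) auto

lemma poly9_subst_mult: "poly9_subst c f (p * q) = poly9_subst c f p * poly9_subst c f q"
proof -
  have sum: "p = (\<Sum>e\<in>Poly_Mapping.keys p. Poly_Mapping.single e (Poly_Mapping.lookup p e))" for p :: "'w poly9"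
    by (rule poly_mapping_eqI)
       (auto simp: lookup_sum lookup_single when_def in_keys_iff sum.delta)
  have "p * q = (\<Sum>e\<in>Poly_Mapping.keys p. \<Sum>e'\<in>Poly_Mapping.keys q.
      Poly_Mapping.single (e + e') (Poly_Mapping.lookup p e * Poly_Mapping.lookup q e'))"
    by (subst sum[of p], subst sum[of q]) (simp add: sum_product mult_single)
  thus ?thesis
    by (simp add: poly9_subst_sum poly9_subst_single c_mult lookup_add power_add prod.distrib
        poly9_subst_def[of c f p] poly9_subst_def[of c f q] sum_product mult_ac)
qed

lemma poly9_subst_one: "poly9_subst c f 1 = 1"
  by (simp add: poly9_subst_single c_one flip: single_one)

lemma poly9_subst_pvar: "poly9_subst c f (pvar i) = f i"
proof -
  have "(\<Prod>j\<in>UNIV. f j ^ Poly_Mapping.lookup (Poly_Mapping.single i 1) j) =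
      (\<Prod>j\<in>UNIV. if j = i then f i else 1)"
    by (rule prod.cong) (auto simp: lookup_single when_def)
  thus ?thesis by (simp add: pvar_def poly9_subst_single c_one)
qed

end

lemma pconst_hom:
  "pconst (x + y) = pconst x + pconst y" "pconst (x * y) = pconst x * pconst y" "pconst 1 = 1"
  by (simp_all add: pconst_def single_add mult_single)


section \<open>The ring \<open>M\<close>\<close>

definition M_relations :: "'w::comm_ring_1 poly9 set" where
  "M_relations = {pvar 0 + pvar 3 + pvar 6, pvar 1 + pvar 4 + pvar 7, pvar 2 + pvar 5 + pvar 8}"

quotient_type (overloaded) 'w M = "'w::strict_3_ring poly9" / "\<lambda>p q. p - q \<in> ideal_gen M_relations"
proof (rule equivpI)
  show "reflp (\<lambda>p q::'w poly9. p - q \<in> ideal_gen M_relations)"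
    by (simp add: reflp_def ideal_gen_zero)
  show "symp (\<lambda>p q::'w poly9. p - q \<in> ideal_gen M_relations)"
    by (rule sympI) (subst minus_diff_eq[symmetric], rule ideal_gen_uminus)
  show "transp (\<lambda>p q::'w poly9. p - q \<in> ideal_gen M_relations)"
    by (rule transpI) (subst diff_eq_sum, rule ideal_gen_add)
qed

text \<open>The augmentation \<open>x\<^sub>i \<mapsto> 1\<close>; it maps all ideals considered below into \<open>3W\<close>.\<close>

abbreviation poly9_aug :: "'w::strict_3_ring poly9 \<Rightarrow> 'w" where
  "poly9_aug \<equiv> poly9_subst (\<lambda>w. w) (\<lambda>_. 1)"

lemmas poly9_aug_simps =
  poly9_subst_add[of "\<lambda>w. w"] poly9_subst_mult[of "\<lambda>w. w"] poly9_subst_one[of "\<lambda>w. w"]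
  poly9_subst_zero[of "\<lambda>w. w"] poly9_subst_pvar[of "\<lambda>w. w"]

lemma poly9_aug_relations: "p \<in> ideal_gen M_relations \<Longrightarrow> 3 dvd poly9_aug p"
  by (induction rule: ideal_gen_induct) (auto simp: poly9_aug_simps M_relations_def)

lemma poly9_aug_diff: "poly9_aug (p - q) = poly9_aug p - poly9_aug q"
  using poly9_aug_simps(1)[where p = "p - q" and q = q and f = "\<lambda>_. 1"] by simp

instantiation M :: (strict_3_ring) comm_ring_1
begin

lift_definition zero_M :: "'a M" is 0 .
lift_definition one_M :: "'a M" is 1 .
lift_definition plus_M :: "'a M \<Rightarrow> 'a M \<Rightarrow> 'a M" is "(+)"
  by (simp only: add_diff_add ideal_gen_add)
lift_definition minus_M :: "'a M \<Rightarrow> 'a M \<Rightarrow> 'a M" is "(-)"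
  by (simp only: diff_diff_eq_diff ideal_gen_diff)
lift_definition uminus_M :: "'a M \<Rightarrow> 'a M" is uminus
  by (simp only: minus_diff_eq_minus ideal_gen_uminus)
lift_definition times_M :: "'a M \<Rightarrow> 'a M \<Rightarrow> 'a M" is "(*)"
  by (simp add: mult_diff_mult ideal_gen_add ideal_gen_mult ideal_gen_mult')

instance
proof
  show "(0::'a M) \<noteq> 1"
  proof (transfer, rule notI)
    assume "(0::'a poly9) - 1 \<in> ideal_gen M_relations"
    hence "3 dvd poly9_aug (0 - 1 :: 'a poly9)" by (rule poly9_aug_relations)
    hence "(3::'a) dvd 0 - 1" by (simp only: poly9_aug_diff poly9_aug_simps)
    hence "(3::'a) dvd 1" by (metis diff_0 dvd_minus_iff)
    thus False using three_not_dvd_one by blast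
  qed
qed (transfer; simp add: algebra_simps ideal_gen_zero)+

end

lift_definition xM :: "9 \<Rightarrow> 'w::strict_3_ring M" is pvar .

lift_definition M_const :: "'w::strict_3_ring \<Rightarrow> 'w M" is pconst .

text \<open>The \<open>W\<close>-algebra automorphism \<open>x\<^sub>i \<mapsto> x\<^sub>i\<^sub>+\<^sub>1\<close>.\<close>

lemmas poly9_gamma_simps =
  poly9_subst_add[of pconst, OF pconst_hom] poly9_subst_mult[of pconst, OF pconst_hom]
  poly9_subst_one[of pconst, OF pconst_hom] poly9_subst_zero[of pconst, OF pconst_hom]
  poly9_subst_pvar[of pconst, OF pconst_hom]

lemma poly9_gamma_relations:
  assumes "p \<in> ideal_gen (M_relations :: 'w::strict_3_ring poly9 set)"
  shows "poly9_subst pconst (\<lambda>i. pvar (i + 1)) p \<in> ideal_gen M_relations"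
proof (rule ideal_gen_hom[OF assms poly9_gamma_simps(1,2,4)])
  fix p :: "'w poly9" assume "p \<in> M_relations"
  moreover have [simp]: "(9 :: 9) = 0" by simp
  ultimately show "poly9_subst pconst (\<lambda>i. pvar (i + 1)) p \<in> ideal_gen M_relations"
    by (intro ideal_gen_base)
       (auto simp: M_relations_def poly9_gamma_simps add_ac)
qed

lift_definition \<gamma> :: "'w::strict_3_ring M \<Rightarrow> 'w M" is "poly9_subst pconst (\<lambda>i. pvar (i + 1))"
proof -
  fix p q :: "'w poly9" assume "p - q \<in> ideal_gen M_relations"
  hence "poly9_subst pconst (\<lambda>i. pvar (i + 1)) (p - q) \<in> ideal_gen M_relations"
    by (rule poly9_gamma_relations)
  moreover have "poly9_subst pconst (\<lambda>i. pvar (i + 1)) p =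
      poly9_subst pconst (\<lambda>i. pvar (i + 1)) (p - q) + poly9_subst pconst (\<lambda>i. pvar (i + 1)) q"
    by (simp flip: poly9_gamma_simps(1))
  ultimately show "poly9_subst pconst (\<lambda>i. pvar (i + 1)) p - poly9_subst pconst (\<lambda>i. pvar (i + 1)) q
      \<in> ideal_gen M_relations"
    by simp
qed

lemma \<gamma>_simps: "\<gamma> (a + b) = \<gamma> a + \<gamma> b" "\<gamma> (a * b) = \<gamma> a * \<gamma> b" "\<gamma> 0 = 0" "\<gamma> 1 = 1"
    "\<gamma> (xM i) = xM (i + 1)"
  by (transfer, simp add: poly9_gamma_simps ideal_gen_zero)+

lemma \<gamma>_diff: "\<gamma> (a - b) = \<gamma> a - \<gamma> b"
  using \<gamma>_simps(1)[of "a - b" b] by simp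

lemma \<gamma>_power: "\<gamma> (a ^ k) = \<gamma> a ^ k"
  by (induction k) (simp_all add: \<gamma>_simps)

definition \<Delta> :: "'w::strict_3_ring M" where
  "\<Delta> = (\<Prod>i\<in>UNIV. xM i)"

lemma \<gamma>_\<Delta>: "\<gamma> \<Delta> = \<Delta>"
proof -
  have "\<gamma> (\<Prod>i\<in>A. xM i) = (\<Prod>i\<in>A. xM (i + 1))" for A :: "9 set"
    by (induction A rule: infinite_finite_induct) (simp_all add: \<gamma>_simps)
  hence "\<gamma> \<Delta> = (\<Prod>i\<in>UNIV. xM (i + 1))" by (simp add: \<Delta>_def)
  also have "\<dots> = \<Delta>"
    unfolding \<Delta>_def
    by (rule prod.reindex_bij_witness[of _ "\<lambda>i. i - 1" "\<lambda>i. i + 1"]) auto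
  finally show ?thesis .
qed


text \<open>\<open>M_aug m w\<close>: the augmentation of \<open>m\<close> in \<open>W/3\<close> is the class of \<open>w\<close>.\<close>

lift_definition M_aug :: "'w::strict_3_ring M \<Rightarrow> 'w \<Rightarrow> bool" is "\<lambda>p w. 3 dvd (poly9_aug p - w)"
proof -
  fix p q :: "'w poly9" assume "p - q \<in> ideal_gen M_relations"
  hence *: "3 dvd poly9_aug p - poly9_aug q"
    using poly9_aug_relations poly9_aug_diff by metis
  have "3 dvd poly9_aug p - w \<longleftrightarrow> 3 dvd poly9_aug q - w" for w
    using dvd_add_right_iff[OF *, of "poly9_aug q - w"] by simp
  thus "(\<lambda>w. 3 dvd poly9_aug p - w) = (\<lambda>w. 3 dvd poly9_aug q - w)" by blast
qed

lemma M_aug_total: "\<exists>w. M_aug m w"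
  by transfer (metis diff_self dvd_0_right)

lemma M_aug_0: "M_aug 0 w \<longleftrightarrow> 3 dvd w"
  by transfer (simp add: poly9_aug_simps)

lemma M_aug_1: "M_aug 1 1"
  by transfer (simp add: poly9_aug_simps)

lemma M_aug_xM: "M_aug (xM i) 1"
  by transfer (simp add: poly9_aug_simps)

lemma M_aug_add: "M_aug a u \<Longrightarrow> M_aug b v \<Longrightarrow> M_aug (a + b) (u + v)"
  by transfer (simp only: poly9_aug_simps add_diff_add dvd_add)

lemma M_aug_diff: "M_aug a u \<Longrightarrow> M_aug b v \<Longrightarrow> M_aug (a - b) (u - v)"
  by transfer (simp only: poly9_aug_diff diff_diff_eq_diff dvd_diff)

lemma M_aug_mult: "M_aug a u \<Longrightarrow> M_aug b v \<Longrightarrow> M_aug (a * b) (u * v)"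
  by transfer (simp add: poly9_aug_simps mult_diff_mult)

lemma M_aug_power: "M_aug a u \<Longrightarrow> M_aug (a ^ k) (u ^ k)"
  by (induction k) (simp_all add: M_aug_1 M_aug_mult)

lemma M_aug_\<Delta>: "M_aug (\<Delta> ^ k) 1"
proof -
  have "M_aug (\<Prod>i\<in>A. xM i) 1" for A :: "9 set"
    by (induction A rule: infinite_finite_induct) (auto simp: M_aug_1 intro: M_aug_mult[OF M_aug_xM, simplified])
  from M_aug_power[OF this, of UNIV k] show ?thesis by (simp add: \<Delta>_def)
qed


section \<open>The localization \<open>\<Delta>\<^sup>-\<^sup>1M\<close>\<close>

text \<open>The pair \<open>(m, k)\<close> represents the fraction \<open>m / \<Delta>\<^sup>k\<close>.\<close>

definition frac_eq :: "'w::strict_3_ring M \<times> nat \<Rightarrow> 'w M \<times> nat \<Rightarrow> bool" where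
  "frac_eq = (\<lambda>(m, k) (m', k'). \<exists>j. \<Delta> ^ j * (\<Delta> ^ k' * m - \<Delta> ^ k * m') = 0)"

quotient_type (overloaded) 'w Mloc = "'w::strict_3_ring M \<times> nat" / frac_eq
proof (rule equivpI)
  show "reflp (frac_eq :: 'w M \<times> nat \<Rightarrow> _)" by (auto simp: reflp_def frac_eq_def)
  show "symp (frac_eq :: 'w M \<times> nat \<Rightarrow> _)"
  proof (rule sympI, clarsimp simp: frac_eq_def)
    fix a b :: "'w M" and k l j
    assume 1: "\<Delta> ^ j * (\<Delta> ^ l * a - \<Delta> ^ k * b) = 0"
    have "\<Delta> ^ j * (\<Delta> ^ k * b - \<Delta> ^ l * a) = - (\<Delta> ^ j * (\<Delta> ^ l * a - \<Delta> ^ k * b))"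
      by (simp add: algebra_simps)
    with 1 show "\<exists>j. \<Delta> ^ j * (\<Delta> ^ k * b - \<Delta> ^ l * a) = 0" by (intro exI[of _ j]) simp
  qed
  show "transp (frac_eq :: 'w M \<times> nat \<Rightarrow> _)"
  proof (rule transpI, clarsimp simp: frac_eq_def)
    fix a b c :: "'w M" and k l n i j
    assume 1: "\<Delta> ^ i * (\<Delta> ^ l * a - \<Delta> ^ k * b) = 0" and 2: "\<Delta> ^ j * (\<Delta> ^ n * b - \<Delta> ^ l * c) = 0"
    have "\<Delta> ^ (i + j + l) * (\<Delta> ^ n * a - \<Delta> ^ k * c) =
        \<Delta> ^ (j + n) * (\<Delta> ^ i * (\<Delta> ^ l * a - \<Delta> ^ k * b)) + \<Delta> ^ (i + k) * (\<Delta> ^ j * (\<Delta> ^ n * b - \<Delta> ^ l * c))"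
      by (simp add: power_add algebra_simps)
    with 1 2 show "\<exists>j. \<Delta> ^ j * (\<Delta> ^ n * a - \<Delta> ^ k * c) = 0" by (intro exI[of _ "i + j + l"]) simp
  qed
qed

instantiation Mloc :: (strict_3_ring) comm_ring_1
begin

lift_definition zero_Mloc :: "'a Mloc" is "(0, 0)" .
lift_definition one_Mloc :: "'a Mloc" is "(1, 0)" .
lift_definition plus_Mloc :: "'a Mloc \<Rightarrow> 'a Mloc \<Rightarrow> 'a Mloc"
  is "\<lambda>(m, k) (m', k'). (\<Delta> ^ k' * m + \<Delta> ^ k * m', k + k')"
proof (clarsimp simp: frac_eq_def)
  fix a a' b b' :: "'a M" and k k' l l' i j
  assume 1: "\<Delta> ^ i * (\<Delta> ^ k' * a - \<Delta> ^ k * a') = 0" and 2: "\<Delta> ^ j * (\<Delta> ^ l' * b - \<Delta> ^ l * b') = 0"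
  have "\<Delta> ^ (i + j) * (\<Delta> ^ (k' + l') * (\<Delta> ^ l * a + \<Delta> ^ k * b) - \<Delta> ^ (k + l) * (\<Delta> ^ l' * a' + \<Delta> ^ k' * b')) =
    \<Delta> ^ (j + l + l') * (\<Delta> ^ i * (\<Delta> ^ k' * a - \<Delta> ^ k * a')) +
    \<Delta> ^ (i + k + k') * (\<Delta> ^ j * (\<Delta> ^ l' * b - \<Delta> ^ l * b'))"
    by (simp add: power_add algebra_simps)
  with 1 2 show "\<exists>j. \<Delta> ^ j * (\<Delta> ^ (k' + l') * (\<Delta> ^ l * a + \<Delta> ^ k * b) - \<Delta> ^ (k + l) * (\<Delta> ^ l' * a' + \<Delta> ^ k' * b')) = 0"
    by (intro exI[of _ "i + j"]) simp
qed
lift_definition uminus_Mloc :: "'a Mloc \<Rightarrow> 'a Mloc" is "\<lambda>(m, k). (- m, k)"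
  by (auto simp: frac_eq_def right_diff_distrib simp flip: minus_diff_eq_minus)
lift_definition times_Mloc :: "'a Mloc \<Rightarrow> 'a Mloc \<Rightarrow> 'a Mloc"
  is "\<lambda>(m, k) (m', k'). (m * m', k + k')"
proof (clarsimp simp: frac_eq_def)
  fix a a' b b' :: "'a M" and k k' l l' i j
  assume 1: "\<Delta> ^ i * (\<Delta> ^ k' * a - \<Delta> ^ k * a') = 0" and 2: "\<Delta> ^ j * (\<Delta> ^ l' * b - \<Delta> ^ l * b') = 0"
  have "\<Delta> ^ (i + j) * (\<Delta> ^ (k' + l') * (a * b) - \<Delta> ^ (k + l) * (a' * b')) =
    \<Delta> ^ (j + l') * b * (\<Delta> ^ i * (\<Delta> ^ k' * a - \<Delta> ^ k * a')) +
    \<Delta> ^ (i + k) * a' * (\<Delta> ^ j * (\<Delta> ^ l' * b - \<Delta> ^ l * b'))"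
    by (simp add: power_add algebra_simps)
  with 1 2 show "\<exists>j. \<Delta> ^ j * (\<Delta> ^ (k' + l') * (a * b) - \<Delta> ^ (k + l) * (a' * b')) = 0"
    by (intro exI[of _ "i + j"]) simp
qed
definition minus_Mloc :: "'a Mloc \<Rightarrow> 'a Mloc \<Rightarrow> 'a Mloc" where "minus_Mloc u v = u + - v"

instance
proof
  show "(0::'a Mloc) \<noteq> 1"
  proof (transfer, clarsimp simp: frac_eq_def)
    fix j assume "\<Delta> ^ j = (0::'a M)"
    moreover have "M_aug (\<Delta> ^ j :: 'a M) 1" by (rule M_aug_\<Delta>)
    ultimately show False by (simp add: M_aug_0 three_not_dvd_one)
  qed
  fix u v w :: "'a Mloc"
  show "u - v = u + - v" by (rule minus_Mloc_def)
qed (transfer; auto simp: frac_eq_def algebra_simps power_add intro!: exI[of _ 0])+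

end

definition mfrac :: "'w::strict_3_ring M \<Rightarrow> nat \<Rightarrow> 'w Mloc" where
  "mfrac m k = abs_Mloc (m, k)"

lemma mfrac_transfer [transfer_rule]: "rel_fun (=) (rel_fun (=) cr_Mloc) Pair mfrac"
  by (auto simp: rel_fun_def cr_Mloc_def mfrac_def)


lift_definition \<gamma>_loc :: "'w::strict_3_ring Mloc \<Rightarrow> 'w Mloc" is "\<lambda>(m, k). (\<gamma> m, k)"
proof (clarsimp simp: frac_eq_def)
  fix a b :: "'w M" and k l j
  assume "\<Delta> ^ j * (\<Delta> ^ l * a - \<Delta> ^ k * b) = 0"
  hence "\<gamma> (\<Delta> ^ j * (\<Delta> ^ l * a - \<Delta> ^ k * b)) = 0" by (simp add: \<gamma>_simps)
  thus "\<exists>j. \<Delta> ^ j * (\<Delta> ^ l * \<gamma> a - \<Delta> ^ k * \<gamma> b) = 0"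
    by (auto simp: \<gamma>_simps \<gamma>_diff \<gamma>_power \<gamma>_\<Delta>)
qed

lemma \<gamma>_loc_simps: "\<gamma>_loc (a + b) = \<gamma>_loc a + \<gamma>_loc b" "\<gamma>_loc (a * b) = \<gamma>_loc a * \<gamma>_loc b"
    "\<gamma>_loc 0 = 0" "\<gamma>_loc 1 = 1" "\<gamma>_loc (mfrac m k) = mfrac (\<gamma> m) k"
  by (transfer; auto simp: frac_eq_def \<gamma>_simps \<gamma>_power \<gamma>_\<Delta>)+

lemma \<gamma>_loc_diff: "\<gamma>_loc (a - b) = \<gamma>_loc a - \<gamma>_loc b"
  using \<gamma>_loc_simps(1)[of "a - b" b] by simp

lift_definition Mloc_aug :: "'w::strict_3_ring Mloc \<Rightarrow> 'w \<Rightarrow> bool" is "\<lambda>(m, k) w. M_aug m w"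
proof -
  have *: "M_aug b w" if "frac_eq (a, k) (b, l)" "M_aug a w" for a b :: "'w M" and k l w
  proof -
    from that obtain j where j: "\<Delta> ^ j * (\<Delta> ^ l * a - \<Delta> ^ k * b) = 0" by (auto simp: frac_eq_def)
    obtain v where v: "M_aug b v" using M_aug_total by blast
    have "M_aug (\<Delta> ^ j * (\<Delta> ^ l * a - \<Delta> ^ k * b)) (1 * (1 * w - 1 * v))"
      by (intro M_aug_mult M_aug_diff M_aug_\<Delta> v that)
    hence "M_aug 0 (w - v)" using j by simp
    hence "M_aug (b + 0) (v + (w - v))" by (intro M_aug_add v)
    thus ?thesis by simp
  qed
  fix p q :: "'w M \<times> nat" assume "frac_eq p q"
  moreover from this have "frac_eq q p" by (metis Mloc_equivp equivp_symp)
  ultimately show "(case p of (m, k) \<Rightarrow> M_aug m) = (case q of (m, k) \<Rightarrow> M_aug m)"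
    by (cases p; cases q) (auto intro!: ext intro: *)
qed


section \<open>The completion\<close>

definition I_M :: "'w::strict_3_ring M set" where
  "I_M = ideal_gen {3, xM 0 - xM 1, xM 1 - xM 2, xM 2 - xM 3, xM 3 - xM 4, xM 4 - xM 5,
                  xM 5 - xM 6, xM 6 - xM 7, xM 7 - xM 8}"

definition I_loc :: "'w::strict_3_ring Mloc set" where
  "I_loc = ideal_gen ((\<lambda>m. mfrac m 0) ` I_M)"

lemma \<gamma>_I_M: "a \<in> (I_M :: 'w::strict_3_ring M set) \<Longrightarrow> \<gamma> a \<in> I_M"
  unfolding I_M_def
proof (erule ideal_gen_hom[OF _ \<gamma>_simps(1-3)])
  let ?S = "{3, xM 0 - xM 1, xM 1 - xM 2, xM 2 - xM 3, xM 3 - xM 4, xM 4 - xM 5,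
                  xM 5 - xM 6, xM 6 - xM 7, xM 7 - xM 8} :: 'w M set"
  have [simp]: "(9 :: 9) = 0" by simp
  have "(3 :: 'w M) = 1 + 1 + 1" by simp
  hence 3: "\<gamma> (3 :: 'w M) = 3" by (metis \<gamma>_simps(1,4))
  have "- ((xM 0 - xM 1) + (xM 1 - xM 2) + (xM 2 - xM 3) + (xM 3 - xM 4) + (xM 4 - xM 5) +
      (xM 5 - xM 6) + (xM 6 - xM 7) + (xM 7 - xM 8)) \<in> ideal_gen ?S"
    by (intro ideal_gen_uminus ideal_gen_add ideal_gen_base) simp_all
  hence 8: "xM 8 - xM 0 \<in> ideal_gen ?S" by (simp add: algebra_simps)
  fix a assume "a \<in> ?S"
  then show "\<gamma> a \<in> ideal_gen ?S"
    by (elim insertE emptyE) (simp_all add: \<gamma>_diff \<gamma>_simps 3 8, auto intro!: ideal_gen_base)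
qed

lemma M_aug_I_M: "a \<in> I_M \<Longrightarrow> M_aug a 0"
  unfolding I_M_def
proof (induction rule: ideal_gen_induct)
  case zero
  show ?case by (simp add: M_aug_0)
next
  case (step c u v)
  obtain w where w: "M_aug c w" using M_aug_total by blast
  have "M_aug (1 + 1 + 1 - 0) (1 + 1 + 1 - 3)"
    by (intro M_aug_diff M_aug_add M_aug_1) (simp add: M_aug_0)
  hence "M_aug 3 0" by simp
  hence "M_aug u 0" using step(1) M_aug_diff[OF M_aug_xM M_aug_xM] by auto
  from M_aug_add[OF M_aug_mult[OF w this] step(2)] show ?case by simp
qed

lemma \<gamma>_loc_I_loc: "a \<in> I_loc \<Longrightarrow> \<gamma>_loc a \<in> I_loc"
  unfolding I_loc_def
  by (erule ideal_gen_hom[OF _ \<gamma>_loc_simps(1-3)])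
     (auto simp: \<gamma>_loc_simps \<gamma>_I_M intro!: ideal_gen_base)

lemma \<gamma>_loc_ideal_pow: "a \<in> ideal_pow I_loc k \<Longrightarrow> \<gamma>_loc a \<in> ideal_pow I_loc k"
  by (erule ideal_pow_hom[OF _ \<gamma>_loc_simps(1-3)]) (rule \<gamma>_loc_I_loc)

lemma Mloc_aug_I_loc: "a \<in> I_loc \<Longrightarrow> Mloc_aug a 0"
  unfolding I_loc_def
proof (induction rule: ideal_gen_induct)
  case zero
  show ?case by transfer (simp add: M_aug_0)
next
  case (step c u v)
  then obtain m where m: "u = mfrac m 0" "M_aug m 0" using M_aug_I_M by auto
  have "Mloc_aug (c * mfrac m 0 + v) 0" if "M_aug m 0" "Mloc_aug v 0" for m c v
    using that
  proof (transfer, clarsimp)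
    fix m c v :: "'b M" and k l
    assume 1: "M_aug m 0" and 2: "M_aug v 0"
    obtain w where w: "M_aug c w" using M_aug_total by blast
    have "M_aug (\<Delta> ^ l * (c * m) + \<Delta> ^ k * v) (1 * (w * 0) + 1 * 0)"
      by (intro M_aug_add M_aug_mult M_aug_\<Delta> w 1 2)
    thus "M_aug (\<Delta> ^ l * (c * m) + \<Delta> ^ k * v) 0" by simp
  qed
  with m step show ?case by blast
qed

text \<open>
  An element of \<open>lim\<^sub>k \<Delta>\<^sup>-\<^sup>1M / I\<^sup>k\<Delta>\<^sup>-\<^sup>1M\<close> is represented by a sequence of
  representatives of its components.
\<close>

definition coherent :: "(nat \<Rightarrow> 'w::strict_3_ring Mloc) \<Rightarrow> bool" where
  "coherent a \<longleftrightarrow> (\<forall>k. a (Suc k) - a k \<in> ideal_pow I_loc k)"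

definition hat_eq :: "(nat \<Rightarrow> 'w::strict_3_ring Mloc) \<Rightarrow> (nat \<Rightarrow> 'w Mloc) \<Rightarrow> bool" where
  "hat_eq a b \<longleftrightarrow> coherent a \<and> coherent b \<and> (\<forall>k. a k - b k \<in> ideal_pow I_loc k)"

lemma coherent_const: "coherent (\<lambda>_. a)"
  by (simp add: coherent_def ideal_pow_zero_mem)

lemma coherent_add: "coherent a \<Longrightarrow> coherent b \<Longrightarrow> coherent (\<lambda>k. a k + b k)"
  by (simp add: coherent_def add_diff_add ideal_pow_add)

lemma coherent_uminus: "coherent a \<Longrightarrow> coherent (\<lambda>k. - a k)"
  by (simp only: coherent_def minus_diff_eq_minus ideal_pow_uminus) simp

lemma ideal_pow_mult_diff:
  "a - b \<in> ideal_pow J k \<Longrightarrow> c - d \<in> ideal_pow J k \<Longrightarrow> a * c - b * d \<in> ideal_pow J k"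
  using ideal_pow_add[OF ideal_pow_mult[of "c - d" J k a] ideal_pow_mult[of "a - b" J k d]]
  by (simp add: algebra_simps)

lemma coherent_mult: "coherent a \<Longrightarrow> coherent b \<Longrightarrow> coherent (\<lambda>k. a k * b k)"
  by (simp add: coherent_def ideal_pow_mult_diff)

quotient_type (overloaded) 'w Mhat = "nat \<Rightarrow> 'w::strict_3_ring Mloc" / partial: hat_eq
proof (rule part_equivpI)
  show "\<exists>a::nat \<Rightarrow> 'w Mloc. hat_eq a a"
    using coherent_const by (auto simp: hat_eq_def ideal_pow_zero_mem)
  show "symp (hat_eq :: (nat \<Rightarrow> 'w Mloc) \<Rightarrow> _)"
  proof (rule sympI, unfold hat_eq_def, safe)
    fix a b :: "nat \<Rightarrow> 'w Mloc" and k
    assume "\<forall>k. a k - b k \<in> ideal_pow I_loc k"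
    hence "- (a k - b k) \<in> ideal_pow I_loc k" by (intro ideal_pow_uminus) auto
    thus "b k - a k \<in> ideal_pow I_loc k" by simp
  qed
  show "transp (hat_eq :: (nat \<Rightarrow> 'w Mloc) \<Rightarrow> _)"
  proof (rule transpI, unfold hat_eq_def, safe)
    fix a b c :: "nat \<Rightarrow> 'w Mloc" and k
    assume "\<forall>k. a k - b k \<in> ideal_pow I_loc k" "\<forall>k. b k - c k \<in> ideal_pow I_loc k"
    hence "(a k - b k) + (b k - c k) \<in> ideal_pow I_loc k" by (intro ideal_pow_add) auto
    thus "a k - c k \<in> ideal_pow I_loc k" by simp
  qed
qed

instantiation Mhat :: (strict_3_ring) comm_ring_1
begin

lift_definition zero_Mhat :: "'a Mhat" is "\<lambda>_. 0"
  by (simp add: hat_eq_def coherent_const ideal_pow_zero_mem)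
lift_definition one_Mhat :: "'a Mhat" is "\<lambda>_. 1"
  by (simp add: hat_eq_def coherent_const ideal_pow_zero_mem)
lift_definition plus_Mhat :: "'a Mhat \<Rightarrow> 'a Mhat \<Rightarrow> 'a Mhat" is "\<lambda>a b k. a k + b k"
  by (simp add: hat_eq_def add_diff_add ideal_pow_add coherent_add)
lift_definition uminus_Mhat :: "'a Mhat \<Rightarrow> 'a Mhat" is "\<lambda>a k. - a k"
  by (simp only: hat_eq_def minus_diff_eq_minus ideal_pow_uminus coherent_uminus) simp
lift_definition times_Mhat :: "'a Mhat \<Rightarrow> 'a Mhat \<Rightarrow> 'a Mhat" is "\<lambda>a b k. a k * b k"
  by (simp add: hat_eq_def coherent_mult ideal_pow_mult_diff)
definition minus_Mhat :: "'a Mhat \<Rightarrow> 'a Mhat \<Rightarrow> 'a Mhat" where "minus_Mhat u v = u + - v"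

instance
proof
  show "(0::'a Mhat) \<noteq> 1"
  proof (transfer, rule notI)
    assume "hat_eq (\<lambda>_. 0) (\<lambda>_. 1::'a Mloc)"
    hence "0 - 1 \<in> ideal_pow (I_loc :: 'a Mloc set) (Suc 0)"
      unfolding hat_eq_def by blast
    from ideal_pow_uminus[OF this] have "1 \<in> ideal_pow (I_loc :: 'a Mloc set) (Suc 0)"
      by (simp del: ideal_pow.simps)
    moreover have "ideal_pow I_loc (Suc 0) \<subseteq> (I_loc :: 'a Mloc set)"
    proof
      fix a assume "a \<in> ideal_pow (I_loc :: 'a Mloc set) (Suc 0)"
      thus "a \<in> I_loc"
        unfolding ideal_pow.simps
      proof (induction rule: ideal_gen_induct)
        case zero
        show ?case by (simp add: I_loc_def ideal_gen_zero)
      next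
        case (step c u v)
        then obtain d e where "u = d * e" "d \<in> I_loc" by auto
        with step(2) show ?case
          unfolding I_loc_def by (simp add: ideal_gen_add ideal_gen_mult ideal_gen_mult')
      qed
    qed
    ultimately have "Mloc_aug (1 :: 'a Mloc) 0" using Mloc_aug_I_loc by blast
    hence "M_aug (1 :: 'a M) 0" by transfer simp
    from M_aug_diff[OF M_aug_1 this] have "M_aug (0 :: 'a M) 1" by simp
    thus False by (simp add: M_aug_0 three_not_dvd_one)
  qed
  fix u v w :: "'a Mhat"
  show "u - v = u + - v" by (rule minus_Mhat_def)
qed (transfer; auto simp: hat_eq_def coherent_const coherent_add coherent_mult coherent_uminus
      algebra_simps ideal_pow_zero_mem)+

end

definition hat_of_M :: "'w::strict_3_ring M \<Rightarrow> 'w Mhat" where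
  "hat_of_M m = abs_Mhat (\<lambda>_. mfrac m 0)"

lift_definition \<gamma>_hat :: "'w::strict_3_ring Mhat \<Rightarrow> 'w Mhat" is "\<lambda>a k. \<gamma>_loc (a k)"
  by (simp add: hat_eq_def coherent_def \<gamma>_loc_ideal_pow flip: \<gamma>_loc_diff)


section \<open>Gradings\<close>

definition M_deg :: "int \<Rightarrow> 'w::strict_3_ring M set" where
  "M_deg n = {abs_M p | p. \<forall>e\<in>Poly_Mapping.keys p. - 2 * (\<Sum>i\<in>UNIV. int (Poly_Mapping.lookup e i)) = n}"

text \<open>\<open>|\<Delta>| = -18\<close>.\<close>

definition Mloc_deg :: "int \<Rightarrow> 'w::strict_3_ring Mloc set" where
  "Mloc_deg n = {mfrac m k | m k. m \<in> M_deg (n - 18 * int k)}"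

text \<open>
  The degree \<open>n\<close> part of the graded completion is \<open>lim\<^sub>k (\<Delta>\<^sup>-\<^sup>1M)\<^sub>n / (I\<^sup>k\<Delta>\<^sup>-\<^sup>1M)\<^sub>n\<close>.  As \<open>I\<close> is
  homogeneous, this is a subgroup of the ungraded completion.  All graded objects below are
  given by the family of their homogeneous parts.
\<close>

definition Mhat_deg :: "int \<Rightarrow> 'w::strict_3_ring Mhat set" where
  "Mhat_deg n = {abs_Mhat a | a. coherent a \<and> (\<forall>k. a k \<in> Mloc_deg n)}"


section \<open>Quotients of abelian groups\<close>

definition add_grp :: "'a::ab_group_add set \<Rightarrow> 'a monoid" where
  "add_grp A = \<lparr>carrier = A, monoid.mult = (+), one = 0\<rparr>"

definition coset :: "'a::ab_group_add set \<Rightarrow> 'a \<Rightarrow> 'a set" where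
  "coset B u = B #>\<^bsub>add_grp UNIV\<^esub> u"

text \<open>The map on cosets, with values in cosets of \<open>B\<close>, that is induced by \<open>f\<close>.\<close>

definition induced :: "'b::ab_group_add set \<Rightarrow> ('a \<Rightarrow> 'b) \<Rightarrow> 'a set \<Rightarrow> 'b set" where
  "induced B f U = (\<Union>u\<in>U. coset B (f u))"


section \<open>Tate cohomology of cyclic groups\<close>

text \<open>
  Let \<open>C\<close> be cyclic of order \<open>m\<close> with generator \<open>\<sigma>\<close>, acting on the abelian group \<open>A\<close>.  The complex
  \<open>Hom\<^sub>C(P, A)\<close> for the periodic complete resolution \<open>P\<close> with \<open>P\<^sub>q = \<int>[C]\<close> for all integers \<open>q\<close> has
  \<open>A\<close> in every degree; the differential from degree \<open>q\<close> to \<open>q + 1\<close> is \<open>\<sigma> - 1\<close> for even \<open>q\<close> and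
  the norm for odd \<open>q\<close>.  In comments, \<open>H\<^sup>q(C; A)\<close> is the Tate cohomology group.
\<close>

definition tate_d :: "nat \<Rightarrow> ('a::ab_group_add \<Rightarrow> 'a) \<Rightarrow> int \<Rightarrow> 'a \<Rightarrow> 'a" where
  "tate_d m \<sigma> q u = (if even q then \<sigma> u - u else (\<Sum>i<m. (\<sigma> ^^ i) u))"

definition tate_Z :: "nat \<Rightarrow> ('a::ab_group_add \<Rightarrow> 'a) \<Rightarrow> 'a set \<Rightarrow> int \<Rightarrow> 'a set" where
  "tate_Z m \<sigma> A q = {u \<in> A. tate_d m \<sigma> q u = 0}"

definition tate_B :: "nat \<Rightarrow> ('a::ab_group_add \<Rightarrow> 'a) \<Rightarrow> 'a set \<Rightarrow> int \<Rightarrow> 'a set" where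
  "tate_B m \<sigma> A q = tate_d m \<sigma> (q - 1) ` A"

definition tate_H :: "nat \<Rightarrow> ('a::ab_group_add \<Rightarrow> 'a) \<Rightarrow> 'a set \<Rightarrow> int \<Rightarrow> 'a set monoid" where
  "tate_H m \<sigma> A q = add_grp (tate_Z m \<sigma> A q) Mod tate_B m \<sigma> A q"

text \<open>
  The cup product of cochains of degrees \<open>p\<close> and \<open>q\<close>, from the diagonal approximation
  \<open>1 \<otimes> 1\<close> (\<open>p\<close> even), \<open>1 \<otimes> \<sigma>\<close> (\<open>p\<close> odd, \<open>q\<close> even), \<open>\<Sum>\<^sub>i\<^sub><\<^sub>j \<sigma>\<^sup>i \<otimes> \<sigma>\<^sup>j\<close> (\<open>p\<close>, \<open>q\<close> odd) of the periodic
  resolution (Cartan--Eilenberg, XII.7), without additional signs.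
\<close>

definition tate_cup :: "nat \<Rightarrow> ('a::comm_ring_1 \<Rightarrow> 'a) \<Rightarrow> int \<Rightarrow> int \<Rightarrow> 'a \<Rightarrow> 'a \<Rightarrow> 'a" where
  "tate_cup m \<sigma> p q u v =
     (if even p then u * v
      else if even q then u * \<sigma> v
      else (\<Sum>j<m. \<Sum>i<j. (\<sigma> ^^ i) u * (\<sigma> ^^ j) v))"

text \<open>
  Restriction to the subgroup generated by \<open>\<sigma>\<^sup>r\<close>, on cochains of degree \<open>q\<close>: the map of periodic
  resolutions over the identity of \<open>\<int>\<close> sends \<open>1\<close> to \<open>1\<close> in even degrees and to
  \<open>1 + \<sigma> + \<dots> + \<sigma>\<^sup>r\<^sup>-\<^sup>1\<close> in odd degrees.
\<close>

definition tate_res :: "nat \<Rightarrow> ('a::ab_group_add \<Rightarrow> 'a) \<Rightarrow> int \<Rightarrow> 'a \<Rightarrow> 'a" where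
  "tate_res r \<sigma> q u = (if even q then u else (\<Sum>i<r. (\<sigma> ^^ i) u))"

text \<open>
  The subgroup \<open>C\<^sub>3\<close> of \<open>C\<^sub>9\<close> is generated by \<open>\<gamma>\<^sup>3\<close>, and \<open>\<gamma>\<close> acts on \<open>H\<^sup>q(C\<^sub>3; -)\<close> by applying
  \<open>\<gamma>\<close> to cochains.
\<close>

definition HC9 :: "int \<Rightarrow> int \<Rightarrow> 'w::strict_3_ring Mhat set monoid" where
  "HC9 q n = tate_H 9 \<gamma>_hat (Mhat_deg n) q"

definition HC9_class :: "int \<Rightarrow> int \<Rightarrow> 'w::strict_3_ring Mhat \<Rightarrow> 'w Mhat set" where
  "HC9_class q n = coset (tate_B 9 \<gamma>_hat (Mhat_deg n) q)"

definition HC3_class :: "int \<Rightarrow> int \<Rightarrow> 'w::strict_3_ring Mhat \<Rightarrow> 'w Mhat set" where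
  "HC3_class q n = coset (tate_B 3 (\<gamma>_hat ^^ 3) (Mhat_deg n) q)"

text \<open>
  The edge homomorphism of the localized Serre spectral sequence, from
  \<open>H\<^sup>q(C\<^sub>9; -)\<close> to \<open>H\<^sup>q(C\<^sub>3; -)\<close>: a class is detected in filtration \<open>0\<close> by its image.
\<close>

definition HC9_res :: "int \<Rightarrow> int \<Rightarrow> 'w::strict_3_ring Mhat set \<Rightarrow> 'w Mhat set" where
  "HC9_res q n = induced (tate_B 3 (\<gamma>_hat ^^ 3) (Mhat_deg n) q) (tate_res 3 \<gamma>_hat q)"


section \<open>The ring \<open>S\<close>\<close>

definition d1 :: "'w::strict_3_ring M" where "d1 = xM 0 * xM 3 * xM 6"
definition d2 :: "'w::strict_3_ring M" where "d2 = xM 1 * xM 4 * xM 7"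
definition d3 :: "'w::strict_3_ring M" where "d3 = xM 2 * xM 5 * xM 8"

definition s1 :: "'w::strict_3_ring M" where "s1 = d1 + d2 + d3"
definition s2 :: "'w::strict_3_ring M" where "s2 = d1 * d2 + d2 * d3 + d3 * d1"
definition s3 :: "'w::strict_3_ring M" where "s3 = d1 * d2 * d3"

text \<open>
  \<open>(W/9)[b\<^sub>1\<^sup>\<plusminus>, s\<^sub>3\<^sup>\<plusminus>][[s\<^sub>1, s\<^sub>2]]\<close>: the Laurent polynomial ring is the monoid ring of \<open>\<int>\<^sup>2\<close>, with
  \<open>(j, c)\<close> the exponent of \<open>b\<^sub>1\<^sup>j s\<^sub>3\<^sup>c\<close>; the outer power series variable is \<open>s\<^sub>1\<close>, the inner one \<open>s\<^sub>2\<close>.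
\<close>

type_synonym 'w S = "((int \<times> int) \<Rightarrow>\<^sub>0 'w W9) fps fps"

abbreviation S_s1 :: "'w::strict_3_ring S" where "S_s1 \<equiv> fps_X"
abbreviation S_s2 :: "'w::strict_3_ring S" where "S_s2 \<equiv> fps_const fps_X"

text \<open>
  The part of cohomological degree \<open>q\<close> and internal degree \<open>n\<close>, where \<open>|b\<^sub>1| = (2, 0)\<close>,
  \<open>|s\<^sub>1| = (0, -6)\<close>, \<open>|s\<^sub>2| = (0, -12)\<close>, \<open>|s\<^sub>3| = (0, -18)\<close>.
\<close>

definition S_deg :: "int \<Rightarrow> int \<Rightarrow> 'w::strict_3_ring S set" where
  "S_deg q n = {f. \<forall>a b j c. Poly_Mapping.lookup (fps_nth (fps_nth f a) b) (j, c) \<noteq> 0 \<longrightarrow>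
     2 * j = q \<and> - 6 * int a - 12 * int b - 18 * c = n}"

definition s3_pow :: "int \<Rightarrow> 'w::strict_3_ring Mloc" where
  "s3_pow c = (if c \<ge> 0 then mfrac (s3 ^ nat c) 0 else mfrac 1 (nat (- c)))"

text \<open>
  The cochain given by \<open>f\<close>.  The class \<open>b\<^sub>1 \<in> H\<^sup>2(C\<^sub>9; W)\<close> is represented by the cochain \<open>1\<close>;
  the power series is summed \<open>I\<close>-adically, which makes sense because \<open>s\<^sub>1\<close> and \<open>s\<^sub>2\<close> lie in \<open>I\<close>.
  The coefficients in \<open>W/9\<close> are lifted to \<open>W\<close>: the choice of the lifts does not affect the
  action on cohomology, which is annihilated by 9, the order of the group.
\<close>

definition S_cochain :: "'w::strict_3_ring S \<Rightarrow> 'w Mhat" where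
  "S_cochain f = abs_Mhat (\<lambda>k. \<Sum>(a, b) | a + b < k.
     \<Sum>(j, c)\<in>Poly_Mapping.keys (fps_nth (fps_nth f a) b).
       mfrac (M_const (rep_W9 (Poly_Mapping.lookup (fps_nth (fps_nth f a) b) (j, c))) * s1 ^ a * s2 ^ b) 0
         * s3_pow c)"

text \<open>
  The cup product of a class in \<open>H\<^sup>q(C\<^sub>9; -)\<close> of internal degree \<open>n\<close> with the class of an element
  of \<open>S\<close> of bidegree \<open>(p, l)\<close>.
\<close>

definition HC9_act :: "int \<Rightarrow> int \<Rightarrow> 'w::strict_3_ring S \<Rightarrow> int \<Rightarrow> int \<Rightarrow> 'w Mhat set \<Rightarrow> 'w Mhat set" where
  "HC9_act p l f q n =
     induced (tate_B 9 \<gamma>_hat (Mhat_deg (n + l)) (q + p)) (tate_cup 9 \<gamma>_hat p q (S_cochain f))"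


section \<open>The \<open>S\<close>-module given by generators and relations\<close>

datatype gen = One | Cbar | Delta | CbarDelta
  | f0 | f1 | f2 | f3 | f4 | f5 | F0 | F1 | F2 | F3 | F4 | F5

text \<open>Cohomological and internal degree; the \<open>c\<^sub>i\<close> have bidegree \<open>(1, -2)\<close>.\<close>

primrec coh_deg :: "gen \<Rightarrow> int" where
  "coh_deg One = 0" | "coh_deg Cbar = 3" | "coh_deg Delta = 0" | "coh_deg CbarDelta = 3"
| "coh_deg f0 = 1" | "coh_deg f1 = 1" | "coh_deg f2 = 1" | "coh_deg f3 = 1" | "coh_deg f4 = 1" | "coh_deg f5 = 1"
| "coh_deg F0 = 2" | "coh_deg F1 = 2" | "coh_deg F2 = 2" | "coh_deg F3 = 2" | "coh_deg F4 = 2" | "coh_deg F5 = 2"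

primrec int_deg :: "gen \<Rightarrow> int" where
  "int_deg One = 0" | "int_deg Cbar = - 6" | "int_deg Delta = - 18" | "int_deg CbarDelta = - 24"
| "int_deg f0 = - 2" | "int_deg f1 = - 8" | "int_deg f2 = - 8" | "int_deg f3 = - 14" | "int_deg f4 = - 14" | "int_deg f5 = - 20"
| "int_deg F0 = - 4" | "int_deg F1 = - 10" | "int_deg F2 = - 10" | "int_deg F3 = - 16" | "int_deg F4 = - 16" | "int_deg F5 = - 22"

text \<open>The free \<open>S\<close>-module on the generators is \<open>gen \<Rightarrow> S\<close>; \<open>gen_times g f\<close> is \<open>f\<close> times the generator \<open>g\<close>.\<close>

definition free_smult :: "'w::strict_3_ring S \<Rightarrow> (gen \<Rightarrow> 'w S) \<Rightarrow> gen \<Rightarrow> 'w S" where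
  "free_smult f u = (\<lambda>g. f * u g)"

definition gen_times :: "gen \<Rightarrow> 'w::strict_3_ring S \<Rightarrow> gen \<Rightarrow> 'w S" where
  "gen_times g f = (\<lambda>h. if h = g then f else 0)"

definition Free_deg :: "int \<Rightarrow> int \<Rightarrow> (gen \<Rightarrow> 'w::strict_3_ring S) set" where
  "Free_deg q n = {u. \<forall>g. u g \<in> S_deg (q - coh_deg g) (n - int_deg g)}"

definition relators :: "(gen \<Rightarrow> 'w::strict_3_ring S) set" where
  "relators = range (\<lambda>g. gen_times g (3 * S_s1)) \<union> range (\<lambda>g. gen_times g (3 * S_s2)) \<union>
     {gen_times g 3 | g. g \<notin> {One, Cbar}}"

text \<open>
  The relators are homogeneous, so the homogeneous elements of the \<open>S\<close>-submodule which they
  generate form the graded submodule which they generate.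
\<close>

definition Rel_deg :: "int \<Rightarrow> int \<Rightarrow> (gen \<Rightarrow> 'w::strict_3_ring S) set" where
  "Rel_deg q n = module.span free_smult relators \<inter> Free_deg q n"

definition Pres :: "int \<Rightarrow> int \<Rightarrow> (gen \<Rightarrow> 'w::strict_3_ring S) set monoid" where
  "Pres q n = add_grp (Free_deg q n) Mod Rel_deg q n"

definition Pres_gen :: "gen \<Rightarrow> (gen \<Rightarrow> 'w::strict_3_ring S) set" where
  "Pres_gen g = coset (Rel_deg (coh_deg g) (int_deg g)) (gen_times g 1)"

definition Pres_act ::
    "int \<Rightarrow> int \<Rightarrow> 'w::strict_3_ring S \<Rightarrow> int \<Rightarrow> int \<Rightarrow> (gen \<Rightarrow> 'w S) set \<Rightarrow> (gen \<Rightarrow> 'w S) set" where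
  "Pres_act p l f q n = induced (Rel_deg (q + p) (n + l)) (free_smult f)"

text \<open>Isomorphisms of (bigraded) \<open>S\<close>-modules from the presented module to \<open>H\<^sup>*(C\<^sub>9; -)\<close>.\<close>

definition is_S_iso ::
    "(int \<Rightarrow> int \<Rightarrow> (gen \<Rightarrow> 'w::strict_3_ring S) set \<Rightarrow> 'w Mhat set) \<Rightarrow> bool" where
  "is_S_iso \<phi> \<longleftrightarrow>
     (\<forall>q n. \<phi> q n \<in> iso (Pres q n) (HC9 q n)) \<and>
     (\<forall>p l q n. \<forall>f\<in>S_deg p l. \<forall>U\<in>carrier (Pres q n).
        \<phi> (q + p) (n + l) (Pres_act p l f q n U) = HC9_act p l f q n (\<phi> q n U))"


section \<open>The detecting elements\<close>

text \<open>
  \<open>W{x\<^sub>0, x\<^sub>3, x\<^sub>6}/(x\<^sub>0 + x\<^sub>3 + x\<^sub>6)\<close>, as the submodule of \<open>M\<close> onto which it maps isomorphically, and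
  cocycles \<open>c\<close> whose class generates the \<open>W\<close>-module \<open>H\<^sup>1(C\<^sub>3; -)\<close> of it.
\<close>

definition V_M :: "'w::strict_3_ring M set" where
  "V_M = {M_const u * xM 0 + M_const v * xM 3 + M_const w * xM 6 | u v w. True}"

definition generates_H1 :: "'w::strict_3_ring M \<Rightarrow> bool" where
  "generates_H1 c \<longleftrightarrow> c \<in> tate_Z 3 (\<gamma> ^^ 3) V_M 1 \<and>
     (\<forall>z\<in>tate_Z 3 (\<gamma> ^^ 3) V_M 1. \<exists>w. z - M_const w * c \<in> tate_B 3 (\<gamma> ^^ 3) V_M 1)"

abbreviation cup3 :: "int \<Rightarrow> int \<Rightarrow> 'w::strict_3_ring M \<Rightarrow> 'w M \<Rightarrow> 'w M" where
  "cup3 \<equiv> tate_cup 3 (\<gamma> ^^ 3)"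

definition tr :: "'w::strict_3_ring M \<Rightarrow> 'w M" where
  "tr u = u + \<gamma> u + \<gamma> (\<gamma> u)"

text \<open>\<open>C\<^sub>3\<close>-cochains on \<open>M\<close> for a given cocycle \<open>c\<close> representing \<open>c\<^sub>1\<close>.\<close>

definition c1c2 :: "'w::strict_3_ring M \<Rightarrow> 'w M" where
  "c1c2 c = cup3 1 1 c (\<gamma> c)"

definition cbar :: "'w::strict_3_ring M \<Rightarrow> 'w M" where
  "cbar c = cup3 2 1 (c1c2 c) (\<gamma> (\<gamma> c))"

definition delta :: "'w::strict_3_ring M" where
  "delta = (d1 - d2) * (d2 - d3) * (d3 - d1)"

primrec detecting :: "'w::strict_3_ring M \<Rightarrow> gen \<Rightarrow> 'w M" where
  "detecting c One = 1"
| "detecting c Cbar = cbar c"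
| "detecting c Delta = delta"
| "detecting c CbarDelta = cup3 3 0 (cbar c) delta"
| "detecting c f0 = tr c"
| "detecting c f1 = tr (cup3 1 0 c d1)"
| "detecting c f2 = tr (cup3 1 0 c d2)"
| "detecting c f3 = tr (cup3 1 0 c (d1 * d2))"
| "detecting c f4 = tr (cup3 1 0 c (d2 * d3))"
| "detecting c f5 = tr (cup3 1 0 c (d1 ^ 2 * d2))"
| "detecting c F0 = tr (c1c2 c)"
| "detecting c F1 = tr (cup3 2 0 (c1c2 c) d1)"
| "detecting c F2 = tr (cup3 2 0 (c1c2 c) d2)"
| "detecting c F3 = tr (cup3 2 0 (c1c2 c) (d1 * d2))"
| "detecting c F4 = tr (cup3 2 0 (c1c2 c) (d2 * d3))"
| "detecting c F5 = tr (cup3 2 0 (c1c2 c) (d1 ^ 2 * d2))"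

end

theory Submission
  imports Defs
begin

text \<open>
  Since \<open>s\<^sub>3 = \<Delta>\<close> is invertible and invariant, a homogeneous part of the completed localization is a homogeneous
  part of the module \<open>N\<close> obtained by setting \<open>s\<^sub>3 = 1\<close>.  Over \<open>U = W[[s\<^sub>1, s\<^sub>2]]\<close>, the ring \<open>D\<close> generated by the \<open>d\<^sub>i\<close> is
  free of rank 6, and \<open>N\<close> is the completed tensor product over \<open>D\<close> of three copies of \<open>W[x, y, z]/(x + y + z)\<close>, cyclically
  permuted by \<open>\<gamma>\<close>.  In each copy the third power of \<open>\<gamma>\<close> permutes freely all basis elements except \<open>1, x, y\<close>, so that only tensors
  in \<open>1, x, y\<close> contribute to Tate cohomology.  Those without \<open>x, y\<close> form \<open>D\<close> and give the classes \<open>1\<close> and \<open>\<delta>\<close> by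
  exactness of the Koszul complex of \<open>3, s\<^sub>1, s\<^sub>2\<close>; those with one, two or three factors from \<open>{x, y}\<close> give the \<open>f\<^sub>i\<close>, the \<open>F\<^sub>i\<close>, and
  \<open>Cbar\<close> and \<open>CbarDelta\<close>.
\<close>

subsection \<open>Coordinates on the polynomial rings\<close>

text \<open>No ring structure is put on \<open>N\<close>. Its elements have infinitely many
  coordinates, but each coordinate of a product with some \<open>x_i\<close> involves only finitely
  many of them, so \<open>M\<close> acts on \<open>N\<close> by operators, and an element is
  recorded by its value on 1. The same action proves that the basis is independent: applied to 1,
  the basis elements give distinct coordinate vectors.

  The completion is formed with powers of I, while coordinates see powers of 3, of q and its
  conjugates, of \<open>s_1\<close> and of \<open>s_2\<close>. The two filtrations are compared only
  up to a factor and a shift, which is enough to identify limits.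

  With \<open>s_3 = 1\<close> only the degree modulo 9 survives. Nothing is lost in a fixed degree,
  because there a monomial in the remaining basis occurs with at most one power of
  \<open>s_3\<close>.

  Coefficients in W/9 have to be lifted to W, and lifting is not additive. The map from the free
  module to cocycles is therefore linear only modulo coboundaries; this suffices because 9 times a
  generator is always a coboundary.\<close>

definition add_map :: "('a::ab_group_add \<Rightarrow> 'b::ab_group_add) \<Rightarrow> bool" where
  "add_map T \<longleftrightarrow> (\<forall>x y. T (x + y) = T x + T y)"

lemma add_mapI: "(\<And>x y. T (x + y) = T x + T y) \<Longrightarrow> add_map T"
  by (simp add: add_map_def)

lemma add_map_add: "add_map T \<Longrightarrow> T (x + y) = T x + T y"
  by (simp add: add_map_def)

lemma add_map_0: "add_map T \<Longrightarrow> T 0 = 0"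
  using add_map_add[of T 0 0] by simp

lemma add_map_minus: "add_map T \<Longrightarrow> T (- x) = - T x"
  using add_map_add[of T x "- x"] by (simp add: add_map_0 eq_neg_iff_add_eq_0 add.commute)

lemma add_map_diff: "add_map T \<Longrightarrow> T (x - y) = T x - T y"
  using add_map_add[of T x "- y"] by (simp add: add_map_minus)

lemma add_map_sum: "add_map T \<Longrightarrow> T (\<Sum>i\<in>A. g i) = (\<Sum>i\<in>A. T (g i))"
  by (induction A rule: infinite_finite_induct) (simp_all add: add_map_0 add_map_add)

lemmas add_map_simps = add_map_add add_map_0 add_map_minus add_map_diff

text \<open>Coordinates of \<open>W[x, y, z]/(x + y + z)\<close> over \<open>W[xyz]\<close>, completed: \<open>E1\<close>, \<open>Ex\<close>, \<open>Ey\<close> belong to \<open>1, x, y\<close>, and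
  \<open>G\<^sub>l i\<close>, \<open>H\<^sub>l i\<close> to \<open>q\<^sup>i \<tau>\<^sup>l(xy)\<close>, \<open>q\<^sup>i \<tau>\<^sup>l(x\<^sup>2y)\<close>, where \<open>q = xy + yz + zx\<close> and \<open>\<tau>\<close> sends \<open>x\<close> to \<open>y\<close> to \<open>z\<close>.  In terms of
  coordinates, \<open>Xop\<close> and \<open>Qop\<close> are multiplication by \<open>x\<close> and \<open>q\<close>, and \<open>d\<close> is multiplication by \<open>xyz\<close>.\<close>

datatype bx = E1 | Ex | Ey | G0 nat | G1 nat | G2 nat | H0 nat | H1 nat | H2 nat

text \<open>Each equation is a row of the matrix of x: it collects all basis elements whose product
  with x has a component there. For example the column x(zx) = -z^2 x - xyz of \<open>G2 0\<close>
  is spread over the equations for \<open>H2\<close> and \<open>E1\<close>.\<close>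

fun Xop :: "('v \<Rightarrow> 'v) \<Rightarrow> (bx \<Rightarrow> 'v) \<Rightarrow> bx \<Rightarrow> 'v::ab_group_add" where
  "Xop d u E1 = d (u (G1 0)) - d (u (G2 0))"
| "Xop d u Ex = u E1"
| "Xop d u Ey = d (u (H0 0)) + d (u (H1 0)) + d (u (H2 0))"
| "Xop d u (G0 0) = u Ey - u Ex + d (u (G1 1)) - d (u (G2 1))"
| "Xop d u (G0 (Suc i)) = d (u (G1 (Suc (Suc i)))) - d (u (G2 (Suc (Suc i)))) - u (H0 i)"
| "Xop d u (G1 i) = d (u (G1 (Suc i))) - d (u (G2 (Suc i)))"
| "Xop d u (G2 0) = - u Ex + d (u (G1 1)) - d (u (G2 1))"
| "Xop d u (G2 (Suc i)) = d (u (G1 (Suc (Suc i)))) - d (u (G2 (Suc (Suc i)))) + u (H2 i)"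
| "Xop d u (H0 i) = u (G0 i) - d (u (H0 (Suc i))) - d (u (H1 (Suc i))) - d (u (H2 (Suc i)))"
| "Xop d u (H1 i) = d (u (H0 (Suc i))) + d (u (H1 (Suc i))) + d (u (H2 (Suc i)))"
| "Xop d u (H2 i) = - u (G2 i)"

fun \<tau>op :: "(bx \<Rightarrow> 'v) \<Rightarrow> bx \<Rightarrow> 'v::ab_group_add" where
  "\<tau>op u E1 = u E1"
| "\<tau>op u Ex = - u Ey"
| "\<tau>op u Ey = u Ex - u Ey"
| "\<tau>op u (G0 i) = u (G2 i)"
| "\<tau>op u (G1 i) = u (G0 i)"
| "\<tau>op u (G2 i) = u (G1 i)"
| "\<tau>op u (H0 i) = u (H2 i)"
| "\<tau>op u (H1 i) = u (H0 i)"
| "\<tau>op u (H2 i) = u (H1 i)"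

fun Qop :: "(bx \<Rightarrow> 'v) \<Rightarrow> bx \<Rightarrow> 'v::ab_group_add" where
  "Qop u E1 = 0"
| "Qop u Ex = 0"
| "Qop u Ey = 0"
| "Qop u (G0 0) = u E1"
| "Qop u (G0 (Suc i)) = u (G0 i)"
| "Qop u (G1 0) = u E1"
| "Qop u (G1 (Suc i)) = u (G1 i)"
| "Qop u (G2 0) = u E1"
| "Qop u (G2 (Suc i)) = u (G2 i)"
| "Qop u (H0 0) = u Ex - u Ey"
| "Qop u (H0 (Suc i)) = u (H0 i)"
| "Qop u (H1 0) = u Ey"
| "Qop u (H1 (Suc i)) = u (H1 i)"
| "Qop u (H2 0) = - u Ex"
| "Qop u (H2 (Suc i)) = u (H2 i)"

definition Yop where "Yop d u = \<tau>op (Xop d (\<tau>op (\<tau>op u)))"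
definition Zop where "Zop d u = \<tau>op (\<tau>op (Xop d (\<tau>op u)))"

lemma \<tau>op_cube: "\<tau>op (\<tau>op (\<tau>op u)) = u"
proof (rule ext)
  fix b show "\<tau>op (\<tau>op (\<tau>op u)) b = u b" by (cases b) simp_all
qed

text \<open>The operators shift an index by one and are composed below, so the indices 0, 1 and at
  least 2 must be told apart before the defining equations apply.\<close>

lemma bx_split:
  assumes "(b = E1 \<Longrightarrow> P)" "(b = Ex \<Longrightarrow> P)" "(b = Ey \<Longrightarrow> P)" "(b = G0 0 \<Longrightarrow> P)" "(b = G0 (Suc 0) \<Longrightarrow> P)" "(\<And>i. b = G0 (Suc (Suc i)) \<Longrightarrow> P)" "(b = G1 0 \<Longrightarrow> P)" "(b = G1 (Suc 0) \<Longrightarrow> P)" "(\<And>i. b = G1 (Suc (Suc i)) \<Longrightarrow> P)" "(b = G2 0 \<Longrightarrow> P)" "(b = G2 (Suc 0) \<Longrightarrow> P)" "(\<And>i. b = G2 (Suc (Suc i)) \<Longrightarrow> P)" "(b = H0 0 \<Longrightarrow> P)" "(b = H0 (Suc 0) \<Longrightarrow> P)" "(\<And>i. b = H0 (Suc (Suc i)) \<Longrightarrow> P)" "(b = H1 0 \<Longrightarrow> P)" "(b = H1 (Suc 0) \<Longrightarrow> P)" "(\<And>i. b = H1 (Suc (Suc i)) \<Longrightarrow> P)" "(b = H2 0 \<Longrightarrow> P)" "(b = H2 (Suc 0) \<Longrightarrow> P)" "(\<And>i. b = H2 (Suc (Suc i)) \<Longrightarrow> P)"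
  shows P
proof -
  have n: "i = 0 \<or> i = Suc 0 \<or> (\<exists>k. i = Suc (Suc k))" for i
    by (metis not0_implies_Suc)
  show ?thesis
    by (cases b) (metis assms n)+
qed

lemma \<tau>op_Xop: "\<tau>op (Xop d u) = Yop d (\<tau>op u)" "\<tau>op (Yop d u) = Zop d (\<tau>op u)"
    "\<tau>op (Zop d u) = Xop d (\<tau>op u)"
  by (simp_all add: Yop_def Zop_def \<tau>op_cube)

context
  fixes d :: "'v::ab_group_add \<Rightarrow> 'v"
  assumes d: "add_map d"
begin

text \<open>With the three lemmas after it this verifies that the table behind \<open>Xop\<close> is
  a multiplication table: it makes the coordinates a module over W[x, y, z]/(x + y + z) in which xyz
  acts as \<open>d\<close>.\<close>

lemma Xop_sum: "Xop d u b + Yop d u b + Zop d u b = 0"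
  unfolding Yop_def Zop_def
  by (cases b rule: bx_split; simp add: add_map_simps[OF d])

lemma Xop_Yop_commute: "Xop d (Yop d u) b = Yop d (Xop d u) b"
  unfolding Yop_def
  by (cases b rule: bx_split; simp add: add_map_simps[OF d] algebra_simps)

lemma XYZ_op: "Xop d (Yop d (Zop d u)) b = d (u b)"
  unfolding Yop_def Zop_def \<tau>op_cube
  by (cases b rule: bx_split; simp add: add_map_simps[OF d] algebra_simps)

lemma Qop_XYZ: "Xop d (Yop d u) b + Yop d (Zop d u) b + Zop d (Xop d u) b = Qop u b"
  unfolding Yop_def Zop_def \<tau>op_cube
  by (cases b rule: bx_split; simp add: add_map_simps[OF d] algebra_simps)

end

text \<open>Every coordinate is an integral combination of values of \<open>u\<close> and
  \<open>d\<close>, hence natural in the coefficients. With \<open>T\<close> an operator on another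
  tensor factor this gives the commutation of operators in different factors.\<close>

lemma Xop_nat: "add_map T \<Longrightarrow> (\<And>x. T (d x) = d' (T x)) \<Longrightarrow> T (Xop d u b) = Xop d' (\<lambda>b. T (u b)) b"
  by (induction d u b rule: Xop.induct) (simp_all add: add_map_simps)

lemma \<tau>op_nat: "add_map T \<Longrightarrow> T (\<tau>op u b) = \<tau>op (\<lambda>b. T (u b)) b"
  by (induction u b rule: \<tau>op.induct) (simp_all add: add_map_simps)

lemma Yop_nat: "add_map T \<Longrightarrow> (\<And>x. T (d x) = d' (T x)) \<Longrightarrow> T (Yop d u b) = Yop d' (\<lambda>b. T (u b)) b"
  unfolding Yop_def
  by (subst \<tau>op_nat, assumption, subst Xop_nat, assumption, assumption, subst \<tau>op_nat, assumption, subst \<tau>op_nat, assumption) simp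

lemma Zop_nat: "add_map T \<Longrightarrow> (\<And>x. T (d x) = d' (T x)) \<Longrightarrow> T (Zop d u b) = Zop d' (\<lambda>b. T (u b)) b"
  unfolding Zop_def
  by (subst \<tau>op_nat, assumption, subst \<tau>op_nat, assumption, subst Xop_nat, assumption, assumption, subst \<tau>op_nat, assumption) simp

text \<open>Coordinates with respect to the basis \<open>1, d\<^sub>1, d\<^sub>2, d\<^sub>1d\<^sub>2, d\<^sub>2d\<^sub>3, d\<^sub>1\<^sup>2d\<^sub>2\<close> over the symmetric functions, with \<open>s\<^sub>3\<close> set to 1.\<close>

datatype sx = S0 | S1 | S2 | S3 | S4 | S5

type_synonym 'w U = "'w fps fps"
type_synonym 'w D = "sx \<Rightarrow> 'w U"
type_synonym 'w N = "bx \<Rightarrow> bx \<Rightarrow> bx \<Rightarrow> 'w D"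

abbreviation t1 :: "'w::comm_ring_1 U" where "t1 \<equiv> fps_X"
abbreviation t2 :: "'w::comm_ring_1 U" where "t2 \<equiv> fps_const fps_X"

text \<open>The six basis elements are the multipliers of \<open>c_1\<close> in \<open>f_0\<close>,
  ..., \<open>f_5\<close>, so that coefficients in this basis are coefficients of the generators.
  The rows come from d1^2 = s1 d1 - s2 + d2 d3 and from the cubic equation of d1.\<close>

fun dop1 :: "'w::comm_ring_1 D \<Rightarrow> 'w D" where
  "dop1 u S0 = u S4 - t2 * u S1"
| "dop1 u S1 = u S0 + t1 * u S1"
| "dop1 u S2 = u S5"
| "dop1 u S3 = u S2 - t2 * u S5"
| "dop1 u S4 = u S1"
| "dop1 u S5 = u S3 + t1 * u S5"

text \<open>The rows come from rewriting the images of the basis: d3 = s1 - d1 - d2, d3 d1 = s2 - d1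
  d2 - d2 d3 and d2^2 d3 = s2 d2 - s1 d1 d2 + d1^2 d2.\<close>

fun gD :: "'w::comm_ring_1 D \<Rightarrow> 'w D" where
  "gD u S0 = u S0 + t1 * u S2 + t2 * u S4"
| "gD u S1 = - u S2"
| "gD u S2 = u S1 - u S2 + t2 * u S5"
| "gD u S3 = - u S4 - t1 * u S5"
| "gD u S4 = u S3 - u S4"
| "gD u S5 = u S5"

definition dop2 where "dop2 u = gD (dop1 (gD (gD u)))"
definition dop3 where "dop3 u = gD (gD (dop1 (gD u)))"

lemma gD_cube: "gD (gD (gD u)) = u"
  by (rule ext, rename_tac j, case_tac j; simp add: algebra_simps)

lemma gD_dop: "gD (dop1 u) = dop2 (gD u)" "gD (dop2 u) = dop3 (gD u)" "gD (dop3 u) = dop1 (gD u)"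
  by (simp_all add: dop2_def dop3_def gD_cube)

lemma dop1_dop2_commute: "dop1 (dop2 u) = dop2 (dop1 u)"
  unfolding dop2_def by (rule ext, rename_tac j, case_tac j; simp add: algebra_simps)

lemma dop2_dop3_commute: "dop2 (dop3 u) = dop3 (dop2 u)"
  using dop1_dop2_commute[of "gD (gD u)"] by (metis gD_cube gD_dop)

lemma dop1_dop3_commute: "dop1 (dop3 u) = dop3 (dop1 u)"
  using dop1_dop2_commute[of "gD u"] by (metis gD_cube gD_dop)

lemma dop_e1: "dop1 u j + dop2 u j + dop3 u j = t1 * u j"
  unfolding dop2_def dop3_def by (cases j; simp add: algebra_simps)

lemma dop_e2: "dop1 (dop2 u) j + dop2 (dop3 u) j + dop3 (dop1 u) j = t2 * u j"
  unfolding dop2_def dop3_def by (cases j; simp add: algebra_simps)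

lemma dop_e3: "dop1 (dop2 (dop3 u)) = u"
  unfolding dop2_def dop3_def gD_cube by (rule ext, rename_tac j, case_tac j; simp add: algebra_simps)

lemma add_map_D: "add_map dop1" "add_map gD"
  by (rule add_mapI, rule ext, rename_tac j, case_tac j; simp add: algebra_simps)+

lemma add_map_dop23: "add_map dop2" "add_map dop3"
  unfolding dop2_def dop3_def by (rule add_mapI, simp add: add_map_add[OF add_map_D(1)] add_map_add[OF add_map_D(2)])+

definition usc :: "'w::comm_ring_1 U \<Rightarrow> 'w D \<Rightarrow> 'w D" where "usc f u = (\<lambda>j. f * u j)"

lemma usc_D: "gD (usc f u) = usc f (gD u)" "dop1 (usc f u) = usc f (dop1 u)"
  by (rule ext, rename_tac j, case_tac j; simp add: usc_def algebra_simps)+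

lemma usc_dop23: "dop2 (usc f u) = usc f (dop2 u)" "dop3 (usc f u) = usc f (dop3 u)"
  by (simp_all add: dop2_def dop3_def usc_D)

lemma add_map_usc: "add_map (usc f)"
  by (rule add_mapI) (simp add: usc_def fun_eq_iff algebra_simps)

section \<open>The threefold tensor product and the operators of the variables\<close>

definition L1 :: "((bx \<Rightarrow> 'w D) \<Rightarrow> bx \<Rightarrow> 'w D) \<Rightarrow> 'w N \<Rightarrow> 'w N" where
  "L1 T u = (\<lambda>b1 b2 b3. T (\<lambda>b. u b b2 b3) b1)"
definition L2 :: "((bx \<Rightarrow> 'w D) \<Rightarrow> bx \<Rightarrow> 'w D) \<Rightarrow> 'w N \<Rightarrow> 'w N" where
  "L2 T u = (\<lambda>b1 b2 b3. T (\<lambda>b. u b1 b b3) b2)"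
definition L3 :: "((bx \<Rightarrow> 'w D) \<Rightarrow> bx \<Rightarrow> 'w D) \<Rightarrow> 'w N \<Rightarrow> 'w N" where
  "L3 T u = (\<lambda>b1 b2 b3. T (\<lambda>b. u b1 b2 b) b3)"

text \<open>\<gamma> carries the first factor to the second, the second to the third, and the third
  back to the first after one application of \<tau>, since its cube sends \<open>x_0\<close> to
  \<open>x_3\<close>. On coordinates the slots therefore shift backwards.\<close>

definition \<gamma>N :: "'w::comm_ring_1 N \<Rightarrow> 'w N" where
  "\<gamma>N u = (\<lambda>b1 b2 b3. \<tau>op (\<lambda>b. gD (u b2 b3 b)) b1)"

definition nsc :: "'w::comm_ring_1 U \<Rightarrow> 'w N \<Rightarrow> 'w N" where
  "nsc f u = (\<lambda>b1 b2 b3. usc f (u b1 b2 b3))"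

lemma add_map_id: "add_map (\<lambda>x. x)" by (simp add: add_map_def)
lemma add_map_at: "add_map (\<lambda>v. v b)" by (simp add: add_map_def)

lemma add_map_fun: "(\<And>b. add_map (\<lambda>u. T u b)) \<Longrightarrow> add_map T"
  by (simp add: add_map_def fun_eq_iff)

lemma add_map_comp: "add_map T \<Longrightarrow> add_map T' \<Longrightarrow> add_map (\<lambda>x. T (T' x))"
  by (simp add: add_map_def)

lemma add_map_Xop: "add_map d \<Longrightarrow> add_map (Xop d)"
  apply (rule add_map_fun)
  subgoal for b by (cases b rule: bx_split; simp add: add_map_def algebra_simps)
  done

lemma add_map_\<tau>op: "add_map \<tau>op"
  apply (rule add_map_fun)
  subgoal for b by (cases b; simp add: add_map_def algebra_simps)
  done

lemma add_map_Qop: "add_map Qop"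
  apply (rule add_map_fun)
  subgoal for b by (cases b rule: bx_split; simp add: add_map_def algebra_simps)
  done

lemma add_map_Yop: "add_map d \<Longrightarrow> add_map (Yop d)"
  by (rule add_mapI) (simp add: Yop_def add_map_add[OF add_map_\<tau>op] add_map_add[OF add_map_Xop])

lemma add_map_Zop: "add_map d \<Longrightarrow> add_map (Zop d)"
  by (rule add_mapI) (simp add: Zop_def add_map_add[OF add_map_\<tau>op] add_map_add[OF add_map_Xop])

lemma \<gamma>N_cube: "\<gamma>N (\<gamma>N (\<gamma>N u)) = (\<lambda>b1 b2 b3. \<tau>op (\<lambda>a1. \<tau>op (\<lambda>a2. \<tau>op (\<lambda>a3. u a1 a2 a3) b3) b2) b1)"
proof (intro ext)
  fix b1 b2 b3 j
  note t = \<tau>op_nat[OF add_map_comp[OF add_map_D(2)], of "\<lambda>x. x", OF add_map_id]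
  have "\<gamma>N (\<gamma>N (\<gamma>N u)) b1 b2 b3 = \<tau>op (\<lambda>a1. gD (\<tau>op (\<lambda>a2. gD (\<tau>op (\<lambda>a3. gD (u a1 a2 a3)) b3)) b2)) b1"
    by (simp add: \<gamma>N_def)
  also have "\<dots> = \<tau>op (\<lambda>a1. \<tau>op (\<lambda>a2. \<tau>op (\<lambda>a3. u a1 a2 a3) b3) b2) b1"
    by (simp add: t gD_cube)
  finally show "\<gamma>N (\<gamma>N (\<gamma>N u)) b1 b2 b3 j = \<tau>op (\<lambda>a1. \<tau>op (\<lambda>a2. \<tau>op (\<lambda>a3. u a1 a2 a3) b3) b2) b1 j"
    by simp
qed

lemma \<tau>op_at: "\<tau>op w b1 = (\<lambda>b. \<tau>op (\<lambda>a. w a b) b1)"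
  by (rule ext) (rule \<tau>op_nat[OF add_map_at])

lemma \<tau>op_comm: "\<tau>op (\<lambda>a. \<tau>op (\<lambda>b. w a b) b2) b1 = \<tau>op (\<lambda>b. \<tau>op (\<lambda>a. w a b) b1) b2"
  using \<tau>op_nat[OF add_map_comp[OF add_map_at add_map_\<tau>op, of b2], of w b1]
  by (subst (asm) \<tau>op_at) simp

definition opn :: "nat \<Rightarrow> ('v \<Rightarrow> 'v) \<Rightarrow> (bx \<Rightarrow> 'v) \<Rightarrow> bx \<Rightarrow> 'v::ab_group_add" where
  "opn k = (if k = 0 then Xop else if k = 1 then Yop else Zop)"

lemma opn_nat: "add_map T \<Longrightarrow> (\<And>x. T (d x) = d' (T x)) \<Longrightarrow> T (opn k d u b) = opn k d' (\<lambda>b. T (u b)) b"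
  unfolding opn_def by (simp add: Xop_nat Yop_nat Zop_nat)

lemma add_map_opn: "add_map d \<Longrightarrow> add_map (opn k d)"
  unfolding opn_def by (simp add: add_map_Xop add_map_Yop add_map_Zop)

lemma opn_comm:
  fixes d d' :: "'v::ab_group_add \<Rightarrow> 'v"
  assumes "add_map d" "add_map d'" "\<And>v. d (d' v) = d' (d v)"
  shows "opn k d (\<lambda>b. opn l d' (\<lambda>b'. w b b') b2) b1 = opn l d' (\<lambda>b'. opn k d (\<lambda>b. w b b') b1) b2"
proof -
  let ?T = "\<lambda>v. opn l d' v b2"
  have T: "add_map ?T"
    using add_map_opn[OF assms(2), of l] by (simp add: add_map_def)
  have c: "?T (\<lambda>b'. d (v b')) = d (?T v)" for v
    using opn_nat[of d d' d' l v b2] assms by simp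
  have "?T (opn k (\<lambda>v b'. d (v b')) w b1) = opn k d (\<lambda>b. ?T (w b)) b1"
    by (rule opn_nat[where T = ?T and d = "\<lambda>v b'. d (v b')" and d' = d, OF T]) (rule c)
  moreover have "opn k (\<lambda>v b'. d (v b')) w b1 = (\<lambda>b'. opn k d (\<lambda>b. w b b') b1)"
    by (rule ext) (rule opn_nat[where T = "\<lambda>v. v _" and d = "\<lambda>v b'. d (v b')" and d' = d, OF add_map_at], simp)
  ultimately show ?thesis by simp
qed

lemma opn_same_comm: "add_map d \<Longrightarrow> opn k d (opn l d u) = opn l d (opn k d u)"
proof -
  assume d: "add_map d"
  have XY: "Xop d (Yop d u) = Yop d (Xop d u)" for u
    by (rule ext) (rule Xop_Yop_commute[OF d])
  have YZ: "Yop d (Zop d u) = Zop d (Yop d u)" for u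
    using XY[of "\<tau>op (\<tau>op u)"] by (metis \<tau>op_cube \<tau>op_Xop)
  have XZ: "Xop d (Zop d u) = Zop d (Xop d u)" for u
    using YZ[of "\<tau>op (\<tau>op u)"] by (metis \<tau>op_cube \<tau>op_Xop)
  show ?thesis unfolding opn_def by (simp add: XY YZ XZ)
qed

lemma \<tau>op_opn: "\<tau>op (opn 0 d u) = opn 1 d (\<tau>op u)" "\<tau>op (opn 1 d u) = opn 2 d (\<tau>op u)"
    "\<tau>op (opn 2 d u) = opn 0 d (\<tau>op u)"
  by (simp_all add: opn_def \<tau>op_Xop)

definition X9 :: "9 \<Rightarrow> 'w::comm_ring_1 N \<Rightarrow> 'w N" where
  "X9 i = (if i = 0 then L1 (opn 0 dop1) else if i = 1 then L2 (opn 0 dop2) else if i = 2 then L3 (opn 0 dop3)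
     else if i = 3 then L1 (opn 1 dop1) else if i = 4 then L2 (opn 1 dop2) else if i = 5 then L3 (opn 1 dop3)
     else if i = 6 then L1 (opn 2 dop1) else if i = 7 then L2 (opn 2 dop2) else L3 (opn 2 dop3))"

lemma idx9: "(i::9) = 0 \<or> i = 1 \<or> i = 2 \<or> i = 3 \<or> i = 4 \<or> i = 5 \<or> i = 6 \<or> i = 7 \<or> i = 8"
proof (cases i)
  case (of_int z)
  hence "z \<in> {0..<9}" by simp
  also have "{0..<9} = {0,1,2,3,4,5,6,7,8::int}" by auto
  finally show ?thesis using of_int(1) by auto
qed

lemma UNIV_9: "(UNIV::9 set) = {0,1,2,3,4,5,6,7,8}"
  using idx9 by auto

lemma X9_simps: "X9 0 = L1 (opn 0 dop1)" "X9 1 = L2 (opn 0 dop2)" "X9 2 = L3 (opn 0 dop3)"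
   "X9 3 = L1 (opn 1 dop1)" "X9 4 = L2 (opn 1 dop2)" "X9 5 = L3 (opn 1 dop3)"
   "X9 6 = L1 (opn 2 dop1)" "X9 7 = L2 (opn 2 dop2)" "X9 8 = L3 (opn 2 dop3)"
  by (simp_all add: X9_def)

lemma X9_cases:
  fixes T :: "'w::comm_ring_1 N \<Rightarrow> 'w N"
  assumes "T = X9 i"
  obtains k where "T = L1 (opn k dop1)" | k where "T = L2 (opn k dop2)" | k where "T = L3 (opn k dop3)"
  using idx9[of i] assms by (metis X9_simps)

lemma L_comm:
  "L1 (opn k dop1) (L1 (opn l dop1) u) = L1 (opn l dop1) (L1 (opn k dop1) u)"
  "L2 (opn k dop2) (L2 (opn l dop2) u) = L2 (opn l dop2) (L2 (opn k dop2) u)"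
  "L3 (opn k dop3) (L3 (opn l dop3) u) = L3 (opn l dop3) (L3 (opn k dop3) u)"
  "L1 (opn k dop1) (L2 (opn l dop2) u) = L2 (opn l dop2) (L1 (opn k dop1) u)"
  "L1 (opn k dop1) (L3 (opn l dop3) u) = L3 (opn l dop3) (L1 (opn k dop1) u)"
  "L2 (opn k dop2) (L3 (opn l dop3) u) = L3 (opn l dop3) (L2 (opn k dop2) u)"
proof -
  show "L1 (opn k dop1) (L1 (opn l dop1) u) = L1 (opn l dop1) (L1 (opn k dop1) u)"
    by (simp add: L1_def opn_same_comm[OF add_map_D(1), of k l])
  show "L2 (opn k dop2) (L2 (opn l dop2) u) = L2 (opn l dop2) (L2 (opn k dop2) u)"
    by (simp add: L2_def opn_same_comm[OF add_map_dop23(1), of k l])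
  show "L3 (opn k dop3) (L3 (opn l dop3) u) = L3 (opn l dop3) (L3 (opn k dop3) u)"
    by (simp add: L3_def opn_same_comm[OF add_map_dop23(2), of k l])
  show "L1 (opn k dop1) (L2 (opn l dop2) u) = L2 (opn l dop2) (L1 (opn k dop1) u)"
    unfolding L1_def L2_def
    by (intro ext, rule fun_cong[OF opn_comm[OF add_map_D(1) add_map_dop23(1) dop1_dop2_commute]])
  show "L1 (opn k dop1) (L3 (opn l dop3) u) = L3 (opn l dop3) (L1 (opn k dop1) u)"
    unfolding L1_def L3_def
    by (intro ext, rule fun_cong[OF opn_comm[OF add_map_D(1) add_map_dop23(2) dop1_dop3_commute]])
  show "L2 (opn k dop2) (L3 (opn l dop3) u) = L3 (opn l dop3) (L2 (opn k dop2) u)"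
    unfolding L2_def L3_def
    by (intro ext, rule fun_cong[OF opn_comm[OF add_map_dop23 dop2_dop3_commute]])
qed

lemma X9_comm: "X9 i (X9 j u) = X9 j (X9 i u)" for u :: "'w::comm_ring_1 N"
proof -
  have "T (T' u) = T' (T u)" if "T = X9 i" "T' = X9 j" for T T' :: "'w N \<Rightarrow> 'w N"
    by (rule X9_cases[OF that(1)]; rule X9_cases[OF that(2)]; simp add: L_comm)
  thus ?thesis by blast
qed

lemma \<gamma>N_L1: "\<gamma>N (L1 (opn k dop1) u) = L2 (opn k dop2) (\<gamma>N u)"
proof (intro ext)
  fix b1 b2 b3 j
  have T: "add_map (\<lambda>w. \<tau>op (\<lambda>b. gD (w b)) b1)"
    by (rule add_mapI) (simp add: add_map_add[OF add_map_D(2)] add_map_add[OF add_map_\<tau>op, unfolded plus_fun_def])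
  have c: "\<tau>op (\<lambda>b. gD (dop1 (x b))) b1 = dop2 (\<tau>op (\<lambda>b. gD (x b)) b1)" for x
    by (simp add: gD_dop \<tau>op_nat[OF add_map_dop23(1)])
  have eq: "opn k dop1 (\<lambda>a. u a b3 b) b2 = opn k (\<lambda>v b. dop1 (v b)) (\<lambda>a. u a b3) b2 b" for b
    by (rule opn_nat[where T = "\<lambda>v. v _" and d = "\<lambda>v b'. dop1 (v b')" and d' = dop1, OF add_map_at, symmetric]) simp
  show "\<gamma>N (L1 (opn k dop1) u) b1 b2 b3 j = L2 (opn k dop2) (\<gamma>N u) b1 b2 b3 j"
    using opn_nat[where T = "\<lambda>w. \<tau>op (\<lambda>b. gD (w b)) b1" and d = "\<lambda>v b. dop1 (v b)" and d' = dop2, OF T c, of k "\<lambda>a b. u a b3 b" b2] by (simp add: eq \<gamma>N_def L1_def L2_def)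
qed

lemma \<gamma>N_L2: "\<gamma>N (L2 (opn k dop2) u) = L3 (opn k dop3) (\<gamma>N u)"
proof (intro ext)
  fix b1 b2 b3 j
  have T: "add_map (\<lambda>w. \<tau>op (\<lambda>b. gD (w b)) b1)"
    by (rule add_mapI) (simp add: add_map_add[OF add_map_D(2)] add_map_add[OF add_map_\<tau>op, unfolded plus_fun_def])
  have c: "\<tau>op (\<lambda>b. gD (dop2 (x b))) b1 = dop3 (\<tau>op (\<lambda>b. gD (x b)) b1)" for x
    by (simp add: gD_dop \<tau>op_nat[OF add_map_dop23(2)])
  have eq: "opn k dop2 (\<lambda>a. u b2 a b) b3 = opn k (\<lambda>v b. dop2 (v b)) (\<lambda>a. u b2 a) b3 b" for b
    by (rule opn_nat[where T = "\<lambda>v. v _" and d = "\<lambda>v b'. dop2 (v b')" and d' = dop2, OF add_map_at, symmetric]) simp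
  show "\<gamma>N (L2 (opn k dop2) u) b1 b2 b3 j = L3 (opn k dop3) (\<gamma>N u) b1 b2 b3 j"
    using opn_nat[where T = "\<lambda>w. \<tau>op (\<lambda>b. gD (w b)) b1" and d = "\<lambda>v b. dop2 (v b)" and d' = dop3, OF T c, of k "\<lambda>a b. u b2 a b" b3] by (simp add: eq \<gamma>N_def L3_def L2_def)
qed

lemma \<gamma>N_L3: "\<gamma>N (L3 (opn 0 dop3) u) = L1 (opn 1 dop1) (\<gamma>N u)"
   "\<gamma>N (L3 (opn 1 dop3) u) = L1 (opn 2 dop1) (\<gamma>N u)" "\<gamma>N (L3 (opn 2 dop3) u) = L1 (opn 0 dop1) (\<gamma>N u)"
  by (simp_all add: \<gamma>N_def L1_def L3_def opn_nat[where T = gD and d = dop3 and d' = dop1, OF add_map_D(2) gD_dop(3)] \<tau>op_opn del: One_nat_def)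

lemma \<gamma>N_X9: "\<gamma>N (X9 i u) = X9 (i + 1) (\<gamma>N u)"
proof -
  have nine: "(9::9) = 0" by simp
  show ?thesis
    using idx9[of i]
    by (elim disjE) (simp_all add: nine X9_simps \<gamma>N_L1 \<gamma>N_L2 \<gamma>N_L3 del: One_nat_def)
qed

subsection \<open>The action of the localization on the model\<close>

definition Ulin :: "('w::comm_ring_1 N \<Rightarrow> 'w N) \<Rightarrow> bool" where
  "Ulin T \<longleftrightarrow> add_map T \<and> (\<forall>f u. T (nsc f u) = nsc f (T u))"

lemma add_map_nsc: "add_map (nsc f)"
  by (rule add_mapI) (simp add: nsc_def fun_eq_iff add_map_add[OF add_map_usc])

lemma Ulin_nsc: "Ulin (nsc f)"
  unfolding Ulin_def by (simp add: add_map_nsc) (simp add: nsc_def usc_def fun_eq_iff mult_ac)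

lemma opn_fun: "add_map d \<Longrightarrow> opn k d (\<lambda>b. x b + y b) b' = opn k d (\<lambda>b. x b) b' + opn k d (\<lambda>b. y b) b'"
  using add_map_add[OF add_map_opn, of d k x y] by (simp add: plus_fun_def)

lemma UlinI:
  assumes "\<And>u v. T (u + v) = T u + T v" "\<And>f u. T (nsc f u) = nsc f (T u)"
  shows "Ulin T"
  using assms by (simp add: Ulin_def add_map_def)

lemma opn_usc: "(\<And>x. d (usc f x) = usc f (d x)) \<Longrightarrow> opn k d (\<lambda>b. usc f (u b)) b' = usc f (opn k d u b')"
  by (rule opn_nat[OF add_map_usc, symmetric]) simp

lemma Ulin_L: "Ulin (L1 (opn k dop1))" "Ulin (L2 (opn k dop2))" "Ulin (L3 (opn k dop3))"
  by (rule UlinI; simp only: L1_def L2_def L3_def nsc_def plus_fun_apply opn_usc[where d = dop1, OF usc_D(2)] opn_usc[where d = dop2, OF usc_dop23(1)]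
      opn_usc[where d = dop3, OF usc_dop23(2)] opn_fun[OF add_map_D(1)] opn_fun[OF add_map_dop23(1)] opn_fun[OF add_map_dop23(2)];
      simp add: fun_eq_iff)+

lemma Ulin_X9: "Ulin (X9 i)"
  by (simp add: X9_def Ulin_L)

text \<open>Operators in the bicommutant of the \<open>X9 i\<close> commute, so polynomials in the \<open>x\<^sub>i\<close> can be evaluated in them.\<close>

typedef (overloaded) 'w cop = "{T :: 'w::comm_ring_1 N \<Rightarrow> 'w N. Ulin T \<and>
    (\<forall>S. Ulin S \<and> (\<forall>i u. S (X9 i u) = X9 i (S u)) \<longrightarrow> (\<forall>u. S (T u) = T (S u)))}"
  morphisms ap Abs_cop
  by (rule exI[of _ "\<lambda>u. u"]) (simp add: Ulin_def add_map_def)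

setup_lifting type_definition_cop

lemma ap_Ulin: "Ulin (ap T)"
  using ap[of T] by auto

lemma ap_X9: "ap T (X9 i u) = X9 i (ap T u)"
  using ap[of T] Ulin_X9[of i] X9_comm by fastforce

lemma ap_commute: "ap T (ap T' u) = ap T' (ap T u)"
  using ap[of T'] ap_Ulin[of T] ap_X9[of T] by blast

lemma Ulin_D: "Ulin T \<Longrightarrow> T (u + v) = T u + T v" "Ulin T \<Longrightarrow> T (nsc f u) = nsc f (T u)"
    "Ulin T \<Longrightarrow> T (- u) = - T u" "Ulin T \<Longrightarrow> T 0 = 0"
  by (simp_all add: Ulin_def add_map_simps)

lemma nsc_0: "nsc f 0 = 0" and nsc_add: "nsc f (u + v) = nsc f u + nsc f v"
    and nsc_uminus: "nsc f (- u) = - nsc f u" and nsc_diff: "nsc f (u - v) = nsc f u - nsc f v"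
  by (simp_all add: add_map_simps[OF add_map_nsc])

instantiation cop :: (comm_ring_1) comm_ring_1
begin

lift_definition zero_cop :: "'a cop" is "\<lambda>_. 0"
proof (intro conjI allI impI UlinI)
  fix S :: "'a N \<Rightarrow> 'a N" assume "Ulin S \<and> (\<forall>i u. S (X9 i u) = X9 i (S u))"
  thus "S 0 = 0" by (blast intro: Ulin_D)
qed (simp_all only: nsc_0 add_0_left)
lift_definition one_cop :: "'a cop" is "\<lambda>u. u"
  by (intro conjI allI impI UlinI refl)
lift_definition plus_cop :: "'a cop \<Rightarrow> 'a cop \<Rightarrow> 'a cop" is "\<lambda>S T u. S u + T u"
  subgoal premises p for S T
  proof -
    have 1: "Ulin S" "Ulin T" using p by blast+
    have "Ulin (\<lambda>u. S u + T u)"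
      by (rule UlinI) (simp_all only: Ulin_D[OF 1(1)] Ulin_D[OF 1(2)] nsc_add add.assoc add.left_commute)
    moreover have "R (S u + T u) = S (R u) + T (R u)" if "Ulin R" "\<forall>i u. R (X9 i u) = X9 i (R u)" for R u
    proof -
      have "R (S u) = S (R u)" "R (T u) = T (R u)" using p that by blast+
      thus ?thesis by (simp only: Ulin_D[OF that(1)])
    qed
    ultimately show ?thesis by blast
  qed
  done
lift_definition uminus_cop :: "'a cop \<Rightarrow> 'a cop" is "\<lambda>T u. - T u"
  subgoal premises p for T
  proof -
    have 1: "Ulin T" using p by blast
    have "Ulin (\<lambda>u. - T u)"
      by (rule UlinI) (simp_all only: Ulin_D[OF 1] nsc_uminus minus_add_distrib)
    moreover have "R (- T u) = - T (R u)" if "Ulin R" "\<forall>i u. R (X9 i u) = X9 i (R u)" for R u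
    proof -
      have "R (T u) = T (R u)" using p that by blast
      thus ?thesis by (simp only: Ulin_D[OF that(1)])
    qed
    ultimately show ?thesis by blast
  qed
  done
lift_definition times_cop :: "'a cop \<Rightarrow> 'a cop \<Rightarrow> 'a cop" is "\<lambda>S T u. S (T u)"
  subgoal premises p for S T
  proof -
    have 1: "Ulin S" "Ulin T" using p by blast+
    have "Ulin (\<lambda>u. S (T u))"
      by (rule UlinI) (simp_all only: Ulin_D[OF 1(1)] Ulin_D[OF 1(2)])
    moreover have "R (S (T u)) = S (T (R u))" if "Ulin R" "\<forall>i u. R (X9 i u) = X9 i (R u)" for R u
    proof -
      have "R (S v) = S (R v)" "R (T v) = T (R v)" for v using p that by blast+
      thus ?thesis by (simp only:)
    qed
    ultimately show ?thesis by blast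
  qed
  done
definition minus_cop :: "'a cop \<Rightarrow> 'a cop \<Rightarrow> 'a cop" where "minus_cop S T = S + - T"

lemma ap_simps0: "ap (S + T) u = ap S u + ap T u" "ap 0 u = 0" "ap 1 u = u"
    "ap (- T) u = - ap T u" "ap (S * T) u = ap S (ap T u)"
  by (simp_all only: plus_cop.rep_eq zero_cop.rep_eq one_cop.rep_eq uminus_cop.rep_eq times_cop.rep_eq)

lemma cop_eqI: "(\<And>u. ap S u = ap T u) \<Longrightarrow> S = T" for S T :: "'a cop"
  by (rule ap_inject[THEN iffD1]) (rule ext)

instance
proof
  fix a b c :: "'a cop"
  show "a * b * c = a * (b * c)" by (rule cop_eqI) (simp only: ap_simps0)
  show "a * b = b * a" by (rule cop_eqI) (simp only: ap_simps0 ap_commute)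
  show "1 * a = a" by (rule cop_eqI) (simp only: ap_simps0)
  show "a + b + c = a + (b + c)" by (rule cop_eqI) (simp only: ap_simps0 add.assoc)
  show "a + b = b + a" by (rule cop_eqI) (simp only: ap_simps0 add.commute)
  show "0 + a = a" by (rule cop_eqI) (simp only: ap_simps0 add_0_left)
  show "- a + a = 0" by (rule cop_eqI) (simp only: ap_simps0 left_minus)
  show "a - b = a + - b" by (rule minus_cop_def)
  show "(a + b) * c = a * c + b * c" by (rule cop_eqI) (simp only: ap_simps0)
  show "(0::'a cop) \<noteq> 1"
  proof
    assume eq: "(0::'a cop) = 1"
    have "ap (0::'a cop) u = ap 1 u" for u by (simp only: eq)
    hence "(0 :: 'a N) = (\<lambda>_ _ _ _. 1::'a U)" by (simp only: ap_simps0)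
    from arg_cong[OF this, of "\<lambda>u. u E1 E1 E1 S0"] show False by simp
  qed
qed

end

lemma ap_diff: "ap (S - T) u = ap S u - ap T u"
  by (simp only: minus_cop_def ap_simps0 diff_conv_add_uminus)

lemmas ap_simps = ap_simps0 ap_diff

lift_definition copX :: "9 \<Rightarrow> 'w::comm_ring_1 cop" is X9
  by (blast intro: Ulin_X9)

lift_definition copU :: "'w::comm_ring_1 U \<Rightarrow> 'w cop" is nsc
  by (blast intro: Ulin_nsc Ulin_D(2))

lemma copU_hom: "copU (f + g) = copU f + copU g" "copU (f * g) = copU f * copU g" "copU 1 = 1"
  by (rule cop_eqI; simp add: ap_simps copU.rep_eq; simp add: nsc_def usc_def fun_eq_iff algebra_simps)+

definition copW :: "'w::comm_ring_1 \<Rightarrow> 'w cop" where "copW w = copU (fps_const (fps_const w))"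

lemma copW_hom: "copW (x + y) = copW x + copW y" "copW (x * y) = copW x * copW y" "copW 1 = 1"
  unfolding copW_def by (simp_all flip: copU_hom)

section \<open>Evaluation of polynomials and fractions in operators\<close>

lemmas M_eval_simps =
  poly9_subst_add[of copW, OF copW_hom] poly9_subst_mult[of copW, OF copW_hom]
  poly9_subst_one[of copW, OF copW_hom] poly9_subst_zero[of copW, OF copW_hom]
  poly9_subst_pvar[of copW, OF copW_hom]

lemma opn_sum: "add_map d \<Longrightarrow> opn 0 d u b + opn 1 d u b + opn 2 d u b = 0"
  using Xop_sum[of d u b] by (simp add: opn_def)

lemma L_sum: "L1 (opn 0 dop1) u + L1 (opn 1 dop1) u + L1 (opn 2 dop1) u = 0"
    "L2 (opn 0 dop2) u + L2 (opn 1 dop2) u + L2 (opn 2 dop2) u = 0"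
    "L3 (opn 0 dop3) u + L3 (opn 1 dop3) u + L3 (opn 2 dop3) u = 0"
proof -
  show "L1 (opn 0 dop1) u + L1 (opn 1 dop1) u + L1 (opn 2 dop1) u = 0"
    using opn_sum[OF add_map_D(1), of "\<lambda>b. u b _ _"] by (intro ext) (simp add: L1_def fun_eq_iff)
  show "L2 (opn 0 dop2) u + L2 (opn 1 dop2) u + L2 (opn 2 dop2) u = 0"
    using opn_sum[OF add_map_dop23(1), of "\<lambda>b. u _ b _"] by (intro ext) (simp add: L2_def fun_eq_iff)
  show "L3 (opn 0 dop3) u + L3 (opn 1 dop3) u + L3 (opn 2 dop3) u = 0"
    using opn_sum[OF add_map_dop23(2), of "\<lambda>b. u _ _ b"] by (intro ext) (simp add: L3_def fun_eq_iff)
qed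

lemma copX_sum: "copX 0 + copX 3 + copX 6 = 0" "copX 1 + copX 4 + copX 7 = 0" "copX 2 + copX 5 + copX 8 = 0"
  by (rule cop_eqI, simp only: ap_simps copX.rep_eq X9_simps L_sum)+

lifting_forget cop.lifting

lemma M_eval_relations: "p \<in> ideal_gen M_relations \<Longrightarrow> poly9_subst copW copX p = (0 :: 'w::strict_3_ring cop)"
  by (induction rule: ideal_gen_induct) (auto simp: M_eval_simps M_relations_def copX_sum)

lift_definition M_hom :: "'w::strict_3_ring M \<Rightarrow> 'w cop" is "poly9_subst copW copX"
proof -
  fix p q :: "'w poly9" assume "p - q \<in> ideal_gen M_relations"
  hence "poly9_subst copW copX (p - q) = (0 :: 'w cop)" by (rule M_eval_relations)
  moreover have "poly9_subst copW copX ((p - q) + q) = poly9_subst copW copX (p - q) + (poly9_subst copW copX q :: 'w cop)"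
    by (rule M_eval_simps)
  ultimately show "poly9_subst copW copX p = (poly9_subst copW copX q :: 'w cop)" by simp
qed

lemma M_hom_simps: "M_hom (a + b) = M_hom a + M_hom b" "M_hom (a * b) = M_hom a * M_hom b"
    "M_hom 0 = 0" "M_hom 1 = 1" "M_hom (xM i) = copX i"
  by (transfer, simp add: M_eval_simps)+

lemma M_hom_const: "M_hom (M_const w) = copW w"
  by transfer (simp add: pconst_def poly9_subst_single[of copW, OF copW_hom])

lemma M_hom_minus: "M_hom (- a) = - M_hom a"
  using M_hom_simps(1)[of a "- a"] by (simp add: M_hom_simps eq_neg_iff_add_eq_0 add.commute)

lemma M_hom_diff: "M_hom (a - b) = M_hom a - M_hom b"
  using M_hom_simps(1)[of a "- b"] by (simp add: M_hom_minus)

lemma M_hom_power: "M_hom (a ^ k) = M_hom a ^ k"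
  by (induction k) (simp_all add: M_hom_simps)

definition pd :: "('w D \<Rightarrow> 'w D) \<Rightarrow> 'w N \<Rightarrow> 'w N" where "pd d u = (\<lambda>b1 b2 b3. d (u b1 b2 b3))"

lemma ap_M_hom_d: "ap (M_hom d1) u = pd dop1 u" "ap (M_hom d2) u = pd dop2 u" "ap (M_hom d3) u = pd dop3 u"
  for u :: "'w::strict_3_ring N"
proof -
  have XYZ: "opn 0 d (opn 1 d (opn 2 d w)) b = d (w b)" if "add_map d" for d :: "'w D \<Rightarrow> 'w D" and w b
    using XYZ_op[OF that] by (simp add: opn_def)
  show "ap (M_hom d1) u = pd dop1 u" "ap (M_hom d2) u = pd dop2 u" "ap (M_hom d3) u = pd dop3 u"
    using XYZ[OF add_map_D(1)] XYZ[OF add_map_dop23(1)] XYZ[OF add_map_dop23(2)]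
    by (simp_all add: d1_def d2_def d3_def M_hom_simps ap_simps copX.rep_eq X9_simps L1_def L2_def L3_def pd_def
       del: One_nat_def)
qed

lemma M_hom_s: "M_hom s1 = copU t1" "M_hom s2 = copU t2" "M_hom s3 = 1"
proof -
  show "M_hom s1 = copU t1"
    by (rule cop_eqI) (simp add: s1_def M_hom_simps ap_simps ap_M_hom_d copU.rep_eq pd_def nsc_def usc_def fun_eq_iff dop_e1)
  show "M_hom s2 = copU t2"
    by (rule cop_eqI) (simp add: s2_def M_hom_simps ap_simps ap_M_hom_d copU.rep_eq pd_def nsc_def usc_def fun_eq_iff dop_e2)
  show "M_hom s3 = 1"
    by (rule cop_eqI) (simp add: s3_def M_hom_simps ap_simps ap_M_hom_d copU.rep_eq pd_def nsc_def usc_def fun_eq_iff dop_e3)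
qed

lemma \<Delta>_eq_s3: "\<Delta> = s3"
  unfolding \<Delta>_def UNIV_9 s3_def d1_def d2_def d3_def by (simp add: mult_ac)

lemma M_hom_\<Delta>: "M_hom (\<Delta> ^ k) = 1"
  by (simp add: M_hom_power \<Delta>_eq_s3 M_hom_s)

text \<open>\<open>\<Delta>\<close> is \<open>s3\<close>, which acts as the identity on
  \<open>N\<close>, so a fraction acts as its numerator.\<close>

lift_definition Mloc_hom :: "'w::strict_3_ring Mloc \<Rightarrow> 'w cop" is "\<lambda>(m, k). M_hom m"
proof (clarsimp simp: frac_eq_def)
  fix a b :: "'w M" and k l j
  assume "\<Delta> ^ j * (\<Delta> ^ l * a - \<Delta> ^ k * b) = 0"
  hence "M_hom (\<Delta> ^ j * (\<Delta> ^ l * a - \<Delta> ^ k * b)) = M_hom 0" by simp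
  thus "M_hom a = M_hom b" by (simp add: M_hom_simps M_hom_diff M_hom_\<Delta>)
qed

lemma Mloc_hom_simps: "Mloc_hom (a + b) = Mloc_hom a + Mloc_hom b" "Mloc_hom (a * b) = Mloc_hom a * Mloc_hom b"
    "Mloc_hom 0 = 0" "Mloc_hom 1 = 1" "Mloc_hom (- a) = - Mloc_hom a"
  by (transfer; auto simp: M_hom_simps M_hom_minus M_hom_\<Delta>)+

lemma Mloc_hom_mfrac: "Mloc_hom (mfrac m k) = M_hom m"
  by transfer simp

lemma Mloc_hom_diff: "Mloc_hom (a - b) = Mloc_hom a - Mloc_hom b"
  using Mloc_hom_simps(1)[of a "- b"] by (simp add: Mloc_hom_simps)

lemma Mloc_hom_sum: "Mloc_hom (\<Sum>i\<in>A. g i) = (\<Sum>i\<in>A. Mloc_hom (g i))"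
  by (induction A rule: infinite_finite_induct) (simp_all add: Mloc_hom_simps)

lemma pvar_power: "pvar i ^ k = Poly_Mapping.single (Poly_Mapping.single i k) 1"
proof (induction k)
  case 0
  show ?case by simp
next
  case (Suc k)
  thus ?case by (simp add: pvar_def mult_single flip: single_add)
qed

lemma single_monomial:
  "Poly_Mapping.single e w = pconst w * (\<Prod>i\<in>UNIV. pvar i ^ Poly_Mapping.lookup e i)"
proof -
  have prod: "(\<Prod>i\<in>A. pvar i ^ n i) = Poly_Mapping.single (\<Sum>i\<in>A. Poly_Mapping.single i (n i)) (1 :: 'a)"
    for A :: "9 set" and n
    by (induction A rule: infinite_finite_induct) (simp_all add: pvar_power mult_single)
  have "(\<Sum>i\<in>UNIV. Poly_Mapping.single i (Poly_Mapping.lookup e i)) = e"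
    by (rule poly_mapping_eqI) (simp add: lookup_sum lookup_single when_def)
  thus ?thesis by (simp add: prod pconst_def mult_single)
qed

lemma poly9_sum_monomials: "p = (\<Sum>e\<in>Poly_Mapping.keys p. Poly_Mapping.single e (Poly_Mapping.lookup p e))"
  for p :: "'w::comm_ring_1 poly9"
  by (rule poly_mapping_eqI) (auto simp: lookup_sum lookup_single when_def in_keys_iff sum.delta)

lemma poly9_induct [case_names const var add mult]:
  assumes "\<And>w. P (pconst w)" "\<And>i. P (pvar i)" "\<And>p q. P p \<Longrightarrow> P q \<Longrightarrow> P (p + q)" "\<And>p q. P p \<Longrightarrow> P q \<Longrightarrow> P (p * q)"
  shows "P (p :: 'w::comm_ring_1 poly9)"
proof -
  have zero: "P 0" using assms(1)[of 0] by (simp add: pconst_def)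
  have one: "P 1" using assms(1)[of 1] by (simp add: pconst_def)
  have pow: "P (pvar i ^ k)" for i k by (induction k) (simp_all add: one assms)
  have "P (\<Prod>i\<in>A. pvar i ^ n i)" for A and n :: "9 \<Rightarrow> nat"
    by (induction A rule: infinite_finite_induct) (simp_all add: one pow assms)
  hence "P (Poly_Mapping.single e w)" for e w by (simp add: single_monomial assms)
  hence "P (\<Sum>e\<in>A. Poly_Mapping.single e (f e))" for A f
    by (induction A rule: infinite_finite_induct) (simp_all add: zero assms)
  thus ?thesis using poly9_sum_monomials[of p] by metis
qed

lemma M_induct [case_names const var add mult]:
  assumes "\<And>w. P (M_const w)" "\<And>i. P (xM i)" "\<And>a b. P a \<Longrightarrow> P b \<Longrightarrow> P (a + b)" "\<And>a b. P a \<Longrightarrow> P b \<Longrightarrow> P (a * b)"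
  shows "P (m :: 'w::strict_3_ring M)"
proof -
  have "P (abs_M p)" for p :: "'w poly9"
    by (induction p rule: poly9_induct)
       (use assms in \<open>simp_all flip: M_const.abs_eq xM.abs_eq plus_M.abs_eq times_M.abs_eq\<close>)
  thus ?thesis by (metis M.abs_induct)
qed

lemma \<gamma>_const: "\<gamma> (M_const w) = M_const w"
proof -
  have "poly9_subst pconst f (pconst w) = pconst w" for f :: "9 \<Rightarrow> 'a poly9" and w :: 'a
    using poly9_subst_single[of pconst, OF pconst_hom, of f 0 w] by (simp add: pconst_def)
  thus ?thesis by transfer (simp add: ideal_gen_zero)
qed

lemma add_map_\<gamma>N: "add_map \<gamma>N"
proof (rule add_mapI)
  fix u v :: "'w::comm_ring_1 N"
  have "\<tau>op (\<lambda>b. x b + y b) b1 = \<tau>op x b1 + \<tau>op y b1" for x y :: "bx \<Rightarrow> 'w D" and b1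
    using add_map_add[OF add_map_\<tau>op, of x y] by (simp add: plus_fun_def)
  thus "\<gamma>N (u + v) = \<gamma>N u + \<gamma>N v"
    by (intro ext) (simp add: \<gamma>N_def add_map_add[OF add_map_D(2)])
qed

lemma \<gamma>N_nsc: "\<gamma>N (nsc f u) = nsc f (\<gamma>N u)"
  by (intro ext) (simp add: \<gamma>N_def nsc_def usc_D \<tau>op_nat[OF add_map_usc])

lemma ap_M_hom_\<gamma>: "ap (M_hom (\<gamma> m)) (\<gamma>N u) = \<gamma>N (ap (M_hom m) u)"
proof (induction m arbitrary: u rule: M_induct)
  case (const w)
  show ?case by (simp add: \<gamma>_const M_hom_const copW_def copU.rep_eq \<gamma>N_nsc)
next
  case (var i)
  show ?case by (simp add: \<gamma>_simps M_hom_simps copX.rep_eq \<gamma>N_X9)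
next
  case (add a b)
  thus ?case by (simp only: \<gamma>_simps M_hom_simps ap_simps add_map_add[OF add_map_\<gamma>N])
next
  case (mult a b)
  thus ?case by (simp add: \<gamma>_simps M_hom_simps ap_simps)
qed

lemma Mloc_cases: obtains a k where "m = mfrac a k"
proof -
  have "\<exists>a k. m = mfrac a k"
    by (rule Mloc.abs_induct[of _ m]) (auto simp: mfrac_def)
  thus ?thesis using that by blast
qed

lemma ap_Mloc_hom_\<gamma>: "ap (Mloc_hom (\<gamma>_loc m)) (\<gamma>N u) = \<gamma>N (ap (Mloc_hom m) u)"
  by (cases m rule: Mloc_cases) (simp add: \<gamma>_loc_simps Mloc_hom_mfrac ap_M_hom_\<gamma>)

subsection \<open>Homogeneous spanning sets\<close>

lemma mfrac0_simps: "mfrac (a + b) 0 = mfrac a 0 + mfrac b 0" "mfrac (a * b) 0 = mfrac a 0 * mfrac b 0"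
    "mfrac 0 0 = 0" "mfrac 1 0 = 1" "mfrac (- a) 0 = - mfrac a 0"
  by (transfer; auto simp: frac_eq_def)+

lemma mfrac0_diff: "mfrac (a - b) 0 = mfrac a 0 - mfrac b 0"
  using mfrac0_simps(1)[of a "- b"] by (simp add: mfrac0_simps)

lemma mfrac0_power: "mfrac (a ^ k) 0 = mfrac a 0 ^ k"
  by (induction k) (simp_all add: mfrac0_simps)

lemma mfrac_mult: "mfrac a k * mfrac b l = mfrac (a * b) (k + l)"
  by transfer (auto simp: frac_eq_def)

lemma mfrac_cancel: "mfrac (\<Delta> ^ l * a) (k + l) = mfrac a k"
  by transfer (auto simp: frac_eq_def power_add algebra_simps intro!: exI[of _ 0])

lemma s3_pow_add: "s3_pow (c + d) = s3_pow c * s3_pow d"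
proof -
  have *: "mfrac (\<Delta> ^ a) b * mfrac (\<Delta> ^ a') b' = mfrac (\<Delta> ^ a'') b''"
    if "a + a' + b'' = a'' + b + b'" for a b a' b' a'' b''
  proof -
    have "mfrac (\<Delta> ^ (a + a')) (b + b') = mfrac (\<Delta> ^ (a + a' + b'')) (b + b' + b'')"
      using mfrac_cancel[of b'' "\<Delta> ^ (a + a')" "b + b'", symmetric] by (simp add: power_add mult_ac add_ac)
    also have "\<dots> = mfrac (\<Delta> ^ (b + b') * \<Delta> ^ a'') (b'' + (b + b'))"
      unfolding that by (simp add: power_add mult_ac add_ac)
    also have "\<dots> = mfrac (\<Delta> ^ a'') b''" by (rule mfrac_cancel)
    finally show ?thesis by (simp add: mfrac_mult power_add)
  qed
  have eq: "s3_pow c = mfrac (\<Delta> ^ nat c) (nat (- c))" for c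
    by (simp add: s3_pow_def \<Delta>_eq_s3)
  show ?thesis unfolding eq by (rule *[symmetric]) linarith
qed

lemma s3_pow_0: "s3_pow 0 = 1"
  by (simp add: s3_pow_def mfrac0_simps)

lemma s3_pow_1: "s3_pow 1 = mfrac s3 0"
  by (simp add: s3_pow_def)

lemma mfrac_eq: "mfrac m k = mfrac m 0 * s3_pow (- int k)"
  by (cases k) (simp_all add: s3_pow_def mfrac_mult mfrac0_simps nat_minus_as_int nat_add_distrib)

lemma \<gamma>_d: "\<gamma> d1 = d2" "\<gamma> d2 = d3" "\<gamma> d3 = d1"
proof -
  have [simp]: "(9::9) = 0" by simp
  show "\<gamma> d1 = d2" "\<gamma> d2 = d3" "\<gamma> d3 = d1"
    by (simp_all add: d1_def d2_def d3_def \<gamma>_simps mult_ac)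
qed

lemma \<gamma>_s: "\<gamma> s1 = s1" "\<gamma> s2 = s2" "\<gamma> s3 = s3"
  by (simp_all add: s1_def s2_def s3_def \<gamma>_simps \<gamma>_d algebra_simps)

lemma \<gamma>_loc_s3_pow: "\<gamma>_loc (s3_pow c) = s3_pow c"
  by (simp add: s3_pow_def \<gamma>_loc_simps \<gamma>_power \<gamma>_s \<gamma>_simps)

lemma Mloc_hom_s3_pow: "Mloc_hom (s3_pow c) = 1"
  by (simp add: s3_pow_def Mloc_hom_mfrac M_hom_power M_hom_s M_hom_simps)

lemma x_rel: "xM 0 + xM 3 + xM 6 = 0" "xM 1 + xM 4 + xM 7 = 0" "xM 2 + xM 5 + xM 8 = 0"
  by (transfer, simp, rule ideal_gen_base, simp add: M_relations_def)+

section \<open>The homogeneous basis and its multiplication table\<close>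

definition qM :: "'w::strict_3_ring M" where "qM = xM 0 * xM 3 + xM 3 * xM 6 + xM 6 * xM 0"

primrec elem :: "bx \<Rightarrow> 'w::strict_3_ring M" where
  "elem E1 = 1"
| "elem Ex = xM 0"
| "elem Ey = xM 3"
| "elem (G0 i) = qM ^ i * (xM 0 * xM 3)"
| "elem (G1 i) = qM ^ i * (xM 3 * xM 6)"
| "elem (G2 i) = qM ^ i * (xM 6 * xM 0)"
| "elem (H0 i) = qM ^ i * (xM 0 * xM 0 * xM 3)"
| "elem (H1 i) = qM ^ i * (xM 3 * xM 3 * xM 6)"
| "elem (H2 i) = qM ^ i * (xM 6 * xM 6 * xM 0)"

text \<open>Degrees are counted in units of -2: the variables have degree 1, and \<open>s1\<close>,
  \<open>s2\<close>, \<open>s3\<close> have degrees 3, 6, 9.\<close>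

primrec degb :: "bx \<Rightarrow> int" where
  "degb E1 = 0"
| "degb Ex = 1"
| "degb Ey = 1"
| "degb (G0 i) = 2 * int i + 2"
| "degb (G1 i) = 2 * int i + 2"
| "degb (G2 i) = 2 * int i + 2"
| "degb (H0 i) = 2 * int i + 3"
| "degb (H1 i) = 2 * int i + 3"
| "degb (H2 i) = 2 * int i + 3"

primrec dbas :: "sx \<Rightarrow> 'w::strict_3_ring M" where
  "dbas S0 = 1" | "dbas S1 = d1" | "dbas S2 = d2" | "dbas S3 = d1 * d2" | "dbas S4 = d2 * d3" | "dbas S5 = d1 * d1 * d2"

primrec degs :: "sx \<Rightarrow> int" where
  "degs S0 = 0" | "degs S1 = 3" | "degs S2 = 3" | "degs S3 = 6" | "degs S4 = 6" | "degs S5 = 9"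

text \<open>The span in a fixed degree of the basis of D over W[s1, s2] with \<open>s3\<close>
  inverted. As an inductive predicate it lets closure under an operator be checked on basis elements
  alone.\<close>

inductive SD :: "int \<Rightarrow> 'w::strict_3_ring Mloc \<Rightarrow> bool" where
  SD_zero: "SD n 0"
| SD_add: "SD n s \<Longrightarrow> SD n t \<Longrightarrow> SD n (s + t)"
| SD_base: "SD (degs j + 3 * int a + 6 * int b + 9 * c)
     (mfrac (dbas j) 0 * (mfrac (M_const w * s1 ^ a * s2 ^ b) 0 * s3_pow c))"

lemma M_const_simps: "M_const (u + v) = M_const u + M_const v" "M_const (u * v) = M_const u * M_const v"
    "M_const 1 = 1" "M_const 0 = 0" "M_const (- u) = - M_const u"
proof -
  show "M_const (u + v) = M_const u + M_const v" "M_const (u * v) = M_const u * M_const v" "M_const 1 = 1"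
    by (transfer, simp add: pconst_hom ideal_gen_zero)+
  show 0: "M_const 0 = 0" by transfer (simp add: pconst_def ideal_gen_zero)
  show "M_const (- u) = - M_const u"
    by transfer (simp add: pconst_def single_uminus ideal_gen_zero)
qed

lemma SD_cong: "SD n t \<Longrightarrow> n = m \<Longrightarrow> t = s \<Longrightarrow> SD m s" by simp

lemma SD_mult_base:
  assumes "SD n t"
  shows "SD (n + 3 * int a + 6 * int b + 9 * c) (mfrac (M_const w * s1 ^ a * s2 ^ b) 0 * s3_pow c * t)"
  using assms
proof (induction)
  case (SD_add n s t)
  thus ?case by (simp add: distrib_left SD.SD_add)
next
  case (SD_base j a' b' c' w')
  show ?case
    by (rule SD_cong[OF SD.SD_base[of j "a + a'" "b + b'" "c + c'" "w * w'"]])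
       (simp_all add: M_const_simps mfrac0_simps s3_pow_add power_add mult_ac)
qed (simp add: SD_zero)

lemma SD_mults:
  assumes "SD n t"
  shows "SD (n + 3) (mfrac s1 0 * t)" "SD (n + 6) (mfrac s2 0 * t)" "SD (n + 9 * c) (s3_pow c * t)"
    "SD n (mfrac (M_const w) 0 * t)" "SD n (- t)"
proof -
  show "SD (n + 3) (mfrac s1 0 * t)"
    using SD_mult_base[OF assms, of 1 0 0 1] by (simp add: M_const_simps s3_pow_0)
  show "SD (n + 6) (mfrac s2 0 * t)"
    using SD_mult_base[OF assms, of 0 1 0 1] by (simp add: M_const_simps s3_pow_0)
  show "SD (n + 9 * c) (s3_pow c * t)"
    using SD_mult_base[OF assms, of 0 0 c 1] by (simp add: M_const_simps mfrac0_simps)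
  show "SD n (mfrac (M_const w) 0 * t)"
    using SD_mult_base[OF assms, of 0 0 0 w] by (simp add: s3_pow_0)
  show "SD n (- t)"
    using SD_mult_base[OF assms, of 0 0 0 "- 1"] by (simp add: M_const_simps mfrac0_simps s3_pow_0)
qed

lemma SD_diff: "SD n s \<Longrightarrow> SD n t \<Longrightarrow> SD n (s - t)"
  using SD_add[of n s "- t"] SD_mults(5)[of n t] by simp

lemma d1_dbas:
  "d1 * dbas S0 = dbas S1" "d1 * dbas S1 = s1 * dbas S1 - s2 * dbas S0 + dbas S4"
  "d1 * dbas S2 = dbas S3" "d1 * dbas S3 = dbas S5" "d1 * dbas S4 = s3 * dbas S0"
  "d1 * dbas S5 = s1 * dbas S5 - s2 * dbas S3 + s3 * dbas S2"
  by (simp_all add: s1_def s2_def s3_def algebra_simps)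

lemma \<gamma>_dbas:
  "\<gamma> (dbas S0) = dbas S0" "\<gamma> (dbas S1) = dbas S2" "\<gamma> (dbas S2) = s1 * dbas S0 - dbas S1 - dbas S2"
  "\<gamma> (dbas S3) = dbas S4" "\<gamma> (dbas S4) = s2 * dbas S0 - dbas S3 - dbas S4"
  "\<gamma> (dbas S5) = s2 * dbas S2 - s1 * dbas S3 + dbas S5"
  by (simp_all add: \<gamma>_simps \<gamma>_d s1_def s2_def s3_def algebra_simps)

lemma SD_d1: "SD n t \<Longrightarrow> SD (n + 3) (mfrac d1 0 * t)"
proof (induction rule: SD.induct)
  case (SD_add n s t)
  thus ?case by (simp add: distrib_left SD.SD_add)
next
  case (SD_base j a b c w)
  define k where "k = 3 * int a + 6 * int b + 9 * c"
  define B where "B = mfrac (M_const w * s1 ^ a * s2 ^ b) 0 * s3_pow c"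
  have base: "SD (degs j + k) (mfrac (dbas j) 0 * B)" for j
    using SD.SD_base[of j a b c w] by (simp add: k_def B_def add_ac)
  have base': "SD n (mfrac (dbas j) 0 * B)" if "n = degs j + k" for j n
    using base that by simp
  have s: "SD n (mfrac s1 0 * (mfrac (dbas j) 0 * B))" if "n = degs j + k + 3" for n j
    using SD_mults(1)[OF base[of j]] that by simp
  have s': "SD n (mfrac s2 0 * (mfrac (dbas j) 0 * B))" if "n = degs j + k + 6" for n j
    using SD_mults(2)[OF base[of j]] that by simp
  have s'': "SD n (mfrac s3 0 * (mfrac (dbas j) 0 * B))" if "n = degs j + k + 9" for n j
    using SD_mults(3)[OF base[of j], of 1] that by (simp add: s3_pow_1)
  have "SD (degs j + k + 3) (mfrac (d1 * dbas j) 0 * B)"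
    by (cases j; simp only: d1_dbas mfrac0_simps mfrac0_diff distrib_right left_diff_distrib mult.assoc;
        intro SD.SD_add SD_diff base' s s' s''; simp)
  thus ?case by (simp add: B_def k_def mfrac0_simps mult_ac add_ac)
qed (simp add: SD_zero)

lemma SD_\<gamma>: "SD n t \<Longrightarrow> SD n (\<gamma>_loc t)"
proof (induction rule: SD.induct)
  case (SD_add n s t)
  thus ?case by (simp add: \<gamma>_loc_simps SD.SD_add)
next
  case (SD_base j a b c w)
  define k where "k = 3 * int a + 6 * int b + 9 * c"
  define B where "B = mfrac (M_const w * s1 ^ a * s2 ^ b) 0 * s3_pow c"
  have base: "SD (degs j + k) (mfrac (dbas j) 0 * B)" for j
    using SD.SD_base[of j a b c w] by (simp add: k_def B_def add_ac)
  have base': "SD n (mfrac (dbas j) 0 * B)" if "n = degs j + k" for j n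
    using base that by simp
  have s: "SD n (mfrac s1 0 * (mfrac (dbas j) 0 * B))" if "n = degs j + k + 3" for n j
    using SD_mults(1)[OF base[of j]] that by simp
  have s': "SD n (mfrac s2 0 * (mfrac (dbas j) 0 * B))" if "n = degs j + k + 6" for n j
    using SD_mults(2)[OF base[of j]] that by simp
  have "SD (degs j + k) (mfrac (\<gamma> (dbas j)) 0 * B)"
    by (cases j; simp only: \<gamma>_dbas mfrac0_simps mfrac0_diff distrib_right left_diff_distrib mult.assoc;
        intro SD.SD_add SD_diff base' s s'; simp)
  moreover have "\<gamma>_loc B = B"
    by (simp add: B_def \<gamma>_loc_simps \<gamma>_simps \<gamma>_const \<gamma>_power \<gamma>_s \<gamma>_loc_s3_pow)
  ultimately show ?case by (simp add: B_def[symmetric] k_def \<gamma>_loc_simps add_ac)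
qed (simp add: SD_zero \<gamma>_loc_simps)

text \<open>The span of the full basis in a fixed degree. Once it is closed under all variables it
  must be the whole homogeneous part, see \<open>Mloc_deg_iff_Sp\<close>.\<close>

inductive Sp :: "int \<Rightarrow> 'w::strict_3_ring Mloc \<Rightarrow> bool" where
  Sp_zero: "Sp n 0"
| Sp_add: "Sp n s \<Longrightarrow> Sp n t \<Longrightarrow> Sp n (s + t)"
| Sp_base: "SD n t \<Longrightarrow> Sp (degb b1 + degb b2 + degb b3 + n)
     (mfrac (elem b1 * (\<gamma> (elem b2) * \<gamma> (\<gamma> (elem b3)))) 0 * t)"

lemma Sp_SD: "Sp n t \<Longrightarrow> (\<And>n t. SD n t \<Longrightarrow> SD (n + m) (r * t)) \<Longrightarrow> Sp (n + m) (r * t)"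
proof (induction rule: Sp.induct)
  case (Sp_add n s t)
  thus ?case by (simp add: distrib_left Sp.Sp_add)
next
  case (Sp_base n t b1 b2 b3)
  from Sp.Sp_base[OF Sp_base(2)[OF Sp_base(1)], of b1 b2 b3]
  show ?case by (simp add: mult_ac add_ac)
qed (simp add: Sp_zero)

lemma Sp_mults:
  assumes "Sp n t"
  shows "Sp (n + 9 * c) (s3_pow c * t)" "Sp n (mfrac (M_const w) 0 * t)" "Sp n (- t)"
proof -
  show "Sp (n + 9 * c) (s3_pow c * t)"
    by (rule Sp_SD[OF assms]) (rule SD_mults)
  have "Sp (n + 0) (mfrac (M_const w) 0 * t)" for w
    by (rule Sp_SD[OF assms]) (simp add: SD_mults)
  from this[of w] this[of "- 1"] show "Sp n (mfrac (M_const w) 0 * t)" "Sp n (- t)"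
    by (simp_all add: M_const_simps mfrac0_simps)
qed

lemma Sp_diff: "Sp n s \<Longrightarrow> Sp n t \<Longrightarrow> Sp n (s - t)"
  using Sp_add[of n s "- t"] Sp_mults(3)[of n t] by simp

lemma x6_eq: "xM 6 = - xM 0 - xM 3"
  using x_rel(1) by (simp add: eq_neg_iff_add_eq_0 algebra_simps)

text \<open>The columns of \<open>Xop\<close>, with a free factor \<open>Q\<close> that becomes a
  power of \<open>qM\<close>. The identities for qM Q d1 and qM Q x3 d1 trade one factor
  \<open>qM\<close> for basis elements of the next lower index.\<close>

lemma x0_Q:
  fixes Q :: "'w::strict_3_ring M"
  shows "xM 0 * (Q * (xM 3 * xM 6)) = Q * d1"
    "xM 0 * (Q * (xM 6 * xM 0)) = - (Q * (xM 6 * xM 6 * xM 0)) - Q * d1"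
    "xM 0 * (Q * (xM 0 * xM 0 * xM 3)) = Q * xM 3 * d1 - qM * Q * (xM 0 * xM 3)"
    "xM 0 * (Q * (xM 3 * xM 3 * xM 6)) = Q * xM 3 * d1"
    "xM 0 * (Q * (xM 6 * xM 6 * xM 0)) = Q * xM 3 * d1 + qM * Q * (xM 6 * xM 0)"
    "qM * Q * d1 = (Q * (xM 0 * xM 3) + Q * (xM 3 * xM 6) + Q * (xM 6 * xM 0)) * d1"
    "qM * Q * xM 3 * d1 = (Q * (xM 3 * xM 3 * xM 6) - Q * (xM 0 * xM 0 * xM 3)) * d1"
    "xM 0 * xM 0 = - (xM 0 * xM 3) - xM 6 * xM 0"
  by (simp_all add: d1_def x6_eq qM_def algebra_simps)

lemma x0_elem:
  "xM 0 * elem E1 = elem Ex"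
  "xM 0 * elem Ex = - elem (G0 0) - elem (G2 0)"
  "xM 0 * elem Ey = elem (G0 0)"
  "xM 0 * elem (G0 i) = elem (H0 i)"
  "xM 0 * elem (G1 0) = elem E1 * d1"
  "xM 0 * elem (G1 (Suc i)) = (elem (G0 i) + elem (G1 i) + elem (G2 i)) * d1"
  "xM 0 * elem (G2 0) = - elem (H2 0) - elem E1 * d1"
  "xM 0 * elem (G2 (Suc i)) = - elem (H2 (Suc i)) - (elem (G0 i) + elem (G1 i) + elem (G2 i)) * d1"
  "xM 0 * elem (H0 0) = elem Ey * d1 - elem (G0 1)"
  "xM 0 * elem (H0 (Suc i)) = (elem (H1 i) - elem (H0 i)) * d1 - elem (G0 (Suc (Suc i)))"
  "xM 0 * elem (H1 0) = elem Ey * d1"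
  "xM 0 * elem (H1 (Suc i)) = (elem (H1 i) - elem (H0 i)) * d1"
  "xM 0 * elem (H2 0) = elem Ey * d1 + elem (G2 1)"
  "xM 0 * elem (H2 (Suc i)) = (elem (H1 i) - elem (H0 i)) * d1 + elem (G2 (Suc (Suc i)))"
proof -
  note r = x0_Q(1)[of "qM ^ Suc i"] x0_Q(2)[of "qM ^ Suc i"] x0_Q(3)[of "qM ^ Suc i"] x0_Q(4)[of "qM ^ Suc i"]
    x0_Q(5)[of "qM ^ Suc i"] x0_Q(6)[of "qM ^ i"] x0_Q(7)[of "qM ^ i"]
  note r0 = x0_Q(1-5)[of 1] x0_Q(8)
  show "xM 0 * elem E1 = elem Ex" "xM 0 * elem Ey = elem (G0 0)" "xM 0 * elem (G0 i) = elem (H0 i)"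
    by (simp_all add: mult_ac)
  show "xM 0 * elem Ex = - elem (G0 0) - elem (G2 0)" using r0 by simp
  show "xM 0 * elem (G1 0) = elem E1 * d1" using r0 by simp
  show "xM 0 * elem (G2 0) = - elem (H2 0) - elem E1 * d1" using r0 by simp
  show "xM 0 * elem (H0 0) = elem Ey * d1 - elem (G0 1)" using r0 by simp
  show "xM 0 * elem (H1 0) = elem Ey * d1" using r0 by simp
  show "xM 0 * elem (H2 0) = elem Ey * d1 + elem (G2 1)" using r0 by simp
  show "xM 0 * elem (G1 (Suc i)) = (elem (G0 i) + elem (G1 i) + elem (G2 i)) * d1"
    unfolding elem.simps r(6)[symmetric] r(1) by simp
  show "xM 0 * elem (G2 (Suc i)) = - elem (H2 (Suc i)) - (elem (G0 i) + elem (G1 i) + elem (G2 i)) * d1"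
    unfolding elem.simps r(6)[symmetric] r(2) by simp
  show "xM 0 * elem (H0 (Suc i)) = (elem (H1 i) - elem (H0 i)) * d1 - elem (G0 (Suc (Suc i)))"
    unfolding elem.simps r(7)[symmetric] r(3) by simp
  show "xM 0 * elem (H1 (Suc i)) = (elem (H1 i) - elem (H0 i)) * d1"
    unfolding elem.simps r(7)[symmetric] r(4) by simp
  show "xM 0 * elem (H2 (Suc i)) = (elem (H1 i) - elem (H0 i)) * d1 + elem (G2 (Suc (Suc i)))"
    unfolding elem.simps r(7)[symmetric] r(5) by simp
qed

lemma \<gamma>3_x: "\<gamma> (\<gamma> (\<gamma> (xM 0))) = xM 3" "\<gamma> (\<gamma> (\<gamma> (xM 3))) = xM 6" "\<gamma> (\<gamma> (\<gamma> (xM 6))) = xM 0"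
proof -
  have [simp]: "(9::9) = 0" by simp
  show "\<gamma> (\<gamma> (\<gamma> (xM 0))) = xM 3" "\<gamma> (\<gamma> (\<gamma> (xM 3))) = xM 6" "\<gamma> (\<gamma> (\<gamma> (xM 6))) = xM 0"
    by (simp_all add: \<gamma>_simps)
qed

lemma \<gamma>3_qM: "\<gamma> (\<gamma> (\<gamma> qM)) = qM"
  by (simp add: qM_def \<gamma>_simps(1,2) \<gamma>3_x algebra_simps)

lemma \<gamma>3_elem:
  "\<gamma> (\<gamma> (\<gamma> (elem E1))) = elem E1"
  "\<gamma> (\<gamma> (\<gamma> (elem Ex))) = elem Ey"
  "\<gamma> (\<gamma> (\<gamma> (elem Ey))) = - elem Ex - elem Ey"
  "\<gamma> (\<gamma> (\<gamma> (elem (G0 i)))) = elem (G1 i)"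
  "\<gamma> (\<gamma> (\<gamma> (elem (G1 i)))) = elem (G2 i)"
  "\<gamma> (\<gamma> (\<gamma> (elem (G2 i)))) = elem (G0 i)"
  "\<gamma> (\<gamma> (\<gamma> (elem (H0 i)))) = elem (H1 i)"
  "\<gamma> (\<gamma> (\<gamma> (elem (H1 i)))) = elem (H2 i)"
  "\<gamma> (\<gamma> (\<gamma> (elem (H2 i)))) = elem (H0 i)"
  by (simp_all add: \<gamma>_simps(1-4) \<gamma>_power \<gamma>3_x \<gamma>3_qM) (simp add: x6_eq)

lemma Sp_base':
  "SD n t \<Longrightarrow> m = degb b1 + degb b2 + degb b3 + n \<Longrightarrow> s = mfrac (elem b1 * (\<gamma> (elem b2) * \<gamma> (\<gamma> (elem b3)))) 0 * t \<Longrightarrow> Sp m s"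
  using Sp_base by blast

lemma Sp_x0: "Sp n t \<Longrightarrow> Sp (n + 1) (mfrac (xM 0) 0 * t)" for t :: "'w::strict_3_ring Mloc"
proof (induction rule: Sp.induct)
  case (Sp_add n s t)
  thus ?case by (simp add: distrib_left Sp.Sp_add)
next
  case (Sp_base n t b1 b2 b3)
  define R :: "'w Mloc" where "R = mfrac (\<gamma> (elem b2) * \<gamma> (\<gamma> (elem b3))) 0"
  define k where "k = degb b2 + degb b3 + n"
  define B D where "B b = mfrac (elem b) 0 * R * t" and "D b = mfrac (elem b) 0 * R * (mfrac d1 0 * t)" for b
  have base: "Sp m (B b)" if "m = degb b + k" for b m
    by (rule Sp_base'[OF Sp_base(1), of _ b b2 b3]) (simp_all add: that k_def B_def R_def mfrac0_simps mult_ac)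
  have based: "Sp m (D b)" if "m = degb b + k + 3" for b m
    by (rule Sp_base'[OF SD_d1[OF Sp_base(1)], of _ b b2 b3]) (simp_all add: that k_def D_def R_def mfrac0_simps mult_ac)
  have eq: "mfrac (elem b) 0 * (mfrac d1 0 * (R * t)) = D b" "mfrac (elem b) 0 * (R * t) = B b" for b
    by (simp_all add: B_def D_def mult_ac)
  have "Sp (degb b1 + k + 1) (mfrac (xM 0 * elem b1) 0 * (R * t))"
    by (cases b1 rule: bx_split; simp only: x0_elem mfrac0_simps mfrac0_diff distrib_right left_diff_distrib mult_minus_left mult.assoc eq;
        intro Sp.Sp_add Sp_diff Sp_mults(3) base based; simp)
  thus ?case by (simp add: R_def k_def mfrac0_simps mult_ac add_ac)
qed (simp add: Sp_zero)

lemma Sp_\<gamma>: "Sp n t \<Longrightarrow> Sp n (\<gamma>_loc t)" for t :: "'w::strict_3_ring Mloc"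
proof (induction rule: Sp.induct)
  case (Sp_add n s t)
  thus ?case by (simp add: \<gamma>_loc_simps Sp.Sp_add)
next
  case (Sp_base n t b1 b2 b3)
  define R :: "'w Mloc" where "R = mfrac (\<gamma> (elem b1) * \<gamma> (\<gamma> (elem b2))) 0"
  define k where "k = degb b1 + degb b2 + n"
  define B where "B b = mfrac (elem b) 0 * R * \<gamma>_loc t" for b
  have base: "Sp m (B b)" if "m = degb b + k" for b m
    by (rule Sp_base'[OF SD_\<gamma>[OF Sp_base(1)], of _ b b1 b2]) (simp_all add: that k_def B_def R_def mfrac0_simps mult_ac)
  have eq: "mfrac (elem b) 0 * (R * \<gamma>_loc t) = B b" for b
    by (simp_all add: B_def mult_ac)
  have "Sp (degb b3 + k) (mfrac (\<gamma> (\<gamma> (\<gamma> (elem b3)))) 0 * (R * \<gamma>_loc t))"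
    by (cases b3; simp only: \<gamma>3_elem mfrac0_simps mfrac0_diff distrib_right left_diff_distrib mult_minus_left mult.assoc eq;
        intro Sp.Sp_add Sp_diff Sp_mults(3) base; simp)
  thus ?case by (simp add: R_def k_def mfrac0_simps \<gamma>_loc_simps \<gamma>_simps mult_ac add_ac)
qed (simp add: Sp_zero \<gamma>_loc_simps)

lemma \<gamma>_9: "(\<gamma> ^^ 9) m = m"
proof -
  have add: "(\<gamma> ^^ k) (a + b) = (\<gamma> ^^ k) a + (\<gamma> ^^ k) b" and mult: "(\<gamma> ^^ k) (a * b) = (\<gamma> ^^ k) a * (\<gamma> ^^ k) b"
    and x: "(\<gamma> ^^ k) (xM i) = xM (i + of_nat k)" and const: "(\<gamma> ^^ k) (M_const w) = M_const w"
    for k and a b :: "'a M" and i w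
    by (induction k) (simp_all add: \<gamma>_simps \<gamma>_const add_ac)
  have nine: "of_nat 9 = (0 :: 9)" by simp
  show ?thesis
    by (induction m rule: M_induct) (simp_all only: add mult x const nine add_0_right)
qed

lemma \<gamma>_loc_9: "(\<gamma>_loc ^^ 9) t = t"
proof -
  have "(\<gamma>_loc ^^ k) (mfrac m l) = mfrac ((\<gamma> ^^ k) m) l" for k l and m :: "'a M"
    by (induction k) (simp_all add: \<gamma>_loc_simps)
  thus ?thesis by (cases t rule: Mloc_cases) (simp only: \<gamma>_9)
qed

text \<open>Only multiplication by \<open>x_0\<close> was computed; each next variable is reached by
  conjugating with \<gamma>.\<close>

lemma Sp_x: "Sp n t \<Longrightarrow> Sp (n + 1) (mfrac (xM i) 0 * t)"
proof -
  have \<gamma>k: "Sp n t \<Longrightarrow> Sp n ((\<gamma>_loc ^^ k) t)" for k n and t :: "'a Mloc"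
    by (induction k) (simp_all add: Sp_\<gamma>)
  have nat: "Sp n t \<Longrightarrow> Sp (n + 1) (mfrac (xM (of_nat k)) 0 * t)" for k n and t :: "'a Mloc"
  proof (induction k arbitrary: t)
    case 0
    thus ?case by (simp add: Sp_x0)
  next
    case (Suc k)
    \<comment> \<open>The inverse of \<gamma> is its eighth power.\<close>
    let ?t = "(\<gamma>_loc ^^ 8) t"
    have "\<gamma>_loc ?t = (\<gamma>_loc ^^ Suc 8) t" by (simp only: funpow.simps comp_apply)
    also have "Suc 8 = 9" by simp
    finally have t: "\<gamma>_loc ?t = t" by (simp only: \<gamma>_loc_9)
    have "Sp (n + 1) (\<gamma>_loc (mfrac (xM (of_nat k)) 0 * ?t))"
      by (rule Sp_\<gamma>[OF Suc.IH[OF \<gamma>k[OF Suc.prems]]])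
    thus ?case by (simp only: \<gamma>_loc_simps \<gamma>_simps t of_nat_Suc add.commute)
  qed
  assume t: "Sp n t"
  show ?thesis
  proof (cases i)
    case (of_int z)
    hence "i = of_nat (nat z)" by simp
    thus ?thesis using nat[OF t, of "nat z"] by simp
  qed
qed

lemma abs_M_monomial: "abs_M (Poly_Mapping.single e w) = M_const w * (\<Prod>i\<in>UNIV. xM i ^ Poly_Mapping.lookup e i)"
  for w :: "'w::strict_3_ring"
proof -
  have pow: "abs_M (pvar i ^ k :: 'w poly9) = xM i ^ k" for i k
    by (induction k) (simp_all flip: one_M.abs_eq times_M.abs_eq xM.abs_eq)
  have "abs_M (\<Prod>i\<in>A. pvar i ^ n i :: 'w poly9) = (\<Prod>i\<in>A. xM i ^ n i)" for A n
    by (induction A rule: infinite_finite_induct) (simp_all add: pow flip: one_M.abs_eq times_M.abs_eq)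
  thus ?thesis by (simp add: single_monomial flip: times_M.abs_eq M_const.abs_eq)
qed

lemma M_deg_induct [consumes 1, case_names zero add monomial]:
  assumes "m \<in> M_deg n" "P 0" "\<And>a b. P a \<Longrightarrow> P b \<Longrightarrow> P (a + b)"
    "\<And>w e. - 2 * (\<Sum>i\<in>UNIV. int (Poly_Mapping.lookup e i)) = n \<Longrightarrow> P (M_const w * (\<Prod>i\<in>UNIV. xM i ^ Poly_Mapping.lookup e i))"
  shows "P m"
proof -
  from assms(1) obtain p where p: "m = abs_M p"
    "\<forall>e\<in>Poly_Mapping.keys p. - 2 * (\<Sum>i\<in>UNIV. int (Poly_Mapping.lookup e i)) = n"
    unfolding M_deg_def by auto
  have "P (abs_M (\<Sum>e\<in>A. Poly_Mapping.single e (f e)))" if "A \<subseteq> Poly_Mapping.keys p" for A f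
    using finite_subset[OF that finite_keys] that
  proof (induction A rule: finite_induct)
    case empty
    show ?case using assms(2) by (simp flip: zero_M.abs_eq)
  next
    case (insert e A)
    thus ?case using assms(3,4) p(2) by (simp add: abs_M_monomial flip: plus_M.abs_eq)
  qed
  thus ?thesis using poly9_sum_monomials[of p] p(1) by (metis subset_refl)
qed

lemma SD_one: "SD 0 1"
  using SD_base[of S0 0 0 0 1] by (simp add: mfrac0_simps M_const_simps s3_pow_0)

lemma Sp_one: "Sp 0 1"
  using Sp_base[OF SD_one, of E1 E1 E1] by (simp add: mfrac0_simps \<gamma>_simps)

lemma Sp_M_deg: "m \<in> M_deg (- 2 * N) \<Longrightarrow> Sp N (mfrac m 0)"
proof (induction rule: M_deg_induct)
  case (monomial w e)
  have pow: "Sp n t \<Longrightarrow> Sp (n + int k) (mfrac (xM i ^ k) 0 * t)" for n k i and t :: "'a Mloc"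
  proof (induction k)
    case (Suc k)
    from Sp_x[OF Suc.IH[OF Suc.prems], of i] show ?case by (simp add: mfrac0_simps mult.assoc add_ac)
  qed (simp add: mfrac0_simps)
  have prod: "Sp (\<Sum>i\<in>A. int (n i)) (mfrac (\<Prod>i\<in>A. xM i ^ n i) 0 :: 'a Mloc)" if "finite A" for A n
    using that
  proof (induction A rule: finite_induct)
    case empty
    show ?case by (simp add: mfrac0_simps Sp_one)
  next
    case (insert i A)
    from pow[OF insert.IH, of "n i" i] insert.hyps show ?case by (simp add: mfrac0_simps add_ac)
  qed
  show ?case
    using Sp_mults(2)[OF prod[of UNIV "Poly_Mapping.lookup e"]] monomial by (simp add: mfrac0_simps)
qed (simp_all add: mfrac0_simps Sp_zero Sp_add)

lemma Sp_Mloc_deg: "t \<in> Mloc_deg (- 2 * N) \<Longrightarrow> Sp N t"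
proof -
  assume "t \<in> Mloc_deg (- 2 * N)"
  then obtain m k where t: "t = mfrac m k" and m: "m \<in> M_deg (- 2 * N - 18 * int k)"
    unfolding Mloc_deg_def by blast
  have eq: "- 2 * N - 18 * int k = - 2 * (N + 9 * int k)" by simp
  have "Sp (N + 9 * int k) (mfrac m 0)" using m unfolding eq by (rule Sp_M_deg)
  from Sp_mults(1)[OF this, of "- int k"] show ?thesis by (simp add: t mfrac_eq[of m k] mult.commute)
qed

lemma M_deg_odd: "m \<in> M_deg n \<Longrightarrow> odd n \<Longrightarrow> m = 0"
proof (induction rule: M_deg_induct)
  case (monomial w e)
  hence "even n" by (metis dvd_triv_left even_minus mult_minus_left)
  with monomial show ?case by blast
qed simp_all

lemma Mloc_deg_odd: "t \<in> Mloc_deg n \<Longrightarrow> odd n \<Longrightarrow> t = 0"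
proof -
  assume "t \<in> Mloc_deg n" "odd n"
  then obtain m k where t: "t = mfrac m k" and m: "m \<in> M_deg (n - 18 * int k)"
    unfolding Mloc_deg_def by blast
  have "m = 0" by (rule M_deg_odd[OF m]) (use \<open>odd n\<close> in simp)
  thus ?thesis using t mfrac_eq[of m k] by (simp add: mfrac0_simps)
qed

subsection \<open>Coefficients of homogeneous elements\<close>

lemma M_deg_monomial:
  "M_const w * (\<Prod>i\<in>UNIV. xM i ^ Poly_Mapping.lookup e i) \<in> M_deg (- 2 * (\<Sum>i\<in>UNIV. int (Poly_Mapping.lookup e i)))"
  unfolding abs_M_monomial[symmetric] M_deg_def by (auto intro!: exI[of _ "Poly_Mapping.single e w"] split: if_splits)

lemma M_deg_eq: "a \<in> M_deg n \<Longrightarrow> n = m \<Longrightarrow> a \<in> M_deg m" by simp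

lemma M_deg_zero: "0 \<in> M_deg n"
  unfolding M_deg_def zero_M.abs_eq by (auto intro!: exI[of _ 0])

lemma M_deg_add: "a \<in> M_deg n \<Longrightarrow> b \<in> M_deg n \<Longrightarrow> a + b \<in> M_deg n"
proof -
  assume "a \<in> M_deg n" "b \<in> M_deg n"
  then obtain p q where "a = abs_M p" "b = abs_M q"
    and pq: "\<forall>e\<in>Poly_Mapping.keys p. - 2 * (\<Sum>i\<in>UNIV. int (Poly_Mapping.lookup e i)) = n"
      "\<forall>e\<in>Poly_Mapping.keys q. - 2 * (\<Sum>i\<in>UNIV. int (Poly_Mapping.lookup e i)) = n"
    unfolding M_deg_def by auto
  hence "a + b = abs_M (p + q)" by (simp add: plus_M.abs_eq)
  with pq show ?thesis
    unfolding M_deg_def using Poly_Mapping.keys_add[of p q] by blast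
qed

lemma M_deg_mult: "a \<in> M_deg n \<Longrightarrow> b \<in> M_deg m \<Longrightarrow> a * b \<in> M_deg (n + m)"
proof (induction rule: M_deg_induct)
  case zero
  show ?case by (simp add: M_deg_zero)
next
  case (add a a')
  thus ?case by (simp add: distrib_right M_deg_add)
next
  case (monomial w e)
  note e = monomial(1)
  from monomial(2) show ?case
  proof (induction rule: M_deg_induct)
    case (monomial w' e')
    have "M_const (w * w') * (\<Prod>i\<in>UNIV. xM i ^ Poly_Mapping.lookup (e + e') i) \<in> M_deg (n + m)"
      by (rule M_deg_eq[OF M_deg_monomial]) (simp add: lookup_add sum.distrib flip: monomial(1) e)
    thus ?case by (simp add: M_const_simps lookup_add power_add prod.distrib mult_ac)
  qed (simp_all add: M_deg_zero M_deg_add distrib_left)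
qed

lemma M_deg_const: "M_const w \<in> M_deg 0"
  using M_deg_monomial[of w 0] by simp

lemma M_deg_one: "1 \<in> M_deg 0"
  using M_deg_const[of 1] by (simp add: M_const_simps)

lemma M_deg_x: "(xM i :: 'w::strict_3_ring M) \<in> M_deg (- 2)"
proof -
  have "(\<Prod>j\<in>UNIV. (xM j :: 'w M) ^ Poly_Mapping.lookup (Poly_Mapping.single i 1) j) = (\<Prod>j\<in>UNIV. if j = i then xM i else 1)"
    by (rule prod.cong) (auto simp: lookup_single when_def)
  moreover have "(\<Sum>j\<in>UNIV. int (Poly_Mapping.lookup (Poly_Mapping.single i (1::nat)) j)) = (\<Sum>j\<in>UNIV. if j = i then 1 else 0)"
    by (rule sum.cong) (auto simp: lookup_single when_def)
  ultimately show ?thesis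
    using M_deg_monomial[of "1::'w" "Poly_Mapping.single i 1"] by (simp add: M_const_simps)
qed

lemma M_deg_power: "a \<in> M_deg n \<Longrightarrow> a ^ k \<in> M_deg (int k * n)"
proof (induction k)
  case (Suc k)
  from M_deg_mult[OF Suc.prems Suc.IH[OF Suc.prems]] show ?case by (simp add: algebra_simps)
qed (simp add: M_deg_one)

lemma M_deg_uminus: "a \<in> M_deg n \<Longrightarrow> - a \<in> M_deg n"
  using M_deg_mult[OF M_deg_const[of "- 1"], of a n] by (simp add: M_const_simps)

lemma M_deg_diff: "a \<in> M_deg n \<Longrightarrow> b \<in> M_deg n \<Longrightarrow> a - b \<in> M_deg n"
  using M_deg_add[of a n "- b"] by (simp add: M_deg_uminus)

lemma M_deg_\<gamma>: "a \<in> M_deg n \<Longrightarrow> \<gamma> a \<in> M_deg n" for a :: "'w::strict_3_ring M"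
proof (induction rule: M_deg_induct)
  case (monomial w e)
  have prod: "(\<Prod>i\<in>A. xM (i + 1) ^ k i :: 'w M) \<in> M_deg (- 2 * (\<Sum>i\<in>A. int (k i)))" if "finite A" for A and k :: "9 \<Rightarrow> nat"
    using that
  proof (induction A rule: finite_induct)
    case (insert i A)
    from M_deg_mult[OF M_deg_power[OF M_deg_x, of "i + 1" "k i"] insert.IH] insert.hyps
    show ?case by (simp add: algebra_simps)
  qed (simp add: M_deg_one)
  have "\<gamma> (\<Prod>i\<in>A. xM i ^ k i) = (\<Prod>i\<in>A. xM (i + 1) ^ k i :: 'w M)" for A and k :: "9 \<Rightarrow> nat"
    by (induction A rule: infinite_finite_induct) (simp_all add: \<gamma>_simps \<gamma>_power)
  with M_deg_mult[OF M_deg_const[of w] prod[of UNIV "Poly_Mapping.lookup e"]] monomial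
  show ?case by (simp add: \<gamma>_simps \<gamma>_const)
qed (simp_all add: \<gamma>_simps M_deg_zero M_deg_add)

lemma M_deg_d: "d1 \<in> M_deg (- 6)" "d2 \<in> M_deg (- 6)" "d3 \<in> M_deg (- 6)"
  unfolding d1_def d2_def d3_def
  by (rule M_deg_eq[OF M_deg_mult[OF M_deg_mult[OF M_deg_x M_deg_x] M_deg_x]], simp)+

lemma M_deg_s: "s1 \<in> M_deg (- 6)" "s2 \<in> M_deg (- 12)" "s3 \<in> M_deg (- 18)"
proof -
  show "s1 \<in> M_deg (- 6)" unfolding s1_def by (intro M_deg_add M_deg_d)
  show "s2 \<in> M_deg (- 12)" unfolding s2_def
    by (intro M_deg_add; rule M_deg_eq[OF M_deg_mult[OF M_deg_d(1) M_deg_d(2)]] M_deg_eq[OF M_deg_mult[OF M_deg_d(2) M_deg_d(3)]]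
        M_deg_eq[OF M_deg_mult[OF M_deg_d(3) M_deg_d(1)]]; simp)
  show "s3 \<in> M_deg (- 18)" unfolding s3_def
    by (rule M_deg_eq[OF M_deg_mult[OF M_deg_mult[OF M_deg_d(1) M_deg_d(2)] M_deg_d(3)]]) simp
qed

lemma M_deg_qM: "qM \<in> M_deg (- 4)"
  unfolding qM_def by (intro M_deg_add; rule M_deg_eq[OF M_deg_mult[OF M_deg_x M_deg_x]]; simp)

lemma M_deg_elem: "elem b \<in> M_deg (- 2 * degb b)"
proof -
  have xx: "xM i * xM j \<in> M_deg (- 4)" for i j
    by (rule M_deg_eq[OF M_deg_mult[OF M_deg_x M_deg_x]]) simp
  have xxx: "xM i * xM j * xM k \<in> M_deg (- 6)" for i j k
    by (rule M_deg_eq[OF M_deg_mult[OF xx M_deg_x]]) simp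
  show ?thesis
    by (cases b; simp only: elem.simps degb.simps;
        rule M_deg_eq[OF M_deg_one] M_deg_eq[OF M_deg_x] M_deg_eq[OF M_deg_mult[OF M_deg_power[OF M_deg_qM] xxx]]
          M_deg_eq[OF M_deg_mult[OF M_deg_power[OF M_deg_qM] xx]]; simp)
qed

lemma M_deg_dbas: "dbas j \<in> M_deg (- 2 * degs j)"
  by (cases j; simp only: dbas.simps degs.simps;
      rule M_deg_eq[OF M_deg_one] M_deg_eq[OF M_deg_d(1)] M_deg_eq[OF M_deg_d(2)]
        M_deg_eq[OF M_deg_mult[OF M_deg_d(1) M_deg_d(2)]] M_deg_eq[OF M_deg_mult[OF M_deg_d(2) M_deg_d(3)]]
        M_deg_eq[OF M_deg_mult[OF M_deg_mult[OF M_deg_d(1) M_deg_d(1)] M_deg_d(2)]]; simp)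

lemma M_deg_Mloc_deg: "m \<in> M_deg n \<Longrightarrow> mfrac m 0 \<in> Mloc_deg n"
  unfolding Mloc_deg_def by (auto intro!: exI[of _ m] exI[of _ "0::nat"])

lemma Mloc_deg_s3_pow: "(s3_pow c :: 'a::strict_3_ring Mloc) \<in> Mloc_deg (- 18 * c)"
proof (cases "c \<ge> 0")
  case True
  thus ?thesis using M_deg_Mloc_deg[OF M_deg_power[OF M_deg_s(3), of "nat c"]] by (simp add: s3_pow_def mult.commute)
next
  case False
  hence "s3_pow c = mfrac 1 (nat (- c))" "(1 :: 'a M) \<in> M_deg (- 18 * c - 18 * int (nat (- c)))"
    using M_deg_one by (simp_all add: s3_pow_def)
  thus ?thesis unfolding Mloc_deg_def by blast
qed

lemma Mloc_deg_mult: "s \<in> Mloc_deg n \<Longrightarrow> t \<in> Mloc_deg m \<Longrightarrow> s * t \<in> Mloc_deg (n + m)"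
proof -
  assume "s \<in> Mloc_deg n" "t \<in> Mloc_deg m"
  then obtain a k b l where st: "s = mfrac a k" "t = mfrac b l"
    and ab: "a \<in> M_deg (n - 18 * int k)" "b \<in> M_deg (m - 18 * int l)"
    unfolding Mloc_deg_def by blast
  have "a * b \<in> M_deg (n + m - 18 * int (k + l))"
    by (rule M_deg_eq[OF M_deg_mult[OF ab]]) simp
  thus ?thesis unfolding st mfrac_mult Mloc_deg_def by blast
qed

lemma Mloc_deg_zero: "0 \<in> Mloc_deg n"
  using M_deg_Mloc_deg[OF M_deg_zero] by (simp add: mfrac0_simps)

lemma Mloc_deg_add: "s \<in> Mloc_deg n \<Longrightarrow> t \<in> Mloc_deg n \<Longrightarrow> s + t \<in> Mloc_deg n"
proof -
  assume "s \<in> Mloc_deg n" "t \<in> Mloc_deg n"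
  then obtain a k b l where st: "s = mfrac a k" "t = mfrac b l"
    and ab: "a \<in> M_deg (n - 18 * int k)" "b \<in> M_deg (n - 18 * int l)"
    unfolding Mloc_deg_def by blast
  have "s + t = mfrac (s3 ^ l * a + s3 ^ k * b) (k + l)"
    unfolding st \<Delta>_eq_s3[symmetric] by transfer (auto simp: frac_eq_def algebra_simps)
  moreover have "s3 ^ l * a + s3 ^ k * b \<in> M_deg (n - 18 * int (k + l))"
    by (intro M_deg_add; rule M_deg_eq[OF M_deg_mult[OF M_deg_power[OF M_deg_s(3)] ab(1)]]
        M_deg_eq[OF M_deg_mult[OF M_deg_power[OF M_deg_s(3)] ab(2)]]; simp)
  ultimately show ?thesis unfolding Mloc_deg_def by blast
qed

lemma Mloc_deg_eq: "a \<in> Mloc_deg n \<Longrightarrow> n = m \<Longrightarrow> a \<in> Mloc_deg m" by simp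

lemma SD_Mloc_deg: "SD N t \<Longrightarrow> t \<in> Mloc_deg (- 2 * N)"
proof (induction rule: SD.induct)
  case (SD_base j a b c w)
  show ?case
    by (rule Mloc_deg_eq[OF Mloc_deg_mult[OF M_deg_Mloc_deg[OF M_deg_dbas] Mloc_deg_mult[OF M_deg_Mloc_deg[OF
          M_deg_mult[OF M_deg_mult[OF M_deg_const M_deg_power[OF M_deg_s(1)]] M_deg_power[OF M_deg_s(2)]]] Mloc_deg_s3_pow]]]) simp
qed (simp_all add: Mloc_deg_zero Mloc_deg_add)

lemma Mloc_deg_iff_Sp: "t \<in> Mloc_deg (- 2 * N) \<longleftrightarrow> Sp N t"
proof
  show "Sp N t \<Longrightarrow> t \<in> Mloc_deg (- 2 * N)"
  proof (induction rule: Sp.induct)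
    case (Sp_base n t b1 b2 b3)
    show ?case
      by (rule Mloc_deg_eq[OF Mloc_deg_mult[OF M_deg_Mloc_deg[OF M_deg_mult[OF M_deg_elem M_deg_mult[OF M_deg_\<gamma>[OF M_deg_elem]
          M_deg_\<gamma>[OF M_deg_\<gamma>[OF M_deg_elem]]]]] SD_Mloc_deg[OF Sp_base]]]) simp
  qed (simp_all add: Mloc_deg_zero Mloc_deg_add)
qed (rule Sp_Mloc_deg)

section \<open>Coordinates of the basis elements\<close>

definition sg :: "bx \<Rightarrow> 'v \<Rightarrow> bx \<Rightarrow> 'v::zero" where "sg b v = (\<lambda>c. if c = b then v else 0)"

definition sgl :: "bx \<Rightarrow> bx \<Rightarrow> bx \<Rightarrow> 'w::comm_ring_1 D \<Rightarrow> 'w N" where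
  "sgl b1 b2 b3 v = (\<lambda>c1 c2 c3. if c1 = b1 \<and> c2 = b2 \<and> c3 = b3 then v else 0)"

definition es :: "sx \<Rightarrow> 'w::comm_ring_1 U \<Rightarrow> 'w D" where "es j f = (\<lambda>k. if k = j then f else 0)"

definition oneN :: "'w::comm_ring_1 N" where "oneN = sgl E1 E1 E1 (es S0 1)"

text \<open>The coordinate vector of an element, obtained as its action on 1; powers of
  \<open>s3\<close> are forgotten.\<close>

definition Rho :: "'w::strict_3_ring Mloc \<Rightarrow> 'w N" where "Rho t = ap (Mloc_hom t) oneN"

lemma L1_comp: "L1 S (L1 T u) = L1 (\<lambda>w. S (T w)) u"
  by (simp add: L1_def)

lemma ap_qM: "ap (M_hom qM) u = L1 Qop u"
proof -
  have Q: "opn 0 dop1 (opn 1 dop1 w) b + opn 1 dop1 (opn 2 dop1 w) b + opn 2 dop1 (opn 0 dop1 w) b = Qop w b"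
    for w :: "bx \<Rightarrow> 'a D" and b
    using Qop_XYZ[OF add_map_D(1)] by (simp add: opn_def)
  show ?thesis
    unfolding qM_def M_hom_simps ap_simps copX.rep_eq X9_simps L1_comp
    using Q[of "\<lambda>b. u b _ _"] by (intro ext) (simp add: L1_def fun_eq_iff)
qed

lemma sg_ops:
  assumes d: "add_map d"
  shows "opn 0 d (sg E1 v) = sg Ex v" "opn 1 d (sg E1 v) = sg Ey v" "opn 0 d (sg Ey v) = sg (G0 0) v"
    "opn 1 d (opn 2 d (sg E1 v)) = sg (G1 0) v" "opn 2 d (sg Ex v) = sg (G2 0) v"
    "opn 0 d (sg (G0 0) v) = sg (H0 0) v" "opn 1 d (sg (G1 0) v) = sg (H1 0) v" "opn 2 d (sg (G2 0) v) = sg (H2 0) v"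
  by (rule ext, rename_tac c, case_tac c rule: bx_split;
      simp add: sg_def opn_def Yop_def Zop_def add_map_simps[OF d])+

lemma Qop_sg: "Qop (sg (G0 i) v) = sg (G0 (Suc i)) v" "Qop (sg (G1 i) v) = sg (G1 (Suc i)) v" "Qop (sg (G2 i) v) = sg (G2 (Suc i)) v"
   "Qop (sg (H0 i) v) = sg (H0 (Suc i)) v" "Qop (sg (H1 i) v) = sg (H1 (Suc i)) v" "Qop (sg (H2 i) v) = sg (H2 (Suc i)) v"
  by (rule ext, rename_tac c, case_tac c rule: bx_split; simp add: sg_def)+

lemma L1_sgl: "L1 T (sgl b E1' E2' v) = sgl c E1' E2' v'" if "T (sg b v) = sg c v'" "add_map T"
proof (intro ext)
  fix c1 c2 c3 k
  have "(\<lambda>x. sgl b E1' E2' v x c2 c3) = (if c2 = E1' \<and> c3 = E2' then sg b v else 0)"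
    by (auto simp: sgl_def sg_def)
  moreover have "T 0 = 0" by (rule add_map_0[OF that(2)])
  ultimately show "L1 T (sgl b E1' E2' v) c1 c2 c3 k = sgl c E1' E2' v' c1 c2 c3 k"
    using that(1) by (auto simp: L1_def sgl_def sg_def)
qed

text \<open>A basis element is a word in x, y, z, q along which a vector with a single entry keeps a
  single entry. Only yz needs two factors at once, because z = -x - y is not a basis
  element.\<close>

lemma elem_sgl: "ap (M_hom (elem b)) (sgl E1 c2 c3 v) = sgl b c2 c3 v" for v :: "'w::strict_3_ring D"
proof -
  note o = sg_ops[OF add_map_D(1)] and a = add_map_opn[OF add_map_D(1)]
  have s: "L1 (opn 0 dop1) (sgl E1 c2 c3 v) = sgl Ex c2 c3 v" "L1 (opn 1 dop1) (sgl E1 c2 c3 v) = sgl Ey c2 c3 v"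
     "L1 (opn 0 dop1) (sgl Ey c2 c3 v) = sgl (G0 0) c2 c3 v" "L1 (opn 2 dop1) (sgl Ex c2 c3 v) = sgl (G2 0) c2 c3 v"
     "L1 (opn 0 dop1) (sgl (G0 0) c2 c3 v) = sgl (H0 0) c2 c3 v" "L1 (opn 1 dop1) (sgl (G1 0) c2 c3 v) = sgl (H1 0) c2 c3 v"
     "L1 (opn 2 dop1) (sgl (G2 0) c2 c3 v) = sgl (H2 0) c2 c3 v"
    by (rule L1_sgl[OF _ a], rule o)+
  have s4: "L1 (opn 1 dop1) (L1 (opn 2 dop1) (sgl E1 c2 c3 v)) = sgl (G1 0) c2 c3 v"
    unfolding L1_comp by (rule L1_sgl[OF o(4) add_map_comp[OF a a]])
  have q: "L1 Qop (sgl (G0 i) c2 c3 v) = sgl (G0 (Suc i)) c2 c3 v" "L1 Qop (sgl (G1 i) c2 c3 v) = sgl (G1 (Suc i)) c2 c3 v"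
     "L1 Qop (sgl (G2 i) c2 c3 v) = sgl (G2 (Suc i)) c2 c3 v" "L1 Qop (sgl (H0 i) c2 c3 v) = sgl (H0 (Suc i)) c2 c3 v"
     "L1 Qop (sgl (H1 i) c2 c3 v) = sgl (H1 (Suc i)) c2 c3 v" "L1 Qop (sgl (H2 i) c2 c3 v) = sgl (H2 (Suc i)) c2 c3 v" for i
    by (rule L1_sgl[OF _ add_map_Qop], rule Qop_sg)+
  have qp: "ap (M_hom qM ^ i) (sgl (G0 0) c2 c3 v) = sgl (G0 i) c2 c3 v" "ap (M_hom qM ^ i) (sgl (G1 0) c2 c3 v) = sgl (G1 i) c2 c3 v"
     "ap (M_hom qM ^ i) (sgl (G2 0) c2 c3 v) = sgl (G2 i) c2 c3 v" "ap (M_hom qM ^ i) (sgl (H0 0) c2 c3 v) = sgl (H0 i) c2 c3 v"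
     "ap (M_hom qM ^ i) (sgl (H1 0) c2 c3 v) = sgl (H1 i) c2 c3 v" "ap (M_hom qM ^ i) (sgl (H2 0) c2 c3 v) = sgl (H2 i) c2 c3 v" for i
    by (induction i) (simp_all only: power_0 power_Suc ap_simps ap_qM q)
  show ?thesis
    by (cases b; simp only: elem.simps M_hom_simps M_hom_power ap_simps copX.rep_eq X9_simps s s4 qp)
qed

lemma \<tau>op_sg: "\<tau>op (sg E1 w) = sg E1 w"
  by (rule ext, rename_tac c, case_tac c; simp add: sg_def)

lemma \<gamma>N_sgl: "\<gamma>N (sgl a1 a2 E1 v) = sgl E1 a1 a2 (gD v)"
proof (intro ext)
  fix b1 b2 b3 j
  have "(\<lambda>b. gD (sgl a1 a2 E1 v b2 b3 b)) = (if b2 = a1 \<and> b3 = a2 then sg E1 (gD v) else 0)"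
    by (auto simp: sgl_def sg_def add_map_0[OF add_map_D(2)])
  thus "\<gamma>N (sgl a1 a2 E1 v) b1 b2 b3 j = sgl E1 a1 a2 (gD v) b1 b2 b3 j"
    by (auto simp: \<gamma>N_def sgl_def \<tau>op_sg add_map_0[OF add_map_\<tau>op]) (simp_all add: sg_def)
qed

lemma elem2_sgl: "ap (M_hom (\<gamma> (elem b))) (sgl E1 E1 c3 v) = sgl E1 b c3 v"
proof -
  have 1: "sgl E1 E1 c3 v = \<gamma>N (sgl E1 c3 E1 (gD (gD v)))" by (simp only: \<gamma>N_sgl gD_cube)
  show ?thesis unfolding 1 ap_M_hom_\<gamma> elem_sgl by (simp only: \<gamma>N_sgl gD_cube)
qed

lemma elem3_sgl: "ap (M_hom (\<gamma> (\<gamma> (elem b)))) (sgl E1 E1 E1 v) = sgl E1 E1 b v"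
proof -
  have 1: "sgl E1 E1 E1 v = \<gamma>N (\<gamma>N (sgl E1 E1 E1 (gD v)))" by (simp only: \<gamma>N_sgl gD_cube)
  show ?thesis unfolding 1 ap_M_hom_\<gamma> elem_sgl by (simp only: \<gamma>N_sgl gD_cube)
qed

lemma pd_sgl: "d 0 = 0 \<Longrightarrow> pd d (sgl b1 b2 b3 v) = sgl b1 b2 b3 (d v)"
  by (intro ext) (simp add: pd_def sgl_def)

lemma es_ops: "dop1 (es S0 f) = es S1 f" "dop2 (es S0 f) = es S2 f" "dop1 (es S2 f) = es S3 f"
    "dop2 (dop3 (es S0 f)) = es S4 f" "dop1 (es S3 f) = es S5 f"
  unfolding dop2_def dop3_def
  by (rule ext, rename_tac c, case_tac c; simp add: es_def)+

lemma dbas_sgl: "ap (M_hom (dbas j)) (sgl b1 b2 b3 (es S0 f)) = sgl b1 b2 b3 (es j f)"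
  by (cases j; simp only: dbas.simps M_hom_simps ap_simps ap_M_hom_d pd_sgl[where d = dop1, OF add_map_0[OF add_map_D(1)]]
      pd_sgl[where d = dop2, OF add_map_0[OF add_map_dop23(1)]] pd_sgl[where d = dop3, OF add_map_0[OF add_map_dop23(2)]] es_ops)

lemma nsc_sgl: "nsc f (sgl b1 b2 b3 (es j g)) = sgl b1 b2 b3 (es j (f * g))"
  by (intro ext) (simp add: nsc_def usc_def sgl_def es_def)

type_synonym idx = "bx \<times> bx \<times> bx \<times> sx \<times> nat \<times> nat"

fun cf :: "'w::comm_ring_1 N \<Rightarrow> idx \<Rightarrow> 'w" where
  "cf u (b1, b2, b3, j, a, b) = fps_nth (fps_nth (u b1 b2 b3 j) a) b"

lemma cf_eqI: "(\<And>i. cf u i = cf v i) \<Longrightarrow> u = v"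
proof (intro ext)
  fix b1 b2 b3 j assume eq: "\<And>i. cf u i = cf v i"
  show "u b1 b2 b3 j = v b1 b2 b3 j"
    by (intro fps_ext) (use eq[of "(b1, b2, b3, j, _, _)"] in simp)
qed

lemma cf_simps: "cf (u + v) i = cf u i + cf v i" "cf (u - v) i = cf u i - cf v i" "cf 0 i = 0" "cf (- u) i = - cf u i"
  by (cases i; simp)+

fun bas :: "idx \<Rightarrow> 'w::strict_3_ring M" where
  "bas (b1, b2, b3, j, a, b) = elem b1 * (\<gamma> (elem b2) * \<gamma> (\<gamma> (elem b3))) * (dbas j * (s1 ^ a * s2 ^ b))"

fun dgi :: "idx \<Rightarrow> int" where
  "dgi (b1, b2, b3, j, a, b) = degb b1 + degb b2 + degb b3 + (degs j + 3 * int a + 6 * int b)"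

text \<open>The weight at index i is i + 1 and not i: q times 1, x or y lies in the span of the
  \<open>G\<close> and \<open>H\<close> of index 0, and multiplication by q is to raise the
  filtration by one everywhere.\<close>

primrec wtb :: "bx \<Rightarrow> nat" where
  "wtb E1 = 0" | "wtb Ex = 0" | "wtb Ey = 0" | "wtb (G0 i) = Suc i" | "wtb (G1 i) = Suc i" | "wtb (G2 i) = Suc i"
| "wtb (H0 i) = Suc i" | "wtb (H1 i) = Suc i" | "wtb (H2 i) = Suc i"

fun wti :: "idx \<Rightarrow> nat" where
  "wti (b1, b2, b3, j, a, b) = wtb b1 + wtb b2 + wtb b3 + a + b"

text \<open>The one multiple of a basis element by a power of \<open>s3\<close> that has degree n.
  It exists only if the degrees agree modulo 9, the degree of \<open>s3\<close>; the value 0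
  otherwise keeps the sums below homogeneous.\<close>

definition bel :: "int \<Rightarrow> idx \<Rightarrow> 'w::strict_3_ring Mloc" where
  "bel n i = (if 9 dvd (n - dgi i) then mfrac (bas i) 0 * s3_pow ((n - dgi i) div 9) else 0)"

lemma Sp_induct_bel [consumes 1, case_names zero add bel]:
  assumes "Sp n t" "P 0" "\<And>s t. P s \<Longrightarrow> P t \<Longrightarrow> P (s + t)"
    "\<And>i w. 9 dvd (n - dgi i) \<Longrightarrow> P (mfrac (M_const w) 0 * bel n i)"
  shows "P t"
  using assms
proof (induction rule: Sp.induct)
  case (Sp_base n t b1 b2 b3)
  note bel = Sp_base(4) and add = Sp_base(3) and zero = Sp_base(2)
  from Sp_base(1) bel show ?case
  proof (induction rule: SD.induct)
    case (SD_base j a b c w)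
    have "mfrac (M_const w) 0 * bel (degb b1 + degb b2 + degb b3 + (degs j + 3 * int a + 6 * int b + 9 * c)) (b1, b2, b3, j, a, b)
      = mfrac (elem b1 * (\<gamma> (elem b2) * \<gamma> (\<gamma> (elem b3)))) 0 * (mfrac (dbas j) 0 * (mfrac (M_const w * s1 ^ a * s2 ^ b) 0 * s3_pow c))"
      by (simp add: bel_def mfrac0_simps mult_ac)
    with SD_base(1)[of "(b1, b2, b3, j, a, b)" w] show ?case by simp
  next
    case (SD_add n s t)
    thus ?case using add by (simp add: distrib_left)
  qed (simp add: zero)
qed blast+

lemma Rho_simps: "Rho (s + t) = Rho s + Rho t" "Rho (s - t) = Rho s - Rho t" "Rho 0 = 0"
    "Rho (mfrac (M_const w) 0 * t) = nsc (fps_const (fps_const w)) (Rho t)"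
  by (simp_all only: Rho_def Mloc_hom_simps Mloc_hom_diff ap_simps Mloc_hom_mfrac M_hom_const copW_def copU.rep_eq)

lemma cf_nsc_const: "cf (nsc (fps_const (fps_const w)) u) i = w * cf u i"
  by (cases i) (simp add: nsc_def usc_def)

lemma Rho_bas: "Rho (mfrac (bas (b1, b2, b3, j, a, b)) 0 * s3_pow c) = (sgl b1 b2 b3 (es j (t1 ^ a * t2 ^ b)) :: 'w::strict_3_ring N)" (is "?L = _")
proof -
  have p: "copU f ^ k = copU (f ^ k)" for f :: "'w U" and k
    by (induction k) (simp_all add: copU_hom)
  have s: "ap (M_hom (s1 ^ a * s2 ^ b)) oneN = sgl E1 E1 E1 (es S0 (t1 ^ a * t2 ^ b) :: 'w D)"
    by (simp only: M_hom_simps M_hom_power M_hom_s p ap_simps copU.rep_eq oneN_def nsc_sgl mult_1_right)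
  have "?L = ap (M_hom (bas (b1, b2, b3, j, a, b))) oneN"
    by (simp only: Rho_def Mloc_hom_simps Mloc_hom_s3_pow Mloc_hom_mfrac mult_1_right)
  also have "\<dots> = ap (M_hom (elem b1)) (ap (M_hom (\<gamma> (elem b2))) (ap (M_hom (\<gamma> (\<gamma> (elem b3)))) (ap (M_hom (dbas j)) (ap (M_hom (s1 ^ a * s2 ^ b)) oneN))))"
    unfolding bas.simps M_hom_simps ap_simps by (rule refl)
  also have "\<dots> = sgl b1 b2 b3 (es j (t1 ^ a * t2 ^ b))"
    unfolding s dbas_sgl elem3_sgl elem2_sgl elem_sgl by (rule refl)
  finally show ?thesis .
qed

lemma cf_sgl: "cf (sgl b1 b2 b3 (es j (t1 ^ a * t2 ^ b))) i = (if i = (b1, b2, b3, j, a, b) then 1 else 0)"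
proof -
  have "t2 ^ b = (fps_const (fps_X ^ b) :: 'a U)" by (induction b) (simp_all flip: fps_const_mult)
  thus ?thesis by (cases i) (auto simp: sgl_def es_def fps_X_power_iff fps_mult_right_const_nth)
qed

lemma cf_Rho_bel: "9 dvd (n - dgi i) \<Longrightarrow> cf (Rho (bel n i)) i' = (if i' = i then 1 else 0)"
  by (cases i) (simp only: bel_def if_True Rho_bas cf_sgl)

lemma finite_sx: "finite (UNIV :: sx set)"
proof -
  have "(UNIV :: sx set) = {S0, S1, S2, S3, S4, S5}" using sx.exhaust by auto
  thus ?thesis by (metis finite.simps)
qed

lemma finite_wti: "finite {i. wti i < k}"
proof -
  define B where "B = {E1, Ex, Ey} \<union> G0 ` {..<k} \<union> G1 ` {..<k} \<union> G2 ` {..<k} \<union> H0 ` {..<k} \<union> H1 ` {..<k} \<union> H2 ` {..<k}"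
  have B: "b \<in> B" if "wtb b < k" for b
    using that unfolding B_def by (cases b) auto
  have fin: "finite B" unfolding B_def by simp
  have "{i. wti i < k} \<subseteq> B \<times> B \<times> B \<times> UNIV \<times> {..<k} \<times> {..<k}"
    using B by auto
  moreover have "finite (B \<times> B \<times> B \<times> (UNIV :: sx set) \<times> {..<k} \<times> {..<k})"
    by (intro finite_cartesian_product finite_sx fin) auto
  ultimately show ?thesis by (rule finite_subset)
qed

text \<open>A truncated inverse of \<open>Rho\<close> in degree n; only finitely many basis elements
  have weight below k.\<close>

definition sig :: "int \<Rightarrow> nat \<Rightarrow> 'w::strict_3_ring N \<Rightarrow> 'w Mloc" where
  "sig n k u = (\<Sum>i | wti i < k. mfrac (M_const (cf u i)) 0 * bel n i)"

lemma sig_add: "sig n k (u + v) = sig n k u + sig n k v"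
  by (simp add: sig_def cf_simps M_const_simps mfrac0_simps distrib_right sum.distrib)

lemma sig_0: "sig n k 0 = 0"
  using sig_add[of n k 0 0] by simp

lemma sig_minus: "sig n k (- u) = - sig n k u"
  using sig_add[of n k u "- u"] by (simp add: sig_0 eq_neg_iff_add_eq_0 add.commute)

lemma sig_diff: "sig n k (u - v) = sig n k u - sig n k v"
  using sig_add[of n k u "- v"] by (simp add: sig_minus)

lemma Sp_bel: "Sp n (bel n i)"
proof (cases "9 dvd (n - dgi i)")
  case True
  obtain b1 b2 b3 j a b where i: "i = (b1, b2, b3, j, a, b)" by (cases i)
  have "Sp (degb b1 + degb b2 + degb b3 + (degs j + 3 * int a + 6 * int b + 9 * ((n - dgi i) div 9)))
    (mfrac (elem b1 * (\<gamma> (elem b2) * \<gamma> (\<gamma> (elem b3)))) 0 * (mfrac (dbas j) 0 * (mfrac (M_const 1 * s1 ^ a * s2 ^ b) 0 * s3_pow ((n - dgi i) div 9))))"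
    by (intro Sp_base SD_base)
  moreover have "degb b1 + degb b2 + degb b3 + (degs j + 3 * int a + 6 * int b + 9 * ((n - dgi i) div 9)) = n"
    using True by (simp add: i)
  ultimately show ?thesis using True by (simp add: bel_def i mfrac0_simps M_const_simps mult_ac)
qed (simp add: bel_def Sp_zero)

lemma Sp_sum: "(\<And>i. i \<in> A \<Longrightarrow> Sp n (g i)) \<Longrightarrow> Sp n (\<Sum>i\<in>A. g i)"
  by (induction A rule: infinite_finite_induct) (simp_all add: Sp_zero Sp_add)

lemma Sp_sig: "Sp n (sig n k u)"
  unfolding sig_def by (intro Sp_sum Sp_mults(2) Sp_bel)

lemma Rho_sum: "Rho (\<Sum>i\<in>A. g i) = (\<Sum>i\<in>A. Rho (g i))"
  by (induction A rule: infinite_finite_induct) (simp_all only: sum.infinite sum.empty sum.insert Rho_simps not_False_eq_True)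

lemma cf_sum: "cf (\<Sum>i\<in>A. g i) j = (\<Sum>i\<in>A. cf (g i) j)"
  by (induction A rule: infinite_finite_induct) (simp_all only: sum.infinite sum.empty sum.insert cf_simps not_False_eq_True)

lemma cf_Rho_sig: "cf (Rho (sig n k u)) i = (if wti i < k \<and> 9 dvd (n - dgi i) then cf u i else 0)" for u :: "'w::strict_3_ring N"
proof -
  have "cf (Rho (bel n i' :: 'w Mloc)) i = (if 9 dvd (n - dgi i') \<and> i' = i then 1 else 0)" for i'
    using cf_Rho_bel[of n i' i] by (auto simp: bel_def Rho_simps cf_simps)
  hence "cf (Rho (sig n k u)) i = (\<Sum>i' | wti i' < k. if i' = i then (if 9 dvd (n - dgi i) then cf u i else 0) else 0)"
    unfolding sig_def Rho_sum cf_sum Rho_simps cf_nsc_const by (intro sum.cong refl) simp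
  also have "\<dots> = (if wti i < k \<and> 9 dvd (n - dgi i) then cf u i else 0)"
    using finite_wti[of k] by (simp add: sum.delta')
  finally show ?thesis .
qed

text \<open>A homogeneous element is a finite combination of basis elements, so its coordinates
  restore it as soon as the truncation passes all of them. In particular \<open>Rho\<close> is
  injective on each homogeneous part.\<close>

lemma Sp_expand: "Sp n t \<Longrightarrow> \<exists>K. \<forall>k\<ge>K. sig n k (Rho t) = t"
proof (induction rule: Sp_induct_bel)
  case zero
  show ?case by (simp only: Rho_simps sig_0) simp
next
  case (add s t)
  then obtain K L where "\<forall>k\<ge>K. sig n k (Rho s) = s" "\<forall>k\<ge>L. sig n k (Rho t) = t" by blast
  hence "\<forall>k\<ge>max K L. sig n k (Rho (s + t)) = s + t" by (simp only: Rho_simps sig_add max.bounded_iff) simp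
  thus ?case by blast
next
  case (bel i w)
  have "sig n k (Rho (mfrac (M_const w) 0 * bel n i)) = mfrac (M_const w) 0 * bel n i" if "k > wti i" for k
  proof -
    have "sig n k (Rho (mfrac (M_const w) 0 * bel n i)) = (\<Sum>i' | wti i' < k. if i' = i then mfrac (M_const w) 0 * bel n i else 0)"
      unfolding sig_def Rho_simps cf_nsc_const cf_Rho_bel[OF bel]
      by (intro sum.cong refl) (simp add: M_const_simps mfrac0_simps)
    thus ?thesis using that finite_wti[of k] by (simp add: sum.delta')
  qed
  thus ?case by (intro exI[of _ "Suc (wti i)"]) simp
qed

lemma cf_Rho_degree: "Sp n t \<Longrightarrow> \<not> 9 dvd (n - dgi i) \<Longrightarrow> cf (Rho t) i = 0"
proof -
  assume t: "Sp n t" and i: "\<not> 9 dvd (n - dgi i)"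
  obtain k where "sig n k (Rho t) = t" using Sp_expand[OF t] by blast
  with cf_Rho_sig[of n k "Rho t" i] i show ?thesis by simp
qed

subsection \<open>The adic filtration\<close>

text \<open>The k-th power of the ideal (3, t1, t2), read off from coefficients. \<open>W\<close>
  extends it to \<open>N\<close> by giving the basis elements the weights
  \<open>wtb\<close>.\<close>

definition WU :: "nat \<Rightarrow> 'w::comm_ring_1 U \<Rightarrow> bool" where
  "WU k f \<longleftrightarrow> (\<forall>a b. 3 ^ (k - (a + b)) dvd fps_nth (fps_nth f a) b)"

definition WD :: "nat \<Rightarrow> 'w::comm_ring_1 D \<Rightarrow> bool" where "WD k v \<longleftrightarrow> (\<forall>j. WU k (v j))"

definition W :: "nat \<Rightarrow> 'w::comm_ring_1 N \<Rightarrow> bool" where "W k u \<longleftrightarrow> (\<forall>i. 3 ^ (k - wti i) dvd cf u i)"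

lemma W_WD: "W k u \<longleftrightarrow> (\<forall>b1 b2 b3. WD (k - (wtb b1 + wtb b2 + wtb b3)) (u b1 b2 b3))"
  by (auto simp: W_def WD_def WU_def diff_diff_left add.assoc)

lemma WU_add: "WU k f \<Longrightarrow> WU k g \<Longrightarrow> WU k (f + g)" by (simp add: WU_def)
lemma WU_diff: "WU k f \<Longrightarrow> WU k g \<Longrightarrow> WU k (f - g)" by (simp add: WU_def)
lemma WU_uminus: "WU k f \<Longrightarrow> WU k (- f)" by (simp add: WU_def)
lemma WU_0: "WU k 0" by (simp add: WU_def)
lemma WU_0': "WU 0 f" by (simp add: WU_def)

lemma WU_mono: "WU k f \<Longrightarrow> m \<le> k \<Longrightarrow> WU m f"
  unfolding WU_def by (meson diff_le_mono dvd_trans le_imp_power_dvd)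

lemma WU_mult: "WU m f \<Longrightarrow> WU k g \<Longrightarrow> WU (m + k) (f * g)"
  unfolding WU_def
proof (intro allI)
  fix a b assume f: "\<forall>a b. 3 ^ (m - (a + b)) dvd fps_nth (fps_nth f a) b" and g: "\<forall>a b. 3 ^ (k - (a + b)) dvd fps_nth (fps_nth g a) b"
  have "fps_nth (fps_nth (f * g) a) b = (\<Sum>i=0..a. \<Sum>l=0..b. fps_nth (fps_nth f i) l * fps_nth (fps_nth g (a - i)) (b - l))"
    by (simp add: fps_mult_nth fps_sum_nth)
  moreover have "3 ^ (m + k - (a + b)) dvd fps_nth (fps_nth f i) l * fps_nth (fps_nth g (a - i)) (b - l)"
    if "i \<le> a" "l \<le> b" for i l
  proof -
    have "(3::'a) ^ (m + k - (a + b)) dvd 3 ^ ((m - (i + l)) + (k - ((a - i) + (b - l))))"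
      by (rule le_imp_power_dvd) (use that in linarith)
    also have "\<dots> dvd fps_nth (fps_nth f i) l * fps_nth (fps_nth g (a - i)) (b - l)"
      unfolding power_add by (intro mult_dvd_mono) (use f g in blast)+
    finally show ?thesis .
  qed
  ultimately show "3 ^ (m + k - (a + b)) dvd fps_nth (fps_nth (f * g) a) b"
    by (auto intro!: dvd_sum)
qed

lemma WU_t: "WU (Suc 0) t1" "WU (Suc 0) t2" "WU (Suc 0) (fps_const (fps_const 3))"
  by (auto simp: WU_def fps_X_def)

lemma WU_mult': "WU k g \<Longrightarrow> WU k (f * g)"
  using WU_mult[OF WU_0', of k g f] by simp

lemma WD_simps: "WD k u \<Longrightarrow> WD k v \<Longrightarrow> WD k (u + v)" "WD k u \<Longrightarrow> WD k v \<Longrightarrow> WD k (u - v)"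
    "WD k u \<Longrightarrow> WD k (- u)" "WD k 0"
  by (simp_all add: WD_def WU_add WU_diff WU_uminus WU_0)

lemma WD_mono: "WD k u \<Longrightarrow> m \<le> k \<Longrightarrow> WD m u"
  unfolding WD_def using WU_mono by blast

lemma WD_gD: "WD k v \<Longrightarrow> WD k (gD v)"
  unfolding WD_def
proof
  fix j assume "\<forall>j. WU k (v j)"
  thus "WU k (gD v j)" by (cases j) (auto intro!: WU_add WU_diff WU_uminus WU_mult')
qed

lemma WD_usc: "WU m f \<Longrightarrow> WD k v \<Longrightarrow> WD (m + k) (usc f v)"
  by (simp add: WD_def usc_def WU_mult)

lemma W_add: "W k u \<Longrightarrow> W k v \<Longrightarrow> W k (u + v)" by (simp add: W_def cf_simps)
lemma W_diff: "W k u \<Longrightarrow> W k v \<Longrightarrow> W k (u - v)" by (simp add: W_def cf_simps)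
lemma W_0: "W k 0" by (simp add: W_def cf_simps)

lemma W_mono: "W k u \<Longrightarrow> m \<le> k \<Longrightarrow> W m u"
  unfolding W_def by (meson diff_le_mono dvd_trans le_imp_power_dvd)

lemma W_nsc: "WU m f \<Longrightarrow> W k u \<Longrightarrow> W (m + k) (nsc f u)"
  unfolding W_WD nsc_def
proof (intro allI)
  fix b1 b2 b3
  assume f: "WU m f" and u: "\<forall>b1 b2 b3. WD (k - (wtb b1 + wtb b2 + wtb b3)) (u b1 b2 b3)"
  show "WD (m + k - (wtb b1 + wtb b2 + wtb b3)) (usc f (u b1 b2 b3))"
    by (rule WD_mono[OF WD_usc[OF f u[rule_format]], of _ b1 b2 b3]) linarith
qed

lemma W_\<gamma>N: "W k u \<Longrightarrow> W k (\<gamma>N u)"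
  unfolding W_WD
proof (intro allI)
  fix b1 b2 b3
  assume u: "\<forall>b1 b2 b3. WD (k - (wtb b1 + wtb b2 + wtb b3)) (u b1 b2 b3)"
  have *: "WD m (gD (u b2 b3 b))" if "m = k - (wtb b2 + wtb b3 + wtb b)" for b m
    using u that WD_gD by blast
  have "WD (k - (wtb b1 + wtb b2 + wtb b3)) (\<tau>op (\<lambda>b. gD (u b2 b3 b)) b1)"
    by (cases b1; simp only: \<tau>op.simps; intro WD_simps *; simp)
  thus "WD (k - (wtb b1 + wtb b2 + wtb b3)) (\<gamma>N u b1 b2 b3)" by (simp add: \<gamma>N_def)
qed

lemma W_Qop: "W k u \<Longrightarrow> W (Suc k) (L1 Qop u)"
  unfolding W_WD L1_def
proof (intro allI)
  fix b1 b2 b3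
  assume u: "\<forall>b1 b2 b3. WD (k - (wtb b1 + wtb b2 + wtb b3)) (u b1 b2 b3)"
  have *: "WD m (u b b2 b3)" if "m = k - (wtb b + wtb b2 + wtb b3)" for b m
    using u that by blast
  show "WD (Suc k - (wtb b1 + wtb b2 + wtb b3)) (Qop (\<lambda>b. u b b2 b3) b1)"
    by (cases b1 rule: bx_split; simp only: Qop.simps; intro WD_simps *; simp)
qed

text \<open>The cube of \<gamma> is \<tau> in all three slots at once; the three copies of \<tau>
  commute, and each has order three.\<close>

lemma \<gamma>N_9: "(\<gamma>N ^^ 9) u = u"
proof -
  define T where "T u = (\<lambda>b1 b2 b3. \<tau>op (\<lambda>a1. \<tau>op (\<lambda>a2. \<tau>op (\<lambda>a3. u a1 a2 a3) b3) b2) b1)" for u :: "'a N"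
  have cube: "\<gamma>N (\<gamma>N (\<gamma>N u)) = T u" for u unfolding T_def by (rule \<gamma>N_cube)
  define A1 A2 A3 where "A1 = L1 (\<tau>op :: (bx \<Rightarrow> 'a D) \<Rightarrow> _)" and "A2 = L2 (\<tau>op :: (bx \<Rightarrow> 'a D) \<Rightarrow> _)" and "A3 = L3 (\<tau>op :: (bx \<Rightarrow> 'a D) \<Rightarrow> _)"
  have T: "T u = A1 (A2 (A3 u))" for u
    by (simp add: T_def A1_def A2_def A3_def L1_def L2_def L3_def)
  have c: "A2 (A1 u) = A1 (A2 u)" "A3 (A1 u) = A1 (A3 u)" "A3 (A2 u) = A2 (A3 u)" for u
    unfolding A1_def A2_def A3_def L1_def L2_def L3_def
    by (intro ext fun_cong[OF \<tau>op_comm])+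
  have 3: "A1 (A1 (A1 u)) = u" "A2 (A2 (A2 u)) = u" "A3 (A3 (A3 u)) = u" for u
    by (simp_all only: A1_def A2_def A3_def L1_def L2_def L3_def \<tau>op_cube)
  have "T (T (T u)) = u" by (simp only: T c 3)
  moreover have "(\<gamma>N ^^ 9) u = T (T (T u))" by (simp add: eval_nat_numeral cube)
  ultimately show ?thesis by simp
qed

text \<open>These elements visibly raise \<open>W\<close> by one in coordinates. They connect
  \<open>W\<close> with I in both directions: they lie in I, and the ninth powers of the generators
  of I lie in the ideal they generate.\<close>

definition Qs :: "'w::strict_3_ring M set" where "Qs = {3, qM, \<gamma> qM, \<gamma> (\<gamma> qM), s1, s2}"

lemma M_const_3: "M_const 3 = 3"
proof -
  have "(3 :: 'a) = 1 + 1 + 1" by simp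
  hence "M_const (3::'a) = 1 + 1 + 1" by (simp only: M_const_simps)
  thus ?thesis by simp
qed

lemma W_Qs: "t \<in> Qs \<Longrightarrow> W k u \<Longrightarrow> W (Suc k) (ap (M_hom t) u)"
proof -
  assume t: "t \<in> Qs" and u: "W k u"
  have \<gamma>: "W (Suc k) (ap (M_hom (\<gamma> m)) u)" if "\<And>u. W k u \<Longrightarrow> W (Suc k) (ap (M_hom m) u)" "W k u" for m :: "'a M" and u
  proof -
    have "(\<gamma>N ^^ Suc 8) u = u" using \<gamma>N_9[of u] by simp
    hence eq: "\<gamma>N ((\<gamma>N ^^ 8) u) = u" by (simp only: funpow.simps comp_apply)
    have "W k ((\<gamma>N ^^ l) u)" for l by (induction l) (simp_all add: that W_\<gamma>N)
    hence "W (Suc k) (\<gamma>N (ap (M_hom m) ((\<gamma>N ^^ 8) u)))" by (intro W_\<gamma>N that)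
    thus ?thesis by (simp only: ap_M_hom_\<gamma>[symmetric] eq)
  qed
  have q: "W (Suc k) (ap (M_hom qM) u)" if "W k u" for u :: "'a N"
    using W_Qop[OF that] by (simp add: ap_qM)
  have 3: "W (Suc k) (ap (M_hom 3) u)"
    using W_nsc[OF WU_t(3) u] by (simp add: M_hom_const copW_def copU.rep_eq flip: M_const_3)
  have s: "W (Suc k) (ap (M_hom s1) u)" "W (Suc k) (ap (M_hom s2) u)"
    using W_nsc[OF WU_t(1) u] W_nsc[OF WU_t(2) u] by (simp_all add: M_hom_s copU.rep_eq)
  show ?thesis
    using t unfolding Qs_def using 3 s q[OF u] \<gamma>[OF q u] \<gamma>[OF \<gamma>[OF q] u] by blast
qed

section \<open>Powers of I against the filtration\<close>

definition TT :: "nat \<Rightarrow> 'w::strict_3_ring Mloc set" where "TT k = {m. \<forall>u. W k (ap (Mloc_hom m) u)}"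

lemma TT_add: "s \<in> TT k \<Longrightarrow> t \<in> TT k \<Longrightarrow> s + t \<in> TT k"
  by (simp only: TT_def mem_Collect_eq Mloc_hom_simps ap_simps W_add simp_thms)

lemma TT_0: "0 \<in> TT k"
  by (simp only: TT_def mem_Collect_eq Mloc_hom_simps ap_simps W_0 simp_thms)

lemma TT_mult: "t \<in> TT k \<Longrightarrow> s * t \<in> TT k"
  by (simp add: TT_def mult.commute[of s] Mloc_hom_simps ap_simps)

lemma TT_ideal_gen: "S \<subseteq> TT k \<Longrightarrow> t \<in> ideal_gen S \<Longrightarrow> t \<in> TT k"
  by (erule ideal_gen_induct) (auto intro: TT_0 TT_add TT_mult)

lemma TT_Qs: "a \<in> ideal_gen Qs \<Longrightarrow> m \<in> TT k \<Longrightarrow> mfrac a 0 * m \<in> TT (Suc k)"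
proof (induction rule: ideal_gen_induct)
  case zero
  show ?case by (simp add: mfrac0_simps TT_0)
next
  case (step c x y)
  have "mfrac x 0 * m \<in> TT (Suc k)"
    using step(3) W_Qs[OF step(1)] by (auto simp: TT_def Mloc_hom_simps Mloc_hom_mfrac ap_simps)
  from TT_add[OF TT_mult[OF this, of "mfrac c 0"] step(2)[OF step(3)]]
  show ?case by (simp add: mfrac0_simps distrib_right mult.assoc)
qed

lemma \<gamma>_ideal_Qs: "a \<in> ideal_gen Qs \<Longrightarrow> \<gamma> a \<in> ideal_gen Qs"
proof (erule ideal_gen_hom[OF _ \<gamma>_simps(1-3)])
  fix x :: "'a M" assume "x \<in> Qs"
  moreover have "\<gamma> 3 = (3 :: 'a M)" using \<gamma>_const[of "3::'a"] by (simp add: M_const_3)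
  ultimately have "\<gamma> x \<in> Qs" by (auto simp: Qs_def \<gamma>_s \<gamma>3_qM)
  thus "\<gamma> x \<in> ideal_gen Qs" by (rule ideal_gen_base)
qed

lemma Qs_mem: "3 * r \<in> ideal_gen Qs" "qM * r \<in> ideal_gen Qs" "\<gamma> qM * r \<in> ideal_gen Qs" "s1 * r \<in> ideal_gen Qs" "s2 * r \<in> ideal_gen Qs"
  by (intro ideal_gen_mult' ideal_gen_base; simp add: Qs_def)+

text \<open>Two cubings. As \<open>x_0^3\<close> = d1 - q \<open>x_0\<close>, the cube of
  \<open>x_0 - x_1\<close> is d1 - d2 modulo q, its conjugate and 3. As d1 and d2 are roots of T^3 -
  s1 T^2 + s2 T - s3, the difference of their cubes, and with it the cube of d1 - d2, vanishes
  modulo 3, s1, s2.\<close>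

lemma x0_x1_power9: "(xM 0 - xM 1) ^ 9 \<in> ideal_gen (Qs :: 'w::strict_3_ring M set)"
proof -
  have cube: "(a - b) ^ 3 = a ^ 3 - b ^ 3 + 3 * (- (a * b * (a - b)))" for a b :: "'w M"
    by (simp add: power3_eq_cube algebra_simps)
  have x0: "xM 0 ^ 3 = d1 + qM * (- xM 0 :: 'w M)"
    by (simp add: d1_def qM_def x6_eq power3_eq_cube algebra_simps)
  have x1: "xM 1 ^ 3 = d2 + \<gamma> qM * (- xM 1 :: 'w M)"
    using arg_cong[OF x0, of \<gamma>] by (simp add: \<gamma>_simps \<gamma>_power \<gamma>_d \<gamma>_diff)
  define \<kappa> where "\<kappa> = qM * (- xM 0) - \<gamma> qM * (- xM 1 :: 'w M) + 3 * (- (xM 0 * xM 1 * (xM 0 - xM 1)))"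
  have \<kappa>: "\<kappa> \<in> ideal_gen Qs" unfolding \<kappa>_def by (intro ideal_gen_add ideal_gen_diff Qs_mem)
  have 1: "(xM 0 - xM 1) ^ 3 = (d1 - d2) + \<kappa>" unfolding cube x0 x1 \<kappa>_def by simp
  have d: "(d1 - d2) ^ 3 = s1 * (d1 * d1 - d2 * d2) - s2 * (d1 - d2) + 3 * (- (d1 * d2 * (d1 - d2)) :: 'w M)"
    unfolding cube by (simp add: s1_def s2_def power3_eq_cube algebra_simps)
  have "(xM 0 - xM 1) ^ 9 = ((xM 0 - xM 1 :: 'w M) ^ 3) ^ 3" by (simp flip: power_mult)
  also have "\<dots> = (d1 - d2) ^ 3 + \<kappa> * (3 * (d1 - d2) ^ 2 + 3 * (d1 - d2) * \<kappa> + \<kappa> ^ 2)"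
    unfolding 1 by (simp add: power3_eq_cube power2_eq_square algebra_simps)
  also have "\<dots> \<in> ideal_gen Qs"
    unfolding d by (intro ideal_gen_add ideal_gen_diff Qs_mem ideal_gen_mult'[OF \<kappa>])
  finally show ?thesis .
qed

definition gensI :: "'w::strict_3_ring M list" where
  "gensI = [3, xM 0 - xM 1, xM 1 - xM 2, xM 2 - xM 3, xM 3 - xM 4, xM 4 - xM 5, xM 5 - xM 6, xM 6 - xM 7, xM 7 - xM 8]"

lemma I_M_gensI: "I_M = ideal_gen (set gensI)"
  by (simp add: I_M_def gensI_def)

lemma gensI_power9: "g \<in> set gensI \<Longrightarrow> g ^ 9 \<in> ideal_gen (Qs :: 'w::strict_3_ring M set)"
proof -
  have x: "(xM (of_nat k) - xM (of_nat k + 1)) ^ 9 \<in> ideal_gen (Qs :: 'w M set)" for k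
  proof (induction k)
    case (Suc k)
    from \<gamma>_ideal_Qs[OF this] show ?case by (simp add: \<gamma>_power \<gamma>_diff \<gamma>_simps add_ac)
  qed (use x0_x1_power9 in simp)
  have "3 ^ 9 \<in> ideal_gen (Qs :: 'w M set)"
    using Qs_mem(1)[of "3 ^ 8"] by (simp flip: power_Suc)
  moreover assume "g \<in> set gensI"
  ultimately show ?thesis
    using x[of 0] x[of 1] x[of 2] x[of 3] x[of 4] x[of 5] x[of 6] x[of 7] by (auto simp: gensI_def)
qed

lemma prod_list_count: "n \<le> count_list xs t \<Longrightarrow> \<exists>r. prod_list xs = t ^ n * r" for t :: "'a::comm_ring_1"
proof (induction xs arbitrary: n)
  case (Cons x xs)
  show ?case
  proof (cases "x = t \<and> n \<noteq> 0")
    case True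
    then obtain m where m: "n = Suc m" by (cases n) auto
    hence "m \<le> count_list xs t" using Cons.prems True by simp
    then obtain r where "prod_list xs = t ^ m * r" using Cons.IH by blast
    thus ?thesis using True m by (auto simp: mult_ac)
  next
    case False
    hence "n \<le> count_list xs t" using Cons.prems by (auto split: if_splits)
    then obtain r where "prod_list xs = t ^ n * r" using Cons.IH by blast
    hence "prod_list (x # xs) = t ^ n * (x * r)" by (simp add: mult_ac)
    thus ?thesis by blast
  qed
qed simp

lemma prod_gensI_73:
  assumes "set xs \<subseteq> set gensI" "length xs = 73"
  shows "prod_list xs \<in> ideal_gen (Qs :: 'w::strict_3_ring M set)"
proof -
  have "\<exists>t\<in>set gensI. 9 \<le> count_list xs t"
  proof (rule ccontr)
    assume "\<not> ?thesis"
    hence le: "count_list xs t \<le> 8" if "t \<in> set gensI" for t using that by force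
    have "73 = (\<Sum>t\<in>set (gensI :: 'w M list). count_list xs t)" using sum_count_set[OF assms(1)] assms(2) by simp
    also have "\<dots> \<le> (\<Sum>t\<in>set (gensI :: 'w M list). 8)" by (intro sum_mono le)
    also have "\<dots> \<le> length (gensI :: 'w M list) * 8" using card_length[of "gensI :: 'w M list"] by simp
    finally show False by (simp add: gensI_def)
  qed
  then obtain t r where "t \<in> set gensI" "prod_list xs = t ^ 9 * r" using prod_list_count by blast
  thus ?thesis by (simp add: ideal_gen_mult' gensI_power9)
qed

lemma prod_gensI_TT:
  "set xs \<subseteq> set gensI \<Longrightarrow> length xs = 73 * k \<Longrightarrow> mfrac (prod_list xs) 0 \<in> TT k"
proof (induction k arbitrary: xs)
  case 0
  thus ?case by (simp add: TT_def W_def)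
next
  case (Suc k)
  have xs: "xs = take 73 xs @ drop 73 xs" by simp
  have "prod_list (take 73 xs) \<in> ideal_gen Qs"
    by (rule prod_gensI_73) (use Suc.prems set_take_subset[of 73 xs] in auto)
  moreover have "mfrac (prod_list (drop 73 xs)) 0 \<in> TT k"
    by (rule Suc.IH) (use Suc.prems set_drop_subset[of 73 xs] in auto)
  ultimately have "mfrac (prod_list (take 73 xs)) 0 * mfrac (prod_list (drop 73 xs)) 0 \<in> TT (Suc k)" by (rule TT_Qs)
  thus ?case by (subst xs) (simp only: prod_list.append mfrac0_simps)
qed

lemma I_loc_gensI: "I_loc \<subseteq> ideal_gen ((\<lambda>g. mfrac g 0) ` set gensI)"
proof
  fix x :: "'a Mloc" assume "x \<in> I_loc"
  thus "x \<in> ideal_gen ((\<lambda>g. mfrac g 0) ` set gensI)"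
    unfolding I_loc_def
  proof (induction rule: ideal_gen_induct)
    case (step c x y)
    then obtain m where m: "x = mfrac m 0" "m \<in> ideal_gen (set gensI)" by (auto simp: I_M_gensI)
    have "mfrac m 0 \<in> ideal_gen ((\<lambda>g. mfrac g 0) ` set gensI)"
      by (rule ideal_gen_hom[OF m(2)]) (auto simp: mfrac0_simps intro: ideal_gen_base)
    thus ?case using step m by (simp add: ideal_gen_add ideal_gen_mult)
  qed (rule ideal_gen_zero)
qed

text \<open>Spans a power of I by monomials in the nine generators, the form in which repeated
  factors can be counted.\<close>

lemma ideal_pow_I_loc:
  "ideal_pow I_loc n \<subseteq> ideal_gen {mfrac (prod_list xs) 0 | xs. set xs \<subseteq> set gensI \<and> length xs = n}"
proof (induction n)
  case 0
  have "x * mfrac (prod_list []) 0 \<in> ideal_gen {mfrac (prod_list xs) 0 | xs. set xs \<subseteq> set gensI \<and> length xs = 0}" for x :: "'a Mloc"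
    by (intro ideal_gen_mult ideal_gen_base) auto
  thus ?case by (auto simp: mfrac0_simps)
next
  case (Suc n)
  let ?P = "\<lambda>n. {mfrac (prod_list xs) 0 | xs :: 'a M list. set xs \<subseteq> set gensI \<and> length xs = n}"
  have g: "mfrac g 0 * p \<in> ideal_gen (?P (Suc n))" if "g \<in> set gensI" "p \<in> ideal_gen (?P n)" for g p
    using that(2)
  proof (induction rule: ideal_gen_induct)
    case (step c x y)
    then obtain xs where xs: "x = mfrac (prod_list xs) 0" "set xs \<subseteq> set gensI" "length xs = n" by blast
    have "mfrac (prod_list (g # xs)) 0 \<in> ideal_gen (?P (Suc n))"
      by (rule ideal_gen_base) (use xs that(1) in \<open>auto intro!: exI[of _ "g # xs"]\<close>)
    from ideal_gen_add[OF ideal_gen_mult[OF this, of c] step(2)]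
    show ?case by (simp add: xs mfrac0_simps algebra_simps)
  qed (simp add: ideal_gen_zero)
  have a: "a * p \<in> ideal_gen (?P (Suc n))" if "a \<in> ideal_gen ((\<lambda>g. mfrac g 0) ` set gensI)" "p \<in> ideal_gen (?P n)" for a p
    using that(1)
  proof (induction rule: ideal_gen_induct)
    case (step c x y)
    then obtain h where h: "x = mfrac h 0" "h \<in> set gensI" by blast
    from ideal_gen_add[OF ideal_gen_mult[OF g[OF h(2) that(2)], of c] step(2)]
    show ?case by (simp add: h algebra_simps)
  qed (simp add: ideal_gen_zero)
  show ?case
  proof
    fix x :: "'a Mloc" assume "x \<in> ideal_pow I_loc (Suc n)"
    thus "x \<in> ideal_gen (?P (Suc n))"
      unfolding ideal_pow.simps
    proof (induction rule: ideal_gen_induct)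
      case (step c x y)
      then obtain s t where st: "x = s * t" "s \<in> I_loc" "t \<in> ideal_pow I_loc n" by blast
      have "s * t \<in> ideal_gen (?P (Suc n))"
        by (rule a) (use st Suc I_loc_gensI in blast)+
      thus ?case using step st by (simp add: ideal_gen_add ideal_gen_mult)
    qed (rule ideal_gen_zero)
  qed
qed

lemma ideal_pow_TT: "m \<in> ideal_pow I_loc (73 * k) \<Longrightarrow> m \<in> TT k"
  by (rule TT_ideal_gen[where S = "{mfrac (prod_list xs) 0 | xs. set xs \<subseteq> set gensI \<and> length xs = 73 * k}"])
     (use prod_gensI_TT ideal_pow_I_loc in blast)+

text \<open>Among \<open>73 = 9 * 8 + 1\<close> factors from the nine generators of \<open>I\<close> one occurs nine times, and the ninth
  power of a generator raises the filtration.\<close>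

lemma W_Rho_ideal_pow: "m \<in> ideal_pow I_loc (73 * k) \<Longrightarrow> W k (Rho m)"
  using ideal_pow_TT[of m k] by (simp add: TT_def Rho_def)

subsection \<open>The completion\<close>

lemma W_D: "W k u \<Longrightarrow> 3 ^ (k - wti i) dvd cf u i"
  unfolding W_def by blast

lemma ideal_pow_mult_add: "x \<in> ideal_pow I a \<Longrightarrow> y \<in> ideal_pow I b \<Longrightarrow> x * y \<in> ideal_pow I (a + b)"
proof (induction a arbitrary: x)
  case 0
  thus ?case by (simp add: ideal_pow_mult)
next
  case (Suc a)
  from Suc.prems(1) have "x * y \<in> ideal_gen {u * v |u v. u \<in> I \<and> v \<in> ideal_pow I (a + b)}"
    unfolding ideal_pow.simps
  proof (induction rule: ideal_gen_induct)
    case (step c s t)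
    then obtain u v where uv: "s = u * v" "u \<in> I" "v \<in> ideal_pow I a" by blast
    have "u * (v * y) \<in> ideal_gen {u * v |u v. u \<in> I \<and> v \<in> ideal_pow I (a + b)}"
      by (rule ideal_gen_base) (use uv Suc.IH[OF uv(3) Suc.prems(2)] in blast)
    from ideal_gen_add[OF ideal_gen_mult[OF this, of c] step(2)] show ?case
      by (simp add: uv distrib_right mult.assoc)
  qed (simp add: ideal_gen_zero)
  thus ?case by simp
qed

lemma ideal_pow_Suc_subset: "x \<in> ideal_pow I (Suc k) \<Longrightarrow> x \<in> ideal_pow I k"
  unfolding ideal_pow.simps
  by (induction rule: ideal_gen_induct) (auto intro: ideal_pow_zero_mem ideal_pow_add ideal_pow_mult)

lemma ideal_pow_antimono: "x \<in> ideal_pow I k \<Longrightarrow> m \<le> k \<Longrightarrow> x \<in> ideal_pow I m"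
proof (induction k)
  case (Suc k)
  thus ?case using ideal_pow_Suc_subset[of x I k] by (cases "m = Suc k") auto
qed simp

lemma ideal_pow_1: "x \<in> I \<Longrightarrow> x \<in> ideal_pow I 1"
  unfolding One_nat_def ideal_pow.simps
  by (rule ideal_gen_base, rule CollectI, rule exI[of _ x], rule exI[of _ 1]) simp

lemma ideal_pow_power: "x \<in> I \<Longrightarrow> x ^ k \<in> ideal_pow I k"
proof (induction k)
  case (Suc k)
  from ideal_pow_mult_add[OF ideal_pow_1[OF Suc.prems] Suc.IH[OF Suc.prems]] show ?case by simp
qed simp

lemma ideal_pow_sum: "(\<And>i. i \<in> A \<Longrightarrow> g i \<in> ideal_pow I k) \<Longrightarrow> (\<Sum>i\<in>A. g i) \<in> ideal_pow I k"
  by (induction A rule: infinite_finite_induct) (simp_all add: ideal_pow_zero_mem ideal_pow_add)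

section \<open>Basis elements in powers of I\<close>

lemma I_locI: "m \<in> I_M \<Longrightarrow> mfrac m 0 \<in> I_loc"
  unfolding I_loc_def by (rule ideal_gen_base) blast

lemma I_M_closed: "a \<in> I_M \<Longrightarrow> b \<in> I_M \<Longrightarrow> a + b \<in> I_M" "a \<in> I_M \<Longrightarrow> b \<in> I_M \<Longrightarrow> a - b \<in> I_M"
    "a \<in> I_M \<Longrightarrow> c * a \<in> I_M" "a \<in> I_M \<Longrightarrow> a * c \<in> I_M"
  unfolding I_M_def by (simp_all add: ideal_gen_add ideal_gen_diff ideal_gen_mult ideal_gen_mult')

lemma I_M_base: "3 \<in> I_M" "xM 0 - xM 1 \<in> I_M" "xM 1 - xM 2 \<in> I_M" "xM 2 - xM 3 \<in> I_M" "xM 3 - xM 4 \<in> I_M"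
   "xM 4 - xM 5 \<in> I_M" "xM 5 - xM 6 \<in> I_M" "xM 6 - xM 7 \<in> I_M" "xM 7 - xM 8 \<in> I_M"
  unfolding I_M_def by (rule ideal_gen_base; simp)+

text \<open>Substituting \<open>x_6\<close> = - \<open>x_0\<close> - \<open>x_3\<close> turns q into
  -(\<open>x_0\<close> - \<open>x_3\<close>)^2 - 3 \<open>x_0\<close> \<open>x_3\<close>.\<close>

lemma I_M_qM: "qM \<in> I_M"
proof -
  have "(xM 0 - xM 1) + (xM 1 - xM 2) + (xM 2 - xM 3) \<in> (I_M :: 'a M set)" by (intro I_M_closed I_M_base)
  hence x: "xM 0 - xM 3 \<in> (I_M :: 'a M set)" by simp
  have "qM = (xM 0 - xM 3) * (xM 3 - xM 0) - 3 * (xM 0 * xM 3 :: 'a M)"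
    by (simp add: qM_def x6_eq algebra_simps)
  moreover have "(xM 0 - xM 3) * (xM 3 - xM 0) - 3 * (xM 0 * xM 3) \<in> (I_M :: 'a M set)"
    by (intro I_M_closed(2) I_M_closed(4) x I_M_base)
  ultimately show ?thesis by simp
qed

lemma I_M_s: "(s1 :: 'a::strict_3_ring M) \<in> I_M" "(s2 :: 'a M) \<in> I_M"
proof -
  let ?I = "I_M :: 'a M set"
  have d12: "d1 - d2 \<in> ?I"
  proof -
    have "d1 - d2 = (xM 0 - xM 1) * (xM 3 * xM 6) + xM 1 * ((xM 3 - xM 4) * xM 6) + xM 1 * xM 4 * (xM 6 - xM 7 :: 'a M)"
      by (simp add: d1_def d2_def algebra_simps)
    thus ?thesis by (simp only:) (intro I_M_closed I_M_base)
  qed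
  from \<gamma>_I_M[OF d12] have d23: "d2 - d3 \<in> ?I" by (simp add: \<gamma>_diff \<gamma>_d)
  have "s1 = 3 * d2 + (d1 - d2) - (d2 - d3 :: 'a M)" by (simp add: s1_def)
  moreover have "3 * d2 + (d1 - d2) - (d2 - d3) \<in> ?I" by (intro I_M_closed I_M_base d12 d23)
  ultimately show "s1 \<in> ?I" by simp
  have "s2 = 3 * d2 * d2 + (d1 - d2) * (d2 + d3) - 2 * d2 * (d2 - d3 :: 'a M)" by (simp add: s2_def algebra_simps)
  moreover have "3 * d2 * d2 + (d1 - d2) * (d2 + d3) - 2 * d2 * (d2 - d3) \<in> ?I"
    by (intro I_M_closed I_M_base d12 d23)
  ultimately show "s2 \<in> ?I" by simp
qed

text \<open>One less than the weight, because \<open>G\<close> and \<open>H\<close> of index 0 have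
  weight 1 without a factor q. Over three tensor factors the loss is 3; this is the shift by 3 in
  \<open>sig_W\<close>, \<open>sig_tail\<close> and \<open>hsig\<close>.\<close>

lemma ideal_pow_elem: "mfrac (elem b) 0 \<in> ideal_pow I_loc (wtb b - 1)"
proof -
  have "mfrac (qM ^ i * r) 0 \<in> ideal_pow I_loc i" for i r
    unfolding mfrac0_simps mfrac0_power
    using ideal_pow_mult_add[OF ideal_pow_power[OF I_locI[OF I_M_qM]], of "mfrac r 0" 0 i] by simp
  thus ?thesis by (cases b) simp_all
qed

lemma ideal_pow_mfrac_\<gamma>: "mfrac m 0 \<in> ideal_pow I_loc k \<Longrightarrow> mfrac (\<gamma> m) 0 \<in> ideal_pow I_loc k"
  using \<gamma>_loc_ideal_pow[of "mfrac m 0" k] by (simp add: \<gamma>_loc_simps)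

lemma ideal_pow_bas: "mfrac (bas i) 0 \<in> ideal_pow I_loc (wti i - 3)"
proof (cases i)
  case (fields b1 b2 b3 j a b)
  have s: "mfrac s1 0 ^ a \<in> ideal_pow I_loc a" "mfrac s2 0 ^ b \<in> ideal_pow I_loc b"
    by (intro ideal_pow_power I_locI I_M_s)+
  have "mfrac (elem b1) 0 * (mfrac (\<gamma> (elem b2)) 0 * mfrac (\<gamma> (\<gamma> (elem b3))) 0) * (mfrac s1 0 ^ a * mfrac s2 0 ^ b)
      \<in> ideal_pow I_loc ((wtb b1 - 1) + ((wtb b2 - 1) + (wtb b3 - 1)) + (a + b))"
    by (intro ideal_pow_mult_add ideal_pow_elem ideal_pow_mfrac_\<gamma> s)
  hence "mfrac (dbas j) 0 * (mfrac (elem b1) 0 * (mfrac (\<gamma> (elem b2)) 0 * mfrac (\<gamma> (\<gamma> (elem b3))) 0) * (mfrac s1 0 ^ a * mfrac s2 0 ^ b))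
      \<in> ideal_pow I_loc (wti i - 3)"
    unfolding fields by - (rule ideal_pow_mult, erule ideal_pow_antimono, simp)
  thus ?thesis by (simp add: fields mfrac0_simps mfrac0_power mult_ac)
qed

lemma ideal_pow_bel: "bel n i \<in> ideal_pow I_loc (wti i - 3)"
  by (auto simp: bel_def ideal_pow_zero_mem) (subst mult.commute, rule ideal_pow_mult, rule ideal_pow_bas)

lemma M_const_power3: "M_const (3 ^ k * r) = 3 ^ k * M_const r"
  by (induction k) (simp_all add: M_const_simps M_const_3 mult.assoc)

lemma ideal_pow_const: "3 ^ k dvd w \<Longrightarrow> mfrac (M_const w) 0 \<in> ideal_pow I_loc k"
proof (elim dvdE)
  fix r assume w: "w = 3 ^ k * r"
  have "mfrac (M_const w) 0 = mfrac (M_const r) 0 * mfrac 3 0 ^ k"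
    unfolding w M_const_power3 mfrac0_simps mfrac0_power by (rule mult.commute)
  thus ?thesis by (simp add: ideal_pow_mult ideal_pow_power I_locI I_M_base)
qed

lemma sig_W: "W (k + 3) u \<Longrightarrow> sig n L u \<in> ideal_pow I_loc k"
  unfolding sig_def
proof (rule ideal_pow_sum)
  fix i assume "W (k + 3) u"
  hence "mfrac (M_const (cf u i)) 0 \<in> ideal_pow I_loc (k + 3 - wti i)" by (intro ideal_pow_const W_D)
  from ideal_pow_mult_add[OF this ideal_pow_bel[of n i]]
  show "mfrac (M_const (cf u i)) 0 * bel n i \<in> ideal_pow I_loc k" by (rule ideal_pow_antimono) simp
qed

lemma sig_tail: "k \<le> L \<Longrightarrow> sig n L u - sig n k u \<in> ideal_pow I_loc (k - 3)"
proof -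
  assume "k \<le> L"
  have "sig n L u - sig n k u = (\<Sum>i \<in> {i. wti i < L} - {i. wti i < k}. mfrac (M_const (cf u i)) 0 * bel n i)"
    unfolding sig_def by (subst sum_diff) (use \<open>k \<le> L\<close> finite_wti in auto)
  also have "\<dots> \<in> ideal_pow I_loc (k - 3)"
    by (intro ideal_pow_sum ideal_pow_mult ideal_pow_antimono[OF ideal_pow_bel]) auto
  finally show ?thesis .
qed

lemma coherent_iff: "coherent a \<longleftrightarrow> hat_eq a a"
  by (simp add: hat_eq_def ideal_pow_zero_mem)

lemma Mhat_cases: obtains a where "coherent a" "\<alpha> = abs_Mhat a"
proof -
  have "hat_eq (rep_Mhat \<alpha>) (rep_Mhat \<alpha>)" "abs_Mhat (rep_Mhat \<alpha>) = \<alpha>"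
    by (rule Quotient3_rep_reflp[OF Quotient3_Mhat], rule Quotient3_abs_rep[OF Quotient3_Mhat])
  thus ?thesis using that coherent_iff by metis
qed

lemma abs_Mhat_eq: "coherent a \<Longrightarrow> coherent b \<Longrightarrow> abs_Mhat a = abs_Mhat b \<longleftrightarrow> (\<forall>k. a k - b k \<in> ideal_pow I_loc k)"
  using Quotient3_rel[OF Quotient3_Mhat, of a b] by (simp add: coherent_iff[symmetric] hat_eq_def)

lemma abs_Mhat_simps:
  assumes "coherent a" "coherent b"
  shows "abs_Mhat a + abs_Mhat b = abs_Mhat (\<lambda>k. a k + b k)" "abs_Mhat a * abs_Mhat b = abs_Mhat (\<lambda>k. a k * b k)"
    "- abs_Mhat a = abs_Mhat (\<lambda>k. - a k)" "\<gamma>_hat (abs_Mhat a) = abs_Mhat (\<lambda>k. \<gamma>_loc (a k))"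
  using assms by (simp_all add: coherent_iff plus_Mhat.abs_eq times_Mhat.abs_eq uminus_Mhat.abs_eq \<gamma>_hat.abs_eq)

lemma coherent_\<gamma>: "coherent a \<Longrightarrow> coherent (\<lambda>k. \<gamma>_loc (a k))"
  by (simp add: coherent_def \<gamma>_loc_ideal_pow flip: \<gamma>_loc_diff)

lemma coherent_le: "coherent a \<Longrightarrow> k \<le> l \<Longrightarrow> a l - a k \<in> ideal_pow I_loc k"
proof (induction l)
  case (Suc l)
  show ?case
  proof (cases "k = Suc l")
    case False
    hence "a l - a k \<in> ideal_pow I_loc k" "a (Suc l) - a l \<in> ideal_pow I_loc k"
      using Suc ideal_pow_antimono[of "a (Suc l) - a l" I_loc l k] by (auto simp: coherent_def)
    from ideal_pow_add[OF this] show ?thesis by simp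
  qed (simp add: ideal_pow_zero_mem del: ideal_pow.simps)
qed (simp add: ideal_pow_zero_mem)

lemma W_all_0: "(\<And>k. W k u) \<Longrightarrow> u = (0 :: 'w::strict_3_ring N)"
proof (rule cf_eqI)
  fix i assume W: "\<And>k. W k u"
  have d: "3 ^ k dvd cf u i" for k using W_D[OF W[of "k + wti i"], of i] by simp
  have "\<exists>!l::'w. \<forall>k. 3 ^ k dvd ((\<lambda>_. 0) k - l)" by (rule three_complete) simp
  moreover have "\<forall>k. 3 ^ k dvd (0 - cf u i)" "\<forall>k. 3 ^ k dvd (0 - 0 :: 'w)" using d by simp_all
  ultimately have "cf u i = 0" by blast
  thus "cf u i = cf 0 i" by (simp add: cf_simps)
qed

section \<open>The limit map from the completion to the model\<close>

definition mkN :: "(idx \<Rightarrow> 'w) \<Rightarrow> 'w::comm_ring_1 N" where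
  "mkN g = (\<lambda>b1 b2 b3 j. Abs_fps (\<lambda>a. Abs_fps (\<lambda>b. g (b1, b2, b3, j, a, b))))"

lemma cf_mkN: "cf (mkN g) i = g i"
  by (cases i) (simp add: mkN_def)

text \<open>Convergence of the coordinate vectors of \<open>a\<close> to \<open>u\<close>, along the
  multiples of 73 because \<open>W_Rho_ideal_pow\<close> controls the filtration there.\<close>

definition Lm :: "(nat \<Rightarrow> 'w::strict_3_ring Mloc) \<Rightarrow> 'w N \<Rightarrow> bool" where
  "Lm a u \<longleftrightarrow> (\<forall>k. W k (Rho (a (73 * k)) - u))"

text \<open>The limit is taken coordinate by coordinate with 3-adic completeness. Level k of
  \<open>W\<close> says nothing about a coordinate of weight at least k, so the sequence for
  coordinate \<open>i\<close> starts at its weight.\<close>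

lemma Lm_exists: "coherent a \<Longrightarrow> \<exists>u. Lm a (u :: 'w::strict_3_ring N)"
proof -
  assume a: "coherent a"
  have step: "W k (Rho (a (73 * l)) - Rho (a (73 * k)))" if "k \<le> l" for k l
    using W_Rho_ideal_pow[OF coherent_le[OF a, of "73 * k" "73 * l"]] that by (simp add: Rho_simps)
  have "\<exists>l. \<forall>k. 3 ^ k dvd cf (Rho (a (73 * (k + wti i)))) i - l" for i
  proof -
    have "3 ^ k dvd (cf (Rho (a (73 * (Suc k + wti i)))) i - cf (Rho (a (73 * (k + wti i)))) i)" for k
    proof -
      have "W (k + wti i) (Rho (a (73 * (Suc k + wti i))) - Rho (a (73 * (k + wti i))))" by (rule step) simp
      from W_D[OF this, of i] show ?thesis by (simp add: cf_simps)
    qed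
    from three_complete[of "\<lambda>k. cf (Rho (a (73 * (k + wti i)))) i", OF this] show ?thesis by blast
  qed
  then obtain l where l: "\<And>i k. 3 ^ k dvd cf (Rho (a (73 * (k + wti i)))) i - l i" by metis
  have "Lm a (mkN l)"
    unfolding Lm_def W_def
  proof (intro allI)
    fix k i
    show "3 ^ (k - wti i) dvd cf (Rho (a (73 * k)) - mkN l) i"
    proof (cases "wti i \<le> k")
      case True
      thus ?thesis using l[of "k - wti i" i] by (simp add: cf_simps cf_mkN)
    qed simp
  qed
  thus ?thesis by blast
qed

lemma Lm_unique: "coherent a \<Longrightarrow> coherent b \<Longrightarrow> abs_Mhat a = abs_Mhat b \<Longrightarrow> Lm a u \<Longrightarrow> Lm b v \<Longrightarrow> u = v"
proof -
  assume ab: "coherent a" "coherent b" "abs_Mhat a = abs_Mhat b" and u: "Lm a u" and v: "Lm b v"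
  have "W k (u - v)" for k
  proof -
    have "W k (Rho (a (73 * k) - b (73 * k)))"
      by (rule W_Rho_ideal_pow) (use abs_Mhat_eq[OF ab(1,2)] ab(3) in blast)
    moreover have "W k (Rho (a (73 * k)) - u)" "W k (Rho (b (73 * k)) - v)" using u v by (simp_all only: Lm_def)
    ultimately have "W k (Rho (a (73 * k) - b (73 * k)) - (Rho (a (73 * k)) - u) + (Rho (b (73 * k)) - v))"
      by (rule W_add[OF W_diff])
    moreover have "Rho (a (73 * k) - b (73 * k)) - (Rho (a (73 * k)) - u) + (Rho (b (73 * k)) - v) = u - v"
      unfolding Rho_simps by (simp only: algebra_simps)
    ultimately show ?thesis by (simp only:)
  qed
  hence "u - v = 0" by (rule W_all_0)
  thus ?thesis by (simp only: right_minus_eq)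
qed

definition Lam :: "'w::strict_3_ring Mhat \<Rightarrow> 'w N" where
  "Lam \<alpha> = (THE u. \<exists>a. coherent a \<and> \<alpha> = abs_Mhat a \<and> Lm a u)"

lemma Lam_eqI: "coherent a \<Longrightarrow> Lm a u \<Longrightarrow> Lam (abs_Mhat a) = u"
  unfolding Lam_def by (rule the_equality) (use Lm_unique in blast)+

lemma Lam_Lm: "coherent a \<Longrightarrow> Lm a (Lam (abs_Mhat a))"
  using Lm_exists[of a] Lam_eqI[of a] by metis

lemma Lm_add: "Lm a u \<Longrightarrow> Lm b v \<Longrightarrow> Lm (\<lambda>k. a k + b k) (u + v)"
proof (unfold Lm_def, intro allI)
  fix k assume "\<forall>k. W k (Rho (a (73 * k)) - u)" "\<forall>k. W k (Rho (b (73 * k)) - v)"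
  hence "W k ((Rho (a (73 * k)) - u) + (Rho (b (73 * k)) - v))" by (intro W_add) blast+
  thus "W k (Rho (a (73 * k) + b (73 * k)) - (u + v))" by (simp only: Rho_simps add_diff_add)
qed

lemma Lam_add: "Lam (\<alpha> + \<beta>) = Lam \<alpha> + Lam \<beta>"
proof -
  obtain a b where a: "coherent a" "\<alpha> = abs_Mhat a" and b: "coherent b" "\<beta> = abs_Mhat b"
    by (metis Mhat_cases)
  have "Lam (abs_Mhat (\<lambda>k. a k + b k)) = Lam (abs_Mhat a) + Lam (abs_Mhat b)"
    by (intro Lam_eqI coherent_add Lm_add Lam_Lm a b)
  thus ?thesis using a b by (simp only: abs_Mhat_simps)
qed

lemma add_map_Lam: "add_map Lam"
  by (rule add_mapI) (rule Lam_add)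

lemma Rho_\<gamma>: "Rho (\<gamma>_loc t) = \<gamma>N (Rho t)" for t :: "'w::strict_3_ring Mloc"
proof -
  have "\<gamma>N oneN = (oneN :: 'w N)" by (simp add: oneN_def \<gamma>N_sgl) (rule arg_cong[where f = "sgl E1 E1 E1"], rule ext, rename_tac j, case_tac j; simp add: es_def)
  thus ?thesis using ap_Mloc_hom_\<gamma>[of t oneN] by (simp add: Rho_def)
qed

lemma Lam_\<gamma>: "Lam (\<gamma>_hat \<alpha>) = \<gamma>N (Lam \<alpha>)"
proof -
  obtain a where a: "coherent a" "\<alpha> = abs_Mhat a" by (metis Mhat_cases)
  have "Lm (\<lambda>k. \<gamma>_loc (a k)) (\<gamma>N (Lam \<alpha>))"
    unfolding Lm_def
  proof
    fix k
    have "W k (\<gamma>N (Rho (a (73 * k)) - Lam \<alpha>))" using Lam_Lm[OF a(1)] by (intro W_\<gamma>N) (simp only: Lm_def a)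
    thus "W k (Rho (\<gamma>_loc (a (73 * k))) - \<gamma>N (Lam \<alpha>))" by (simp only: Rho_\<gamma> add_map_diff[OF add_map_\<gamma>N])
  qed
  from Lam_eqI[OF coherent_\<gamma>[OF a(1)] this] show ?thesis using a by (simp only: abs_Mhat_simps)
qed

lemma Lam_hat_of_M: "Lam (hat_of_M m) = ap (M_hom m) oneN"
  unfolding hat_of_M_def
  by (rule Lam_eqI[OF coherent_const]) (simp add: Lm_def Rho_def Mloc_hom_mfrac W_0)

text \<open>Setting \<open>s3\<close> to 1 identifies degrees that differ by 9, so homogeneity
  survives as a congruence.\<close>

definition NG :: "int \<Rightarrow> 'w::comm_ring_1 N \<Rightarrow> bool" where
  "NG n u \<longleftrightarrow> (\<forall>i. \<not> 9 dvd (n - dgi i) \<longrightarrow> cf u i = 0)"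

definition hsig :: "int \<Rightarrow> 'w::strict_3_ring N \<Rightarrow> 'w Mhat" where
  "hsig n u = abs_Mhat (\<lambda>k. sig n (k + 3) u)"

lemma coherent_sig: "coherent (\<lambda>k. sig n (k + 3) u)"
  using sig_tail[of "_ + 3" "Suc _ + 3" n u] by (simp add: coherent_def)

lemma hsig_deg: "hsig n u \<in> Mhat_deg (- 2 * n)"
  unfolding hsig_def Mhat_deg_def using coherent_sig Sp_sig[of n _ u] Mloc_deg_iff_Sp by blast

lemma Lam_hsig: "NG n u \<Longrightarrow> Lam (hsig n u) = u"
  unfolding hsig_def
proof (rule Lam_eqI[OF coherent_sig], unfold Lm_def W_def, intro allI)
  fix k i assume "NG n u"
  hence "\<not> 9 dvd (n - dgi i) \<Longrightarrow> cf u i = 0" unfolding NG_def by blast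
  thus "3 ^ (k - wti i) dvd cf (Rho (sig n (73 * k + 3) u) - u) i"
    by (cases "wti i < 73 * k + 3"; cases "9 dvd (n - dgi i)") (simp_all add: cf_simps cf_Rho_sig)
qed

lemma Mhat_deg_cases: "\<alpha> \<in> Mhat_deg n \<Longrightarrow> \<exists>a. coherent a \<and> (\<forall>k. a k \<in> Mloc_deg n) \<and> \<alpha> = abs_Mhat a"
  by (auto simp: Mhat_deg_def)

lemma hsig_Lam: "\<alpha> \<in> Mhat_deg (- 2 * n) \<Longrightarrow> hsig n (Lam \<alpha>) = \<alpha>"
proof -
  assume "\<alpha> \<in> Mhat_deg (- 2 * n)"
  then obtain a where a: "coherent a" "\<And>k. Sp n (a k)" "\<alpha> = abs_Mhat a"
    using Mhat_deg_cases[of \<alpha> "- 2 * n"] Mloc_deg_iff_Sp by blast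
  have "sig n (k + 3) (Lam \<alpha>) - a k \<in> ideal_pow I_loc k" for k
  proof -
    \<comment> \<open>A late member of the sequence: its own coordinates restore it exactly, they
      are close to the limit by \<open>sig_W\<close>, and cutting the truncation back from
      \<open>l\<close> to \<open>k + 3\<close> is harmless by \<open>sig_tail\<close>.\<close>
    define t where "t = a (73 * (k + 3))"
    obtain L where L: "\<forall>l\<ge>L. sig n l (Rho t) = t" using Sp_expand a(2) unfolding t_def by blast
    define l where "l = max L (k + 3)"
    have 1: "sig n l (Rho t - Lam \<alpha>) \<in> ideal_pow I_loc k"
      using Lam_Lm[OF a(1)] by (intro sig_W) (simp only: t_def a Lm_def)
    have 2: "sig n l (Lam \<alpha>) - sig n (k + 3) (Lam \<alpha>) \<in> ideal_pow I_loc k"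
      using sig_tail[of "k + 3" l n] by (simp add: l_def)
    have 3: "t - a k \<in> ideal_pow I_loc k" unfolding t_def by (rule coherent_le[OF a(1)]) simp
    have 4: "sig n l (Rho t) = t" using L by (simp add: l_def)
    have "sig n (k + 3) (Lam \<alpha>) - a k = (t - a k) - sig n l (Rho t - Lam \<alpha>) - (sig n l (Lam \<alpha>) - sig n (k + 3) (Lam \<alpha>))"
      by (simp add: sig_diff 4)
    thus ?thesis by (rule ssubst) (intro ideal_pow_diff 1 2 3)
  qed
  thus ?thesis unfolding hsig_def a(3) by (subst abs_Mhat_eq[OF coherent_sig a(1)]) (simp add: a(3))
qed

text \<open>Projecting the limit to the degrees congruent to n gives another limit of the same
  sequence, because every member is homogeneous. Uniqueness of limits does the rest.\<close>

lemma NG_Lam: "\<alpha> \<in> Mhat_deg (- 2 * n) \<Longrightarrow> NG n (Lam \<alpha>)"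
proof -
  assume "\<alpha> \<in> Mhat_deg (- 2 * n)"
  then obtain a where a: "coherent a" "\<And>k. Sp n (a k)" "\<alpha> = abs_Mhat a"
    using Mhat_deg_cases[of \<alpha> "- 2 * n"] Mloc_deg_iff_Sp by blast
  define P where "P u = mkN (\<lambda>i. if 9 dvd (n - dgi i) then cf u i else 0)" for u :: "'a N"
  have "Lm a (P (Lam \<alpha>))"
    unfolding Lm_def W_def
  proof (intro allI)
    fix k i
    show "3 ^ (k - wti i) dvd cf (Rho (a (73 * k)) - P (Lam \<alpha>)) i"
    proof (cases "9 dvd (n - dgi i)")
      case True
      have "W k (Rho (a (73 * k)) - Lam \<alpha>)" using Lam_Lm[OF a(1)] by (simp only: Lm_def a)
      from W_D[OF this, of i] True show ?thesis by (simp add: P_def cf_simps cf_mkN)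
    next
      case False
      thus ?thesis using cf_Rho_degree[OF a(2) False] by (simp add: P_def cf_simps cf_mkN)
    qed
  qed
  hence "Lam \<alpha> = P (Lam \<alpha>)" using Lam_eqI[OF a(1)] a(3) by metis
  moreover have "NG n (P (Lam \<alpha>))" by (simp add: NG_def P_def cf_mkN)
  ultimately show ?thesis by simp
qed

lemma Lam_inject: "\<alpha> \<in> Mhat_deg (- 2 * n) \<Longrightarrow> \<beta> \<in> Mhat_deg (- 2 * n) \<Longrightarrow> Lam \<alpha> = Lam \<beta> \<Longrightarrow> \<alpha> = \<beta>"
  by (metis hsig_Lam)

lemma Mhat_deg_odd: "\<alpha> \<in> Mhat_deg n \<Longrightarrow> odd n \<Longrightarrow> \<alpha> = 0"
proof -
  assume "\<alpha> \<in> Mhat_deg n" "odd n"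
  then obtain a where a: "coherent a" "\<And>k. a k \<in> Mloc_deg n" "\<alpha> = abs_Mhat a" by (auto simp: Mhat_deg_def)
  hence "a = (\<lambda>_. 0)" using Mloc_deg_odd \<open>odd n\<close> by blast
  thus ?thesis by (simp add: a zero_Mhat_def)
qed

subsection \<open>Vanishing of the cohomology of the induced part\<close>

definition tr3 :: "('a \<Rightarrow> 'a) \<Rightarrow> 'a \<Rightarrow> 'a::ab_group_add" where "tr3 g u = u + g u + g (g u)"

locale order_nine =
  fixes g :: "'a::ab_group_add \<Rightarrow> 'a"
  assumes add: "add_map g" and nine: "g (g (g (g (g (g (g (g (g u)))))))) = u"
begin

lemmas gs = add_map_simps[OF add]

definition c where "c u = g (g (g u))"

lemma tr3_c: "tr3 g (tr3 c u) = tr3 c (tr3 g u)"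
  by (simp add: tr3_def c_def gs algebra_simps)

lemma tr3_diff: "tr3 g (u - v) = tr3 g u - tr3 g v" "tr3 c (u - v) = tr3 c u - tr3 c v" "c (u - v) = c u - c v"
  by (simp_all add: tr3_def c_def gs algebra_simps)

lemma tr3_add: "tr3 g (u + v) = tr3 g u + tr3 g v" "tr3 c (u + v) = tr3 c u + tr3 c v"
  by (simp_all add: tr3_def c_def gs algebra_simps)

lemma tr3_coboundary: "tr3 g (g u - u) = c u - u" "tr3 g (g u) - tr3 g u = c u - u" "tr3 c (c u) = tr3 c u" "tr3 c (g u) = g (tr3 c u)"
  by (simp_all add: tr3_def c_def gs nine algebra_simps)

text \<open>If the subgroup of order three has no Tate cohomology on \<open>P\<close>, neither has
  the group of order nine. This is the spectral sequence argument carried out with explicit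
  cochains.\<close>

lemma trivial_lift:
  assumes P: "\<And>u v. P u \<Longrightarrow> P v \<Longrightarrow> P (u + v)" "\<And>u v. P u \<Longrightarrow> P v \<Longrightarrow> P (u - v)" "\<And>u. P u \<Longrightarrow> P (g u)"
    and even: "\<And>u. P u \<Longrightarrow> c u = u \<Longrightarrow> \<exists>v. P v \<and> u = tr3 c v"
    and odd: "\<And>u. P u \<Longrightarrow> tr3 c u = 0 \<Longrightarrow> \<exists>v. P v \<and> u = c v - v"
  shows "P u \<Longrightarrow> g u = u \<Longrightarrow> \<exists>v. u = tr3 g (tr3 c v)"
    and "P u \<Longrightarrow> tr3 g (tr3 c u) = 0 \<Longrightarrow> \<exists>v. u = g v - v"
proof -
  have Ptr: "P (tr3 g v)" "P (tr3 c v)" if "P v" for v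
    using that P by (auto simp: tr3_def c_def)
  have step: "\<exists>v w. P v \<and> g v = v \<and> u = v + v + v + tr3 g (tr3 c w)" if u: "P u" "g u = u" for u
  proof -
    have "c u = u" by (simp add: c_def u)
    then obtain v where v: "P v" "u = tr3 c v" using even u by blast
    have "tr3 c (g v - v) = 0" using u(2) by (simp add: tr3_diff tr3_coboundary v(2))
    then obtain w where w: "P w" "g v - v = c w - w" using odd[of "g v - v"] P v by blast
    \<comment> \<open>The correction makes \<open>v\<close> invariant: g moves
      \<open>tr3 g w\<close> by exactly \<open>c w - w\<close>.\<close>
    define v' where "v' = v - tr3 g w"
    have gv: "g v' = v'"
      using w(2) tr3_coboundary(2)[of w] by (simp add: v'_def gs tr3_def algebra_simps)
    have "tr3 c v' = v' + v' + v'" by (simp add: tr3_def c_def gv)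
    hence "u = v' + v' + v' + tr3 g (tr3 c w)"
      unfolding v(2) tr3_c by (simp add: v'_def tr3_diff diff_eq_eq)
    thus ?thesis using gv P v w Ptr by (intro exI[of _ v'] exI[of _ w]) (simp add: v'_def)
  qed
  show "\<exists>v. u = tr3 g (tr3 c v)" if u: "P u" "g u = u"
  proof -
    obtain v w where v: "P v" "g v = v" "u = v + v + v + tr3 g (tr3 c w)" using step[OF u] by blast
    \<comment> \<open>A second round writes \<open>u\<close> as 9 v' plus norms, and 9 v' is the
      norm of the invariant v'.\<close>
    obtain v' w' where v': "g v' = v'" "v = v' + v' + v' + tr3 g (tr3 c w')" using step[OF v(1,2)] by blast
    have "tr3 g (tr3 c v') = v' + v' + v' + (v' + v' + v') + (v' + v' + v')"
      by (simp add: tr3_def c_def v'(1) gs)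
    hence "u = tr3 g (tr3 c (v' + w' + w' + w' + w))"
      by (simp add: v(3) tr3_add) (simp add: v'(2) algebra_simps)
    thus ?thesis by blast
  qed
  show "\<exists>v. u = g v - v" if u: "P u" "tr3 g (tr3 c u) = 0"
  proof -
    have "tr3 c (tr3 g u) = 0" using u by (simp add: tr3_c)
    then obtain w where w: "P w" "tr3 g u = c w - w" using odd Ptr u by blast
    \<comment> \<open>Subtracting this coboundary kills \<open>tr3 g u\<close>, because
      \<open>tr3 g (g w - w) = c w - w\<close>.\<close>
    define u' where "u' = u - (g w - w)"
    have u': "P u'" "tr3 g u' = 0" using u w P by (simp_all add: u'_def tr3_diff tr3_coboundary)
    have fix3: "c v = v" if "tr3 g v = 0" for v
    proof -
      have "tr3 g (g v) = g (tr3 g v)" by (simp add: tr3_def gs)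
      thus ?thesis using tr3_coboundary(2)[of v] that by (simp add: gs)
    qed
    obtain v where v: "P v" "u' = tr3 c v" using even[OF u'(1) fix3[OF u'(2)]] by blast
    have "tr3 c (tr3 g v) = 0" using u'(2) by (simp add: v(2) tr3_c)
    then obtain w' where w': "P w'" "tr3 g v = c w' - w'" using odd Ptr v by blast
    define v' where "v' = v - (g w' - w')"
    have v': "tr3 g v' = 0" by (simp add: v'_def tr3_diff w' tr3_coboundary)
    have "c v' = v'" by (rule fix3[OF v'])
    hence "tr3 c v' = v' + v' + v'" by (simp add: tr3_def)
    moreover define t where "t = tr3 c w'"
    moreover have "u' = tr3 c v' + (g (tr3 c w') - tr3 c w')"
      by (simp add: v(2) v'_def tr3_diff tr3_coboundary)
    ultimately have "u' = v' + v' + v' + (g t - t)" by simp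
    \<comment> \<open>From 3 - (1 + g + g^2) = (1 - g)(2 + g) the element 3 v' is a coboundary,
      since v' is killed by 1 + g + g^2.\<close>
    moreover have "g (g v') = - v' - g v'"
      using minus_unique[OF v'[unfolded tr3_def]] by simp
    ultimately have "u' = g (t - v' - v' - g v') - (t - v' - v' - g v')"
      by (simp add: gs)
    hence "u = g (t - v' - v' - g v' + w) - (t - v' - v' - g v' + w)"
      by (simp add: u'_def gs algebra_simps)
    thus ?thesis by blast
  qed
qed

end

lemma \<gamma>N_nine: "\<gamma>N (\<gamma>N (\<gamma>N (\<gamma>N (\<gamma>N (\<gamma>N (\<gamma>N (\<gamma>N (\<gamma>N u)))))))) = u"
  using \<gamma>N_9[of u] by (simp add: eval_nat_numeral)

interpretation nine: order_nine "\<gamma>N :: 'w::comm_ring_1 N \<Rightarrow> 'w N"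
  by unfold_locales (rule add_map_\<gamma>N, rule \<gamma>N_nine)

abbreviation c\<gamma> :: "'w::comm_ring_1 N \<Rightarrow> 'w N" where "c\<gamma> \<equiv> nine.c"

section \<open>Tensors containing a freely permuted basis element\<close>

primrec kind :: "bx \<Rightarrow> bool" where
  "kind E1 = False" | "kind Ex = False" | "kind Ey = False"
| "kind (G0 i) = True" | "kind (G1 i) = True" | "kind (G2 i) = True"
| "kind (H0 i) = True" | "kind (H1 i) = True" | "kind (H2 i) = True"

text \<open>The position in an orbit of \<tau>; 3 marks the elements outside free orbits.\<close>

primrec lab :: "bx \<Rightarrow> nat" where
  "lab E1 = 3" | "lab Ex = 3" | "lab Ey = 3"
| "lab (G0 i) = 0" | "lab (G1 i) = 1" | "lab (G2 i) = 2"
| "lab (H0 i) = 0" | "lab (H1 i) = 1" | "lab (H2 i) = 2"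

definition prev :: "nat \<Rightarrow> nat" where "prev l = (if l = 3 then 3 else if l = 0 then 2 else l - 1)"

definition msk :: "(bx \<Rightarrow> bx \<Rightarrow> bx \<Rightarrow> bool) \<Rightarrow> 'w::comm_ring_1 N \<Rightarrow> 'w N" where
  "msk Q u = (\<lambda>b1 b2 b3. if Q b1 b2 b3 then u b1 b2 b3 else 0)"

definition isF :: "bx \<Rightarrow> bx \<Rightarrow> bx \<Rightarrow> bool" where "isF b1 b2 b3 \<longleftrightarrow> kind b1 \<or> kind b2 \<or> kind b3"

text \<open>The label of the first freely permuted slot. The cube of \<gamma> applies \<tau> to all
  slots at once and so moves this label by one step, which exhibits the masked part as induced from
  the trivial subgroup.\<close>

definition flab :: "bx \<Rightarrow> bx \<Rightarrow> bx \<Rightarrow> nat" where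
  "flab b1 b2 b3 = (if lab b1 \<noteq> 3 then lab b1 else if lab b2 \<noteq> 3 then lab b2 else lab b3)"

lemma msk_simps: "msk Q (u + v) = msk Q u + msk Q v" "msk Q (u - v) = msk Q u - msk Q v" "msk Q 0 = 0"
  by (simp_all add: msk_def fun_eq_iff)

lemma \<tau>op_mask_kind: "\<tau>op (\<lambda>b. if Q (kind b) then w b else 0) b1 = (if Q (kind b1) then \<tau>op w b1 else 0)"
  by (cases b1) simp_all

lemma \<tau>op_mask_lab: "\<tau>op (\<lambda>b. if Q (lab b) then w b else 0) b1 = (if Q (prev (lab b1)) then \<tau>op w b1 else 0)"
  by (cases b1) (simp_all add: prev_def)

lemma \<gamma>N_isF: "\<gamma>N (msk isF u) = msk isF (\<gamma>N u)"
proof (intro ext)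
  fix b1 b2 b3 j
  have "(\<lambda>b. gD (msk isF u b2 b3 b)) = (\<lambda>b. if kind b2 \<or> kind b3 \<or> kind b then gD (u b2 b3 b) else 0)"
    by (simp add: msk_def isF_def fun_eq_iff add_map_0[OF add_map_D(2)])
  thus "\<gamma>N (msk isF u) b1 b2 b3 j = msk isF (\<gamma>N u) b1 b2 b3 j"
    using \<tau>op_mask_kind[of "\<lambda>k. kind b2 \<or> kind b3 \<or> k" "\<lambda>b. gD (u b2 b3 b)" b1]
    by (auto simp: \<gamma>N_def msk_def isF_def)
qed

lemma c\<gamma>_flab: "c\<gamma> (msk (\<lambda>b1 b2 b3. flab b1 b2 b3 = l) u) = msk (\<lambda>b1 b2 b3. prev (flab b1 b2 b3) = l) (c\<gamma> u)"
proof (intro ext)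
  fix b1 b2 b3 j
  define Q where "Q l1 l2 l3 \<longleftrightarrow> (if l1 \<noteq> 3 then l1 else if l2 \<noteq> 3 then l2 else l3) = l" for l1 l2 l3 :: nat
  have "msk (\<lambda>b1 b2 b3. flab b1 b2 b3 = l) u = (\<lambda>b1 b2 b3. if Q (lab b1) (lab b2) (lab b3) then u b1 b2 b3 else 0)"
    by (simp add: msk_def flab_def Q_def)
  hence "c\<gamma> (msk (\<lambda>b1 b2 b3. flab b1 b2 b3 = l) u) b1 b2 b3 =
      (if Q (prev (lab b1)) (prev (lab b2)) (prev (lab b3)) then c\<gamma> u b1 b2 b3 else 0)"
    by (simp only: nine.c_def \<gamma>N_cube \<tau>op_mask_lab[where Q = "Q _ _"] \<tau>op_mask_lab[where Q = "\<lambda>l. Q _ l _"] \<tau>op_mask_lab[where Q = "\<lambda>l. Q l _ _"])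
  moreover have "Q (prev (lab b1)) (prev (lab b2)) (prev (lab b3)) \<longleftrightarrow> prev (flab b1 b2 b3) = l"
    unfolding Q_def flab_def by (cases b1; simp add: prev_def; cases b2; simp add: prev_def; cases b3; simp add: prev_def)
  ultimately show "c\<gamma> (msk (\<lambda>b1 b2 b3. flab b1 b2 b3 = l) u) b1 b2 b3 j = msk (\<lambda>b1 b2 b3. prev (flab b1 b2 b3) = l) (c\<gamma> u) b1 b2 b3 j"
    by (simp add: msk_def)
qed

lemma rearrange: "u = (- x - y) + p + q \<Longrightarrow> u = (p + z + q) - (y + x + z)" for u :: "'a::ab_group_add"
  by simp

text \<open>\<open>R 0\<close> projects onto a summand whose three translates under
  \<open>c\<gamma>\<close> make up the masked part. An invariant element is thus the norm of its
  component of label 0; elements of norm zero are treated below, and \<open>trivial_lift\<close>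
  passes to C9.\<close>

lemma F_trivial:
  assumes "msk isF u = (u :: 'w::comm_ring_1 N)"
  shows "\<gamma>N u = u \<Longrightarrow> \<exists>v. u = tr3 \<gamma>N (tr3 c\<gamma> v)" "tr3 \<gamma>N (tr3 c\<gamma> u) = 0 \<Longrightarrow> \<exists>v. u = \<gamma>N v - v"
proof -
  define R where "R l u = msk (\<lambda>b1 b2 b3. flab b1 b2 b3 = l) (u :: 'w N)" for l u
  have lab3: "lab b = 3 \<longleftrightarrow> \<not> kind b" and lab4: "lab b = 0 \<or> lab b = 1 \<or> lab b = 2 \<or> lab b = 3" for b
    by (cases b; simp)+
  have PR: "msk isF (R l u) = R l u" if "msk isF u = u" for l u
    using that by (simp add: R_def msk_def fun_eq_iff)
  have prev: "prev m = 0 \<longleftrightarrow> m = 1" "prev m = 1 \<longleftrightarrow> m = 2" if "m = 0 \<or> m = 1 \<or> m = 2 \<or> m = 3" for m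
    using that by (auto simp: prev_def)
  have fl: "flab b1 b2 b3 = 0 \<or> flab b1 b2 b3 = 1 \<or> flab b1 b2 b3 = 2 \<or> flab b1 b2 b3 = 3" for b1 b2 b3
  proof -
    have "flab b1 b2 b3 = lab b1 \<or> flab b1 b2 b3 = lab b2 \<or> flab b1 b2 b3 = lab b3"
      unfolding flab_def by argo
    thus ?thesis using lab4[of b1] lab4[of b2] lab4[of b3] by metis
  qed
  have c: "c\<gamma> (R 0 u) = R 1 (c\<gamma> u)" "c\<gamma> (R 1 u) = R 2 (c\<gamma> u)" for u
    unfolding R_def c\<gamma>_flab using prev[OF fl] by simp_all
  have sum: "u = R 0 u + R 1 u + R 2 u" if "msk isF u = u" for u
  proof (intro ext)
    fix b1 b2 b3 j
    have F: "flab b1 b2 b3 = 3 \<longleftrightarrow> \<not> isF b1 b2 b3"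
      using lab3[of b1] lab3[of b2] lab3[of b3] by (simp add: flab_def isF_def)
    have "u b1 b2 b3 = msk isF u b1 b2 b3" by (simp only: that)
    hence "\<not> isF b1 b2 b3 \<Longrightarrow> u b1 b2 b3 = 0" by (simp add: msk_def)
    thus "u b1 b2 b3 j = (R 0 u + R 1 u + R 2 u) b1 b2 b3 j"
      using fl[of b1 b2 b3] F by (elim disjE) (simp_all add: R_def msk_def)
  qed
  have cc: "c\<gamma> (c\<gamma> (c\<gamma> u)) = u" for u :: "'w N" by (simp add: nine.c_def \<gamma>N_nine)
  have even: "\<exists>v. msk isF v = v \<and> u = tr3 c\<gamma> v" if "msk isF u = u" "c\<gamma> u = u" for u :: "'w N"
  proof (intro exI[of _ "R 0 u"] conjI PR that)
    show "u = tr3 c\<gamma> (R 0 u)" unfolding tr3_def c that(2) by (rule sum[OF that(1)])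
  qed
  have cadd: "add_map (c\<gamma> :: 'w N \<Rightarrow> 'w N)" by (rule add_mapI) (simp only: nine.c_def add_map_add[OF add_map_\<gamma>N])
  have odd: "\<exists>v. msk isF v = v \<and> u = c\<gamma> v - v" if u: "msk isF u = u" "tr3 c\<gamma> u = 0" for u :: "'w N"
  proof -
    \<comment> \<open>The solution of \<open>c\<gamma> v - v = u\<close> without a component of
      label 2: labels 2 and 1 of the equation determine the components of labels 1 and 0, and label
      0 of the equation is then the norm condition.\<close>
    define v where "v = R 0 (c\<gamma> (c\<gamma> u)) + R 0 (c\<gamma> u) + c\<gamma> (R 0 (c\<gamma> u))"
    have cP: "msk isF (c\<gamma> w) = c\<gamma> w" if "msk isF w = w" for w :: "'w N"
      using that by (simp only: nine.c_def \<gamma>N_isF[symmetric])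
    have "msk isF v = v" unfolding v_def msk_simps by (simp only: PR cP u(1))
    moreover have "R 0 (u + c\<gamma> u + c\<gamma> (c\<gamma> u)) = 0" using u(2) by (simp only: tr3_def) (simp add: R_def msk_simps)
    hence "R 0 u + R 0 (c\<gamma> u) + R 0 (c\<gamma> (c\<gamma> u)) = 0" by (simp only: R_def msk_simps)
    hence "(R 0 (c\<gamma> u) + R 0 (c\<gamma> (c\<gamma> u))) + R 0 u = 0" by (simp only: add.commute add.left_commute)
    from minus_unique[OF this] have "R 0 u = - R 0 (c\<gamma> u) - R 0 (c\<gamma> (c\<gamma> u))"
      by (simp only: minus_add_distrib diff_conv_add_uminus)
    hence "u = (- R 0 (c\<gamma> u) - R 0 (c\<gamma> (c\<gamma> u))) + R 1 u + R 2 u" using sum[OF u(1)] by (simp only:)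
    hence "u = (R 1 u + R 1 (c\<gamma> (c\<gamma> u)) + R 2 u) - (R 0 (c\<gamma> (c\<gamma> u)) + R 0 (c\<gamma> u) + R 1 (c\<gamma> (c\<gamma> u)))"
      by (rule rearrange)
    hence "u = c\<gamma> v - v" unfolding v_def by (simp only: add_map_add[OF cadd] c cc)
    ultimately show ?thesis by blast
  qed
  note lift = nine.trivial_lift[of "\<lambda>u. msk isF u = u", OF _ _ _ even odd]
  show "\<gamma>N u = u \<Longrightarrow> \<exists>v. u = tr3 \<gamma>N (tr3 c\<gamma> v)"
    by (rule lift(1)) (simp_all only: msk_simps \<gamma>N_isF[symmetric] assms)
  show "tr3 \<gamma>N (tr3 c\<gamma> u) = 0 \<Longrightarrow> \<exists>v. u = \<gamma>N v - v"
    by (rule lift(2)) (simp_all only: msk_simps \<gamma>N_isF[symmetric] assms)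
qed

subsection \<open>The symmetric part\<close>

lemma nth_t2: "fps_nth (fps_nth (t2 * f) a) (Suc b) = fps_nth (fps_nth f a) b" "fps_nth (fps_nth (t2 * f) a) 0 = 0"
    "fps_nth (fps_nth (t1 * f) (Suc a)) b = fps_nth (fps_nth f a) b" "fps_nth (t1 * f) 0 = 0"
  by simp_all

lemma fps_nth_3: "fps_nth (3 * f) n = 3 * fps_nth f n" for f :: "'a::comm_ring_1 fps"
  by (simp only: numeral_fps_const fps_mult_left_const_nth)

lemma nth_3: "fps_nth (fps_nth (3 * f) a) b = 3 * fps_nth (fps_nth f a) b" for f :: "'w::comm_ring_1 U"
  by (simp only: fps_nth_3)

lemma three_U: "3 * f = 0 \<Longrightarrow> f = (0 :: 'w::strict_3_ring U)"
proof (intro fps_ext)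
  fix a b assume 0: "3 * f = 0"
  have "3 * fps_nth (fps_nth f a) b = 0" unfolding nth_3[symmetric] 0 by simp
  thus "fps_nth (fps_nth f a) b = fps_nth (fps_nth 0 a) b" by (simp add: three_torsion_free)
qed

lemma three_U_cancel: "3 * f = 3 * g \<Longrightarrow> f = (g :: 'w::strict_3_ring U)"
proof -
  assume "3 * f = 3 * g"
  hence "3 * (f - g) = 0" by (simp only: right_diff_distrib diff_self)
  from three_U[OF this] show ?thesis by simp
qed

lemma t1_cancel: "t1 * f = t1 * g \<Longrightarrow> f = (g :: 'w::strict_3_ring U)"
proof (rule fps_ext)
  fix n assume "t1 * f = t1 * g"
  hence "fps_nth (t1 * f) (Suc n) = fps_nth (t1 * g) (Suc n)" by (simp only:)
  thus "fps_nth f n = fps_nth g n" by simp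
qed

lemma three_dvd_U: "(\<And>a b. 3 dvd fps_nth (fps_nth f a) b) \<Longrightarrow> \<exists>g :: 'w::strict_3_ring U. f = 3 * g"
proof -
  assume "\<And>a b. 3 dvd fps_nth (fps_nth f a) b"
  then obtain h where h: "\<And>a b. fps_nth (fps_nth f a) b = 3 * h a b" unfolding dvd_def by metis
  have "f = 3 * Abs_fps (\<lambda>a. Abs_fps (h a))" by (intro fps_ext) (simp add: h fps_nth_3)
  thus ?thesis by blast
qed

lemma t2_three: "t2 * f = 3 * g \<Longrightarrow> \<exists>h :: 'w::strict_3_ring U. f = 3 * h"
proof (rule three_dvd_U)
  fix a b assume "t2 * f = 3 * g"
  hence "fps_nth (fps_nth (t2 * f) a) (Suc b) = fps_nth (fps_nth (3 * g) a) (Suc b)" by simp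
  thus "3 dvd fps_nth (fps_nth f a) b" unfolding nth_t2 nth_3 by simp
qed

text \<open>The sequence \<open>3, t1, t2\<close> is regular; this is exactness of its Koszul complex in the middle.\<close>

lemma koszul:
  fixes \<alpha> \<beta> \<epsilon> :: "'w::strict_3_ring U"
  assumes "3 * \<alpha> + \<beta> * t1 + \<epsilon> * t2 = 0"
  obtains k a e where "\<alpha> = k * t2 + a * t1" "\<beta> = - 3 * a - e * t2" "\<epsilon> = - 3 * k + e * t1"
proof -
  \<comment> \<open>Modulo t1 the hypothesis reads 3 \<alpha> + t2 \<epsilon> = 0, which gives
    \<alpha> = t2 k0 and \<epsilon> = -3 k0 there. What remains of \<alpha> and \<epsilon> is
    divisible by t1, and \<beta> follows by cancelling t1.\<close>
  define k0 where "k0 = Abs_fps (\<lambda>b. fps_nth (fps_nth \<alpha> 0) (Suc b))"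
  define k where "k = fps_const k0"
  define a where "a = Abs_fps (\<lambda>i. fps_nth \<alpha> (Suc i) )"
  have eq: "fps_nth (fps_nth (3 * \<alpha> + t1 * \<beta> + t2 * \<epsilon>) i) j = 0" for i j
    using assms by (simp add: mult.commute)
  have e0: "3 * fps_nth (fps_nth \<alpha> 0) j + fps_nth (fps_nth (t2 * \<epsilon>) 0) j = 0" for j
    using eq[of 0 j] by (simp only: fps_add_nth nth_3 nth_t2 fps_zero_nth add_0_right)
  have "fps_nth (fps_nth \<alpha> 0) 0 = 0" using e0[of 0] by (simp only: nth_t2) (simp add: three_torsion_free)
  hence \<alpha>0: "fps_nth \<alpha> 0 = fps_X * k0" unfolding k0_def by (intro fps_ext) simp
  have \<alpha>: "\<alpha> = k * t2 + a * t1"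
  proof (rule fps_ext)
    fix i show "fps_nth \<alpha> i = fps_nth (k * t2 + a * t1) i"
      by (cases i) (simp_all add: k_def a_def \<alpha>0 mult.commute)
  qed
  have "fps_nth \<epsilon> 0 = - 3 * k0"
  proof (rule fps_ext)
    fix j
    have "3 * fps_nth (fps_nth \<alpha> 0) (Suc j) + fps_nth (fps_nth \<epsilon> 0) j = 0" using e0[of "Suc j"] by (simp only: nth_t2)
    moreover have "fps_nth (3 * k0) j = 3 * fps_nth k0 j" by (rule fps_nth_3)
    ultimately show "fps_nth (fps_nth \<epsilon> 0) j = fps_nth (- 3 * k0) j"
      by (simp add: k0_def eq_neg_iff_add_eq_0 add.commute)
  qed
  hence \<epsilon>0: "fps_nth (\<epsilon> + 3 * k) 0 = 0"
  proof -
    have "fps_nth (3 * k) 0 = 3 * k0" by (simp add: k_def fps_nth_3)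
    thus ?thesis using \<open>fps_nth \<epsilon> 0 = - 3 * k0\<close> by simp
  qed
  define e where "e = Abs_fps (\<lambda>i. fps_nth (\<epsilon> + 3 * k) (Suc i))"
  have "\<epsilon> + 3 * k = e * t1"
  proof (rule fps_ext)
    fix i show "fps_nth (\<epsilon> + 3 * k) i = fps_nth (e * t1) i"
      using \<epsilon>0 by (cases i) (simp_all add: e_def mult.commute[of _ t1])
  qed
  hence \<epsilon>: "\<epsilon> = - 3 * k + e * t1" by (simp add: algebra_simps eq_diff_eq)
  have "t1 * (\<beta> - (- 3 * a - e * t2)) = 3 * \<alpha> + \<beta> * t1 + \<epsilon> * t2"
    unfolding \<alpha> \<epsilon> by (simp add: algebra_simps)
  hence "t1 * (\<beta> - (- 3 * a - e * t2)) = t1 * 0" unfolding assms by simp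
  from t1_cancel[OF this] have "\<beta> = - 3 * a - e * t2" by (simp only: right_minus_eq)
  from that[OF \<alpha> this \<epsilon>] show ?thesis .
qed

abbreviation one\<^sub>D :: "'w::comm_ring_1 D" where "one\<^sub>D \<equiv> es S0 1"

definition mkD :: "'w::comm_ring_1 U \<Rightarrow> 'w U \<Rightarrow> 'w U \<Rightarrow> 'w U \<Rightarrow> 'w U \<Rightarrow> 'w U \<Rightarrow> 'w D" where
  "mkD a b c d e f = (\<lambda>j. case j of S0 \<Rightarrow> a | S1 \<Rightarrow> b | S2 \<Rightarrow> c | S3 \<Rightarrow> d | S4 \<Rightarrow> e | S5 \<Rightarrow> f)"

lemma mkD_simps: "mkD a b c d e f S0 = a" "mkD a b c d e f S1 = b" "mkD a b c d e f S2 = c"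
   "mkD a b c d e f S3 = d" "mkD a b c d e f S4 = e" "mkD a b c d e f S5 = f"
  by (simp_all add: mkD_def)

lemma D_eqI: "u S0 = v S0 \<Longrightarrow> u S1 = v S1 \<Longrightarrow> u S2 = v S2 \<Longrightarrow> u S3 = v S3 \<Longrightarrow> u S4 = v S4 \<Longrightarrow> u S5 = v S5 \<Longrightarrow> u = v"
  by (rule ext, rename_tac j, case_tac j; simp)

text \<open>The coordinates of \<open>\<delta>\<close>.\<close>

definition dlt :: "'w::comm_ring_1 D" where
  "dlt = mkD (- (t1 * t2 + 3)) (2 * t2) (- 2 * t2) (4 * t1) (2 * t1) (- 6)"

text \<open>The norm of C9 on D: the subgroup C3 acts trivially on D, so the nine terms are three
  times the trace of \<gamma>.\<close>

definition trD :: "'w::comm_ring_1 D \<Rightarrow> 'w D" where "trD d = usc 3 (tr3 gD d)"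

lemma tr3_gD:
  "tr3 gD d S0 = 3 * d S0 + (d S1 + d S2) * t1 + (d S3 + d S4) * t2 + d S5 * (t1 * t2)"
  "tr3 gD d S1 = - d S5 * t2" "tr3 gD d S2 = d S5 * t2" "tr3 gD d S3 = - 2 * d S5 * t1" "tr3 gD d S4 = - d S5 * t1"
  "tr3 gD d S5 = 3 * d S5"
  by (simp_all add: tr3_def algebra_simps)

text \<open>Invariance gives t2 times the coordinate at \<open>S5\<close> as 3 times the one at
  \<open>S2\<close>. As 3, t2 is a regular sequence, the former is 3 \<nu>, and \<nu> determines all
  coordinates except the one at \<open>S0\<close>.\<close>

lemma gD_invariant:
  fixes d :: "'w::strict_3_ring D"
  assumes "gD d = d"
  shows "\<exists>\<alpha> \<beta> y. d = usc \<alpha> one\<^sub>D + usc \<beta> dlt + trD y"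
proof -
  have e: "gD d j = d j" for j using assms by simp
  have 1: "d S1 = - d S2" "d S3 = 2 * d S4" using e[of S1] e[of S4] by (simp_all add: algebra_simps)
  have "t1 * d S5 + 3 * d S4 = 0" using e[of S3] 1 by (simp add: algebra_simps)
  from minus_unique[OF this] e[of S2] 1 have 2: "t2 * d S5 = 3 * d S2" "3 * d S4 = - t1 * d S5"
    by (simp_all add: algebra_simps)
  obtain \<nu> where \<nu>: "d S5 = 3 * \<nu>" using t2_three[OF 2(1)] by blast
  have 3: "d S2 = t2 * \<nu>" by (rule three_U_cancel) (use 2 in \<open>simp add: \<nu> algebra_simps\<close>)
  have 4: "d S4 = - t1 * \<nu>" by (rule three_U_cancel) (use 2 in \<open>simp add: \<nu> algebra_simps\<close>)
  \<comment> \<open>At \<open>S5\<close> the value 3 \<nu> arises as -6 \<nu> from \<delta> and 9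
    \<nu> from the norm.\<close>
  have "d = usc (d S0 + \<nu> * (t1 * t2 + 3)) one\<^sub>D + usc \<nu> dlt + trD (mkD 0 (- \<nu> * t2) 0 0 0 \<nu>)"
    by (rule D_eqI; simp add: usc_def es_def trD_def tr3_gD mkD_simps dlt_def 1 3 4 \<nu> algebra_simps)
  thus ?thesis by blast
qed

text \<open>The trace at \<open>S5\<close> is 3 times that coordinate, which therefore vanishes. The
  trace at \<open>S0\<close> is then a linear relation between 3, t1 and t2, and exactness of the
  Koszul complex supplies the coordinates of a primitive.\<close>

lemma gD_trace_zero:
  fixes d :: "'w::strict_3_ring D"
  assumes "tr3 gD d = 0"
  shows "\<exists>y. d = gD y - y"
proof -
  have e: "tr3 gD d j = 0" for j using assms by simp
  have 5: "d S5 = 0" using three_U[of "d S5"] e[of S5] by (simp add: tr3_gD)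
  have "3 * d S0 + (d S1 + d S2) * t1 + (d S3 + d S4) * t2 = 0" using e[of S0] by (simp add: tr3_gD 5)
  then obtain k a m where k: "d S0 = k * t2 + a * t1" "d S1 + d S2 = - 3 * a - m * t2" "d S3 + d S4 = - 3 * k + m * t1"
    by (rule koszul)
  have 2: "d S2 = - 3 * a - m * t2 - d S1" "d S4 = - 3 * k + m * t1 - d S3" using k by (simp_all add: algebra_simps eq_diff_eq)
  have "d = gD (mkD 0 (- d S1 - a) a (m * t1 - d S3 - k) k (- m)) - mkD 0 (- d S1 - a) a (m * t1 - d S3 - k) k (- m)"
    by (rule D_eqI; simp add: mkD_simps k(1) 2 5 algebra_simps)
  thus ?thesis by blast
qed

text \<open>Coordinate \<open>S5\<close> reads -6 \<beta> = 9 y5, which makes \<beta> divisible by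
  3; substituted into coordinate \<open>S0\<close> this puts \<alpha> into 3 (3, t1, t2). These are
  the relations on 1 and \<delta>, and \<open>trD_rels\<close> is the converse.\<close>

lemma trD_detect:
  fixes \<alpha> \<beta> :: "'w::strict_3_ring U"
  assumes "usc \<alpha> one\<^sub>D + usc \<beta> dlt = trD y"
  shows "\<exists>a b c h. \<alpha> = 3 * (3 * a + t1 * b + t2 * c) \<and> \<beta> = 3 * h"
proof -
  have e: "(usc \<alpha> one\<^sub>D + usc \<beta> dlt) j = trD y j" for j using assms by simp
  have 5: "- 6 * \<beta> = 9 * y S5" using e[of S5] by (simp add: usc_def es_def trD_def tr3_gD dlt_def mkD_simps algebra_simps)
  have "\<beta> = 3 * (\<beta> + y S5)"
  proof (rule three_U_cancel)
    have "3 * (3 * (\<beta> + y S5)) = 9 * \<beta> + 9 * y S5" by (simp add: algebra_simps)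
    also have "\<dots> = 3 * \<beta>" unfolding 5[symmetric] by (simp add: algebra_simps)
    finally show "3 * \<beta> = 3 * (3 * (\<beta> + y S5))" ..
  qed
  moreover have 0: "\<alpha> - \<beta> * (t1 * t2 + 3) = 3 * (3 * y S0 + (y S1 + y S2) * t1 + (y S3 + y S4) * t2 + y S5 * (t1 * t2))"
    using e[of S0] by (simp add: usc_def es_def trD_def tr3_gD dlt_def mkD_simps algebra_simps)
  ultimately have "\<alpha> = 3 * (3 * (y S0 + (\<beta> + y S5)) + t1 * (y S1 + y S2 + (\<beta> + y S5) * t2 + y S5 * t2) + t2 * (y S3 + y S4))"
  proof -
    have "\<alpha> = \<beta> * (t1 * t2 + 3) + 3 * (3 * y S0 + (y S1 + y S2) * t1 + (y S3 + y S4) * t2 + y S5 * (t1 * t2))"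
      using 0 by (simp add: algebra_simps)
    also have "\<beta> * (t1 * t2 + 3) = 3 * (\<beta> + y S5) * (t1 * t2 + 3)"
      by (rule arg_cong[where f = "\<lambda>z. z * (t1 * t2 + 3)"]) (rule \<open>\<beta> = 3 * (\<beta> + y S5)\<close>)
    finally show ?thesis by (simp add: algebra_simps)
  qed
  with \<open>\<beta> = 3 * (\<beta> + y S5)\<close> show ?thesis by blast
qed

lemma trD_rels:
  "usc (3 * (3 * a + t1 * b + t2 * c)) one\<^sub>D = trD (mkD a b 0 c 0 0)"
  "usc (3 * h) dlt = trD (usc h (mkD (- 1) t2 0 0 0 (- 2)))"
  by (rule D_eqI; simp add: usc_def es_def trD_def tr3_gD mkD_simps dlt_def algebra_simps)+

lemma trD_tr: "trD d = tr3 gD d + tr3 gD d + tr3 gD d"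
  by (simp add: trD_def usc_def fun_eq_iff algebra_simps)

lemma D_three: "(v :: 'w::strict_3_ring D) + v + v = 0 \<Longrightarrow> v = 0"
proof (rule ext)
  fix j assume "v + v + v = 0"
  hence "(v + v + v) j = 0" by simp
  hence "3 * v j = 0" by (simp add: algebra_simps)
  thus "v j = 0 j" by (simp add: three_U)
qed

subsection \<open>The cohomology of the remaining part\<close>

abbreviation N9 :: "'w::comm_ring_1 N \<Rightarrow> 'w N" where "N9 u \<equiv> tr3 \<gamma>N (tr3 c\<gamma> u)"

lemma add_cancel_rules:
  "- (- A - B) - A = B" "A' + B + C + D + d' + (- D - a') = (A' - a') + B + C + d'" "D + a' + (- D - a') = 0" "A = B + (A - B)"
  for A B :: "'a::ab_group_add"
  by (simp_all add: algebra_simps)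

lemma add_solve_middle: "p + q - q - q + s = 0 \<Longrightarrow> q = p + s" for p :: "'a::ab_group_add"
proof -
  assume "p + q - q - q + s = 0"
  moreover have "p + q - q - q + s = p + s - q" by (simp add: algebra_simps)
  ultimately have "p + s - q = 0" by (simp only:)
  thus ?thesis by simp
qed

lemma add_solve:
  fixes k :: "'a::ab_group_add"
  shows "P = - Q \<Longrightarrow> Q = P - Q \<Longrightarrow> Q + Q + (Q :: 'a) = 0" "k = - (A + Y) \<Longrightarrow> Y = - k - A" "k = - B \<Longrightarrow> C - B = C + k"
    "- k - a2 = - (- k - a2) - (- a2 - a1) + a1 - (- a1 - k) \<Longrightarrow> (k + a1 + a2) + (k + a1 + a2) + (k + a1 + a2) = 0"
    "k + a1 + a2 = 0 \<Longrightarrow> - k - a2 = a1"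
proof -
  assume 1: "P = - Q" and 2: "Q = P - Q"
  have "Q + Q + Q = Q + Q + (- Q - Q)" using 2 unfolding 1 by (simp only:)
  thus "Q + Q + Q = 0" by simp
next
  assume "k = - (A + Y)" thus "Y = - k - A" by simp
next
  assume "k = - B" thus "C - B = C + k" by simp
next
  assume 1: "- k - a2 = - (- k - a2) - (- a2 - a1) + a1 - (- a1 - k)"
  have "(k + a1 + a2) + (k + a1 + a2) + (k + a1 + a2) = (- (- k - a2) - (- a2 - a1) + a1 - (- a1 - k)) - (- k - a2)"
    by (simp add: algebra_simps)
  thus "(k + a1 + a2) + (k + a1 + a2) + (k + a1 + a2) = 0" unfolding 1[symmetric] by simp
next
  assume 1: "k + a1 + a2 = 0"
  have "- k - a2 = a1 - (k + a1 + a2)" by (simp add: algebra_simps)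
  thus "- k - a2 = a1" unfolding 1 by simp
qed

lemmas gDs = add_map_simps[OF add_map_D(2)]
lemmas \<gamma>Ns = add_map_simps[OF add_map_\<gamma>N]

lemma sgl_simps: "sgl a b c (u + v) = sgl a b c u + sgl a b c v" "sgl a b c (u - v) = sgl a b c u - sgl a b c v"
   "sgl a b c (- u) = - sgl a b c u" "sgl a b c 0 = 0"
  by (simp_all add: sgl_def fun_eq_iff)

lemma sgl_at: "sgl a b c v a' b' c' = (if a' = a \<and> b' = b \<and> c' = c then v else 0)"
  by (simp add: sgl_def)

lemma \<gamma>N_at:
  "\<gamma>N u E1 b c = gD (u b c E1)" "\<gamma>N u Ex b c = - gD (u b c Ey)" "\<gamma>N u Ey b c = gD (u b c Ex) - gD (u b c Ey)"
  by (simp_all add: \<gamma>N_def)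

lemma \<gamma>N_sglx: "\<gamma>N (sgl a b Ex v) = sgl Ey a b (gD v)" "\<gamma>N (sgl a b Ey v) = - sgl Ex a b (gD v) - sgl Ey a b (gD v)"
  by (intro ext, rename_tac b1 b2 b3 j, case_tac b1; simp add: \<gamma>N_def sgl_def gDs)+

lemma msk_uminus: "msk Q (- u) = - msk Q u"
  by (simp add: msk_def fun_eq_iff)

lemmas \<gamma>N_sgls = \<gamma>N_sgl \<gamma>N_sglx

section \<open>Tensors in 1, x, y and equality modulo coboundaries\<close>

definition noF :: "'w::comm_ring_1 N \<Rightarrow> bool" where "noF u \<longleftrightarrow> msk isF u = 0"

lemma noF_eqI:
  assumes "noF u" "noF v" "\<forall>a\<in>{E1, Ex, Ey}. \<forall>b\<in>{E1, Ex, Ey}. \<forall>c\<in>{E1, Ex, Ey}. u a b c = v a b c"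
  shows "u = v"
proof (intro ext)
  fix a b c j
  have k: "\<not> kind a \<longleftrightarrow> a \<in> {E1, Ex, Ey}" for a by (cases a) simp_all
  have "msk isF u a b c = 0" "msk isF v a b c = 0" using assms(1,2) by (simp_all add: noF_def)
  hence "isF a b c \<Longrightarrow> u a b c = v a b c" by (simp add: msk_def)
  moreover have "\<not> isF a b c \<Longrightarrow> u a b c = v a b c" using assms(3)[rule_format, of a b c] k[of a] k[of b] k[of c] by (simp only: isF_def) blast
  ultimately show "u a b c j = v a b c j" by metis
qed

lemma noF_simps: "noF u \<Longrightarrow> noF v \<Longrightarrow> noF (u + v)" "noF u \<Longrightarrow> noF v \<Longrightarrow> noF (u - v)" "noF u \<Longrightarrow> noF (\<gamma>N u)"
    "noF u \<Longrightarrow> noF (- u)"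
  by (simp_all only: noF_def msk_simps msk_uminus \<gamma>N_isF[symmetric] \<gamma>Ns add_0_left diff_zero minus_zero)

lemma noF_tr3: "noF u \<Longrightarrow> noF (tr3 \<gamma>N u)" "noF u \<Longrightarrow> noF (tr3 c\<gamma> u)"
  by (simp_all add: tr3_def nine.c_def noF_simps)

lemma noF_sgl: "\<not> isF a b c \<Longrightarrow> noF (sgl a b c v)"
  by (auto simp: noF_def msk_def sgl_def fun_eq_iff)

lemma isF_E: "\<not> isF a b c \<longleftrightarrow> \<not> kind a \<and> \<not> kind b \<and> \<not> kind c" by (simp add: isF_def)

text \<open>The normal form for tensors with two factors from {x, y}: the factor 1 is rotated to the
  last slot by \<gamma>.\<close>

definition i12 :: "'w::comm_ring_1 D \<Rightarrow> 'w D \<Rightarrow> 'w D \<Rightarrow> 'w D \<Rightarrow> 'w N" where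
  "i12 p q r s = sgl Ex Ex E1 p + sgl Ex Ey E1 q + sgl Ey Ex E1 r + sgl Ey Ey E1 s"

lemma noF_i12: "noF (i12 p q r s)"
  unfolding i12_def by (intro noF_simps noF_sgl) (simp_all add: isF_E)

definition eqO :: "'w::comm_ring_1 N \<Rightarrow> 'w N \<Rightarrow> bool" where "eqO u v \<longleftrightarrow> (\<exists>y. u = v + (\<gamma>N y - y))"

lemma eqO_refl: "eqO u u"
  unfolding eqO_def by (rule exI[of _ 0]) (simp only: \<gamma>Ns diff_self add_0_right)

lemma eqO_trans: "eqO u v \<Longrightarrow> eqO v w \<Longrightarrow> eqO u w"
  unfolding eqO_def
proof (elim exE)
  fix y z assume 1: "u = v + (\<gamma>N y - y)" and 2: "v = w + (\<gamma>N z - z)"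
  show "\<exists>y. u = w + (\<gamma>N y - y)"
    unfolding 1 2 by (rule exI[of _ "y + z"]) (simp only: \<gamma>Ns, simp only: algebra_simps)
qed

lemma eqO_sym: "eqO u v \<Longrightarrow> eqO v u"
  unfolding eqO_def
proof (elim exE)
  fix y assume 1: "u = v + (\<gamma>N y - y)"
  show "\<exists>y. v = u + (\<gamma>N y - y)"
    unfolding 1 by (rule exI[of _ "- y"]) (simp only: \<gamma>Ns, simp)
qed

lemma eqO_add: "eqO u v \<Longrightarrow> eqO u' v' \<Longrightarrow> eqO (u + u') (v + v')"
  unfolding eqO_def
proof (elim exE)
  fix y z assume 1: "u = v + (\<gamma>N y - y)" and 2: "u' = v' + (\<gamma>N z - z)"
  show "\<exists>y. u + u' = v + v' + (\<gamma>N y - y)"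
    unfolding 1 2 by (rule exI[of _ "y + z"]) (simp only: \<gamma>Ns, simp only: algebra_simps)
qed

lemma eqO_uminus: "eqO u v \<Longrightarrow> eqO (- u) (- v)"
  unfolding eqO_def
proof (elim exE)
  fix y assume 1: "u = v + (\<gamma>N y - y)"
  show "\<exists>y. - u = - v + (\<gamma>N y - y)"
    unfolding 1 by (rule exI[of _ "- y"]) (simp only: \<gamma>Ns, simp)
qed

lemma eqO_\<gamma>: "eqO (\<gamma>N u) u"
  unfolding eqO_def by (rule exI[of _ u]) simp

lemma eqO_N9: "eqO u v \<Longrightarrow> N9 u = N9 v"
proof -
  assume "eqO u v"
  then obtain y where y: "u = v + (\<gamma>N y - y)" by (auto simp: eqO_def)
  have "N9 (\<gamma>N y - y) = 0"
    unfolding tr3_def nine.c_def by (simp only: \<gamma>Ns \<gamma>N_nine) simp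
  thus ?thesis unfolding y nine.tr3_add by simp
qed

lemma noF_expand: "noF u \<Longrightarrow> u =
    sgl E1 E1 E1 (u E1 E1 E1) +
    (sgl Ex E1 E1 (u Ex E1 E1) + sgl Ey E1 E1 (u Ey E1 E1) + sgl E1 Ex E1 (u E1 Ex E1) + sgl E1 Ey E1 (u E1 Ey E1)
      + sgl E1 E1 Ex (u E1 E1 Ex) + sgl E1 E1 Ey (u E1 E1 Ey)) +
    (sgl Ex Ex E1 (u Ex Ex E1) + sgl Ex Ey E1 (u Ex Ey E1) + sgl Ey Ex E1 (u Ey Ex E1) + sgl Ey Ey E1 (u Ey Ey E1)
     + sgl E1 Ex Ex (u E1 Ex Ex) + sgl E1 Ex Ey (u E1 Ex Ey) + sgl E1 Ey Ex (u E1 Ey Ex) + sgl E1 Ey Ey (u E1 Ey Ey)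
     + sgl Ex E1 Ex (u Ex E1 Ex) + sgl Ex E1 Ey (u Ex E1 Ey) + sgl Ey E1 Ex (u Ey E1 Ex) + sgl Ey E1 Ey (u Ey E1 Ey)) +
    (sgl Ex Ex Ex (u Ex Ex Ex) + sgl Ex Ex Ey (u Ex Ex Ey) + sgl Ex Ey Ex (u Ex Ey Ex) + sgl Ex Ey Ey (u Ex Ey Ey)
     + sgl Ey Ex Ex (u Ey Ex Ex) + sgl Ey Ex Ey (u Ey Ex Ey) + sgl Ey Ey Ex (u Ey Ey Ex) + sgl Ey Ey Ey (u Ey Ey Ey))"
  (is "_ \<Longrightarrow> u = ?r")
proof (rule noF_eqI)
  show "noF ?r" by (intro noF_simps noF_sgl) (simp_all add: isF_E)
qed (simp_all add: sgl_at)

subsection \<open>Odd degrees\<close>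

text \<open>\<gamma> puts \<tau> of the last factor in front, so modulo coboundaries the first
  factor can be moved to the end. Applying \<open>gD\<close> twice inverts it.\<close>

lemma eqO_shift: "eqO (sgl E1 a b v) (sgl a b E1 (gD (gD v)))" "eqO (sgl Ey a b v) (sgl a b Ex (gD (gD v)))"
    "eqO (sgl Ex a b v) (- sgl a b Ey (gD (gD v)) - sgl a b Ex (gD (gD v)))"
proof -
  show 1: "eqO (sgl E1 a b v) (sgl a b E1 (gD (gD v)))"
    using eqO_\<gamma>[of "sgl a b E1 (gD (gD v))"] by (simp only: \<gamma>N_sgls gD_cube)
  show 2: "eqO (sgl Ey a b v) (sgl a b Ex (gD (gD v)))"
    using eqO_\<gamma>[of "sgl a b Ex (gD (gD v))"] by (simp only: \<gamma>N_sgls gD_cube)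
  have "eqO (- sgl Ex a b v - sgl Ey a b v) (sgl a b Ey (gD (gD v)))"
    using eqO_\<gamma>[of "sgl a b Ey (gD (gD v))"] by (simp only: \<gamma>N_sgls gD_cube)
  from eqO_uminus[OF eqO_add[OF this 2]]
  show "eqO (sgl Ex a b v) (- sgl a b Ey (gD (gD v)) - sgl a b Ex (gD (gD v)))"
    by (simp only: diff_conv_add_uminus minus_add_distrib minus_minus add.assoc left_minus right_minus add_0_right)
qed

lemma odd_slots_1: "\<exists>p. eqO (sgl Ex E1 E1 a + sgl Ey E1 E1 b + sgl E1 Ex E1 c + sgl E1 Ey E1 d + sgl E1 E1 Ex e + sgl E1 E1 Ey f) (sgl Ex E1 E1 p)"
proof -
  define R where "R u \<longleftrightarrow> (\<exists>p. eqO u (sgl Ex E1 E1 p))" for u :: "'a N"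
  have add: "R u \<Longrightarrow> R v \<Longrightarrow> R (u + v)" for u v
    unfolding R_def using eqO_add sgl_simps(1) by metis
  have tr: "eqO u v \<Longrightarrow> R v \<Longrightarrow> R u" for u v unfolding R_def using eqO_trans by blast
  have 1: "R (sgl Ex E1 E1 v)" for v unfolding R_def using eqO_refl by blast
  have 2: "R (sgl E1 Ex E1 v)" for v by (rule tr[OF eqO_shift(1) 1])
  have 3: "R (sgl E1 E1 Ex v)" for v by (rule tr[OF eqO_shift(1) 2])
  have 4: "R (sgl Ey E1 E1 v)" for v by (rule tr[OF eqO_shift(2) 3])
  have 5: "R (sgl E1 Ey E1 v)" for v by (rule tr[OF eqO_shift(1) 4])
  have 6: "R (sgl E1 E1 Ey v)" for v by (rule tr[OF eqO_shift(1) 5])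
  show ?thesis unfolding R_def[symmetric] by (intro add 1 2 3 4 5 6)
qed

lemma odd_slots_2: "\<exists>p q r s. eqO (sgl Ex Ex E1 a1 + sgl Ex Ey E1 a2 + sgl Ey Ex E1 a3 + sgl Ey Ey E1 a4
     + sgl E1 Ex Ex b1 + sgl E1 Ex Ey b2 + sgl E1 Ey Ex b3 + sgl E1 Ey Ey b4
     + sgl Ex E1 Ex c1 + sgl Ex E1 Ey c2 + sgl Ey E1 Ex c3 + sgl Ey E1 Ey c4) (i12 p q r s)"
proof -
  define R where "R u \<longleftrightarrow> (\<exists>p q r s. eqO u (i12 p q r s))" for u :: "'a N"
  have i_add: "i12 p q r s + i12 p' q' r' s' = i12 (p + p') (q + q') (r + r') (s + s')" for p q r s p' q' r' s' :: "'a D"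
    unfolding i12_def sgl_simps by (simp only: add.assoc add.commute add.left_commute)
  have add: "R u \<Longrightarrow> R v \<Longrightarrow> R (u + v)" for u v
    unfolding R_def using eqO_add i_add by metis
  have i_min: "- i12 p q r s = i12 (- p) (- q) (- r) (- s)" for p q r s :: "'a D"
    unfolding i12_def sgl_simps by (simp only: minus_add_distrib)
  have min: "R u \<Longrightarrow> R (- u)" for u
    unfolding R_def using eqO_uminus i_min by metis
  have sub: "R u \<Longrightarrow> R v \<Longrightarrow> R (u - v)" for u v using add[of u "- v"] min[of v] by simp
  have tr: "eqO u v \<Longrightarrow> R v \<Longrightarrow> R u" for u v unfolding R_def using eqO_trans by blast
  have i: "R (i12 p q r s)" for p q r s unfolding R_def using eqO_refl by blast
  have 1: "R (sgl Ex Ex E1 v)" "R (sgl Ex Ey E1 v)" "R (sgl Ey Ex E1 v)" "R (sgl Ey Ey E1 v)" for v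
    using i[of v 0 0 0] i[of 0 v 0 0] i[of 0 0 v 0] i[of 0 0 0 v] by (simp_all only: i12_def sgl_simps add_0_left add_0_right)
  have 2: "R (sgl E1 Ex Ex v)" "R (sgl E1 Ex Ey v)" "R (sgl E1 Ey Ex v)" "R (sgl E1 Ey Ey v)" for v
    by (rule tr[OF eqO_shift(1)], rule 1)+
  have 3: "R (sgl Ey E1 Ex v)" "R (sgl Ey E1 Ey v)" "R (sgl Ex E1 Ex v)" "R (sgl Ex E1 Ey v)" for v
    by (rule tr[OF eqO_shift(2)] tr[OF eqO_shift(3)], intro sub min 2)+
  show ?thesis unfolding R_def[symmetric] by (intro add 1 2 3)
qed

text \<open>A leading y rotates to a trailing x, which settles the words y...yx...x. A trailing y or
  a leading x rotates to minus a sum of two words, which settles the others.\<close>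

lemma odd_slots_3: "\<exists>a. eqO (sgl Ex Ex Ex a1 + sgl Ex Ex Ey a2 + sgl Ex Ey Ex a3 + sgl Ex Ey Ey a4
     + sgl Ey Ex Ex a5 + sgl Ey Ex Ey a6 + sgl Ey Ey Ex a7 + sgl Ey Ey Ey a8) (sgl Ex Ex Ex a)"
proof -
  define R where "R u \<longleftrightarrow> (\<exists>p. eqO u (sgl Ex Ex Ex p))" for u :: "'a N"
  have add: "R u \<Longrightarrow> R v \<Longrightarrow> R (u + v)" for u v
    unfolding R_def using eqO_add sgl_simps(1) by metis
  have min: "R u \<Longrightarrow> R (- u)" for u
    unfolding R_def using eqO_uminus sgl_simps(3) by metis
  have sub: "R u \<Longrightarrow> R v \<Longrightarrow> R (u - v)" for u v using add[of u "- v"] min[of v] by simp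
  have tr: "eqO u v \<Longrightarrow> R v \<Longrightarrow> R u" for u v unfolding R_def using eqO_trans by blast
  have tr': "R u \<Longrightarrow> eqO u v \<Longrightarrow> R v" for u v unfolding R_def using eqO_trans eqO_sym by blast
  have xxx: "R (sgl Ex Ex Ex v)" for v unfolding R_def using eqO_refl by blast
  have yxx: "R (sgl Ey Ex Ex v)" for v by (rule tr[OF eqO_shift(2) xxx])
  have yyx: "R (sgl Ey Ey Ex v)" for v by (rule tr[OF eqO_shift(2) yxx])
  have yyy: "R (sgl Ey Ey Ey v)" for v by (rule tr[OF eqO_shift(2) yyx])
  have bk: "R (sgl a b Ey v)" if "\<And>v. R (sgl Ex a b v)" "\<And>v. R (sgl Ey a b v)" for a b v
  proof (rule tr'[OF _ eqO_\<gamma>])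
    show "R (\<gamma>N (sgl a b Ey v))" unfolding \<gamma>N_sgls by (intro sub min that)
  qed
  have xxy: "R (sgl Ex Ex Ey v)" for v by (rule bk[OF xxx yxx])
  have xyy: "R (sgl Ex Ey Ey v)" for v by (rule tr[OF eqO_shift(3)]) (intro sub min yyy yyx)
  have yxy: "R (sgl Ey Ex Ey v)" for v
  proof -
    have "R (\<gamma>N (sgl Ex Ey Ey (gD (gD v))))" by (rule tr[OF eqO_\<gamma> xyy])
    hence "R (- sgl Ex Ex Ey v - sgl Ey Ex Ey v)" unfolding \<gamma>N_sgls gD_cube .
    from sub[OF min[OF this] xxy[of v]] show ?thesis by (simp only: add_cancel_rules(1))
  qed
  have xyx: "R (sgl Ex Ey Ex v)" for v
  proof (rule tr'[OF _ eqO_\<gamma>])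
    show "R (\<gamma>N (sgl Ex Ey Ex v))" unfolding \<gamma>N_sgls by (rule yxy)
  qed
  show ?thesis unfolding R_def[symmetric] by (intro add xxx xxy xyx xyy yxx yxy yyx yyy)
qed

lemmas N9_simps = tr3_def nine.c_def \<gamma>Ns \<gamma>N_sgls gD_cube sgl_simps gDs

lemma N9_at: "N9 u E1 E1 E1 = trD (u E1 E1 E1)"
  by (simp only: tr3_def nine.c_def \<gamma>N_at plus_fun_apply gD_cube trD_tr gDs) (simp only: add_ac)

lemma trD_0: "trD 0 = (0 :: 'w::comm_ring_1 D)"
  by (simp only: trD_tr tr3_def gDs add_0_right)

text \<open>Already 1 + \<tau> + \<tau>^2 kills x and y, so the cocycle condition does not constrain
  a coefficient with one factor x.\<close>

lemma N9_x11: "N9 (sgl Ex E1 E1 p) = 0"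
  by (simp only: N9_simps) (simp add: algebra_simps)

lemma c\<gamma>_i12: "tr3 c\<gamma> (i12 p q r s) = i12 (p + p + s + s - q - r) (p + q - r - r + s) (p - q - q + r + s) (p + p + s + s - q - r)"
  unfolding i12_def by (simp only: N9_simps) (simp add: algebra_simps)

lemma tr3_i12_at: "tr3 \<gamma>N (i12 p q r s) Ex Ey E1 = q" "tr3 \<gamma>N (i12 p q r s) Ey Ex E1 = r"
    "tr3 \<gamma>N (i12 p q r s) E1 E1 E1 = 0" "tr3 \<gamma>N (i12 p q r s) Ex Ex Ex = 0"
  by (simp_all add: tr3_def \<gamma>N_at i12_def sgl_at gDs)

lemma N9_xxx: "N9 (sgl Ex Ex Ex a) Ex Ex Ex = gD a - gD (gD a)" "N9 (sgl Ex Ex Ex a) Ex Ey E1 = 0" "N9 (sgl Ex Ex Ex a) Ey Ex E1 = 0"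
  by (simp_all add: tr3_def nine.c_def \<gamma>N_at sgl_at gDs gD_cube)

lemma N9_111: "N9 (sgl E1 E1 E1 d) Ex Ex Ex = 0" "N9 (sgl E1 E1 E1 d) Ex Ey E1 = 0" "N9 (sgl E1 E1 E1 d) Ey Ex E1 = 0"
  by (simp_all add: tr3_def nine.c_def \<gamma>N_at sgl_at gDs gD_cube)

text \<open>The cube of \<gamma> takes xx to yy and yy to (x + y)(x + y). Modulo coboundaries hence
  yy equals xx, and xx + xy + yx is zero; the tensor in question is a combination of these two
  relations.\<close>

lemma i12_zero: "eqO (i12 p (p + s) (p + s) s) (0 :: 'w::comm_ring_1 N)"
proof -
  have c: "eqO (c\<gamma> u) u" for u :: "'w N"
    unfolding nine.c_def using eqO_\<gamma> eqO_trans by blast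
  have 1: "eqO (sgl Ey Ey E1 s) (sgl Ex Ex E1 s)"
    using c[of "sgl Ex Ex E1 s"] by (simp only: N9_simps)
  have "eqO (sgl Ex Ex E1 (p + s) + sgl Ex Ey E1 (p + s) + sgl Ey Ex E1 (p + s) + sgl Ey Ey E1 (p + s)) (sgl Ey Ey E1 (p + s))"
    using c[of "sgl Ey Ey E1 (p + s)"] by (simp only: nine.c_def \<gamma>Ns \<gamma>N_sgls gD_cube) (simp add: algebra_simps)
  from eqO_add[OF eqO_add[OF this 1] eqO_refl[of "- sgl Ey Ey E1 (p + s) - sgl Ex Ex E1 s"]]
  have "eqO (sgl Ex Ex E1 (p + s) + sgl Ex Ey E1 (p + s) + sgl Ey Ex E1 (p + s) + sgl Ey Ey E1 (p + s) + sgl Ey Ey E1 s + (- sgl Ey Ey E1 (p + s) - sgl Ex Ex E1 s))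
    (sgl Ey Ey E1 (p + s) + sgl Ex Ex E1 s + (- sgl Ey Ey E1 (p + s) - sgl Ex Ex E1 s))" .
  moreover have "sgl Ex Ex E1 (p + s) - sgl Ex Ex E1 s = sgl Ex Ex E1 p"
    by (simp only: sgl_simps add_diff_cancel)
  ultimately show ?thesis by (simp only: add_cancel_rules i12_def)
qed

text \<open>If the i-th translate of xxx is given the coefficient b twisted back i times, all nine
  translates carry b and add up to 0, as the nine translates of xxx do. Modulo coboundaries each is
  xxx with the twisted coefficient, and these coefficients add up to \<open>trD b\<close>.\<close>

lemma sgl_xxx_trD: "eqO (sgl Ex Ex Ex (trD b)) (0 :: 'w::comm_ring_1 N)"
proof -
  define z where "z v = sgl Ex Ex Ex v" for v :: "'w D"
  have g: "eqO u (\<gamma>N v)" if "eqO u v" for u v :: "'w N"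
    using eqO_trans[OF that eqO_sym[OF eqO_\<gamma>]] .
  note e = eqO_refl g[OF eqO_refl] g[OF g[OF eqO_refl]]
  note e3 = g[OF e(3)] g[OF g[OF e(3)]] g[OF g[OF g[OF e(3)]]]
  note e6 = g[OF e3(3)] g[OF g[OF e3(3)]] g[OF g[OF g[OF e3(3)]]]
  have "eqO (z b + z (gD (gD b)) + z (gD b) + z b + z (gD (gD b)) + z (gD b) + z b + z (gD (gD b)) + z (gD b))
    (z b + \<gamma>N (z (gD (gD b))) + \<gamma>N (\<gamma>N (z (gD b))) + \<gamma>N (\<gamma>N (\<gamma>N (z b))) + \<gamma>N (\<gamma>N (\<gamma>N (\<gamma>N (z (gD (gD b)))))) + \<gamma>N (\<gamma>N (\<gamma>N (\<gamma>N (\<gamma>N (z (gD b)))))) + \<gamma>N (\<gamma>N (\<gamma>N (\<gamma>N (\<gamma>N (\<gamma>N (z b)))))) + \<gamma>N (\<gamma>N (\<gamma>N (\<gamma>N (\<gamma>N (\<gamma>N (\<gamma>N (z (gD (gD b))))))))) + \<gamma>N (\<gamma>N (\<gamma>N (\<gamma>N (\<gamma>N (\<gamma>N (\<gamma>N (\<gamma>N (z (gD b))))))))))"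
    by (intro eqO_add e e3 e6)
  moreover have "z b + z (gD (gD b)) + z (gD b) + z b + z (gD (gD b)) + z (gD b) + z b + z (gD (gD b)) + z (gD b) = z (trD b)"
    unfolding z_def trD_tr tr3_def sgl_simps by (simp only: add.assoc add.commute add.left_commute)
  moreover have "z b + \<gamma>N (z (gD (gD b))) + \<gamma>N (\<gamma>N (z (gD b))) + \<gamma>N (\<gamma>N (\<gamma>N (z b))) + \<gamma>N (\<gamma>N (\<gamma>N (\<gamma>N (z (gD (gD b)))))) + \<gamma>N (\<gamma>N (\<gamma>N (\<gamma>N (\<gamma>N (z (gD b)))))) + \<gamma>N (\<gamma>N (\<gamma>N (\<gamma>N (\<gamma>N (\<gamma>N (z b)))))) + \<gamma>N (\<gamma>N (\<gamma>N (\<gamma>N (\<gamma>N (\<gamma>N (\<gamma>N (z (gD (gD b))))))))) + \<gamma>N (\<gamma>N (\<gamma>N (\<gamma>N (\<gamma>N (\<gamma>N (\<gamma>N (\<gamma>N (z (gD b))))))))) = 0"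
    unfolding z_def by (simp only: \<gamma>Ns \<gamma>N_sgls gD_cube) (simp add: algebra_simps)
  ultimately show ?thesis unfolding z_def by (simp only:)
qed

lemma msk_N9: "msk isF (N9 u) = N9 (msk isF u)"
  unfolding tr3_def nine.c_def by (simp only: msk_simps \<gamma>N_isF[symmetric])

lemma noF_diff_msk: "noF (u - msk isF u)"
proof -
  have "msk isF (msk isF u) = msk isF u" by (simp add: msk_def fun_eq_iff)
  thus ?thesis by (simp only: noF_def msk_simps diff_self)
qed

text \<open>After reduction to representatives four coordinates of the norm decide: the one at 1, 1,
  1 makes \<open>d\<close> a coboundary, the two at x, y, 1 and y, x, 1 bring the part with two
  factors into the form of \<open>i12_zero\<close>, and the one at x, x, x makes \<open>a\<close>
  invariant.\<close>

theorem odd_classes: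
  fixes u :: "'w::strict_3_ring N"
  assumes "N9 u = 0"
  shows "\<exists>p \<alpha> \<beta>. eqO u (sgl Ex E1 E1 p + sgl Ex Ex Ex (usc \<alpha> one\<^sub>D + usc \<beta> dlt))"
proof -
  let ?f = "msk isF u"
  define e where "e = u - ?f"
  have f0: "N9 ?f = 0" by (simp only: msk_N9[symmetric] assms msk_simps)
  have "msk isF ?f = ?f" by (simp add: msk_def fun_eq_iff)
  from F_trivial(2)[OF this f0] obtain v where "?f = \<gamma>N v - v" by blast
  hence f: "eqO ?f 0" unfolding eqO_def by auto
  have e0: "N9 e = 0" by (simp only: e_def nine.tr3_diff assms f0 diff_self)
  obtain d p p2 q2 r2 s2 a where w: "eqO e (sgl E1 E1 E1 d + sgl Ex E1 E1 p + i12 p2 q2 r2 s2 + sgl Ex Ex Ex a)"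
  proof -
    note x = noF_expand[OF noF_diff_msk, of u, folded e_def]
    from odd_slots_1[of "e Ex E1 E1" "e Ey E1 E1" "e E1 Ex E1" "e E1 Ey E1" "e E1 E1 Ex" "e E1 E1 Ey"] obtain p where
      p: "eqO (sgl Ex E1 E1 (e Ex E1 E1) + sgl Ey E1 E1 (e Ey E1 E1) + sgl E1 Ex E1 (e E1 Ex E1) + sgl E1 Ey E1 (e E1 Ey E1)
      + sgl E1 E1 Ex (e E1 E1 Ex) + sgl E1 E1 Ey (e E1 E1 Ey)) (sgl Ex E1 E1 p)" by blast
    from odd_slots_2[of "e Ex Ex E1" "e Ex Ey E1" "e Ey Ex E1" "e Ey Ey E1" "e E1 Ex Ex" "e E1 Ex Ey" "e E1 Ey Ex" "e E1 Ey Ey"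
        "e Ex E1 Ex" "e Ex E1 Ey" "e Ey E1 Ex" "e Ey E1 Ey"] obtain p2 q2 r2 s2 where
      q: "eqO (sgl Ex Ex E1 (e Ex Ex E1) + sgl Ex Ey E1 (e Ex Ey E1) + sgl Ey Ex E1 (e Ey Ex E1) + sgl Ey Ey E1 (e Ey Ey E1)
     + sgl E1 Ex Ex (e E1 Ex Ex) + sgl E1 Ex Ey (e E1 Ex Ey) + sgl E1 Ey Ex (e E1 Ey Ex) + sgl E1 Ey Ey (e E1 Ey Ey)
     + sgl Ex E1 Ex (e Ex E1 Ex) + sgl Ex E1 Ey (e Ex E1 Ey) + sgl Ey E1 Ex (e Ey E1 Ex) + sgl Ey E1 Ey (e Ey E1 Ey)) (i12 p2 q2 r2 s2)" by blast
    from odd_slots_3[of "e Ex Ex Ex" "e Ex Ex Ey" "e Ex Ey Ex" "e Ex Ey Ey" "e Ey Ex Ex" "e Ey Ex Ey" "e Ey Ey Ex" "e Ey Ey Ey"] obtain a where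
      r: "eqO (sgl Ex Ex Ex (e Ex Ex Ex) + sgl Ex Ex Ey (e Ex Ex Ey) + sgl Ex Ey Ex (e Ex Ey Ex) + sgl Ex Ey Ey (e Ex Ey Ey)
     + sgl Ey Ex Ex (e Ey Ex Ex) + sgl Ey Ex Ey (e Ey Ex Ey) + sgl Ey Ey Ex (e Ey Ey Ex) + sgl Ey Ey Ey (e Ey Ey Ey)) (sgl Ex Ex Ex a)" by blast
    from eqO_add[OF eqO_add[OF eqO_add[OF eqO_refl[of "sgl E1 E1 E1 (e E1 E1 E1)"] p] q] r] x that show thesis by metis
  qed
  define t where "t = N9 (sgl E1 E1 E1 d) + N9 (sgl Ex E1 E1 p) + N9 (i12 p2 q2 r2 s2) + N9 (sgl Ex Ex Ex a)"
  have t0: "t = 0" using eqO_N9[OF w] e0 by (simp only: t_def nine.tr3_add)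
  have at: "t x y z = N9 (sgl E1 E1 E1 d) x y z + N9 (sgl Ex E1 E1 p) x y z + N9 (i12 p2 q2 r2 s2) x y z + N9 (sgl Ex Ex Ex a) x y z" for x y z
    by (simp add: t_def)
  have t0': "t x y z = 0" for x y z by (simp add: t0)
  have z: "sgl E1 E1 E1 d E1 E1 E1 = d" "sgl Ex Ex Ex a E1 E1 E1 = 0" by (simp_all add: sgl_at)
  have d: "trD d = 0"
    using t0'[of E1 E1 E1] unfolding at N9_at[of "sgl E1 E1 E1 d"] N9_at[of "sgl Ex Ex Ex a"] z N9_x11 c\<gamma>_i12 tr3_i12_at trD_0
      zero_fun_apply add_0_right .
  have Q: "p2 + q2 - r2 - r2 + s2 = 0"
    using t0'[of Ex Ey E1] unfolding at N9_x11 c\<gamma>_i12 tr3_i12_at N9_xxx N9_111 zero_fun_apply add_0_right add_0_left .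
  have R: "p2 - q2 - q2 + r2 + s2 = 0"
    using t0'[of Ey Ex E1] unfolding at N9_x11 c\<gamma>_i12 tr3_i12_at N9_xxx N9_111 zero_fun_apply add_0_right add_0_left .
  have "gD a - gD (gD a) = 0"
    using t0'[of Ex Ex Ex] unfolding at N9_x11 c\<gamma>_i12 tr3_i12_at N9_xxx N9_111 zero_fun_apply add_0_right add_0_left .
  hence "gD a = gD (gD a)" by (simp only: right_minus_eq)
  from arg_cong[OF this, of "\<lambda>v. gD (gD v)"] have a: "gD a = a" by (simp only: gD_cube)
  from gD_invariant[OF a] obtain \<alpha> \<beta> y where y: "a = usc \<alpha> one\<^sub>D + usc \<beta> dlt + trD y" by blast
  have "tr3 gD d + tr3 gD d + tr3 gD d = 0" using d by (simp only: trD_tr)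
  from gD_trace_zero[OF D_three[OF this]] obtain y' where "d = gD y' - y'" by blast
  hence 1: "eqO (sgl E1 E1 E1 d) 0"
    using eqO_add[OF eqO_\<gamma>[of "sgl E1 E1 E1 y'"] eqO_refl[of "- sgl E1 E1 E1 y'"]] by (simp only: \<gamma>N_sgls sgl_simps) simp
  have "(q2 - r2) + (q2 - r2) + (q2 - r2) = (p2 + q2 - r2 - r2 + s2) - (p2 - q2 - q2 + r2 + s2)" by (simp only: algebra_simps)
  hence "(q2 - r2) + (q2 - r2) + (q2 - r2) = 0" unfolding Q R by (simp only: diff_self)
  hence "q2 - r2 = 0" by (rule D_three)
  hence qr: "r2 = q2" by (simp only: right_minus_eq)
  have q: "q2 = p2 + s2" using Q unfolding qr by (rule add_solve_middle)
  have 2: "eqO (i12 p2 q2 r2 s2) 0" unfolding qr q by (rule i12_zero)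
  have 3: "eqO (sgl Ex Ex Ex a) (sgl Ex Ex Ex (usc \<alpha> one\<^sub>D + usc \<beta> dlt))"
    using eqO_add[OF eqO_refl sgl_xxx_trD] by (simp only: y sgl_simps add_0_right)
  have "eqO (?f + e) (0 + (0 + sgl Ex E1 E1 p + 0 + sgl Ex Ex Ex (usc \<alpha> one\<^sub>D + usc \<beta> dlt)))"
    by (rule eqO_add[OF f eqO_trans[OF w]]) (intro eqO_add 1 2 3 eqO_refl)
  moreover have "?f + e = u" by (simp add: e_def)
  ultimately have "eqO u (sgl Ex E1 E1 p + sgl Ex Ex Ex (usc \<alpha> one\<^sub>D + usc \<beta> dlt))"
    by (simp only: add_0_left add_0_right)
  thus ?thesis by blast
qed

theorem odd_detect:
  fixes p a :: "'w::strict_3_ring D"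
  assumes "sgl Ex E1 E1 p + sgl Ex Ex Ex a = \<gamma>N y - y"
  shows "\<exists>h. p = h + h + h" "\<exists>y. a = trD y"
proof -
  have e: "(sgl Ex E1 E1 p + sgl Ex Ex Ex a) x1 x2 x3 = \<gamma>N y x1 x2 x3 - y x1 x2 x3" for x1 x2 x3 by (subst assms) simp
  note e' = e[simplified plus_fun_apply sgl_at]
  define V where "V x1 x2 x3 = \<gamma>N y x1 x2 x3 - y x1 x2 x3" for x1 x2 x3
  have V: "V Ex Ex Ex = a" "V Ex Ex Ey = 0" "V Ex Ey Ex = 0" "V Ex Ey Ey = 0" "V Ey Ex Ex = 0" "V Ey Ex Ey = 0"
    "V Ey Ey Ex = 0" "V Ey Ey Ey = 0"
    unfolding V_def e'[symmetric] by simp_all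
  have V1: "V Ex E1 E1 = p" "V Ey E1 E1 = 0" "V E1 Ex E1 = 0" "V E1 Ey E1 = 0" "V E1 E1 Ex = 0" "V E1 E1 Ey = 0"
    unfolding V_def e'[symmetric] by simp_all
  \<comment> \<open>All values of \<open>V\<close> added here are 0; they are chosen so that the
    contributions of \<open>y\<close> telescope to three times one coordinate.\<close>
  have "p = V Ex E1 E1 + V Ey E1 E1 + gD (V E1 E1 Ex) + gD (V E1 E1 Ey) + gD (gD (V E1 Ex E1)) + gD (gD (V E1 Ey E1))"
    unfolding V1 by (simp only: gDs add_0_right)
  also have "\<dots> = (- gD (y E1 E1 Ey)) + (- gD (y E1 E1 Ey)) + (- gD (y E1 E1 Ey))"
    unfolding V_def \<gamma>N_at by (simp only: gDs gD_cube) (simp only: algebra_simps, simp)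
  finally show "\<exists>h. p = h + h + h" by blast
  \<comment> \<open>Again zeros are added, now so that the contributions of \<open>y\<close>
    telescope to minus the norm of one coordinate.\<close>
  have "a = V Ex Ex Ex - V Ex Ex Ey + V Ey Ex Ey + (V Ey Ey Ey - V Ex Ey Ey + V Ex Ey Ex)
      + gD (gD (V Ey Ex Ex + (- V Ex Ey Ey + V Ex Ey Ex + V Ey Ex Ey) + V Ex Ey Ex))
      + gD (V Ey Ey Ex + V Ey Ex Ey + (- V Ex Ex Ey + V Ex Ey Ex + V Ey Ex Ey))"
    unfolding V by (simp only: gDs minus_zero add_0_right diff_zero)
  also have "\<dots> = - trD (y Ey Ex Ey)"
    unfolding V_def trD_tr tr3_def \<gamma>N_at by (simp only: gDs gD_cube minus_add_distrib) (simp only: algebra_simps minus_add_distrib, simp)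
  finally have "a = - trD (y Ey Ex Ey)" .
  moreover have "trD (- y Ey Ex Ey) = - trD (y Ey Ex Ey)" by (simp add: trD_tr tr3_def gDs)
  ultimately show "\<exists>y. a = trD y" by metis
qed

text \<open>With one factor outside 1 the cube of \<gamma> is just \<tau>: it makes x and y equal
  modulo coboundaries, and y equal to -x - y, whence 3x is zero.\<close>

lemma odd_trivial_x11: "eqO (sgl Ey E1 E1 (v :: 'w D)) (sgl Ex E1 E1 v)" "eqO (sgl Ex E1 E1 (h + h + h)) (0 :: 'w::comm_ring_1 N)"
proof -
  have s: "eqO (sgl E1 E1 Ex w) (sgl Ex E1 E1 (gD w))" "eqO (sgl E1 E1 Ey w) (sgl Ey E1 E1 (gD w))" for w :: "'w D"
    using eqO_trans[OF eqO_shift(1)[of E1 Ex w] eqO_shift(1)[of Ex E1 "gD (gD w)"]]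
      eqO_trans[OF eqO_shift(1)[of E1 Ey w] eqO_shift(1)[of Ey E1 "gD (gD w)"]] by (simp_all only: gD_cube)
  have yx: "eqO (sgl Ey E1 E1 v) (sgl Ex E1 E1 v)" for v :: "'w D"
    using eqO_trans[OF eqO_shift(2)[of E1 E1 v] s(1)] by (simp only: gD_cube)
  show "eqO (sgl Ey E1 E1 v) (sgl Ex E1 E1 v)" by (rule yx)
  have "eqO (- sgl E1 E1 Ey (gD (gD h)) + - sgl E1 E1 Ex (gD (gD h))) (- sgl Ex E1 E1 h + - sgl Ex E1 E1 h)"
    using eqO_add[OF eqO_uminus[OF eqO_trans[OF s(2)[of "gD (gD h)"] yx]] eqO_uminus[OF s(1)[of "gD (gD h)"]]] by (simp only: gD_cube)
  from eqO_trans[OF eqO_shift(3)[of E1 E1 h] this[folded diff_conv_add_uminus]]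
  have "eqO (sgl Ex E1 E1 h) (- sgl Ex E1 E1 h - sgl Ex E1 E1 h)" .
  from eqO_add[OF this eqO_refl[of "sgl Ex E1 E1 h + sgl Ex E1 E1 h"]]
  show "eqO (sgl Ex E1 E1 (h + h + h)) 0" unfolding sgl_simps by (simp add: add.assoc)
qed

subsection \<open>Even degrees\<close>

lemma N9_sgl111: "sgl E1 E1 E1 (trD d) = N9 (sgl E1 E1 E1 d)"
  unfolding trD_tr by (simp only: N9_simps) (simp only: add_ac)

lemma N9_i12: "tr3 \<gamma>N (i12 (h + h + h) 0 (h + h + h) (h + h + h)) = N9 (i12 h (- h) 0 0)"
proof -
  have "h + h + 0 + 0 - - h - 0 = h + h + h" "h + - h - 0 - 0 + 0 = 0" "h - - h - - h + 0 + 0 = h + h + h"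
    by (simp_all only: diff_minus_eq_add add_0_right diff_zero right_minus)
  thus ?thesis unfolding c\<gamma>_i12 by (simp only:)
qed

text \<open>The norm of q xx under the cube of \<gamma> has entries 2q, q, q, 2q; subtracting it
  clears the entry at xy.\<close>

lemma i12_split: "i12 (q + r) q r (q + r) = i12 (r - q) 0 (r - q) (r - q) + tr3 c\<gamma> (i12 q 0 0 0)"
proof -
  have i: "i12 p q r s + i12 p' q' r' s' = i12 (p + p') (q + q') (r + r') (s + s')" for p q r s p' q' r' s' :: "'a D"
    unfolding i12_def sgl_simps by (simp only: add.assoc add.commute add.left_commute)
  have "r - q + (q + q + 0 + 0 - 0 - 0) = q + r" "0 + (q + 0 - 0 - 0 + 0) = q" "r - q + (q - 0 - 0 + 0 + 0) = r"
    by (simp_all only: algebra_simps) simp_all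
  thus ?thesis unfolding c\<gamma>_i12 i by (simp only:)
qed

text \<open>Invariance expresses every coordinate by a few. Those with one factor from {x, y}
  vanish, those with two depend on \<open>q\<close> and \<open>r\<close>, and those with three
  depend on one coefficient \<open>k\<close> of trace zero, which makes them a norm.\<close>

theorem even_classes:
  fixes u :: "'w::strict_3_ring N"
  assumes "\<gamma>N u = u"
  shows "\<exists>\<alpha> \<beta> l y. u = sgl E1 E1 E1 (usc \<alpha> one\<^sub>D + usc \<beta> dlt) + tr3 \<gamma>N (i12 l 0 l l) + N9 y"
proof -
  let ?f = "msk isF u"
  define e where "e = u - ?f"
  have f0: "\<gamma>N ?f = ?f" by (simp only: \<gamma>N_isF assms)
  have "msk isF ?f = ?f" by (simp add: msk_def fun_eq_iff)
  from F_trivial(1)[OF this f0] obtain vf where f: "?f = N9 vf" by blast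
  have e0: "\<gamma>N e = e" by (simp only: e_def \<gamma>Ns assms f0)
  hence E: "e x1 x2 x3 = \<gamma>N e x1 x2 x3" for x1 x2 x3 by (simp only:)
  have E1: "e E1 b c = gD (e b c E1)" and Ex: "e Ex b c = - gD (e b c Ey)" and Ey: "e Ey b c = gD (e b c Ex) - gD (e b c Ey)" for b c
    using E[of E1 b c] E[of Ex b c] E[of Ey b c] unfolding \<gamma>N_at .
  \<comment> \<open>Rotating three times compares the coordinates at x and y with themselves; the
    result is 3 times one of them being 0.\<close>
  have P0: "e Ex E1 E1 = - e Ey E1 E1" "e Ey E1 E1 = e Ex E1 E1 - e Ey E1 E1"
    using Ex[of E1 E1] Ey[of E1 E1] unfolding E1[of E1 Ey] E1[of E1 Ex] E1[of Ey E1] E1[of Ex E1] gD_cube .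
  have y0: "e Ey E1 E1 = 0" by (rule D_three[OF add_solve(1)[OF P0]])
  hence x0: "e Ex E1 E1 = 0" using P0(1) by (simp only: minus_zero)
  note xy0 = x0 y0
  define p q r s where "p = e Ex Ex E1" and "q = e Ex Ey E1" and "r = e Ey Ex E1" and "s = e Ey Ey E1"
  note pqrs = p_def[symmetric] q_def[symmetric] r_def[symmetric] s_def[symmetric]
  have A2: "e E1 Ex Ex = gD p" "e E1 Ex Ey = gD q" "e E1 Ey Ex = gD r" "e E1 Ey Ey = gD s"
    by (simp_all only: E1 pqrs)
  have A2': "e Ex E1 Ex = - gD (gD q)" "e Ex E1 Ey = - gD (gD s)" "e Ey E1 Ex = gD (gD p) - gD (gD q)" "e Ey E1 Ey = gD (gD r) - gD (gD s)"
    by (simp_all only: Ex[of E1] Ey[of E1] A2)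
  have "p = s" using Ex[of Ex E1] by (simp only: A2' pqrs gDs gD_cube minus_minus)
  moreover have q: "q = s - r" using Ex[of Ey E1] by (simp only: A2' pqrs gDs gD_cube minus_diff_eq)
  hence "s = q + r" by (simp only: eq_diff_eq)
  ultimately have w: "i12 p q r s = i12 (q + r) q r (q + r)" by (simp only:)
  have A1: "e E1 Ex E1 = 0" "e E1 Ey E1 = 0" "e E1 E1 Ex = 0" "e E1 E1 Ey = 0"
    by (simp_all only: E1[of Ex E1] E1[of Ey E1] E1[of E1 Ex] E1[of E1 Ey] xy0 gDs)
  \<comment> \<open>The eight coordinates in x, y are first expressed by \<open>k\<close> and
    \<open>Y\<close>. The equation at y, y, y then becomes 3 times the trace of \<open>k\<close>
    being 0, and trace zero gives \<open>Y = gD k\<close>.\<close>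
  define k Y where "k = e Ex Ey Ex" and "Y = e Ey Ey Ey"
  have A3: "e Ex Ey Ey = - gD Y" "e Ex Ex Ey = gD (gD Y)" "e Ex Ex Ex = - Y"
    by (simp_all only: Ex Y_def[symmetric] gDs gD_cube minus_minus)
  have yxx: "e Ey Ex Ex = - gD Y - Y" by (simp only: Ey[of Ex Ex] A3 gDs gD_cube)
  have yxy': "e Ey Ex Ey = gD k + gD (gD Y)" by (simp only: Ey[of Ex Ey] A3 k_def[symmetric] gDs diff_minus_eq_add)
  have k: "k = - gD (e Ey Ex Ey)" by (simp only: k_def Ex[of Ey Ex])
  have Y: "Y = - k - gD (gD k)"
    by (rule add_solve(2), rule trans[OF k]) (simp only: yxy' gDs gD_cube)
  have yyx: "e Ey Ey Ex = - gD (gD Y) - gD Y + k"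
    unfolding Ey[of Ey Ex] yxx gDs by (rule add_solve(3)[OF k])
  have yyy: "Y = (- gD (gD (gD Y)) - gD (gD Y) + gD k) - gD Y"
    using Ey[of Ey Ey] unfolding yyx Y_def[symmetric] gDs .
  have "- k - gD (gD k) = - (- k - gD (gD k)) - (- gD (gD k) - gD k) + gD k - (- gD k - k)"
    using yyy unfolding Y gDs gD_cube .
  hence trk: "tr3 gD k = 0" unfolding tr3_def by (rule D_three[OF add_solve(4)])
  have Yk: "Y = gD k" unfolding Y by (rule add_solve(5)[OF trk[unfolded tr3_def]])
  from gD_trace_zero[OF trk] obtain e' where e': "k = gD e' - e'" by blast
  have eq: "e = sgl E1 E1 E1 (e E1 E1 E1) + tr3 \<gamma>N (i12 p q r s) + N9 (sgl Ex Ex Ex e')"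
  proof (rule noF_eqI)
    show "noF e" unfolding e_def by (rule noF_diff_msk)
    show "noF (sgl E1 E1 E1 (e E1 E1 E1) + tr3 \<gamma>N (i12 p q r s) + N9 (sgl Ex Ex Ex e'))"
      by (intro noF_simps(1) noF_tr3 noF_i12 noF_sgl) (simp_all add: isF_E)
    have "e x1 x2 x3 = sgl E1 E1 E1 (e E1 E1 E1) x1 x2 x3 + tr3 \<gamma>N (i12 p q r s) x1 x2 x3 + N9 (sgl Ex Ex Ex e') x1 x2 x3"
      if "x1 \<in> {E1, Ex, Ey}" "x2 \<in> {E1, Ex, Ey}" "x3 \<in> {E1, Ex, Ey}" for x1 x2 x3
      using that
      by (elim insertE emptyE; simp only: tr3_def nine.c_def plus_fun_apply \<gamma>N_at sgl_at i12_def bx.distinct simp_thms if_True if_False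
          gDs gD_cube add_0_left add_0_right diff_zero minus_zero A1 A2 A2' A3 yxx yxy' yyx xy0 pqrs k_def[symmetric] Y_def[symmetric] Yk e')
        (simp_all only: algebra_simps, simp_all)
    thus "\<forall>a\<in>{E1, Ex, Ey}. \<forall>b\<in>{E1, Ex, Ey}. \<forall>c\<in>{E1, Ex, Ey}. e a b c =
        (sgl E1 E1 E1 (e E1 E1 E1) + tr3 \<gamma>N (i12 p q r s) + N9 (sgl Ex Ex Ex e')) a b c"
      by (simp only: plus_fun_apply) blast
  qed
  have "gD (e E1 E1 E1) = e E1 E1 E1" by (rule E1[symmetric])
  from gD_invariant[OF this] obtain \<alpha> \<beta> y where y: "e E1 E1 E1 = usc \<alpha> one\<^sub>D + usc \<beta> dlt + trD y" by blast
  have "u = ?f + e" unfolding e_def by (rule add_cancel_rules(4))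
  also have "\<dots> = sgl E1 E1 E1 (usc \<alpha> one\<^sub>D + usc \<beta> dlt) + tr3 \<gamma>N (i12 (r - q) 0 (r - q) (r - q))
     + N9 (vf + sgl E1 E1 E1 y + i12 q 0 0 0 + sgl Ex Ex Ex e')"
    unfolding f w y i12_split nine.tr3_add sgl_simps N9_sgl111[symmetric] eq[unfolded f w y i12_split nine.tr3_add sgl_simps]
    by (simp only: add_ac)
  finally show ?thesis by blast
qed

lemma tr3c\<gamma>_at: "tr3 c\<gamma> Z Ex Ey E1 = Z Ex Ex E1 + Z Ex Ey E1 - Z Ey Ex E1 - Z Ey Ex E1 + Z Ey Ey E1"
   "tr3 c\<gamma> Z Ey Ex E1 = Z Ex Ex E1 - Z Ex Ey E1 - Z Ex Ey E1 + Z Ey Ex E1 + Z Ey Ey E1"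
  unfolding tr3_def nine.c_def plus_fun_apply by (simp_all only: \<gamma>N_at gDs gD_cube) (simp_all add: algebra_simps)

theorem even_detect:
  fixes d l :: "'w::strict_3_ring D"
  assumes "sgl E1 E1 E1 d + tr3 \<gamma>N (i12 l 0 l l) = N9 y"
  shows "\<exists>h. l = h + h + h" "\<exists>y. d = trD y"
proof -
  have e: "sgl E1 E1 E1 d x1 x2 x3 + tr3 \<gamma>N (i12 l 0 l l) x1 x2 x3 = N9 y x1 x2 x3" for x1 x2 x3
    unfolding assms[symmetric] by simp
  show "\<exists>y. d = trD y" using e[of E1 E1 E1] unfolding N9_at tr3_i12_at sgl_at by auto
  define Z where "Z = tr3 \<gamma>N y"
  have 1: "0 = Z Ex Ex E1 + Z Ex Ey E1 - Z Ey Ex E1 - Z Ey Ex E1 + Z Ey Ey E1"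
    using e[of Ex Ey E1] unfolding nine.tr3_c tr3_i12_at sgl_at tr3c\<gamma>_at Z_def[symmetric] by simp
  have 2: "l = Z Ex Ex E1 - Z Ex Ey E1 - Z Ex Ey E1 + Z Ey Ex E1 + Z Ey Ey E1"
    using e[of Ey Ex E1] unfolding nine.tr3_c tr3_i12_at sgl_at tr3c\<gamma>_at Z_def[symmetric] by simp
  \<comment> \<open>The norm has the coordinate l at y, x, 1 and 0 at x, y, 1; their difference is 3
    times a difference of coordinates of \<open>Z\<close>.\<close>
  have "l = l - 0" by simp
  also have "\<dots> = (Z Ey Ex E1 - Z Ex Ey E1) + (Z Ey Ex E1 - Z Ex Ey E1) + (Z Ey Ex E1 - Z Ex Ey E1)"
    unfolding 2 1 by (simp only: algebra_simps)
  finally show "\<exists>h. l = h + h + h" by blast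
qed

subsection \<open>Reduction of coefficients\<close>

lemma nth_mult2:
  "fps_nth (fps_nth (f * g) a) b = (\<Sum>i=0..a. \<Sum>l=0..b. fps_nth (fps_nth f i) l * fps_nth (fps_nth g (a - i)) (b - l))"
  for f g :: "'a::comm_ring_1 fps fps"
  by (simp add: fps_mult_nth fps_sum_nth)

definition map2 :: "('a::comm_ring_1 \<Rightarrow> 'b::comm_ring_1) \<Rightarrow> 'a fps fps \<Rightarrow> 'b fps fps" where
  "map2 h f = Abs_fps (\<lambda>a. Abs_fps (\<lambda>b. h (fps_nth (fps_nth f a) b)))"

lemma map2_nth: "fps_nth (fps_nth (map2 h f) a) b = h (fps_nth (fps_nth f a) b)"
  by (simp add: map2_def)

lemma fps2_eqI: "(\<And>a b. fps_nth (fps_nth f a) b = fps_nth (fps_nth g a) b) \<Longrightarrow> f = g"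
  by (intro fps_ext) simp

lemma map2_hom:
  assumes "\<And>x y. h (x + y) = h x + h y" "\<And>x y. h (x * y) = h x * h y" "h 1 = 1"
  shows "map2 h (f + g) = map2 h f + map2 h g" "map2 h (f * g) = map2 h f * map2 h g" "map2 h 1 = 1" "map2 h 0 = 0"
    "map2 h 3 = 3" "map2 h (- f) = - map2 h f" "map2 h (f - g) = map2 h f - map2 h g"
    "map2 h fps_X = fps_X" "map2 h (fps_const fps_X) = fps_const fps_X"
proof -
  have 0: "h 0 = 0" using assms(1)[of 0 0] by simp
  have s: "h (\<Sum>i\<in>A. g i) = (\<Sum>i\<in>A. h (g i))" for g :: "nat \<Rightarrow> 'a" and A
    by (induction A rule: infinite_finite_induct) (simp_all add: 0 assms(1))
  show add: "map2 h (f + g) = map2 h f + map2 h g" for f g by (rule fps2_eqI) (simp add: map2_nth assms(1))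
  show "map2 h (f * g) = map2 h f * map2 h g"
    by (rule fps2_eqI) (simp only: map2_nth nth_mult2 s assms(2))
  show one: "map2 h 1 = 1" by (rule fps2_eqI) (simp add: map2_nth 0 assms(3) fps_one_nth)
  show zero: "map2 h 0 = 0" by (rule fps2_eqI) (simp add: map2_nth 0)
  have "(3 :: 'a fps fps) = 1 + 1 + 1" "(3 :: 'b fps fps) = 1 + 1 + 1" by simp_all
  thus "map2 h 3 = 3" by (simp only: add one)
  have "map2 h f + map2 h (- f) = 0" for f by (simp only: add[symmetric] right_minus zero)
  hence m: "map2 h (- f) = - map2 h f" for f by (metis minus_unique)
  show "map2 h (- f) = - map2 h f" by (rule m)
  show "map2 h (f - g) = map2 h f - map2 h g" by (simp only: diff_conv_add_uminus add m)
  show "map2 h fps_X = fps_X" by (rule fps2_eqI) (simp add: map2_nth 0 assms(3) fps_X_def fps_one_nth)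
  show "map2 h (fps_const fps_X) = fps_const fps_X" by (rule fps2_eqI) (simp add: map2_nth 0 assms(3) fps_X_def)
qed

text \<open>The coefficient sum sets \<open>b\<^sub>1\<close> and \<open>s\<^sub>3\<close> to 1, like the model \<open>N\<close> does.\<close>

definition coef_sum :: "((int \<times> int) \<Rightarrow>\<^sub>0 'a::comm_ring_1) \<Rightarrow> 'a" where
  "coef_sum p = (\<Sum>k\<in>Poly_Mapping.keys p. Poly_Mapping.lookup p k)"

lemma coef_sum_superset:
  "finite A \<Longrightarrow> Poly_Mapping.keys p \<subseteq> A \<Longrightarrow> coef_sum p = (\<Sum>k\<in>A. Poly_Mapping.lookup p k)"
  unfolding coef_sum_def by (rule sum.mono_neutral_left) (auto simp: in_keys_iff)

lemma coef_sum_single: "coef_sum (Poly_Mapping.single k w) = w"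
  by (subst coef_sum_superset[of "{k}"]) auto

lemma coef_sum_add: "coef_sum (p + q) = coef_sum p + coef_sum q"
proof -
  let ?A = "Poly_Mapping.keys p \<union> Poly_Mapping.keys q"
  show ?thesis
    by (subst (1 2 3) coef_sum_superset[where A = ?A])
       (use Poly_Mapping.keys_add[of p q] in \<open>auto simp: lookup_add sum.distrib\<close>)
qed

lemma coef_sum_sum: "coef_sum (\<Sum>i\<in>A. g i) = (\<Sum>i\<in>A. coef_sum (g i))"
  by (induction A rule: infinite_finite_induct) (simp_all add: coef_sum_add, simp_all add: coef_sum_def)

lemma coef_sum_mult: "coef_sum (p * q) = coef_sum p * coef_sum q"
proof -
  have sum: "p = (\<Sum>e\<in>Poly_Mapping.keys p. Poly_Mapping.single e (Poly_Mapping.lookup p e))" for p :: "(int \<times> int) \<Rightarrow>\<^sub>0 'a"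
    by (rule poly_mapping_eqI) (auto simp: lookup_sum lookup_single when_def in_keys_iff sum.delta)
  have "p * q = (\<Sum>e\<in>Poly_Mapping.keys p. \<Sum>e'\<in>Poly_Mapping.keys q.
      Poly_Mapping.single (e + e') (Poly_Mapping.lookup p e * Poly_Mapping.lookup q e'))"
    by (subst sum[of p], subst sum[of q]) (simp add: sum_product mult_single)
  thus ?thesis
    by (simp add: coef_sum_sum coef_sum_single coef_sum_def[of p] coef_sum_def[of q] sum_product)
qed

lemma coef_sum_1: "coef_sum 1 = 1"
  by (simp add: coef_sum_single flip: single_one)

section \<open>Comparison of homogeneous elements of S with power series over W\<close>

abbreviation collapse :: "'w::strict_3_ring S \<Rightarrow> 'w W9 fps fps" where "collapse \<equiv> map2 coef_sum"
abbreviation red :: "'w::strict_3_ring U \<Rightarrow> 'w W9 fps fps" where "red \<equiv> map2 abs_W9"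

lemmas collapse_hom = map2_hom[OF coef_sum_add coef_sum_mult coef_sum_1]
lemmas red_hom = map2_hom[of abs_W9, OF plus_W9.abs_eq[symmetric] times_W9.abs_eq[symmetric] one_W9.abs_eq[symmetric]]

lemma nth_9: "fps_nth (fps_nth (9 * f) a) b = 9 * fps_nth (fps_nth f a) b" for f :: "'w::comm_ring_1 U"
proof -
  have 9: "(9 :: 'w U) = 3 * 3" "(9 :: 'w) = 3 * 3" by simp_all
  show ?thesis unfolding 9 mult.assoc nth_3 ..
qed

lemma red_eq: "red f = red g \<longleftrightarrow> (\<exists>h. f = g + 9 * h)"
proof
  assume "red f = red g"
  hence "fps_nth (fps_nth (red f) a) b = fps_nth (fps_nth (red g) a) b" for a b by (simp only:)
  hence "9 dvd fps_nth (fps_nth f a) b - fps_nth (fps_nth g a) b" for a b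
    unfolding map2_nth by (simp add: W9.abs_eq_iff)
  then obtain h where h: "fps_nth (fps_nth f a) b - fps_nth (fps_nth g a) b = 9 * h a b" for a b
    unfolding dvd_def by metis
  have "f = g + 9 * Abs_fps (\<lambda>a. Abs_fps (\<lambda>b. h a b))"
    by (rule fps2_eqI) (simp only: fps_add_nth nth_9 fps_nth_Abs_fps h[symmetric], simp)
  thus "\<exists>h. f = g + 9 * h" ..
next
  assume "\<exists>h. f = g + 9 * h"
  then obtain h where h: "f = g + 9 * h" by blast
  show "red f = red g"
  proof (rule fps2_eqI)
    fix a b
    have "9 dvd fps_nth (fps_nth f a) b - fps_nth (fps_nth g a) b" unfolding h fps_add_nth nth_9 by simp
    thus "fps_nth (fps_nth (red f) a) b = fps_nth (fps_nth (red g) a) b"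
      unfolding map2_nth by (simp add: W9.abs_eq_iff)
  qed
qed

text \<open>The representatives are those used by \<open>S_cochain\<close>, so this is the power
  series by which that cochain acts on \<open>N\<close>, see \<open>Lam_S_cochain\<close>. It
  respects sums and products only modulo 9.\<close>

definition liftS :: "'w::strict_3_ring S \<Rightarrow> 'w U" where
  "liftS f = Abs_fps (\<lambda>a. Abs_fps (\<lambda>b. \<Sum>k\<in>Poly_Mapping.keys (fps_nth (fps_nth f a) b). rep_W9 (Poly_Mapping.lookup (fps_nth (fps_nth f a) b) k)))"

lemma abs_rep_W9: "abs_W9 (rep_W9 x) = x"
  by (rule Quotient_abs_rep[OF Quotient_W9])

lemma abs_W9_sum: "abs_W9 (\<Sum>i\<in>A. g i) = (\<Sum>i\<in>A. abs_W9 (g i))"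
  by (induction A rule: infinite_finite_induct) (simp_all add: plus_W9.abs_eq[symmetric], simp_all add: zero_W9_def)

lemma red_liftS: "red (liftS f) = collapse f"
  by (rule fps2_eqI) (simp only: map2_nth liftS_def fps_nth_Abs_fps abs_W9_sum abs_rep_W9 coef_sum_def)

text \<open>A section of \<open>liftS\<close> modulo 9 on the elements of bidegree \<open>(p, l)\<close>.\<close>

definition unlift :: "int \<Rightarrow> int \<Rightarrow> 'w::strict_3_ring U \<Rightarrow> 'w S" where
  "unlift p l f = Abs_fps (\<lambda>a. Abs_fps (\<lambda>b. if 18 dvd (- 6 * int a - 12 * int b - l)
     then Poly_Mapping.single (p div 2, (- 6 * int a - 12 * int b - l) div 18) (abs_W9 (fps_nth (fps_nth f a) b)) else 0))"

lemma unlift_deg: "even p \<Longrightarrow> unlift p l f \<in> S_deg p l"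
  by (auto simp: S_deg_def unlift_def lookup_single when_def split: if_splits)

lemma unlift_zero: "unlift p l 0 = 0"
  by (rule fps2_eqI) (simp add: unlift_def flip: zero_W9_def)

lemma unlift_add: "unlift p l (f + g) = unlift p l f + unlift p l g"
  by (rule fps2_eqI) (simp add: unlift_def plus_W9.abs_eq[symmetric] single_add)

lemma collapse_unlift:
  assumes "\<And>a b. \<not> 18 dvd (- 6 * int a - 12 * int b - l) \<Longrightarrow> fps_nth (fps_nth f a) b = 0"
  shows "collapse (unlift p l f) = red f"
proof (rule fps2_eqI)
  fix a b
  show "fps_nth (fps_nth (collapse (unlift p l f)) a) b = fps_nth (fps_nth (red f) a) b"
    unfolding map2_nth unlift_def fps_nth_Abs_fps using assms[of a b]
    by (simp add: coef_sum_single) (simp add: coef_sum_def flip: zero_W9_def)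
qed

lemma unlift_mult: "unlift p l (t1 * f) = S_s1 * unlift p (l + 6) f" "unlift p l (t2 * f) = S_s2 * unlift p (l + 12) f"
    "unlift p l (3 * f) = 3 * unlift p l f"
proof -
  have e: "- 6 * int (Suc a) - 12 * int b - l = - 6 * int a - 12 * int b - (l + 6)"
    "- 6 * int a - 12 * int (Suc b) - l = - 6 * int a - 12 * int b - (l + 12)" for a b by simp_all
  show "unlift p l (t1 * f) = S_s1 * unlift p (l + 6) f"
  proof (rule fps2_eqI)
    fix a b show "fps_nth (fps_nth (unlift p l (t1 * f)) a) b = fps_nth (fps_nth (S_s1 * unlift p (l + 6) f) a) b"
      by (cases a) (simp_all only: unlift_def fps_nth_Abs_fps nth_t2 e nat.case fps_zero_nth zero_W9_def[symmetric] single_zero if_cancel)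
  qed
  show "unlift p l (t2 * f) = S_s2 * unlift p (l + 12) f"
  proof (rule fps2_eqI)
    fix a b show "fps_nth (fps_nth (unlift p l (t2 * f)) a) b = fps_nth (fps_nth (S_s2 * unlift p (l + 12) f) a) b"
      by (cases b) (simp_all only: unlift_def fps_nth_Abs_fps nth_t2 e fps_zero_nth zero_W9_def[symmetric] single_zero if_cancel)
  qed
  have "(3 :: 'a U) * f = f + f + f" "(3 :: 'a S) * unlift p l f = unlift p l f + unlift p l f + unlift p l f"
    by (simp_all add: algebra_simps)
  thus "unlift p l (3 * f) = 3 * unlift p l f" by (simp only: unlift_add)
qed

lemma unlift_9: "unlift p l (9 * f) = 0"
proof (rule fps2_eqI)
  fix a b
  have "abs_W9 (9 * fps_nth (fps_nth f a) b) = 0" unfolding zero_W9_def by (simp add: W9.abs_eq_iff)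
  thus "fps_nth (fps_nth (unlift p l (9 * f)) a) b = fps_nth (fps_nth 0 a) b"
    unfolding unlift_def fps_nth_Abs_fps nth_9 by simp
qed

text \<open>The bidegree determines, for every monomial in s1 and s2, the exponents of b1 and s3.
  Hence setting both to 1 loses nothing on homogeneous elements.\<close>

lemma S_deg_key: "f \<in> S_deg p l \<Longrightarrow> Poly_Mapping.lookup (fps_nth (fps_nth f a) b) k \<noteq> 0 \<Longrightarrow>
   even p \<and> 18 dvd (- 6 * int a - 12 * int b - l) \<and> k = (p div 2, (- 6 * int a - 12 * int b - l) div 18)"
proof (cases k)
  case (Pair j c)
  assume "f \<in> S_deg p l" "Poly_Mapping.lookup (fps_nth (fps_nth f a) b) k \<noteq> 0"
  hence 1: "2 * j = p" "- 6 * int a - 12 * int b - 18 * c = l" unfolding Pair S_deg_def by auto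
  have "p = 2 * j" "- 6 * int a - 12 * int b - l = 18 * c" using 1 by simp_all
  thus ?thesis unfolding Pair by simp
qed

lemma unlift_liftS:
  assumes f: "f \<in> S_deg p l"
  shows "unlift p l (liftS f) = f"
proof (rule fps2_eqI, rule poly_mapping_eqI)
  fix a b k
  let ?c = "fps_nth (fps_nth f a) b" and ?k = "(p div 2, (- 6 * int a - 12 * int b - l) div 18)"
  have key: "k \<in> Poly_Mapping.keys ?c \<Longrightarrow> k = ?k \<and> 18 dvd (- 6 * int a - 12 * int b - l)" for k
    using S_deg_key[OF f, of a b k] by (simp add: in_keys_iff)
  have "abs_W9 (fps_nth (fps_nth (liftS f) a) b) = coef_sum ?c"
    using arg_cong[OF red_liftS[of f], of "\<lambda>g. fps_nth (fps_nth g a) b"] by (simp only: map2_nth)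
  also have "\<dots> = Poly_Mapping.lookup ?c ?k"
  proof -
    have "Poly_Mapping.keys ?c \<subseteq> {?k}" using key by blast
    from coef_sum_superset[OF _ this] show ?thesis by (simp del: minus_mult_minus mult_minus_left)
  qed
  finally show "Poly_Mapping.lookup (fps_nth (fps_nth (unlift p l (liftS f)) a) b) k = Poly_Mapping.lookup ?c k"
    using key[of k] key[of ?k] unfolding unlift_def fps_nth_Abs_fps
    by (auto simp: lookup_single when_def in_keys_iff)
qed

lemma S_deg_odd: "f \<in> S_deg p l \<Longrightarrow> odd p \<or> odd l \<Longrightarrow> f = 0"
proof (rule fps2_eqI, rule poly_mapping_eqI)
  fix a b k assume f: "f \<in> S_deg p l" and o: "odd p \<or> odd l"
  have "even l" if "18 dvd (- 6 * int a - 12 * int b - l)"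
  proof -
    have "even (- 6 * int a - 12 * int b - l)" using dvd_trans[OF _ that, of 2] by simp
    thus ?thesis by simp
  qed
  thus "Poly_Mapping.lookup (fps_nth (fps_nth f a) b) k = Poly_Mapping.lookup (fps_nth (fps_nth 0 a) b) k"
    using S_deg_key[OF f, of a b k] o by auto
qed

lemma S_deg_closed: "0 \<in> S_deg p l" "f \<in> S_deg p l \<Longrightarrow> g \<in> S_deg p l \<Longrightarrow> f + g \<in> S_deg p l"
    "f \<in> S_deg p l \<Longrightarrow> - f \<in> S_deg p l"
    "f \<in> S_deg p l \<Longrightarrow> g \<in> S_deg p' l' \<Longrightarrow> f * g \<in> S_deg (p + p') (l + l')"
proof -
  show "0 \<in> S_deg p l" by (simp add: S_deg_def)
  show "f \<in> S_deg p l \<Longrightarrow> g \<in> S_deg p l \<Longrightarrow> f + g \<in> S_deg p l"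
    unfolding S_deg_def by (simp add: lookup_add) (metis add.right_neutral)
  show "f \<in> S_deg p l \<Longrightarrow> - f \<in> S_deg p l"
    unfolding S_deg_def by simp
  assume f: "f \<in> S_deg p l" and g: "g \<in> S_deg p' l'"
  show "f * g \<in> S_deg (p + p') (l + l')"
    unfolding S_deg_def
  proof (intro CollectI allI impI)
    fix a b j c
    let ?g = "\<lambda>i m. fps_nth (fps_nth f i) m * fps_nth (fps_nth g (a - i)) (b - m)"
    assume "Poly_Mapping.lookup (fps_nth (fps_nth (f * g) a) b) (j, c) \<noteq> 0"
    hence "(\<Sum>i=0..a. \<Sum>m=0..b. Poly_Mapping.lookup (?g i m) (j, c)) \<noteq> 0"
      unfolding nth_mult2 lookup_sum .
    then obtain i m where im: "i \<le> a" "m \<le> b" "Poly_Mapping.lookup (?g i m) (j, c) \<noteq> 0"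
      by (metis (no_types, lifting) atLeastAtMost_iff sum.neutral)
    hence "(j, c) \<in> Poly_Mapping.keys (?g i m)" by (simp add: in_keys_iff)
    then obtain k k' where k: "k \<in> Poly_Mapping.keys (fps_nth (fps_nth f i) m)"
        "k' \<in> Poly_Mapping.keys (fps_nth (fps_nth g (a - i)) (b - m))" "(j, c) = k + k'"
      using keys_mult[of "fps_nth (fps_nth f i) m" "fps_nth (fps_nth g (a - i)) (b - m)"] by blast
    obtain j1 c1 j2 c2 where [simp]: "k = (j1, c1)" "k' = (j2, c2)" by (cases k, cases k')
    have "2 * j1 = p \<and> - 6 * int i - 12 * int m - 18 * c1 = l"
      using f k(1) unfolding S_deg_def in_keys_iff by simp
    moreover have "2 * j2 = p' \<and> - 6 * int (a - i) - 12 * int (b - m) - 18 * c2 = l'"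
      using g k(2) unfolding S_deg_def in_keys_iff by simp
    ultimately show "2 * j = p + p' \<and> - 6 * int a - 12 * int b - 18 * c = l + l'"
      using k(3) im(1,2) by (simp add: of_nat_diff)
  qed
qed

subsection \<open>The cochains of coefficients\<close>

definition S_seq :: "'w::strict_3_ring S \<Rightarrow> nat \<Rightarrow> 'w Mloc" where
  "S_seq f k = (\<Sum>(a, b) | a + b < k. \<Sum>(j, c)\<in>Poly_Mapping.keys (fps_nth (fps_nth f a) b).
       mfrac (M_const (rep_W9 (Poly_Mapping.lookup (fps_nth (fps_nth f a) b) (j, c))) * s1 ^ a * s2 ^ b) 0 * s3_pow c)"

lemma S_cochain_seq: "S_cochain f = abs_Mhat (S_seq f)"
  unfolding S_cochain_def S_seq_def ..

lemma finite_ab: "finite {(a, b). a + b < (k :: nat)}"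
  by (rule finite_subset[of _ "{..<k} \<times> {..<k}"]) auto

lemma coherent_S_seq: "coherent (S_seq (f :: 'w::strict_3_ring S))"
  unfolding coherent_def
proof
  fix k
  define T where "T = (\<lambda>(a, b). \<Sum>(j, c)\<in>Poly_Mapping.keys (fps_nth (fps_nth f a) b).
       mfrac (M_const (rep_W9 (Poly_Mapping.lookup (fps_nth (fps_nth f a) b) (j, c))) * s1 ^ a * s2 ^ b) 0 * s3_pow c :: 'w Mloc)"
  have s: "S_seq f k = sum T {(a, b). a + b < k}" for k unfolding S_seq_def T_def ..
  have "sum T {(a, b). a + b < Suc k} - sum T {(a, b). a + b < k} = sum T ({(a, b). a + b < Suc k} - {(a, b). a + b < k})"
    by (subst sum_diff[OF finite_ab]) auto
  also have "\<dots> \<in> ideal_pow I_loc k"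
  proof (rule ideal_pow_sum)
    fix i assume "i \<in> {(a, b). a + b < Suc k} - {(a, b). a + b < k}"
    then obtain a b where i: "i = (a, b)" and k: "k = a + b" by force
    have st: "mfrac s1 0 ^ a * mfrac s2 0 ^ b \<in> ideal_pow (I_loc :: 'w Mloc set) k"
      unfolding k by (intro ideal_pow_mult_add ideal_pow_power I_locI I_M_s)
    have "mfrac (M_const w * s1 ^ a * s2 ^ b) 0 * s3_pow c \<in> ideal_pow I_loc k" for w :: 'w and c
    proof -
      have "mfrac (M_const w * s1 ^ a * s2 ^ b) 0 * s3_pow c = (mfrac (M_const w) 0 * s3_pow c) * (mfrac s1 0 ^ a * mfrac s2 0 ^ b)"
        by (simp only: mfrac0_simps mfrac0_power mult.assoc mult.commute mult.left_commute)
      thus ?thesis using ideal_pow_mult[OF st] by (simp only:)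
    qed
    thus "T i \<in> ideal_pow I_loc k" unfolding i T_def by (auto intro!: ideal_pow_sum)
  qed
  finally show "S_seq f (Suc k) - S_seq f k \<in> ideal_pow I_loc k" unfolding s .
qed

definition trunc :: "nat \<Rightarrow> 'w::comm_ring_1 U \<Rightarrow> 'w U" where
  "trunc k f = (\<Sum>(a, b) | a + b < k. fps_const (fps_const (fps_nth (fps_nth f a) b)) * t1 ^ a * t2 ^ b)"

lemma nth_monomial: "fps_nth (fps_nth (fps_const (fps_const w) * t1 ^ a * t2 ^ b) a') b' = (if a' = a \<and> b' = b then w else 0)"
proof -
  have "t2 ^ b = (fps_const (fps_X ^ b) :: 'a U)" by (induction b) (simp_all flip: fps_const_mult)
  hence e: "fps_const (fps_const w) * t1 ^ a * t2 ^ b = fps_const (fps_const w * fps_X ^ b) * t1 ^ a"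
    by (simp add: mult_ac flip: fps_const_mult)
  show ?thesis unfolding e by (simp add: fps_X_power_iff)
qed

lemma fps_sum_nth2: "fps_nth (fps_nth (\<Sum>i\<in>A. g i) a) b = (\<Sum>i\<in>A. fps_nth (fps_nth (g i) a) b)"
  by (simp add: fps_sum_nth)

lemma WU_trunc: "WU k (trunc k f - f)"
  unfolding WU_def
proof (intro allI)
  fix a b
  have "fps_nth (fps_nth (trunc k f) a) b = (\<Sum>i\<in>{(a', b'). a' + b' < k}. if i = (a, b) then fps_nth (fps_nth f a) b else 0)"
    unfolding trunc_def fps_sum_nth2
  proof (intro sum.cong refl)
    fix i :: "nat \<times> nat"
    obtain a' b' where i: "i = (a', b')" by (cases i)
    show "fps_nth (fps_nth (case i of (a, b) \<Rightarrow> fps_const (fps_const (fps_nth (fps_nth f a) b)) * t1 ^ a * t2 ^ b) a) b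
      = (if i = (a, b) then fps_nth (fps_nth f a) b else 0)"
      unfolding i prod.case nth_monomial prod.inject by (cases "a = a' \<and> b = b'") auto
  qed
  also have "\<dots> = (if a + b < k then fps_nth (fps_nth f a) b else 0)"
    by (subst sum.delta[OF finite_ab]) simp
  finally show "3 ^ (k - (a + b)) dvd fps_nth (fps_nth (trunc k f - f) a) b" by simp
qed

lemma copU_sum: "copU (\<Sum>i\<in>A. g i) = (\<Sum>i\<in>A. copU (g i))"
proof -
  have "copU 0 + copU 0 = copU (0 :: 'a U) + 0" by (simp add: copU_hom(1)[symmetric])
  hence "copU (0 :: 'a U) = 0" by (simp only: add_left_cancel)
  thus ?thesis by (induction A rule: infinite_finite_induct) (simp_all add: copU_hom)
qed

lemma Mloc_hom_S_seq: "Mloc_hom (S_seq f k) = copU (trunc k (liftS f))"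
proof -
  have p: "copU t ^ n = copU (t ^ n)" for t :: "'a U" and n by (induction n) (simp_all add: copU_hom)
  have c: "fps_const (fps_const (\<Sum>i\<in>A. g i)) = (\<Sum>i\<in>A. fps_const (fps_const (g i)))" for g :: "int \<times> int \<Rightarrow> 'a" and A
    by (induction A rule: infinite_finite_induct) (simp_all flip: fps_const_add)
  have "Mloc_hom (mfrac (M_const w * s1 ^ a * s2 ^ b) 0 * s3_pow c) = copU (fps_const (fps_const w) * t1 ^ a * t2 ^ b)" for w :: 'a and a b c
    by (simp only: Mloc_hom_simps Mloc_hom_mfrac Mloc_hom_s3_pow M_hom_simps M_hom_const M_hom_power M_hom_s copW_def p copU_hom mult_1_right)
  hence "Mloc_hom (S_seq f k) = (\<Sum>(a, b) | a + b < k. \<Sum>(j, c)\<in>Poly_Mapping.keys (fps_nth (fps_nth f a) b).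
      copU (fps_const (fps_const (rep_W9 (Poly_Mapping.lookup (fps_nth (fps_nth f a) b) (j, c)))) * t1 ^ a * t2 ^ b))"
    unfolding S_seq_def Mloc_hom_sum by (simp add: case_prod_unfold Mloc_hom_sum)
  also have "\<dots> = copU (trunc k (liftS f))"
    unfolding trunc_def copU_sum liftS_def fps_nth_Abs_fps c by (simp add: case_prod_unfold sum_distrib_right copU_sum)
  finally show ?thesis .
qed

lemma Lam_S_cochain: "Lam (S_cochain f * \<alpha>) = nsc (liftS f) (Lam \<alpha>)"
proof -
  obtain a where a: "coherent a" "\<alpha> = abs_Mhat a" by (metis Mhat_cases)
  have n: "nsc f u - nsc g u = nsc (f - g) u" for f g :: "'a U" and u
    by (intro ext) (simp add: nsc_def usc_def left_diff_distrib)
  have "Lm (\<lambda>k. S_seq f k * a k) (nsc (liftS f) (Lam \<alpha>))"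
    unfolding Lm_def
  proof
    fix k
    have "Rho (S_seq f (73 * k) * a (73 * k)) = nsc (trunc (73 * k) (liftS f)) (Rho (a (73 * k)))"
      by (simp only: Rho_def Mloc_hom_simps Mloc_hom_S_seq ap_simps copU.rep_eq)
    moreover have "X - Z = (X - Y) + (Y - Z)" for X Y Z :: "'a N" by simp
    ultimately have e: "Rho (S_seq f (73 * k) * a (73 * k)) - nsc (liftS f) (Lam \<alpha>)
        = nsc (trunc (73 * k) (liftS f) - liftS f) (Rho (a (73 * k))) + nsc (liftS f) (Rho (a (73 * k)) - Lam \<alpha>)"
      unfolding n[symmetric] nsc_diff by (simp only:)
    have "W (73 * k + 0) (nsc (trunc (73 * k) (liftS f) - liftS f) (Rho (a (73 * k))))"
      by (intro W_nsc WU_trunc) (simp add: W_def)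
    hence 1: "W k (nsc (trunc (73 * k) (liftS f) - liftS f) (Rho (a (73 * k))))" by (rule W_mono) simp
    have "W (0 + k) (nsc (liftS f) (Rho (a (73 * k)) - Lam \<alpha>))"
      using Lam_Lm[OF a(1)] by (intro W_nsc WU_0') (simp add: Lm_def a)
    with 1 show "W k (Rho (S_seq f (73 * k) * a (73 * k)) - nsc (liftS f) (Lam \<alpha>))" unfolding e by (intro W_add) simp_all
  qed
  from Lam_eqI[OF coherent_mult[OF coherent_S_seq a(1)] this] show ?thesis
    unfolding S_cochain_seq a(2) abs_Mhat_simps(2)[OF coherent_S_seq a(1)] .
qed

lemma Mhat_deg_closed: "0 \<in> (Mhat_deg n :: 'w Mhat set)" "(\<alpha> :: 'w::strict_3_ring Mhat) \<in> Mhat_deg n \<Longrightarrow> \<beta> \<in> Mhat_deg n \<Longrightarrow> \<alpha> + \<beta> \<in> Mhat_deg n"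
    "\<alpha> \<in> Mhat_deg n \<Longrightarrow> \<beta> \<in> Mhat_deg m \<Longrightarrow> \<alpha> * \<beta> \<in> Mhat_deg (n + m)" "\<alpha> \<in> Mhat_deg n \<Longrightarrow> - \<alpha> \<in> Mhat_deg n"
    "\<alpha> \<in> Mhat_deg n \<Longrightarrow> \<gamma>_hat \<alpha> \<in> Mhat_deg n" "(x :: 'w M) \<in> M_deg n \<Longrightarrow> hat_of_M x \<in> Mhat_deg n"
    "\<alpha> \<in> Mhat_deg n \<Longrightarrow> \<beta> \<in> Mhat_deg n \<Longrightarrow> \<alpha> - \<beta> \<in> Mhat_deg n"
proof -
  show 0: "0 \<in> (Mhat_deg n :: 'w Mhat set)"
    unfolding Mhat_deg_def zero_Mhat_def using coherent_const Mloc_deg_zero by (auto intro!: exI[of _ "\<lambda>_. 0"])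
  show "x \<in> M_deg n \<Longrightarrow> hat_of_M x \<in> Mhat_deg n"
    unfolding Mhat_deg_def hat_of_M_def using coherent_const M_deg_Mloc_deg by blast
  have m1: "- s \<in> Mloc_deg n" if "s \<in> Mloc_deg n" for s :: "'w Mloc" and n
    using Mloc_deg_mult[OF M_deg_Mloc_deg[OF M_deg_const[of "- 1"]] that] by (simp add: M_const_simps mfrac0_simps)
  have g: "\<gamma>_loc s \<in> Mloc_deg n" if s: "s \<in> Mloc_deg n" for s :: "'w Mloc" and n
  proof -
    obtain x k where x: "s = mfrac x k" "x \<in> M_deg (n - 18 * int k)" using s unfolding Mloc_deg_def by blast
    have "\<gamma>_loc s = mfrac (\<gamma> x) k" by (simp only: x \<gamma>_loc_simps)
    thus ?thesis unfolding Mloc_deg_def using M_deg_\<gamma>[OF x(2)] by blast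
  qed
  show add: "\<alpha> \<in> Mhat_deg n \<Longrightarrow> \<beta> \<in> Mhat_deg n \<Longrightarrow> \<alpha> + \<beta> \<in> Mhat_deg n" for \<alpha> \<beta> :: "'w Mhat"
  proof -
    assume "\<alpha> \<in> Mhat_deg n" "\<beta> \<in> Mhat_deg n"
    then obtain a b where ab: "coherent a" "\<And>k. a k \<in> Mloc_deg n" "\<alpha> = abs_Mhat a" "coherent b" "\<And>k. b k \<in> Mloc_deg n" "\<beta> = abs_Mhat b"
      by (metis Mhat_deg_cases)
    have "\<alpha> + \<beta> = abs_Mhat (\<lambda>k. a k + b k)" by (simp only: ab abs_Mhat_simps)
    thus ?thesis unfolding Mhat_deg_def using coherent_add[OF ab(1,4)] Mloc_deg_add[OF ab(2,5)] by blast
  qed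
  show "\<alpha> \<in> Mhat_deg n \<Longrightarrow> \<beta> \<in> Mhat_deg m \<Longrightarrow> \<alpha> * \<beta> \<in> Mhat_deg (n + m)"
  proof -
    assume "\<alpha> \<in> Mhat_deg n" "\<beta> \<in> Mhat_deg m"
    then obtain a b where ab: "coherent a" "\<And>k. a k \<in> Mloc_deg n" "\<alpha> = abs_Mhat a" "coherent b" "\<And>k. b k \<in> Mloc_deg m" "\<beta> = abs_Mhat b"
      by (metis Mhat_deg_cases)
    have "\<alpha> * \<beta> = abs_Mhat (\<lambda>k. a k * b k)" by (simp only: ab abs_Mhat_simps)
    thus ?thesis unfolding Mhat_deg_def using coherent_mult[OF ab(1,4)] Mloc_deg_mult[OF ab(2,5)] by blast
  qed
  show min: "\<alpha> \<in> Mhat_deg n \<Longrightarrow> - \<alpha> \<in> Mhat_deg n" for \<alpha> :: "'w Mhat"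
  proof -
    assume "\<alpha> \<in> Mhat_deg n"
    then obtain a where a: "coherent a" "\<And>k. a k \<in> Mloc_deg n" "\<alpha> = abs_Mhat a" by (metis Mhat_deg_cases)
    have "- \<alpha> = abs_Mhat (\<lambda>k. - a k)" unfolding a(3) by (rule abs_Mhat_simps(3)[OF a(1) a(1)])
    thus ?thesis unfolding Mhat_deg_def using coherent_uminus[OF a(1)] m1[OF a(2)] by blast
  qed
  show "\<alpha> \<in> Mhat_deg n \<Longrightarrow> \<gamma>_hat \<alpha> \<in> Mhat_deg n"
  proof -
    assume "\<alpha> \<in> Mhat_deg n"
    then obtain a where a: "coherent a" "\<And>k. a k \<in> Mloc_deg n" "\<alpha> = abs_Mhat a" by (metis Mhat_deg_cases)
    have "\<gamma>_hat \<alpha> = abs_Mhat (\<lambda>k. \<gamma>_loc (a k))" unfolding a(3) by (rule abs_Mhat_simps(4)[OF a(1) a(1)])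
    thus ?thesis unfolding Mhat_deg_def using coherent_\<gamma>[OF a(1)] g[OF a(2)] by blast
  qed
  show "\<alpha> \<in> Mhat_deg n \<Longrightarrow> \<beta> \<in> Mhat_deg n \<Longrightarrow> \<alpha> - \<beta> \<in> Mhat_deg n"
    unfolding diff_conv_add_uminus by (intro add min)
qed

lemma Mloc_deg_sum: "(\<And>i. i \<in> A \<Longrightarrow> g i \<in> Mloc_deg n) \<Longrightarrow> (\<Sum>i\<in>A. g i) \<in> Mloc_deg n"
  by (induction A rule: infinite_finite_induct) (simp_all add: Mloc_deg_zero Mloc_deg_add)

lemma S_cochain_deg:
  assumes f: "f \<in> S_deg p l"
  shows "S_cochain f \<in> Mhat_deg l"
proof -
  have "S_seq f k \<in> Mloc_deg l" for k
    unfolding S_seq_def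
  proof (rule Mloc_deg_sum, clarsimp, rule Mloc_deg_sum, clarsimp)
    fix a b j c assume "(j, c) \<in> Poly_Mapping.keys (fps_nth (fps_nth f a) b)"
    hence "- 6 * int a - 12 * int b - 18 * c = l" using f by (simp add: in_keys_iff S_deg_def)
    hence l: "0 + int a * - 6 + int b * - 12 + - 18 * c = l" by simp
    show "mfrac (M_const (rep_W9 (Poly_Mapping.lookup (fps_nth (fps_nth f a) b) (j, c))) * s1 ^ a * s2 ^ b) 0 * s3_pow c \<in> Mloc_deg l"
      by (rule Mloc_deg_eq[OF _ l]) (intro Mloc_deg_mult M_deg_Mloc_deg M_deg_mult M_deg_const M_deg_power M_deg_s Mloc_deg_s3_pow)
  qed
  thus ?thesis unfolding S_cochain_seq Mhat_deg_def using coherent_S_seq by blast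
qed

lemma S_cochain_0: "S_cochain 0 = (0 :: 'w::strict_3_ring Mhat)"
proof -
  have "S_seq (0 :: 'w S) = (\<lambda>_. 0)" by (simp add: S_seq_def fun_eq_iff case_prod_unfold)
  thus ?thesis by (simp add: S_cochain_seq zero_Mhat_def)
qed

subsection \<open>Homogeneous parts\<close>

definition hpart :: "int \<Rightarrow> 'w::comm_ring_1 N \<Rightarrow> 'w N" where
  "hpart n u = mkN (\<lambda>i. if 9 dvd (n - dgi i) then cf u i else 0)"

lemma cf_hpart: "cf (hpart n u) i = (if 9 dvd (n - dgi i) then cf u i else 0)"
  by (simp add: hpart_def cf_mkN)

lemma NG_hpart: "NG n (hpart n u)"
  by (simp add: NG_def cf_hpart)

lemma hpart_NG: "NG n u \<Longrightarrow> hpart n u = u"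
  by (rule cf_eqI) (auto simp: NG_def cf_hpart)

lemma hpart_NG_other: "NG m u \<Longrightarrow> \<not> 9 dvd (n - m) \<Longrightarrow> hpart n u = 0"
proof (rule cf_eqI)
  fix i assume u: "NG m u" and nm: "\<not> 9 dvd (n - m)"
  have "\<not> 9 dvd (m - dgi i)" if "9 dvd (n - dgi i)"
    using nm dvd_diff[OF that, of "m - dgi i"] by auto
  hence "9 dvd (n - dgi i) \<Longrightarrow> cf u i = 0" using u unfolding NG_def by blast
  thus "cf (hpart n u) i = cf 0 i" by (cases "9 dvd (n - dgi i)") (simp_all only: cf_hpart cf_simps if_True if_False)
qed

lemma add_map_hpart: "add_map (hpart n)"
  by (intro add_mapI cf_eqI) (simp add: cf_hpart cf_simps)

text \<open>The claim is transported from the graded completion, where \<gamma> obviously preserves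
  the degree, through \<open>hsig\<close> and \<open>Lam\<close>.\<close>

lemma NG_\<gamma>N: "NG n u \<Longrightarrow> NG n (\<gamma>N u)" for u :: "'w::strict_3_ring N"
  using NG_Lam[OF Mhat_deg_closed(5)[OF hsig_deg[of n u]]] by (simp only: Lam_\<gamma> Lam_hsig)

lemma hpart_\<gamma>N: "hpart n (\<gamma>N u) = \<gamma>N (hpart n u)" for u :: "'w::strict_3_ring N"
proof -
  \<comment> \<open>The residues of the degree modulo 9 split \<open>u\<close> into nine pieces, on
    which preservation of degree can be applied.\<close>
  have u: "u = (\<Sum>m\<in>{0..8::int}. hpart (n + m) u)"
  proof (rule cf_eqI)
    fix i
    have "9 dvd (n + m - dgi i) \<longleftrightarrow> m = (dgi i - n) mod 9" if "m \<in> {0..8}" for m :: int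
    proof -
      have "n + m - dgi i = m - (dgi i - n)" by simp
      hence "9 dvd (n + m - dgi i) \<longleftrightarrow> m mod 9 = (dgi i - n) mod 9" by (simp only: mod_eq_dvd_iff)
      moreover have "m mod 9 = m" using that by (intro mod_pos_pos_trivial) simp_all
      ultimately show ?thesis by (simp only:)
    qed
    hence "(\<Sum>m\<in>{0..8::int}. cf (hpart (n + m) u) i) = (\<Sum>m\<in>{0..8::int}. if m = (dgi i - n) mod 9 then cf u i else 0)"
      unfolding cf_hpart by (intro sum.cong refl) (simp only:)
    also have "\<dots> = cf u i"
      by (subst sum.delta) auto
    finally show "cf u i = cf (\<Sum>m\<in>{0..8::int}. hpart (n + m) u) i" by (simp only: cf_sum)
  qed
  have "hpart n (\<gamma>N u) = (\<Sum>m\<in>{0..8::int}. hpart n (\<gamma>N (hpart (n + m) u)))"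
    by (subst u) (simp only: add_map_sum[OF add_map_\<gamma>N] add_map_sum[OF add_map_hpart])
  also have "\<dots> = (\<Sum>m\<in>{0..8::int}. if m = 0 then \<gamma>N (hpart n u) else 0)"
  proof (intro sum.cong refl)
    fix m :: int assume m: "m \<in> {0..8}"
    show "hpart n (\<gamma>N (hpart (n + m) u)) = (if m = 0 then \<gamma>N (hpart n u) else 0)"
    proof (cases "m = 0")
      case True thus ?thesis using hpart_NG[OF NG_\<gamma>N[OF NG_hpart]] by simp
    next
      case False
      hence "\<not> 9 dvd (n - (n + m))" using m zdvd_not_zless[of m 9] by auto
      from hpart_NG_other[OF NG_\<gamma>N[OF NG_hpart] this] show ?thesis using False by (simp only: if_False)
    qed
  qed
  also have "\<dots> = \<gamma>N (hpart n u)" by (subst sum.delta) auto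
  finally show ?thesis .
qed

definition hpartU :: "int \<Rightarrow> 'w::comm_ring_1 U \<Rightarrow> 'w U" where
  "hpartU n f = Abs_fps (\<lambda>a. Abs_fps (\<lambda>b. if 9 dvd (n - 3 * int a - 6 * int b) then fps_nth (fps_nth f a) b else 0))"

text \<open>Moves a projection from a combination of homogeneous cochains to its coefficients, so
  that \<open>Xi_surj\<close> can make the coefficients homogeneous.\<close>

lemma hpart_nsc:
  assumes z: "NG m z"
  shows "hpart n (nsc f z) = nsc (hpartU (n - m) f) z"
proof (rule cf_eqI)
  fix i :: idx
  obtain b1 b2 b3 j a b where i: "i = (b1, b2, b3, j, a, b)" by (cases i)
  let ?z = "\<lambda>k l. fps_nth (fps_nth (z b1 b2 b3 j) (a - k)) (b - l)"
  let ?P = "9 dvd (n - dgi i)"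
  have e: "(if ?P then fps_nth (fps_nth f k) l * ?z k l else 0) = fps_nth (fps_nth (hpartU (n - m) f) k) l * ?z k l"
    if kl: "k \<le> a" "l \<le> b" for k l
  proof (cases "?z k l = 0")
    case False
    hence "9 dvd (m - dgi (b1, b2, b3, j, a - k, b - l))" using z unfolding NG_def by fastforce
    moreover have "n - dgi i = (m - dgi (b1, b2, b3, j, a - k, b - l)) + (n - m - 3 * int k - 6 * int l)"
      using kl by (simp add: i of_nat_diff)
    ultimately have "?P \<longleftrightarrow> 9 dvd (n - m - 3 * int k - 6 * int l)" by (simp only: dvd_add_right_iff)
    thus ?thesis by (simp add: hpartU_def)
  qed simp
  have c: "cf (nsc g z) i = (\<Sum>k=0..a. \<Sum>l=0..b. fps_nth (fps_nth g k) l * ?z k l)" for g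
    by (simp add: i nsc_def usc_def nth_mult2)
  have "cf (hpart n (nsc f z)) i = (\<Sum>k=0..a. \<Sum>l=0..b. if ?P then fps_nth (fps_nth f k) l * ?z k l else 0)"
    unfolding cf_hpart c by (cases ?P) (simp_all only: if_True if_False sum.neutral_const)
  also have "\<dots> = cf (nsc (hpartU (n - m) f) z) i"
    unfolding c by (intro sum.cong refl e) simp_all
  finally show "cf (hpart n (nsc f z)) i = cf (nsc (hpartU (n - m) f) z) i" .
qed

subsection \<open>Tate cochains in the model\<close>

lemma sum_funpow_9: "(\<Sum>i<9. (g ^^ i) u) = u + g u + g (g u) + g (g (g u)) + g (g (g (g u))) + g (g (g (g (g u)))) + g (g (g (g (g (g u)))))
    + g (g (g (g (g (g (g u)))))) + g (g (g (g (g (g (g (g u)))))))" for u :: "'a::ab_group_add"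
  by (simp add: eval_nat_numeral)

lemma tr3_sum_9:
  fixes g :: "'a::ab_group_add \<Rightarrow> 'a"
  assumes "\<And>x y. g (x + y) = g x + g y"
  shows "tr3 g (tr3 (\<lambda>x. g (g (g x))) u) = (\<Sum>i<9. (g ^^ i) u)"
  unfolding sum_funpow_9 tr3_def assms by (simp add: add_ac)

lemma tate_d_N: "tate_d 9 \<gamma>N q u = (if even q then \<gamma>N u - u else N9 u)"
proof -
  have c: "c\<gamma> = (\<lambda>x. \<gamma>N (\<gamma>N (\<gamma>N (x :: 'a N))))" by (rule ext) (rule nine.c_def)
  have "N9 u = (\<Sum>i<9. (\<gamma>N ^^ i) u)" unfolding c by (rule tr3_sum_9[OF \<gamma>Ns(1)])
  thus ?thesis unfolding tate_d_def by (rule ssubst) (rule refl)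
qed

lemma Lam_funpow: "Lam ((\<gamma>_hat ^^ i) \<alpha>) = (\<gamma>N ^^ i) (Lam \<alpha>)"
  by (induction i) (simp_all add: Lam_\<gamma>)

lemma Lam_tate_d: "Lam (tate_d 9 \<gamma>_hat q \<alpha>) = tate_d 9 \<gamma>N q (Lam \<alpha>)"
  by (simp add: tate_d_def add_map_sum[OF add_map_Lam] add_map_diff[OF add_map_Lam] Lam_\<gamma> Lam_funpow)

lemma Mhat_deg_funpow: "\<alpha> \<in> Mhat_deg n \<Longrightarrow> (\<gamma>_hat ^^ i) \<alpha> \<in> Mhat_deg n"
  by (induction i) (simp_all add: Mhat_deg_closed)

lemma Mhat_deg_sum: "(\<And>i. i \<in> A \<Longrightarrow> g i \<in> Mhat_deg n) \<Longrightarrow> (\<Sum>i\<in>A. g i) \<in> Mhat_deg n"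
  by (induction A rule: infinite_finite_induct) (simp_all add: Mhat_deg_closed)

lemma Mhat_deg_tate_d: "\<alpha> \<in> Mhat_deg n \<Longrightarrow> tate_d 9 \<gamma>_hat q \<alpha> \<in> Mhat_deg n"
  by (simp add: tate_d_def Mhat_deg_closed Mhat_deg_sum Mhat_deg_funpow)

lemma hpart_tate_d: "hpart n (tate_d 9 \<gamma>N q u) = tate_d 9 \<gamma>N q (hpart n u)" for u :: "'w::strict_3_ring N"
proof -
  have "hpart n ((\<gamma>N ^^ i) u) = (\<gamma>N ^^ i) (hpart n u)" for i by (induction i) (simp_all add: hpart_\<gamma>N)
  thus ?thesis
    by (simp add: tate_d_def add_map_sum[OF add_map_hpart] add_map_diff[OF add_map_hpart] hpart_\<gamma>N)
qed

definition cob :: "int \<Rightarrow> 'w::comm_ring_1 N \<Rightarrow> bool" where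
  "cob q u \<longleftrightarrow> (\<exists>y. u = tate_d 9 \<gamma>N (q - 1) y)"

lemma add_map_tate_d: "add_map (tate_d 9 \<gamma>N q)"
  by (intro add_mapI, cases "even q") (simp_all only: tate_d_N if_True if_False \<gamma>Ns nine.tr3_add add_diff_add)

lemma cob_closed: "cob q (0 :: 'w N)" "cob q (u :: 'w::comm_ring_1 N) \<Longrightarrow> cob q v \<Longrightarrow> cob q (u + v)" "cob q u \<Longrightarrow> cob q v \<Longrightarrow> cob q (u - v)" "cob q u \<Longrightarrow> cob q (nsc f u)"
proof -
  note t = add_map_simps[OF add_map_tate_d]
  show "cob q (0 :: 'w N)" unfolding cob_def by (rule exI[of _ 0]) (simp only: t)
  show "cob q u \<Longrightarrow> cob q v \<Longrightarrow> cob q (u + v)" unfolding cob_def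
  proof (elim exE)
    fix y z assume 1: "u = tate_d 9 \<gamma>N (q - 1) y" "v = tate_d 9 \<gamma>N (q - 1) z"
    show "\<exists>y. u + v = tate_d 9 \<gamma>N (q - 1) y" by (rule exI[of _ "y + z"]) (simp only: t 1)
  qed
  show "cob q u \<Longrightarrow> cob q v \<Longrightarrow> cob q (u - v)" unfolding cob_def
  proof (elim exE)
    fix y z assume 1: "u = tate_d 9 \<gamma>N (q - 1) y" "v = tate_d 9 \<gamma>N (q - 1) z"
    show "\<exists>y. u - v = tate_d 9 \<gamma>N (q - 1) y" by (rule exI[of _ "y - z"]) (simp only: t 1)
  qed
  have n: "nsc f (tate_d 9 \<gamma>N (q - 1) y) = tate_d 9 \<gamma>N (q - 1) (nsc f y)" for y :: "'w N"
    by (cases "even (q - 1)") (simp_all only: tate_d_N if_True if_False tr3_def nine.c_def nsc_add nsc_diff \<gamma>N_nsc \<gamma>Ns)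
  show "cob q u \<Longrightarrow> cob q (nsc f u)" unfolding cob_def
  proof (elim exE)
    fix y assume 1: "u = tate_d 9 \<gamma>N (q - 1) y"
    show "\<exists>y. nsc f u = tate_d 9 \<gamma>N (q - 1) y" by (rule exI[of _ "nsc f y"]) (simp only: n 1)
  qed
qed

lemma Lam_0: "Lam 0 = 0" by (rule add_map_0[OF add_map_Lam])

lemma Lam_inject': "\<alpha> \<in> Mhat_deg n \<Longrightarrow> \<beta> \<in> Mhat_deg n \<Longrightarrow> Lam \<alpha> = Lam \<beta> \<Longrightarrow> \<alpha> = \<beta>"
proof (cases "even n")
  case True
  then obtain m where n: "n = - 2 * (- m)" by (auto elim: evenE)
  assume "\<alpha> \<in> Mhat_deg n" "\<beta> \<in> Mhat_deg n" "Lam \<alpha> = Lam \<beta>"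
  thus ?thesis unfolding n by (rule Lam_inject)
next
  case False
  assume "\<alpha> \<in> Mhat_deg n" "\<beta> \<in> Mhat_deg n"
  thus ?thesis using Mhat_deg_odd False by metis
qed

text \<open>A primitive found in \<open>N\<close> may mix degrees. The differential commutes with
  \<open>hpart\<close>, so its homogeneous part is a primitive too, and that part lifts to the
  completion by \<open>hsig\<close>.\<close>

lemma tate_B_iff:
  assumes \<alpha>: "\<alpha> \<in> Mhat_deg n"
  shows "\<alpha> \<in> tate_B 9 \<gamma>_hat (Mhat_deg n) q \<longleftrightarrow> cob q (Lam \<alpha>)"
proof
  assume "\<alpha> \<in> tate_B 9 \<gamma>_hat (Mhat_deg n) q"
  thus "cob q (Lam \<alpha>)" unfolding tate_B_def cob_def using Lam_tate_d by blast
next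
  assume "cob q (Lam \<alpha>)"
  then obtain y where y: "Lam \<alpha> = tate_d 9 \<gamma>N (q - 1) y" by (auto simp: cob_def)
  show "\<alpha> \<in> tate_B 9 \<gamma>_hat (Mhat_deg n) q"
  proof (cases "even n")
    case True
    then obtain m where n: "n = - 2 * (- m)" by (auto elim: evenE)
    let ?y = "hsig (- m) (hpart (- m) y)"
    have deg: "?y \<in> Mhat_deg n" unfolding n by (rule hsig_deg)
    have "Lam (tate_d 9 \<gamma>_hat (q - 1) ?y) = tate_d 9 \<gamma>N (q - 1) (hpart (- m) y)"
      by (simp only: Lam_tate_d Lam_hsig NG_hpart)
    also have "\<dots> = hpart (- m) (Lam \<alpha>)" by (simp only: y hpart_tate_d)
    also have "\<dots> = Lam \<alpha>" using \<alpha> unfolding n by (intro hpart_NG NG_Lam)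
    finally have "tate_d 9 \<gamma>_hat (q - 1) ?y = \<alpha>" by (intro Lam_inject'[OF Mhat_deg_tate_d[OF deg] \<alpha>])
    thus ?thesis unfolding tate_B_def using deg by blast
  next
    case False
    hence "\<alpha> = 0" by (rule Mhat_deg_odd[OF \<alpha>])
    moreover have "tate_d 9 \<gamma>_hat (q - 1) 0 = (0 :: 'a Mhat)"
      by (rule Lam_inject'[OF Mhat_deg_tate_d[OF Mhat_deg_closed(1)] Mhat_deg_closed(1)])
        (simp only: Lam_tate_d Lam_0 add_map_0[OF add_map_tate_d])
    ultimately show ?thesis unfolding tate_B_def using Mhat_deg_closed(1) by (metis image_eqI)
  qed
qed

lemma tate_Z_iff: "\<alpha> \<in> Mhat_deg n \<Longrightarrow> \<alpha> \<in> tate_Z 9 \<gamma>_hat (Mhat_deg n) q \<longleftrightarrow> tate_d 9 \<gamma>N q (Lam \<alpha>) = 0"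
  unfolding tate_Z_def
  using Lam_inject'[OF Mhat_deg_tate_d Mhat_deg_closed(1), of \<alpha> n q] by (auto simp: Lam_tate_d Lam_0 simp flip: Lam_tate_d)

subsection \<open>The module generated by the model cochains\<close>

definition kU :: "'w::comm_ring_1 \<Rightarrow> 'w U" where "kU w = fps_const (fps_const w)"

lemma kU_hom: "kU (x + y) = kU x + kU y" "kU (x * y) = kU x * kU y" "kU 1 = (1 :: 'w::comm_ring_1 U)" "kU (- x) = - kU (x :: 'w)" "kU 9 = (9 :: 'w U)"
proof -
  have *: "kU (x + y) = kU x + kU y" "kU (x * y) = kU x * kU y" "kU 1 = (1 :: 'w U)" "kU (- x) = - kU x" for x y :: 'w
    by (simp_all only: kU_def fps_const_add fps_const_mult fps_const_neg fps_const_1_eq_1)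
  show "kU (x + y) = kU x + kU y" "kU (x * y) = kU x * kU y" "kU 1 = (1 :: 'w U)" "kU (- x) = - kU x" by (rule *)+
  have "(9 :: 'w) = (1 + 1 + 1) * (1 + 1 + 1)" "(9 :: 'w U) = (1 + 1 + 1) * (1 + 1 + 1)" by simp_all
  thus "kU 9 = (9 :: 'w U)" by (simp only: *)
qed

text \<open>Invertibility modulo 9 is what is needed of the constants, because multiples of 9 can be
  absorbed by coboundaries.\<close>

definition unit9 :: "'w::comm_ring_1 \<Rightarrow> bool" where "unit9 x \<longleftrightarrow> (\<exists>e m. e * x = 1 + 9 * m)"

lemma unit9_mult: "unit9 x \<Longrightarrow> unit9 y \<Longrightarrow> unit9 (x * y)"
  unfolding unit9_def
proof (elim exE)
  fix e m e' m' assume 1: "e * x = 1 + 9 * m" and 2: "e' * y = 1 + 9 * m'"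
  have "(e * e') * (x * y) = (e * x) * (e' * y)" by (simp add: mult_ac)
  also have "\<dots> = 1 + 9 * (m + m' + 9 * m * m')" unfolding 1 2 by (simp add: algebra_simps)
  finally show "\<exists>e m. e * (x * y) = 1 + 9 * m" by blast
qed

lemma unit9_uminus: "unit9 x \<Longrightarrow> unit9 (- x)"
  unfolding unit9_def by (metis minus_mult_minus)

text \<open>The factor 1 - 3m improves an inverse modulo 3 to one modulo 9.\<close>

lemma unit9I: "e * x = 1 + 3 * m \<Longrightarrow> unit9 x"
proof -
  assume 1: "e * x = 1 + 3 * m"
  have "(e * (1 - 3 * m)) * x = (e * x) * (1 - 3 * m)" by (simp add: mult_ac)
  also have "\<dots> = 1 + 9 * (- m * m)" unfolding 1 by (simp add: algebra_simps)
  finally show ?thesis unfolding unit9_def by blast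
qed

lemma unit9_U: "unit9 w \<Longrightarrow> \<exists>e m. e * kU w = 1 + 9 * m"
  unfolding unit9_def by (metis kU_hom(1,2,3,5))

text \<open>For \<open>c = u x\<^sub>0 + v x\<^sub>3\<close> the product \<open>c\<^sub>1c\<^sub>2\<close> is \<open>- kap u v\<close> times \<open>x\<^sub>0x\<^sub>1 + x\<^sub>3x\<^sub>1 + x\<^sub>3x\<^sub>4\<close>; modulo 3, \<open>kap u v\<close> is \<open>(u + v)\<^sup>2\<close>.\<close>

definition kap :: "'w::comm_ring_1 \<Rightarrow> 'w \<Rightarrow> 'w" where "kap u v = u * u - u * v + v * v"

lemma unit9_kap: "e * (u + v) = 1 + 3 * m \<Longrightarrow> unit9 (kap u v)"
proof -
  assume 1: "e * (u + v) = 1 + 3 * m"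
  have "(e * e) * kap u v = (e * (u + v)) * (e * (u + v)) + 3 * (- e * e * u * v)" by (simp add: kap_def algebra_simps)
  also have "\<dots> = 1 + 3 * (m + m + 3 * m * m - e * e * u * v)" unfolding 1 by (simp add: algebra_simps)
  finally show ?thesis by (rule unit9I)
qed

definition zf :: "'w::comm_ring_1 \<Rightarrow> 'w \<Rightarrow> sx \<Rightarrow> 'w N" where
  "zf u v j = sgl Ex E1 E1 (es j (kU u)) + sgl Ey E1 E1 (es j (kU v))"

definition zF :: "'w::comm_ring_1 \<Rightarrow> 'w \<Rightarrow> sx \<Rightarrow> 'w N" where
  "zF u v j = tr3 \<gamma>N (i12 (es j (kU (- kap u v))) 0 (es j (kU (- kap u v))) (es j (kU (- kap u v))))"

text \<open>The coordinate vectors of the cocycles \<open>zM\<close> that represent the generators,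
  see \<open>RM_zM\<close>.\<close>

primrec zeta :: "'w::comm_ring_1 \<Rightarrow> 'w \<Rightarrow> gen \<Rightarrow> 'w N" where
  "zeta u v One = sgl E1 E1 E1 one\<^sub>D" | "zeta u v Delta = sgl E1 E1 E1 dlt"
| "zeta u v Cbar = sgl Ex Ex Ex (usc (kU (- kap u v * (u + v))) one\<^sub>D)"
| "zeta u v CbarDelta = sgl Ex Ex Ex (usc (kU (- kap u v * (u + v))) dlt)"
| "zeta u v f0 = zf u v S0" | "zeta u v f1 = zf u v S1" | "zeta u v f2 = zf u v S2"
| "zeta u v f3 = zf u v S3" | "zeta u v f4 = zf u v S4" | "zeta u v f5 = zf u v S5"
| "zeta u v F0 = zF u v S0" | "zeta u v F1 = zF u v S1" | "zeta u v F2 = zF u v S2"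
| "zeta u v F3 = zF u v S3" | "zeta u v F4 = zF u v S4" | "zeta u v F5 = zF u v S5"

lemma UNIV_gen: "UNIV = {One, Cbar, Delta, CbarDelta, f0, f1, f2, f3, f4, f5, F0, F1, F2, F3, F4, F5}"
  using gen.exhaust by blast

lemma finite_gen: "finite (UNIV :: gen set)"
  unfolding UNIV_gen by simp

lemma sum_gen: "(\<Sum>g\<in>UNIV. f g) = f One + f Cbar + f Delta + f CbarDelta + f f0 + f f1 + f f2 + f f3 + f f4 + f f5
    + f F0 + f F1 + f F2 + f F3 + f F4 + f F5" for f :: "gen \<Rightarrow> 'a::ab_group_add"
  unfolding UNIV_gen by (simp add: add_ac)

definition Zs :: "'w::comm_ring_1 \<Rightarrow> 'w \<Rightarrow> (gen \<Rightarrow> 'w U) \<Rightarrow> 'w N" where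
  "Zs u v a = (\<Sum>g\<in>UNIV. nsc (a g) (zeta u v g))"

lemma usc_simps: "usc (f + g) x = usc f x + usc g x" "usc (f - g) x = usc f x - usc g x" "usc f (usc g x) = usc (f * g) x"
   "usc f (x + y) = usc f x + usc f y" "usc 0 x = 0" "usc f 0 = 0"
  by (simp_all add: usc_def fun_eq_iff algebra_simps)

lemma nsc_simps: "nsc (f + g) x = nsc f x + nsc g x" "nsc (f - g) x = nsc f x - nsc g x" "nsc f (nsc g x) = nsc (f * g) x" "nsc 0 x = 0"
  by (simp_all add: nsc_def usc_def fun_eq_iff algebra_simps)

lemma nsc_sgl': "nsc f (sgl a b c v) = sgl a b c (usc f v)"
  by (intro ext) (simp add: nsc_def usc_def sgl_def)

lemma nsc_i12: "nsc f (i12 p q r s) = i12 (usc f p) (usc f q) (usc f r) (usc f s)"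
  unfolding i12_def by (simp only: nsc_add nsc_sgl')

lemma i12_add: "i12 p q r s + i12 p' q' r' s' = i12 (p + p') (q + q') (r + r') (s + s')"
  unfolding i12_def sgl_simps by (simp only: add_ac)

lemma nsc_tr3: "nsc f (tr3 \<gamma>N x) = tr3 \<gamma>N (nsc f x)"
  unfolding tr3_def by (simp only: nsc_add \<gamma>N_nsc)

lemma Zs_add: "Zs u v (\<lambda>g. a g + b g) = Zs u v a + Zs u v b"
  unfolding Zs_def nsc_simps by (rule sum.distrib)

lemma Zs_diff: "Zs u v (\<lambda>g. a g - b g) = Zs u v a - Zs u v b"
  unfolding Zs_def nsc_simps by (rule sum_subtractf)

lemma nsc_Zs: "nsc f (Zs u v a) = Zs u v (\<lambda>g. f * a g)"
  unfolding Zs_def add_map_sum[OF add_map_nsc] nsc_simps ..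

text \<open>Since b1 has degree 2 and is set to 1, the cohomological degree constrains a combination
  of generators only through parity.\<close>

definition supp :: "int \<Rightarrow> (gen \<Rightarrow> 'w::comm_ring_1 U) \<Rightarrow> bool" where
  "supp q a \<longleftrightarrow> (\<forall>g. odd (q - coh_deg g) \<longrightarrow> a g = 0)"

lemma supp_even:
  assumes "supp q a" "even q"
  shows "a Cbar = 0" "a CbarDelta = 0" "a f0 = 0" "a f1 = 0" "a f2 = 0" "a f3 = 0" "a f4 = 0" "a f5 = 0"
  using assms unfolding supp_def by simp_all

lemma supp_odd:
  assumes "supp q a" "odd q"
  shows "a One = 0" "a Delta = 0" "a F0 = 0" "a F1 = 0" "a F2 = 0" "a F3 = 0" "a F4 = 0" "a F5 = 0"
  using assms unfolding supp_def by simp_all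

lemma mkD_sum: "usc a0 (es S0 k) + usc a1 (es S1 k) + usc a2 (es S2 k) + usc a3 (es S3 k) + usc a4 (es S4 k) + usc a5 (es S5 k)
   = usc k (mkD a0 a1 a2 a3 a4 a5)"
  by (rule D_eqI) (simp_all add: usc_def es_def mkD_simps mult.commute)

lemma Zs_even:
  fixes u v :: "'w::comm_ring_1"
  assumes "supp q a" "even q"
  defines "L \<equiv> usc (kU (- kap u v)) (mkD (a F0) (a F1) (a F2) (a F3) (a F4) (a F5))"
  shows "Zs u v a = sgl E1 E1 E1 (usc (a One) one\<^sub>D + usc (a Delta) dlt) + tr3 \<gamma>N (i12 L 0 L L)"
proof -
  define K where "K = kU (- kap u v)"
  have F: "nsc f (zF u v j) = tr3 \<gamma>N (i12 (usc f (es j K)) 0 (usc f (es j K)) (usc f (es j K)))" for f j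
    unfolding zF_def K_def[symmetric] nsc_tr3 nsc_i12 usc_simps ..
  have t: "tr3 \<gamma>N (i12 L 0 L L) = nsc (a F0) (zF u v S0) + nsc (a F1) (zF u v S1) + nsc (a F2) (zF u v S2) + nsc (a F3) (zF u v S3) + nsc (a F4) (zF u v S4) + nsc (a F5) (zF u v S5)"
    unfolding L_def K_def[symmetric] F nine.tr3_add[symmetric] i12_add add_0_right mkD_sum ..
  have "Zs u v a = nsc (a One) (zeta u v One) + nsc (a Delta) (zeta u v Delta) + (nsc (a F0) (zF u v S0) + nsc (a F1) (zF u v S1) + nsc (a F2) (zF u v S2) + nsc (a F3) (zF u v S3) + nsc (a F4) (zF u v S4) + nsc (a F5) (zF u v S5))"
    unfolding Zs_def sum_gen zeta.simps supp_even[OF assms(1,2)] nsc_simps(4) add_0_left add_0_right by (simp only: add_ac)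
  thus ?thesis unfolding t zeta.simps nsc_sgl' sgl_simps .
qed

lemma Zs_odd:
  fixes u v :: "'w::comm_ring_1"
  assumes "supp q a" "odd q"
  defines "L \<equiv> mkD (a f0) (a f1) (a f2) (a f3) (a f4) (a f5)"
  shows "Zs u v a = sgl Ex E1 E1 (usc (kU u) L) + sgl Ey E1 E1 (usc (kU v) L)
     + sgl Ex Ex Ex (usc (kU (- kap u v * (u + v)) * a Cbar) one\<^sub>D + usc (kU (- kap u v * (u + v)) * a CbarDelta) dlt)"
proof -
  have f: "nsc f (zf u v j) = sgl Ex E1 E1 (usc f (es j (kU u))) + sgl Ey E1 E1 (usc f (es j (kU v)))" for f j
    unfolding zf_def nsc_add nsc_sgl' ..
  have t: "sgl Ex E1 E1 (usc (kU u) L) + sgl Ey E1 E1 (usc (kU v) L) = nsc (a f0) (zf u v S0) + nsc (a f1) (zf u v S1) + nsc (a f2) (zf u v S2) + nsc (a f3) (zf u v S3) + nsc (a f4) (zf u v S4) + nsc (a f5) (zf u v S5)"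
    unfolding L_def mkD_sum[symmetric] sgl_simps f by (simp only: add_ac)
  have "Zs u v a = (nsc (a f0) (zf u v S0) + nsc (a f1) (zf u v S1) + nsc (a f2) (zf u v S2) + nsc (a f3) (zf u v S3) + nsc (a f4) (zf u v S4) + nsc (a f5) (zf u v S5)) + (nsc (a Cbar) (zeta u v Cbar) + nsc (a CbarDelta) (zeta u v CbarDelta))"
    unfolding Zs_def sum_gen zeta.simps supp_odd[OF assms(1,2)] nsc_simps(4) add_0_left add_0_right by (simp only: add_ac)
  thus ?thesis unfolding t zeta.simps nsc_sgl' usc_simps sgl_simps by (simp only: mult.commute)
qed

text \<open>\<open>Jid\<close> will be the annihilator of the classes of \<open>One\<close> and
  \<open>Cbar\<close>, generated by 9, 3 t1 and 3 t2; \<open>Tid\<close> will be that of every other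
  generator.\<close>

definition Jid :: "'w::comm_ring_1 U \<Rightarrow> bool" where "Jid x \<longleftrightarrow> (\<exists>a b c. x = 3 * (3 * a + t1 * b + t2 * c))"
definition Tid :: "'w::comm_ring_1 U \<Rightarrow> bool" where "Tid x \<longleftrightarrow> (\<exists>h. x = 3 * h)"

lemma Jid_closed: "Jid (0 :: 'w U)" "Jid (x :: 'w::comm_ring_1 U) \<Longrightarrow> Jid y \<Longrightarrow> Jid (x + y)" "Jid x \<Longrightarrow> Jid (f * x)" "Jid (9 * f :: 'w U)" "Jid x \<Longrightarrow> Jid y \<Longrightarrow> Jid (x - y)"
proof -
  show "Jid (0 :: 'w U)" unfolding Jid_def by (rule exI[of _ 0], rule exI[of _ 0], rule exI[of _ 0]) simp
  show "Jid x \<Longrightarrow> Jid y \<Longrightarrow> Jid (x + y)" unfolding Jid_def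
  proof (elim exE)
    fix a b c a' b' c' assume 1: "x = 3 * (3 * a + t1 * b + t2 * c)" "y = 3 * (3 * a' + t1 * b' + t2 * c')"
    have "x + y = 3 * (3 * (a + a') + t1 * (b + b') + t2 * (c + c'))" unfolding 1 by (simp only: distrib_left add_ac)
    thus "\<exists>a b c. x + y = 3 * (3 * a + t1 * b + t2 * c)" by blast
  qed
  show "Jid x \<Longrightarrow> Jid (f * x)" unfolding Jid_def
  proof (elim exE)
    fix a b c assume 1: "x = 3 * (3 * a + t1 * b + t2 * c)"
    have "f * x = 3 * (3 * (f * a) + t1 * (f * b) + t2 * (f * c))" unfolding 1 by (simp only: distrib_left mult_ac)
    thus "\<exists>a b c. f * x = 3 * (3 * a + t1 * b + t2 * c)" by blast
  qed
  show "Jid (9 * f)" unfolding Jid_def by (rule exI[of _ f], rule exI[of _ 0], rule exI[of _ 0]) simp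
  show "Jid x \<Longrightarrow> Jid y \<Longrightarrow> Jid (x - y)" unfolding Jid_def
  proof (elim exE)
    fix a b c a' b' c' assume 1: "x = 3 * (3 * a + t1 * b + t2 * c)" "y = 3 * (3 * a' + t1 * b' + t2 * c')"
    have "x - y = 3 * (3 * (a - a') + t1 * (b - b') + t2 * (c - c'))" unfolding 1 by (simp only: algebra_simps)
    thus "\<exists>a b c. x - y = 3 * (3 * a + t1 * b + t2 * c)" by blast
  qed
qed

lemma Tid_closed: "Tid (0 :: 'w U)" "Tid (x :: 'w::comm_ring_1 U) \<Longrightarrow> Tid y \<Longrightarrow> Tid (x + y)" "Tid x \<Longrightarrow> Tid (f * x)" "Tid (9 * f :: 'w U)" "Tid x \<Longrightarrow> Tid y \<Longrightarrow> Tid (x - y)" "Tid (3 * f :: 'w U)"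
proof -
  show "Tid (0 :: 'w U)" unfolding Tid_def by (rule exI[of _ 0]) simp
  show "Tid x \<Longrightarrow> Tid y \<Longrightarrow> Tid (x + y)" unfolding Tid_def by (metis distrib_left)
  show "Tid x \<Longrightarrow> Tid y \<Longrightarrow> Tid (x - y)" unfolding Tid_def by (metis right_diff_distrib)
  show "Tid x \<Longrightarrow> Tid (f * x)" unfolding Tid_def by (metis mult.left_commute)
  show "Tid (3 * f)" unfolding Tid_def by blast
  have "9 * f = 3 * (3 * f)" by simp
  thus "Tid (9 * f)" unfolding Tid_def by blast
qed

lemma unit9_cancel:
  assumes "unit9 w"
  shows "Jid (kU w * x) \<Longrightarrow> Jid x" "Tid (kU w * x) \<Longrightarrow> Tid x"
proof -
  obtain e m where e: "e * kU w = 1 + 9 * m" using unit9_U[OF assms] by blast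
  have "e * (kU w * x) - 9 * (m * x) = (e * kU w) * x - 9 * m * x" by (simp only: mult.assoc)
  also have "\<dots> = x" unfolding e by (simp add: algebra_simps)
  finally have x: "x = e * (kU w * x) - 9 * (m * x)" ..
  show "Jid x" if J: "Jid (kU w * x)"
    using Jid_closed(5)[OF Jid_closed(3)[OF J, of e] Jid_closed(4)[of "m * x"]] unfolding x[symmetric] .
  show "Tid x" if T: "Tid (kU w * x)"
    using Tid_closed(5)[OF Tid_closed(3)[OF T, of e] Tid_closed(4)[of "m * x"]] unfolding x[symmetric] .
qed

lemma unit9_solve: "unit9 w \<Longrightarrow> \<exists>y m. kU w * y = x + 9 * m"
proof -
  assume "unit9 w"
  then obtain e m where e: "e * kU w = 1 + 9 * m" using unit9_U by blast
  have "kU w * (e * x) = (e * kU w) * x" by (simp only: mult_ac)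
  also have "\<dots> = x + 9 * (m * x)" unfolding e by (simp add: algebra_simps)
  finally show ?thesis by blast
qed

section \<open>Cocycles and coboundaries among the combinations of generators\<close>

definition crit :: "(gen \<Rightarrow> 'w::comm_ring_1 U) \<Rightarrow> bool" where
  "crit a \<longleftrightarrow> (\<forall>g. if g \<in> {One, Cbar} then Jid (a g) else Tid (a g))"

lemma cob_even: "even q \<Longrightarrow> cob q x \<longleftrightarrow> (\<exists>y. x = N9 y)"
  by (simp add: cob_def tate_d_N)

lemma cob_odd: "odd q \<Longrightarrow> cob q x \<longleftrightarrow> eqO x 0"
  by (simp add: cob_def tate_d_N eqO_def)

lemma trD_add: "trD (x + y) = trD x + trD y"
  unfolding trD_tr tr3_def gDs by (simp only: add_ac)

lemma crit_trD:
  fixes \<alpha> \<beta> :: "'w::strict_3_ring U"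
  shows "(\<exists>y. usc \<alpha> one\<^sub>D + usc \<beta> dlt = trD y) \<longleftrightarrow> Jid \<alpha> \<and> Tid \<beta>"
proof
  assume "\<exists>y. usc \<alpha> one\<^sub>D + usc \<beta> dlt = trD y"
  thus "Jid \<alpha> \<and> Tid \<beta>" using trD_detect unfolding Jid_def Tid_def by blast
next
  assume "Jid \<alpha> \<and> Tid \<beta>"
  then obtain a b c h where "\<alpha> = 3 * (3 * a + t1 * b + t2 * c)" "\<beta> = 3 * h" unfolding Jid_def Tid_def by blast
  hence "usc \<alpha> one\<^sub>D + usc \<beta> dlt = trD (mkD a b 0 c 0 0 + usc h (mkD (- 1) t2 0 0 0 (- 2)))"
    by (simp only: trD_add trD_rels)
  thus "\<exists>y. usc \<alpha> one\<^sub>D + usc \<beta> dlt = trD y" by blast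
qed

lemma crit_mkD: "(\<exists>h. usc k (mkD a0 a1 a2 a3 a4 a5) = h + h + h) \<longleftrightarrow>
   Tid (k * a0) \<and> Tid (k * a1) \<and> Tid (k * a2) \<and> Tid (k * a3) \<and> Tid (k * a4) \<and> Tid (k * a5)" for k :: "'w::comm_ring_1 U"
proof
  assume "\<exists>h. usc k (mkD a0 a1 a2 a3 a4 a5) = h + h + h"
  then obtain h where h: "usc k (mkD a0 a1 a2 a3 a4 a5) = h + h + h" by blast
  have "k * mkD a0 a1 a2 a3 a4 a5 j = 3 * h j" for j
    using fun_cong[OF h, of j] by (simp add: usc_def)
  from this[of S0] this[of S1] this[of S2] this[of S3] this[of S4] this[of S5]
  show "Tid (k * a0) \<and> Tid (k * a1) \<and> Tid (k * a2) \<and> Tid (k * a3) \<and> Tid (k * a4) \<and> Tid (k * a5)"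
    unfolding mkD_simps Tid_def by blast
next
  assume "Tid (k * a0) \<and> Tid (k * a1) \<and> Tid (k * a2) \<and> Tid (k * a3) \<and> Tid (k * a4) \<and> Tid (k * a5)"
  then obtain h0 h1 h2 h3 h4 h5 where "k * a0 = 3 * h0" "k * a1 = 3 * h1" "k * a2 = 3 * h2" "k * a3 = 3 * h3" "k * a4 = 3 * h4" "k * a5 = 3 * h5"
    unfolding Tid_def by blast
  hence "usc k (mkD a0 a1 a2 a3 a4 a5) = mkD h0 h1 h2 h3 h4 h5 + mkD h0 h1 h2 h3 h4 h5 + mkD h0 h1 h2 h3 h4 h5"
    by (intro D_eqI) (simp_all add: usc_def mkD_simps)
  thus "\<exists>h. usc k (mkD a0 a1 a2 a3 a4 a5) = h + h + h" by blast
qed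

lemma eqO_x11: "eqO (sgl Ex E1 E1 (usc (kU u) L) + sgl Ey E1 E1 (usc (kU v) L)) (sgl Ex E1 E1 (usc (kU (u + v)) L))"
  using eqO_add[OF eqO_refl odd_trivial_x11(1)] by (simp only: kU_hom usc_simps sgl_simps)

lemma eqO_0_cong: "eqO x y \<Longrightarrow> eqO x 0 \<longleftrightarrow> eqO y 0"
  using eqO_trans eqO_sym by blast

text \<open>The classification theorems describe coboundaries up to the constants u + v and
  \<open>kap u v\<close>. Both are units modulo 9, and 9 lies in \<open>Jid\<close> and in
  \<open>Tid\<close>, so the constants cancel.\<close>

theorem Zs_cob:
  fixes u v :: "'w::strict_3_ring"
  assumes e: "e * (u + v) = 1 + 3 * m" and a: "supp q a"
  shows "cob q (Zs u v a) \<longleftrightarrow> crit a"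
proof (cases "even q")
  case True
  note z = Zs_even[OF a True, of u v]
  define L where "L = usc (kU (- kap u v)) (mkD (a F0) (a F1) (a F2) (a F3) (a F4) (a F5))"
  have un: "unit9 (- kap u v)" by (intro unit9_uminus unit9_kap[OF e])
  have T: "Tid (kU (- kap u v) * x) \<longleftrightarrow> Tid x" for x using unit9_cancel(2)[OF un] Tid_closed(3) by blast
  have L: "(\<exists>h. L = h + h + h) \<longleftrightarrow> Tid (a F0) \<and> Tid (a F1) \<and> Tid (a F2) \<and> Tid (a F3) \<and> Tid (a F4) \<and> Tid (a F5)"
    unfolding L_def crit_mkD T ..
  have "cob q (Zs u v a) \<longleftrightarrow> (\<exists>y. usc (a One) one\<^sub>D + usc (a Delta) dlt = trD y) \<and> (\<exists>h. L = h + h + h)"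
    unfolding cob_even[OF True] z L_def[symmetric]
  proof
    assume "\<exists>y. sgl E1 E1 E1 (usc (a One) one\<^sub>D + usc (a Delta) dlt) + tr3 \<gamma>N (i12 L 0 L L) = N9 y"
    thus "(\<exists>y. usc (a One) one\<^sub>D + usc (a Delta) dlt = trD y) \<and> (\<exists>h. L = h + h + h)" using even_detect by blast
  next
    assume "(\<exists>y. usc (a One) one\<^sub>D + usc (a Delta) dlt = trD y) \<and> (\<exists>h. L = h + h + h)"
    then obtain y h where y: "usc (a One) one\<^sub>D + usc (a Delta) dlt = trD y" and h: "L = h + h + h" by blast
    have "sgl E1 E1 E1 (usc (a One) one\<^sub>D + usc (a Delta) dlt) + tr3 \<gamma>N (i12 L 0 L L) = N9 (sgl E1 E1 E1 y + i12 h (- h) 0 0)"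
      unfolding y h N9_sgl111 N9_i12 nine.tr3_add ..
    thus "\<exists>y. sgl E1 E1 E1 (usc (a One) one\<^sub>D + usc (a Delta) dlt) + tr3 \<gamma>N (i12 L 0 L L) = N9 y" by blast
  qed
  also have "\<dots> \<longleftrightarrow> crit a"
    unfolding crit_trD L crit_def all_simps
  proof -
    have "(\<forall>g. P g) \<longleftrightarrow> (\<forall>g\<in>UNIV. P g)" for P :: "gen \<Rightarrow> bool" by simp
    thus "((Jid (a One) \<and> Tid (a Delta)) \<and> Tid (a F0) \<and> Tid (a F1) \<and> Tid (a F2) \<and> Tid (a F3) \<and> Tid (a F4) \<and> Tid (a F5)) =
       (\<forall>g. if g \<in> {One, Cbar} then Jid (a g) else Tid (a g))"
      unfolding UNIV_gen using supp_even[OF a True] by (simp add: Jid_closed Tid_closed)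
  qed
  finally show ?thesis .
next
  case False
  hence o: "odd q" .
  note z = Zs_odd[OF a o, of u v]
  define L where "L = mkD (a f0) (a f1) (a f2) (a f3) (a f4) (a f5)"
  define K where "K = - kap u v * (u + v)"
  define d where "d = usc (kU K * a Cbar) one\<^sub>D + usc (kU K * a CbarDelta) dlt"
  have un: "unit9 (u + v)" by (rule unit9I[OF e])
  have K: "unit9 K" unfolding K_def by (intro unit9_mult unit9_uminus unit9_kap[OF e] un)
  have T: "Tid (kU (u + v) * x) \<longleftrightarrow> Tid x" "Tid (kU K * x) \<longleftrightarrow> Tid x" "Jid (kU K * x) \<longleftrightarrow> Jid x" for x
    using unit9_cancel(2)[OF un] unit9_cancel[OF K] Tid_closed(3) Jid_closed(3) by blast+
  have L: "(\<exists>h. usc (kU (u + v)) L = h + h + h) \<longleftrightarrow> Tid (a f0) \<and> Tid (a f1) \<and> Tid (a f2) \<and> Tid (a f3) \<and> Tid (a f4) \<and> Tid (a f5)"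
    unfolding L_def crit_mkD T ..
  have eq: "eqO (Zs u v a) (sgl Ex E1 E1 (usc (kU (u + v)) L) + sgl Ex Ex Ex d)"
    unfolding z L_def[symmetric] K_def[symmetric] d_def[symmetric] by (intro eqO_add eqO_x11 eqO_refl)
  have "cob q (Zs u v a) \<longleftrightarrow> (\<exists>y. d = trD y) \<and> (\<exists>h. usc (kU (u + v)) L = h + h + h)"
    unfolding cob_odd[OF o] eqO_0_cong[OF eq]
  proof
    assume "eqO (sgl Ex E1 E1 (usc (kU (u + v)) L) + sgl Ex Ex Ex d) 0"
    then obtain y where "sgl Ex E1 E1 (usc (kU (u + v)) L) + sgl Ex Ex Ex d = \<gamma>N y - y" unfolding eqO_def by (auto simp only: add_0_left)
    thus "(\<exists>y. d = trD y) \<and> (\<exists>h. usc (kU (u + v)) L = h + h + h)" using odd_detect by blast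
  next
    assume "(\<exists>y. d = trD y) \<and> (\<exists>h. usc (kU (u + v)) L = h + h + h)"
    then obtain y h where y: "d = trD y" and h: "usc (kU (u + v)) L = h + h + h" by blast
    have "eqO (sgl Ex E1 E1 (h + h + h) + sgl Ex Ex Ex (trD y)) (0 + 0)"
      by (intro eqO_add odd_trivial_x11 sgl_xxx_trD)
    thus "eqO (sgl Ex E1 E1 (usc (kU (u + v)) L) + sgl Ex Ex Ex d) 0" unfolding y h add_0_right .
  qed
  also have "\<dots> \<longleftrightarrow> crit a"
    unfolding d_def crit_trD L crit_def T
  proof -
    have "(\<forall>g. P g) \<longleftrightarrow> (\<forall>g\<in>UNIV. P g)" for P :: "gen \<Rightarrow> bool" by simp
    thus "((Jid (a Cbar) \<and> Tid (a CbarDelta)) \<and> Tid (a f0) \<and> Tid (a f1) \<and> Tid (a f2) \<and> Tid (a f3) \<and> Tid (a f4) \<and> Tid (a f5)) =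
       (\<forall>g. if g \<in> {One, Cbar} then Jid (a g) else Tid (a g))"
      unfolding UNIV_gen using supp_odd[OF a o] by (simp add: Jid_closed Tid_closed)
  qed
  finally show ?thesis .
qed

lemma gD_one_dlt: "gD (usc \<alpha> one\<^sub>D) = usc \<alpha> (one\<^sub>D :: 'w D)" "gD (usc \<beta> dlt) = usc \<beta> (dlt :: 'w::comm_ring_1 D)"
proof -
  have "gD one\<^sub>D = (one\<^sub>D :: 'w D)" by (rule D_eqI) (simp_all add: es_def)
  moreover have "gD dlt = (dlt :: 'w D)" by (rule D_eqI) (simp_all add: dlt_def mkD_simps algebra_simps)
  ultimately show "gD (usc \<alpha> one\<^sub>D) = usc \<alpha> one\<^sub>D" "gD (usc \<beta> dlt) = usc \<beta> dlt" by (simp_all only: usc_D)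
qed

lemma N9_xxx_inv: "gD d = d \<Longrightarrow> N9 (sgl Ex Ex Ex d) = 0"
  by (simp only: tr3_def nine.c_def \<gamma>Ns \<gamma>N_sgls sgl_simps gDs) (simp add: algebra_simps)

text \<open>The tensor xx + yx + yy is already invariant under the cube of \<gamma>, so three terms
  of \<gamma> suffice to make an invariant.\<close>

lemma tr3_i12_inv: "\<gamma>N (tr3 \<gamma>N (i12 l 0 l l)) = tr3 \<gamma>N (i12 l 0 l l)"
proof -
  have c: "c\<gamma> (i12 l 0 l l) = i12 l 0 l l"
    unfolding nine.c_def i12_def by (simp only: \<gamma>Ns \<gamma>N_sgls sgl_simps gDs gD_cube) (simp add: algebra_simps)
  show ?thesis unfolding tr3_def \<gamma>Ns using c[unfolded nine.c_def] by (simp only: add_ac)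
qed

lemma Zs_cocycle: "supp q a \<Longrightarrow> tate_d 9 \<gamma>N q (Zs u v a) = 0"
proof (cases "even q")
  case True
  assume a: "supp q a"
  show ?thesis unfolding tate_d_N Zs_even[OF a True] \<gamma>Ns tr3_i12_inv \<gamma>N_sgls gDs gD_one_dlt using True by simp
next
  case False
  assume a: "supp q a"
  have 1: "N9 (sgl Ex E1 E1 (usc (kU u) L) + sgl Ey E1 E1 (usc (kU v) L)) = 0" for L :: "'a D"
    unfolding eqO_N9[OF eqO_x11] by (rule N9_x11)
  have 2: "N9 (sgl Ex Ex Ex (usc \<alpha> one\<^sub>D + usc \<beta> dlt)) = 0" for \<alpha> \<beta> :: "'a U"
    by (rule N9_xxx_inv) (simp only: gDs gD_one_dlt)
  have "N9 (Zs u v a) = 0"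
    by (simp only: Zs_odd[OF a False] nine.tr3_add[of _ "sgl Ex Ex Ex _"] 1[unfolded nine.tr3_add] 1 2 nine.tr3_add add_0_right)
  thus ?thesis unfolding tate_d_N using False by simp
qed

theorem Zs_surj:
  fixes u v :: "'w::strict_3_ring"
  assumes e: "e * (u + v) = 1 + 3 * m" and z: "tate_d 9 \<gamma>N q z = 0"
  shows "\<exists>a. supp q a \<and> cob q (z - Zs u v a)"
proof (cases "even q")
  case True
  hence "\<gamma>N z = z" using z by (simp add: tate_d_N)
  from even_classes[OF this] obtain \<alpha> \<beta> l y where l: "z = sgl E1 E1 E1 (usc \<alpha> one\<^sub>D + usc \<beta> dlt) + tr3 \<gamma>N (i12 l 0 l l) + N9 y" by blast
  have un: "unit9 (- kap u v)" by (intro unit9_uminus unit9_kap[OF e])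
  have "\<forall>j. \<exists>y m. kU (- kap u v) * y = l j + 9 * m"
    using unit9_solve[OF un] by blast
  from choice[OF this] obtain x where "\<forall>j. \<exists>m. kU (- kap u v) * x j = l j + 9 * m" by blast
  from choice[OF this] obtain m where x: "\<And>j. kU (- kap u v) * x j = l j + 9 * m j" by blast
  define a where "a g = (case g of One \<Rightarrow> \<alpha> | Delta \<Rightarrow> \<beta> | F0 \<Rightarrow> x S0 | F1 \<Rightarrow> x S1 | F2 \<Rightarrow> x S2 | F3 \<Rightarrow> x S3 | F4 \<Rightarrow> x S4 | F5 \<Rightarrow> x S5 | _ \<Rightarrow> 0)" for g
  have a: "supp q a"
    unfolding supp_def
  proof
    fix g show "odd (q - coh_deg g) \<longrightarrow> a g = 0" using True by (cases g) (simp_all add: a_def)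
  qed
  \<comment> \<open>The error 9 m of dividing by a constant is h + h + h, the form that
    \<open>N9_i12\<close> recognizes as a norm.\<close>
  define h where "h j = 3 * m j" for j
  have "usc (kU (- kap u v)) (mkD (a F0) (a F1) (a F2) (a F3) (a F4) (a F5)) = l + (h + h + h)"
    by (rule D_eqI) (simp_all add: usc_def mkD_simps a_def x h_def)
  moreover have "i12 (l + k) 0 (l + k) (l + k) = i12 l 0 l l + i12 k 0 k k" for k by (simp only: i12_add add_0_right)
  moreover have "a One = \<alpha>" "a Delta = \<beta>" by (simp_all add: a_def)
  ultimately have Z: "Zs u v a = sgl E1 E1 E1 (usc \<alpha> one\<^sub>D + usc \<beta> dlt) + (tr3 \<gamma>N (i12 l 0 l l) + N9 (i12 h (- h) 0 0))"
    by (simp only: Zs_even[OF a True] nine.tr3_add N9_i12)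
  have "A + B + C - (A + (B + D)) = C - D" for A B C D :: "'w N" by simp
  hence "z - Zs u v a = N9 y - N9 (i12 h (- h) 0 0)" unfolding Z l by (simp only:)
  hence "cob q (z - Zs u v a)" unfolding cob_even[OF True] nine.tr3_diff[symmetric] by blast
  with a show ?thesis by blast
next
  case False
  hence o: "odd q" .
  hence "N9 z = 0" using z by (simp add: tate_d_N)
  from odd_classes[OF this] obtain p \<alpha> \<beta> where p: "eqO z (sgl Ex E1 E1 p + sgl Ex Ex Ex (usc \<alpha> one\<^sub>D + usc \<beta> dlt))" by blast
  define K where "K = - kap u v * (u + v)"
  have un: "unit9 (u + v)" by (rule unit9I[OF e])
  have K: "unit9 K" unfolding K_def by (intro unit9_mult unit9_uminus unit9_kap[OF e] un)
  have "\<forall>j. \<exists>y m. kU (u + v) * y = p j + 9 * m"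
    using unit9_solve[OF un] by blast
  from choice[OF this] obtain x where "\<forall>j. \<exists>m. kU (u + v) * x j = p j + 9 * m" by blast
  from choice[OF this] obtain m where x: "\<And>j. kU (u + v) * x j = p j + 9 * m j" by blast
  obtain \<alpha>' m1 where \<alpha>': "kU K * \<alpha>' = \<alpha> + 9 * m1" using unit9_solve[OF K] by blast
  obtain \<beta>' m2 where \<beta>': "kU K * \<beta>' = \<beta> + 9 * m2" using unit9_solve[OF K] by blast
  define a where "a g = (case g of Cbar \<Rightarrow> \<alpha>' | CbarDelta \<Rightarrow> \<beta>' | f0 \<Rightarrow> x S0 | f1 \<Rightarrow> x S1 | f2 \<Rightarrow> x S2 | f3 \<Rightarrow> x S3 | f4 \<Rightarrow> x S4 | f5 \<Rightarrow> x S5 | _ \<Rightarrow> 0)" for g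
  have a: "supp q a"
    unfolding supp_def
  proof
    fix g show "odd (q - coh_deg g) \<longrightarrow> a g = 0" using o by (cases g) (simp_all add: a_def)
  qed
  \<comment> \<open>Here too the error 9 m is written as h + h + h, now to be absorbed by
    \<open>odd_trivial_x11\<close>.\<close>
  define h where "h j = 3 * m j" for j
  define L where "L = mkD (a f0) (a f1) (a f2) (a f3) (a f4) (a f5)"
  have L: "usc (kU (u + v)) L = p + (h + h + h)"
    by (rule D_eqI) (simp_all add: usc_def L_def mkD_simps a_def x h_def)
  have aC: "a Cbar = \<alpha>'" "a CbarDelta = \<beta>'" by (simp_all add: a_def)
  have "Jid (9 * m1) \<and> Tid (9 * m2)" by (intro conjI Jid_closed Tid_closed)
  then obtain y where y: "usc (9 * m1) one\<^sub>D + usc (9 * m2) dlt = trD y" unfolding crit_trD[symmetric] by blast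
  have "usc (kU K * \<alpha>') one\<^sub>D + usc (kU K * \<beta>') dlt = (usc \<alpha> one\<^sub>D + usc \<beta> dlt) + trD y"
    unfolding \<alpha>' \<beta>' y[symmetric] usc_simps by (simp only: add_ac)
  hence Z: "Zs u v a = sgl Ex E1 E1 (usc (kU u) L) + sgl Ey E1 E1 (usc (kU v) L) + (sgl Ex Ex Ex (usc \<alpha> one\<^sub>D + usc \<beta> dlt) + sgl Ex Ex Ex (trD y))"
    by (simp only: Zs_odd[OF a o] L_def[symmetric] K_def[symmetric] aC sgl_simps(1)[symmetric])
  have "eqO (Zs u v a) ((sgl Ex E1 E1 p + 0) + (sgl Ex Ex Ex (usc \<alpha> one\<^sub>D + usc \<beta> dlt) + 0))"
    unfolding Z
  proof (rule eqO_add)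
    show "eqO (sgl Ex E1 E1 (usc (kU u) L) + sgl Ey E1 E1 (usc (kU v) L)) (sgl Ex E1 E1 p + 0)"
      by (rule eqO_trans[OF eqO_x11]) (unfold L sgl_simps(1)[of _ _ _ p], intro eqO_add eqO_refl odd_trivial_x11)
  qed (intro eqO_add eqO_refl sgl_xxx_trD)
  hence Z': "eqO (Zs u v a) (sgl Ex E1 E1 p + sgl Ex Ex Ex (usc \<alpha> one\<^sub>D + usc \<beta> dlt))" by (simp only: add_0_right)
  have "eqO (z + - Zs u v a) ((sgl Ex E1 E1 p + sgl Ex Ex Ex (usc \<alpha> one\<^sub>D + usc \<beta> dlt)) + - (sgl Ex E1 E1 p + sgl Ex Ex Ex (usc \<alpha> one\<^sub>D + usc \<beta> dlt)))"
    by (intro eqO_add eqO_uminus p Z')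
  hence "cob q (z - Zs u v a)" unfolding cob_odd[OF o] right_minus diff_conv_add_uminus .
  with a show ?thesis by blast
qed

subsection \<open>The generators as cochains\<close>

abbreviation RM :: "'w::strict_3_ring M \<Rightarrow> 'w N" where "RM x \<equiv> ap (M_hom x) oneN"

lemma \<gamma>_x: "\<gamma> (xM 0) = xM 1" "\<gamma> (xM 1) = xM 2" "\<gamma> (xM 2) = xM 3" "\<gamma> (xM 3) = xM 4" "\<gamma> (xM 4) = xM 5" "\<gamma> (xM 5) = xM 6"
    "\<gamma> (xM 6) = xM 7"
  by (simp_all add: \<gamma>_simps(5))

lemma x7_eq: "xM 7 = - xM 1 - (xM 4 :: 'w::strict_3_ring M)"
proof -
  have "\<gamma> (xM 0 + xM 3 + xM 6) = (0 :: 'w M)" by (simp only: x_rel \<gamma>_simps(3))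
  hence "xM 1 + xM 4 + xM 7 = (0 :: 'w M)" by (simp only: \<gamma>_simps(1) \<gamma>_x)
  thus ?thesis by (simp add: eq_neg_iff_add_eq_0 algebra_simps)
qed

lemma \<gamma>_uminus: "\<gamma> (- a) = - \<gamma> a" for a :: "'w::strict_3_ring M"
  using \<gamma>_diff[of 0 a] by (simp add: \<gamma>_simps)

lemma \<gamma>3: "(\<gamma> ^^ 3) x = \<gamma> (\<gamma> (\<gamma> x))"
  by (simp add: numeral_3_eq_3)

lemma cup3_11: "tate_cup 3 g 1 1 a b = a * g b + (a * g (g b) + g a * g (g b))" for a :: "'a::comm_ring_1"
  by (simp add: tate_cup_def eval_nat_numeral)

lemma tate_d3_odd: "tate_d 3 g 1 x = x + g x + g (g x)" for x :: "'a::ab_group_add"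
  by (simp add: tate_d_def eval_nat_numeral)

lemma cup3_even_odd: "tate_cup 3 g 1 0 a b = a * g b" "tate_cup 3 g 2 q a b = a * b" "tate_cup 3 g 3 0 a b = a * g b"
  for a :: "'a::comm_ring_1"
  by (simp_all add: tate_cup_def)

lemma \<gamma>_dbas3: "\<gamma> (\<gamma> (\<gamma> d1)) = d1" "\<gamma> (\<gamma> (\<gamma> d2)) = d2" "\<gamma> (\<gamma> (\<gamma> d3)) = d3"
  by (simp_all only: \<gamma>_d)

lemma \<gamma>_delta: "\<gamma> delta = delta"
  unfolding delta_def by (simp only: \<gamma>_simps \<gamma>_diff \<gamma>_d) (simp only: mult_ac)

lemma V_M_form: "c \<in> V_M \<Longrightarrow> \<exists>u v. c = M_const u * xM 0 + M_const v * xM 3"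
proof -
  assume "c \<in> V_M"
  then obtain u v w where c: "c = M_const u * xM 0 + M_const v * xM 3 + M_const w * xM 6" unfolding V_M_def by blast
  have "c = M_const (u + - w) * xM 0 + M_const (v + - w) * xM 3"
    unfolding c x6_eq M_const_simps by (simp add: algebra_simps)
  thus ?thesis by blast
qed

lemma kap_const: "M_const (- kap u v) = - (M_const u * M_const u - M_const u * M_const v + M_const v * M_const v)"
  unfolding kap_def by (simp only: diff_conv_add_uminus M_const_simps)

text \<open>In the model this is xx + yx + yy in the first two factors, the invariant that spans the
  part with two factors in \<open>even_classes\<close>.\<close>

definition thM :: "'w::strict_3_ring M" where "thM = xM 0 * xM 1 + xM 3 * xM 1 + xM 3 * xM 4"

lemma thM_\<gamma>3: "\<gamma> (\<gamma> (\<gamma> thM)) = (thM :: 'w::strict_3_ring M)"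
  unfolding thM_def by (simp only: \<gamma>_simps(1,2) \<gamma>_uminus \<gamma>_diff \<gamma>_x x6_eq x7_eq) (simp add: algebra_simps)

lemma RM_simps: "RM (x + y) = RM x + RM y" "RM (x - y) = RM x - RM y" "RM (- x) = - RM x" "RM (M_const w * x) = nsc (kU w) (RM x)"
    "RM (s1 * x) = nsc t1 (RM x)" "RM (s2 * x) = nsc t2 (RM x)" "RM (s3 * x) = RM x"
  by (simp_all only: M_hom_simps M_hom_diff M_hom_minus M_hom_const M_hom_s copW_def kU_def ap_simps copU.rep_eq)

lemma RM_numeral: "RM (2 * x) = nsc 2 (RM x)" "RM (3 * x) = nsc 3 (RM x)" "RM (4 * x) = nsc 4 (RM x)" "RM (6 * x) = nsc 6 (RM x)"
proof -
  have M: "(2 :: 'a M) * x = x + x" "(3 :: 'a M) * x = x + x + x" "(4 :: 'a M) * x = x + x + (x + x)" "(6 :: 'a M) * x = x + x + x + (x + x + x)"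
    by (simp_all add: algebra_simps)
  have U: "(2 :: 'a U) = 1 + 1" "(3 :: 'a U) = 1 + 1 + 1" "(4 :: 'a U) = 1 + 1 + (1 + 1)" "(6 :: 'a U) = 1 + 1 + 1 + (1 + 1 + 1)"
    by simp_all
  have 1: "nsc 1 y = y" for y :: "'a N" by (simp add: nsc_def usc_def)
  show "RM (2 * x) = nsc 2 (RM x)" "RM (3 * x) = nsc 3 (RM x)" "RM (4 * x) = nsc 4 (RM x)" "RM (6 * x) = nsc 6 (RM x)"
    unfolding M U nsc_simps(1) 1 RM_simps by (rule refl)+
qed

lemma RM_bas: "RM (elem b1 * (\<gamma> (elem b2) * \<gamma> (\<gamma> (elem b3))) * dbas j) = sgl b1 b2 b3 (es j 1)"
  using Rho_bas[of b1 b2 b3 j 0 0 0] by (simp only: Rho_def s3_pow_0 Mloc_hom_mfrac bas.simps power_0 mult_1_right)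

lemma RM_\<gamma>: "RM (\<gamma> x) = \<gamma>N (RM x)" for x :: "'w::strict_3_ring M"
proof -
  have "gD one\<^sub>D = (one\<^sub>D :: 'w D)" by (rule D_eqI) (simp_all add: es_def)
  hence "\<gamma>N oneN = (oneN :: 'w N)" unfolding oneN_def \<gamma>N_sgl by (simp only:)
  with ap_M_hom_\<gamma>[of x oneN] show ?thesis by (simp only:)
qed

lemma RM_tr: "RM (tr x) = tr3 \<gamma>N (RM x)"
  by (simp only: tr_def RM_simps RM_\<gamma> tr3_def)

lemma delta_dbas: "delta = - (s1 * (s2 * dbas S0)) - 3 * (s3 * dbas S0) + 2 * (s2 * dbas S1) - 2 * (s2 * dbas S2)
     + 4 * (s1 * dbas S3) + 2 * (s1 * dbas S4) - 6 * dbas S5"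
  by (simp add: delta_def s1_def s2_def s3_def algebra_simps)

lemma RM_delta: "RM (elem b1 * (\<gamma> (elem b2) * \<gamma> (\<gamma> (elem b3))) * delta) = (sgl b1 b2 b3 dlt :: 'w::strict_3_ring N)"
proof -
  define b :: "'w M" where "b = elem b1 * (\<gamma> (elem b2) * \<gamma> (\<gamma> (elem b3)))"
  have e: "b * delta = - (s1 * (s2 * (b * dbas S0))) - 3 * (s3 * (b * dbas S0)) + 2 * (s2 * (b * dbas S1)) - 2 * (s2 * (b * dbas S2))
     + 4 * (s1 * (b * dbas S3)) + 2 * (s1 * (b * dbas S4)) - 6 * (b * dbas S5)"
    unfolding delta_dbas by (simp only: distrib_left right_diff_distrib mult_minus_right mult.left_commute)
  have R: "RM (b * dbas j) = sgl b1 b2 b3 (es j 1)" for j unfolding b_def by (rule RM_bas)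
  have d: "- es S0 (t1 * (t2 * 1)) - es S0 (3 * 1) + es S1 (2 * (t2 * 1)) - es S2 (2 * (t2 * 1)) + es S3 (4 * (t1 * 1)) + es S4 (2 * (t1 * 1)) - es S5 (6 * 1)
      = (dlt :: 'w D)"
    by (rule D_eqI) (simp_all add: dlt_def mkD_simps es_def)
  have "RM (b * delta) = sgl b1 b2 b3 dlt"
    unfolding e RM_simps RM_numeral R nsc_sgl d[symmetric] sgl_simps by (simp only: minus_add_distrib)
  thus ?thesis unfolding b_def .
qed

lemma RM_const_x: "RM (M_const (a :: 'w::strict_3_ring) * (xM 0 * dbas j) + M_const b * (xM 3 * dbas j)) = sgl Ex E1 E1 (es j (kU a)) + sgl Ey E1 E1 (es j (kU b))"
proof -
  have "RM (xM 0 * dbas j :: 'w M) = sgl Ex E1 E1 (es j 1)" "RM (xM 3 * dbas j :: 'w M) = sgl Ey E1 E1 (es j 1)"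
    using RM_bas[of Ex E1 E1 j] RM_bas[of Ey E1 E1 j] by (simp_all only: elem.simps \<gamma>_simps mult_1_right)
  thus ?thesis by (simp only: RM_simps nsc_sgl mult_1_right)
qed

lemma M_const_x_inject:
  assumes "M_const a * xM 0 + M_const b * xM 3 = M_const a' * xM 0 + M_const b' * xM 3"
  shows "a = a'" "b = b'"
proof -
  have "RM (M_const a * (xM 0 * dbas S0) + M_const b * (xM 3 * dbas S0)) = RM (M_const a' * (xM 0 * dbas S0) + M_const b' * (xM 3 * dbas S0))"
    by (simp only: dbas.simps mult_1_right assms)
  hence e: "(sgl Ex E1 E1 (es S0 (kU a)) + sgl Ey E1 E1 (es S0 (kU b))) x E1 E1 S0 = (sgl Ex E1 E1 (es S0 (kU a')) + sgl Ey E1 E1 (es S0 (kU b'))) x E1 E1 S0" for x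
    unfolding RM_const_x by (simp only:)
  have "kU a = kU a'" "kU b = kU b'" using e[of Ex] e[of Ey] by (simp_all add: sgl_at es_def)
  from this[THEN arg_cong[of _ _ "\<lambda>f. fps_nth (fps_nth f 0) 0"]] show "a = a'" "b = b'" by (simp_all add: kU_def)
qed

text \<open>\<open>x_0\<close> is itself a cocycle, hence a multiple w c up to a coboundary. The
  coordinates of a coboundary at \<open>x_0\<close> and \<open>x_3\<close> add up to a multiple of
  3, so w (u + v) is 1 modulo 3.\<close>

lemma generates_H1_unit:
  assumes "generates_H1 (c :: 'w::strict_3_ring M)"
  obtains u v e m where "c = M_const u * xM 0 + M_const v * xM 3" "e * (u + v) = 1 + 3 * (m :: 'w)"
proof -
  have "c \<in> V_M" using assms unfolding generates_H1_def tate_Z_def by blast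
  then obtain u v where c: "c = M_const u * xM 0 + M_const v * xM 3" using V_M_form by blast
  have "xM 0 \<in> (V_M :: 'w M set)"
    unfolding V_M_def by (intro CollectI exI[of _ 1] exI[of _ 0]) (simp add: M_const_simps)
  moreover have "tate_d 3 (\<gamma> ^^ 3) 1 (xM 0) = (0 :: 'w M)"
    unfolding tate_d3_odd \<gamma>3 \<gamma>_x by (rule x_rel(1))
  ultimately have "(xM 0 :: 'w M) \<in> tate_Z 3 (\<gamma> ^^ 3) V_M 1" unfolding tate_Z_def by blast
  then obtain w where "xM 0 - M_const w * c \<in> tate_B 3 (\<gamma> ^^ 3) V_M 1" using assms unfolding generates_H1_def by blast
  then obtain y where y: "y \<in> V_M" "xM 0 - M_const w * c = \<gamma> (\<gamma> (\<gamma> y)) - y"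
    unfolding tate_B_def tate_d_def \<gamma>3 by auto
  obtain p r where p: "y = M_const p * xM 0 + M_const r * xM 3" using V_M_form[OF y(1)] by blast
  have "M_const (1 + - (w * u)) * xM 0 + M_const (- (w * v)) * xM 3 = xM 0 - M_const w * c"
    unfolding c M_const_simps by (simp add: algebra_simps)
  also have "\<dots> = M_const (- p + - r) * xM 0 + M_const (p + - r + - r) * xM 3"
    unfolding y(2) p by (simp only: \<gamma>_simps(1,2) \<gamma>_uminus \<gamma>_diff \<gamma>_const \<gamma>_x x6_eq M_const_simps) (simp add: algebra_simps)
  finally have "1 + - (w * u) = - p + - r" "- (w * v) = p + - r + - r" using M_const_x_inject by blast+
  hence "(1 + - (w * u)) + - (w * v) = (- p + - r) + (p + - r + - r)" by (simp only:)
  hence "w * (u + v) = 1 + 3 * r" by (simp add: algebra_simps)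
  with c that show ?thesis by blast
qed

lemma c1c2_eq:
  assumes "c = M_const u * xM 0 + M_const v * xM 3"
  shows "c1c2 c = M_const (- kap u v) * thM"
  unfolding c1c2_def cup3_11 \<gamma>3 assms thM_def kap_const
  by (simp only: \<gamma>_simps(1,2) \<gamma>_uminus \<gamma>_diff \<gamma>_const \<gamma>_x x6_eq x7_eq) (simp add: algebra_simps)

text \<open>Cochains of C9, whereas \<open>detecting\<close> gives their restrictions to C3.
  Restriction is the trace of \<gamma> in odd degrees and the identity in even degrees, so
  \<open>f_i\<close> is represented without the trace and \<open>F_i\<close> with it.\<close>

primrec zM :: "'w::strict_3_ring \<Rightarrow> 'w \<Rightarrow> 'w M \<Rightarrow> gen \<Rightarrow> 'w M" where
  "zM u v c One = 1" | "zM u v c Delta = delta"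
| "zM u v c Cbar = M_const (- kap u v * (u + v)) * (xM 0 * (xM 1 * xM 2))"
| "zM u v c CbarDelta = M_const (- kap u v * (u + v)) * (xM 0 * (xM 1 * xM 2)) * delta"
| "zM u v c f0 = c * dbas S0" | "zM u v c f1 = c * dbas S1" | "zM u v c f2 = c * dbas S2"
| "zM u v c f3 = c * dbas S3" | "zM u v c f4 = c * dbas S4" | "zM u v c f5 = c * dbas S5"
| "zM u v c F0 = tr (c1c2 c * dbas S0)" | "zM u v c F1 = tr (c1c2 c * dbas S1)" | "zM u v c F2 = tr (c1c2 c * dbas S2)"
| "zM u v c F3 = tr (c1c2 c * dbas S3)" | "zM u v c F4 = tr (c1c2 c * dbas S4)" | "zM u v c F5 = tr (c1c2 c * dbas S5)"

lemma RM_zM: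
  assumes c: "c = M_const u * xM 0 + M_const v * xM 3"
  shows "RM (zM u v c g) = zeta u v g"
proof -
  have f: "RM (c * dbas j) = zf u v j" for j
    unfolding zf_def RM_const_x[symmetric] c by (simp only: distrib_right mult.assoc)
  have "RM (xM 0 * (xM 1 * 1) * dbas j :: 'a M) = sgl Ex Ex E1 (es j 1)" "RM (xM 3 * (xM 1 * 1) * dbas j :: 'a M) = sgl Ey Ex E1 (es j 1)"
    "RM (xM 3 * (xM 4 * 1) * dbas j :: 'a M) = sgl Ey Ey E1 (es j 1)" for j
    using RM_bas[of Ex Ex E1 j] RM_bas[of Ey Ex E1 j] RM_bas[of Ey Ey E1 j] by (simp_all only: elem.simps \<gamma>_simps(4) \<gamma>_x)
  note xx = this[unfolded mult_1_right]
  have "RM (c1c2 c * dbas j) = i12 (es j (kU (- kap u v))) 0 (es j (kU (- kap u v))) (es j (kU (- kap u v)))" for j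
  proof -
    have "c1c2 c * dbas j = M_const (- kap u v) * (xM 0 * xM 1 * dbas j + xM 3 * xM 1 * dbas j + xM 3 * xM 4 * dbas j)"
      unfolding c1c2_eq[OF c] thM_def by (simp only: mult.assoc distrib_right)
    thus ?thesis by (simp only: RM_simps xx nsc_add nsc_sgl mult_1_right i12_def sgl_simps add_0_right)
  qed
  hence F: "RM (tr (c1c2 c * dbas j)) = zF u v j" for j unfolding RM_tr zF_def by (simp only:)
  have X: "elem Ex * (\<gamma> (elem Ex) * \<gamma> (\<gamma> (elem Ex))) = xM 0 * (xM 1 * (xM 2 :: 'a M))" by (simp only: elem.simps \<gamma>_x)
  have O: "elem E1 * (\<gamma> (elem E1) * \<gamma> (\<gamma> (elem E1))) = (1 :: 'a M)" by (simp only: elem.simps \<gamma>_simps mult_1_right)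
  have 1: "RM (1 :: 'a M) = sgl E1 E1 E1 one\<^sub>D" 
  proof -
    have "RM (elem E1 * (\<gamma> (elem E1) * \<gamma> (\<gamma> (elem E1))) * dbas S0 :: 'a M) = sgl E1 E1 E1 one\<^sub>D" by (rule RM_bas)
    thus ?thesis unfolding O dbas.simps mult_1_right .
  qed
  have 2: "RM (xM 0 * (xM 1 * xM 2) :: 'a M) = sgl Ex Ex Ex one\<^sub>D" 
  proof -
    have "RM (elem Ex * (\<gamma> (elem Ex) * \<gamma> (\<gamma> (elem Ex))) * dbas S0 :: 'a M) = sgl Ex Ex Ex one\<^sub>D" by (rule RM_bas)
    thus ?thesis unfolding X dbas.simps mult_1_right .
  qed
  have 3: "RM (delta :: 'a M) = sgl E1 E1 E1 dlt" 
  proof -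
    have "RM (elem E1 * (\<gamma> (elem E1) * \<gamma> (\<gamma> (elem E1))) * delta :: 'a M) = sgl E1 E1 E1 dlt" by (rule RM_delta)
    thus ?thesis unfolding O mult_1_left .
  qed
  have 4: "RM (xM 0 * (xM 1 * xM 2) * delta :: 'a M) = sgl Ex Ex Ex dlt" 
  proof -
    have "RM (elem Ex * (\<gamma> (elem Ex) * \<gamma> (\<gamma> (elem Ex))) * delta :: 'a M) = sgl Ex Ex Ex dlt" by (rule RM_delta)
    thus ?thesis unfolding X .
  qed
  show ?thesis
    by (cases g) (simp_all only: zM.simps zeta.simps f F 1 2 3 4 mult.assoc[of "M_const _"] RM_simps(4) nsc_sgl')
qed

lemma M_deg_tr: "x \<in> M_deg n \<Longrightarrow> tr x \<in> M_deg n" for x :: "'w::strict_3_ring M"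
  unfolding tr_def by (intro M_deg_add M_deg_\<gamma>)

lemma zM_deg:
  assumes c: "c = M_const u * xM 0 + M_const v * xM 3"
  shows "zM u v c g \<in> M_deg (int_deg g)"
proof -
  have "c \<in> M_deg (0 + - 2)" unfolding c by (intro M_deg_add M_deg_mult M_deg_const M_deg_x)
  hence f: "c * dbas j \<in> M_deg (- 2 + - 2 * degs j)" for j by (intro M_deg_mult M_deg_dbas) simp
  have "thM \<in> (M_deg (- 2 + - 2) :: 'a M set)" unfolding thM_def by (intro M_deg_add M_deg_mult M_deg_x)
  hence "M_const (- kap u v) * thM * dbas j \<in> M_deg (0 + - 4 + - 2 * degs j)" for j by (intro M_deg_mult M_deg_dbas M_deg_const) simp
  hence F: "tr (c1c2 c * dbas j) \<in> M_deg (- 4 + - 2 * degs j)" for j unfolding c1c2_eq[OF c] by (intro M_deg_tr) simp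
  have d: "delta \<in> (M_deg (- 6 + - 6 + - 6) :: 'a M set)" unfolding delta_def by (intro M_deg_mult M_deg_diff M_deg_d)
  have x: "M_const (- kap u v * (u + v)) * (xM 0 * (xM 1 * xM 2)) \<in> M_deg (0 + (- 2 + (- 2 + - 2)))"
    by (intro M_deg_mult M_deg_x M_deg_const)
  have xd: "M_const (- kap u v * (u + v)) * (xM 0 * (xM 1 * xM 2)) * delta \<in> M_deg ((0 + (- 2 + (- 2 + - 2))) + (- 6 + - 6 + - 6))"
    by (intro M_deg_mult[OF x d])
  show ?thesis
    by (cases g) (use f[of S0] f[of S1] f[of S2] f[of S3] f[of S4] f[of S5] F[of S0] F[of S1] F[of S2] F[of S3] F[of S4] F[of S5]
       d x xd M_deg_one in simp_all)
qed

lemma hat_of_M_hom: "hat_of_M (x + y) = hat_of_M x + hat_of_M y" "hat_of_M (- x) = - hat_of_M x" "hat_of_M 1 = 1"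
    "\<gamma>_hat (hat_of_M x) = hat_of_M (\<gamma> x)" "hat_of_M (x - y) = hat_of_M x - hat_of_M y"
proof -
  note a = abs_Mhat_simps[OF coherent_const coherent_const]
  show add: "hat_of_M (x + y) = hat_of_M x + hat_of_M y" for x y :: "'a M" unfolding hat_of_M_def a mfrac0_simps ..
  show min: "hat_of_M (- x) = - hat_of_M x" for x :: "'a M" unfolding hat_of_M_def a mfrac0_simps ..
  show "hat_of_M 1 = 1" unfolding hat_of_M_def mfrac0_simps one_Mhat_def ..
  show "\<gamma>_hat (hat_of_M x) = hat_of_M (\<gamma> x)" unfolding hat_of_M_def a \<gamma>_loc_simps ..
  show "hat_of_M (x - y) = hat_of_M x - hat_of_M y" unfolding diff_conv_add_uminus add min ..
qed

lemma \<gamma>_hat_add: "\<gamma>_hat (a + b) = \<gamma>_hat a + \<gamma>_hat b"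
proof -
  obtain x y where a: "coherent x" "a = abs_Mhat x" and b: "coherent y" "b = abs_Mhat y" by (metis Mhat_cases)
  show ?thesis
    unfolding a(2) b(2) abs_Mhat_simps(1)[OF a(1) b(1)] abs_Mhat_simps(4)[OF coherent_add[OF a(1) b(1)] a(1)]
      abs_Mhat_simps(4)[OF a(1) a(1)] abs_Mhat_simps(4)[OF b(1) b(1)] abs_Mhat_simps(1)[OF coherent_\<gamma>[OF a(1)] coherent_\<gamma>[OF b(1)]]
      \<gamma>_loc_simps ..
qed

lemma add_map_\<gamma>_hat: "add_map \<gamma>_hat" by (rule add_mapI) (rule \<gamma>_hat_add)

lemmas \<gamma>_hats = add_map_simps[OF add_map_\<gamma>_hat]

text \<open>The cochain of \<open>Cbar\<close> restricts to \<open>cbar c\<close> only up to the coboundary of \<open>Y\<close>.\<close>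

lemma res_zM:
  assumes c: "c = M_const u * xM 0 + M_const v * xM 3"
  shows "\<exists>y\<in>M_deg (int_deg g). (if even (coh_deg g) then zM u v c g else tr (zM u v c g)) - detecting c g =
    (if even (coh_deg g) then 0 else \<gamma> (\<gamma> (\<gamma> y)) - y)"
proof -
  \<comment> \<open>The trace of \<open>x_0\<close> \<open>x_1\<close> \<open>x_2\<close> is
    \<open>thM\<close> times \<open>x_2\<close>, while \<open>cbar c\<close> has u
    \<open>x_2\<close> + v \<open>x_5\<close> in place of (u + v) \<open>x_2\<close>. The difference
    is a multiple of \<open>x_5 - x_2\<close>, and \<open>x_5\<close> is the image of
    \<open>x_2\<close> under the cube of \<gamma>.\<close>
  define Y where "Y = M_const (kap u v * v) * (thM * xM 2)"
  have cb: "cbar c = M_const (- kap u v) * thM * (M_const u * xM 2 + M_const v * xM 5)"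
    unfolding cbar_def cup3_even_odd c1c2_eq[OF c] by (subst c) (simp only: \<gamma>_simps(1,2) \<gamma>_const \<gamma>_x)
  have "tr (xM 0 * (xM 1 * xM 2)) = thM * (xM 2 :: 'a M)"
    unfolding tr_def thM_def by (simp only: \<gamma>_simps(2) \<gamma>_x) (simp add: algebra_simps)
  moreover have "tr (M_const w * x) = M_const w * tr x" for w and x :: "'a M"
    unfolding tr_def by (simp only: \<gamma>_simps(2) \<gamma>_const distrib_left)
  ultimately have t: "tr (zM u v c Cbar) = M_const (- kap u v * (u + v)) * (thM * xM 2)" by (simp only: zM.simps)
  have Y3: "\<gamma> (\<gamma> (\<gamma> Y)) = M_const (kap u v * v) * (thM * xM 5)"
    unfolding Y_def by (simp only: \<gamma>_simps(2) \<gamma>_const thM_\<gamma>3 \<gamma>_x)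
  have C: "tr (zM u v c Cbar) - cbar c = \<gamma> (\<gamma> (\<gamma> Y)) - Y"
    unfolding t cb Y3 unfolding Y_def M_const_simps by (simp add: algebra_simps)
  have td: "tr (x * delta) = tr x * delta" for x :: "'a M"
    unfolding tr_def by (simp only: \<gamma>_simps(2) \<gamma>_delta distrib_right)
  have "tr (zM u v c CbarDelta) - detecting c CbarDelta = (tr (zM u v c Cbar) - cbar c) * delta"
    by (simp only: zM.simps td detecting.simps cup3_even_odd \<gamma>3 \<gamma>_delta left_diff_distrib)
  also have "\<dots> = \<gamma> (\<gamma> (\<gamma> (Y * delta))) - Y * delta" unfolding C by (simp only: \<gamma>_simps(2) \<gamma>_delta left_diff_distrib)
  finally have CD: "tr (zM u v c CbarDelta) - detecting c CbarDelta = \<gamma> (\<gamma> (\<gamma> (Y * delta))) - Y * delta" .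
  have "M_const (kap u v * v) * (thM * xM 2) \<in> M_deg (0 + ((- 2 + - 2) + - 2))"
    unfolding thM_def by (intro M_deg_mult M_deg_add M_deg_x M_deg_const)
  hence Yd: "Y \<in> M_deg (- 6)" unfolding Y_def by simp
  have "delta \<in> (M_deg (- 6 + - 6 + - 6) :: 'a M set)" unfolding delta_def by (intro M_deg_mult M_deg_diff M_deg_d)
  from M_deg_mult[OF Yd this] have Yd': "Y * delta \<in> M_deg (- 24)" by simp
  have o: "\<exists>y\<in>M_deg n. x - x = \<gamma> (\<gamma> (\<gamma> y)) - y" for x :: "'a M" and n
    by (rule bexI[OF _ M_deg_zero]) (simp add: \<gamma>_simps)
  have z: "\<exists>y\<in>M_deg n. x - x = (0 :: 'a M)" for x :: "'a M" and n
    by (rule bexI[OF _ M_deg_zero]) (simp only: diff_self)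
  have p: "d1 ^ 2 * d2 = d1 * d1 * (d2 :: 'a M)" by (simp only: power2_eq_square)
  note s = zM.simps detecting.simps coh_deg.simps int_deg.simps cup3_even_odd \<gamma>3 \<gamma>_simps(2) \<gamma>_dbas3 dbas.simps p mult_1_right
  have ev: "even (0 :: int)" "even (2 :: int)" "\<not> even (1 :: int)" "\<not> even (3 :: int)" by simp_all
  show ?thesis
  proof (cases g)
    case Cbar thus ?thesis using C Yd by (simp only: coh_deg.simps int_deg.simps ev if_False detecting.simps) blast
  next
    case CbarDelta thus ?thesis using CD Yd' by (simp only: coh_deg.simps int_deg.simps ev if_False) blast
  qed (simp_all only: s ev if_True if_False, (rule o z)+)
qed

subsection \<open>Cosets\<close>

definition subgrp :: "'a::ab_group_add set \<Rightarrow> bool" where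
  "subgrp B \<longleftrightarrow> 0 \<in> B \<and> (\<forall>x\<in>B. \<forall>y\<in>B. x + y \<in> B \<and> x - y \<in> B)"

lemma subgrpD: "subgrp B \<Longrightarrow> 0 \<in> B" "subgrp B \<Longrightarrow> x \<in> B \<Longrightarrow> y \<in> B \<Longrightarrow> x + y \<in> B" "subgrp B \<Longrightarrow> x \<in> B \<Longrightarrow> y \<in> B \<Longrightarrow> x - y \<in> B"
  by (auto simp: subgrp_def)

lemma mem_coset: "x \<in> coset B u \<longleftrightarrow> x - u \<in> B"
  unfolding coset_def r_coset_def add_grp_def by (auto simp: diff_eq_eq) (metis diff_add_cancel)

lemma coset_eq: "subgrp B \<Longrightarrow> coset B u = coset B v \<longleftrightarrow> u - v \<in> B"
proof
  assume B: "subgrp B" and "coset B u = coset B v"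
  moreover have "u \<in> coset B u" by (simp add: mem_coset subgrpD B)
  ultimately show "u - v \<in> B" by (simp add: mem_coset)
next
  assume B: "subgrp B" and uv: "u - v \<in> B"
  have "x - u \<in> B \<longleftrightarrow> x - v \<in> B" for x
  proof
    assume "x - u \<in> B" from subgrpD(2)[OF B this uv] show "x - v \<in> B" by simp
  next
    assume "x - v \<in> B" from subgrpD(3)[OF B this uv] show "x - u \<in> B" by simp
  qed
  thus "coset B u = coset B v" by (auto simp: mem_coset)
qed

lemma induced_coset:
  assumes R: "subgrp R" and B: "subgrp B" and f: "\<And>x. x - u \<in> R \<Longrightarrow> f x - w \<in> B"
  shows "induced B f (coset R u) = coset B w"
proof -
  have "coset B (f x) = coset B w" if "x \<in> coset R u" for x using f that coset_eq[OF B] by (simp add: mem_coset)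
  moreover have "u \<in> coset R u" by (simp add: mem_coset subgrpD R)
  ultimately show ?thesis unfolding induced_def by blast
qed

lemma carrier_Mod: "carrier (add_grp A Mod R) = coset R ` A"
  unfolding FactGroup_def RCOSETS_def coset_def r_coset_def add_grp_def by auto

lemma mult_Mod:
  assumes R: "subgrp R"
  shows "coset R a \<otimes>\<^bsub>add_grp A Mod R\<^esub> coset R b = coset R (a + b)"
proof -
  have "coset R a \<otimes>\<^bsub>add_grp A Mod R\<^esub> coset R b = {x + y | x y. x - a \<in> R \<and> y - b \<in> R}"
    unfolding FactGroup_def set_mult_def by (auto simp: mem_coset add_grp_def) blast
  also have "\<dots> = coset R (a + b)"
  proof (intro equalityI subsetI)
    fix z assume "z \<in> {x + y | x y. x - a \<in> R \<and> y - b \<in> R}"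
    then obtain x y where xy: "z = x + y" "x - a \<in> R" "y - b \<in> R" by blast
    from subgrpD(2)[OF R xy(2,3)] show "z \<in> coset R (a + b)" by (simp add: mem_coset xy(1) add_diff_add)
  next
    fix z assume "z \<in> coset R (a + b)"
    hence "z - b - a \<in> R" by (simp add: mem_coset algebra_simps)
    moreover have "b - b \<in> R" by (simp add: subgrpD R)
    moreover have "z = (z - b) + b" by simp
    ultimately show "z \<in> {x + y | x y. x - a \<in> R \<and> y - b \<in> R}" by blast
  qed
  finally show ?thesis .
qed

text \<open>A version of the first isomorphism theorem for a map that is additive only modulo
  \<open>B\<close>, as maps depending on lifts from W/9 are.\<close>

lemma iso_induced:
  assumes sub: "subgrp A" "subgrp R" "subgrp B" "R \<subseteq> A"
    and Z: "\<And>x. x \<in> A \<Longrightarrow> h x \<in> Z"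
    and add: "\<And>x y. x \<in> A \<Longrightarrow> y \<in> A \<Longrightarrow> h (x + y) - (h x + h y) \<in> B"
    and ker: "\<And>x. x \<in> A \<Longrightarrow> h x \<in> B \<longleftrightarrow> x \<in> R"
    and surj: "\<And>z. z \<in> Z \<Longrightarrow> \<exists>x\<in>A. z - h x \<in> B"
  shows "\<And>a. a \<in> A \<Longrightarrow> induced B h (coset R a) = coset B (h a)"
    and "induced B h \<in> iso (add_grp A Mod R) (add_grp Z Mod B)"
proof -
  have diff: "(h x - h y) - h (x - y) \<in> B" if "x \<in> A" "y \<in> A" for x y
    using add[OF subgrpD(3)[OF sub(1) that] that(2)] by (simp add: algebra_simps)
  have key: "h x - h y \<in> B \<longleftrightarrow> x - y \<in> R" if xy: "x \<in> A" "y \<in> A" for x y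
  proof -
    have "h x - h y \<in> B \<longleftrightarrow> h (x - y) \<in> B"
    proof
      assume "h x - h y \<in> B" from subgrpD(3)[OF sub(3) this diff[OF xy]] show "h (x - y) \<in> B" by simp
    next
      assume "h (x - y) \<in> B" from subgrpD(2)[OF sub(3) diff[OF xy] this] show "h x - h y \<in> B" by simp
    qed
    thus ?thesis using ker[OF subgrpD(3)[OF sub(1) xy]] by simp
  qed
  show ind: "induced B h (coset R a) = coset B (h a)" if a: "a \<in> A" for a
  proof (rule induced_coset[OF sub(2,3)])
    fix x assume "x - a \<in> R"
    hence "x - a \<in> A" using sub(4) by blast
    from subgrpD(2)[OF sub(1) this a] have "x \<in> A" by simp
    with key[OF this a] \<open>x - a \<in> R\<close> show "h x - h a \<in> B" by blast
  qed
  show "induced B h \<in> iso (add_grp A Mod R) (add_grp Z Mod B)"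
    unfolding iso_def hom_def bij_betw_def inj_on_def carrier_Mod
  proof (intro CollectI conjI ballI impI)
    show "induced B h \<in> coset R ` A \<rightarrow> coset B ` Z" using ind Z by auto
  next
    fix U V assume "U \<in> coset R ` A" "V \<in> coset R ` A"
    then obtain x y where xy: "x \<in> A" "y \<in> A" "U = coset R x" "V = coset R y" by blast
    have "induced B h (coset R (x + y)) = coset B (h x + h y)"
      unfolding ind[OF subgrpD(2)[OF sub(1) xy(1,2)]] coset_eq[OF sub(3)] by (rule add[OF xy(1,2)])
    thus "induced B h (U \<otimes>\<^bsub>add_grp A Mod R\<^esub> V) = induced B h U \<otimes>\<^bsub>add_grp Z Mod B\<^esub> induced B h V"
      unfolding xy(3,4) mult_Mod[OF sub(2)] ind[OF xy(1)] ind[OF xy(2)] mult_Mod[OF sub(3)] .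
  next
    fix U V assume "U \<in> coset R ` A" "V \<in> coset R ` A" and e: "induced B h U = induced B h V"
    then obtain x y where xy: "x \<in> A" "y \<in> A" "U = coset R x" "V = coset R y" by blast
    from e show "U = V" unfolding xy(3,4) ind[OF xy(1)] ind[OF xy(2)] coset_eq[OF sub(3)] coset_eq[OF sub(2)] key[OF xy(1,2)] .
  next
    show "induced B h ` (coset R ` A) = coset B ` Z"
    proof (intro equalityI subsetI)
      fix V assume "V \<in> induced B h ` (coset R ` A)" thus "V \<in> coset B ` Z" using ind Z by auto
    next
      fix V assume "V \<in> coset B ` Z"
      then obtain z where z: "z \<in> Z" "V = coset B z" by blast
      obtain x where x: "x \<in> A" "z - h x \<in> B" using surj[OF z(1)] by blast
      hence "V = induced B h (coset R x)" unfolding z(2) ind[OF x(1)] coset_eq[OF sub(3)] by blast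
      thus "V \<in> induced B h ` (coset R ` A)" using x(1) by blast
    qed
  qed
qed

subsection \<open>The free module and its relations\<close>

lemma module_free: "module (free_smult :: 'w::strict_3_ring S \<Rightarrow> _)"
  by unfold_locales (simp_all add: free_smult_def fun_eq_iff algebra_simps)

definition relK :: "(gen \<Rightarrow> 'w::strict_3_ring S) set" where
  "relK = {f. \<forall>g. if g \<in> {One, Cbar} then \<exists>x y. f g = 3 * S_s1 * x + 3 * S_s2 * y else \<exists>x. f g = 3 * x}"

lemma relK_D:
  "f \<in> relK \<Longrightarrow> g \<in> {One, Cbar} \<Longrightarrow> \<exists>x y. f g = 3 * S_s1 * x + 3 * S_s2 * y"
  "f \<in> relK \<Longrightarrow> g \<notin> {One, Cbar} \<Longrightarrow> \<exists>x. f g = 3 * x"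
  unfolding relK_def mem_Collect_eq by (drule spec[of _ g], simp only: if_True if_False)+

text \<open>Every relator is a multiple of a single generator, so membership in the submodule is
  decided separately at each generator.\<close>

lemma span_relators: "module.span free_smult relators = (relK :: (gen \<Rightarrow> 'w::strict_3_ring S) set)"
proof (intro equalityI subsetI)
  fix f :: "gen \<Rightarrow> 'w S" assume "f \<in> module.span free_smult relators"
  thus "f \<in> relK"
  proof (induction rule: module.span_induct_alt[OF module_free, consumes 1, case_names zero step])
    case zero
    have "(0 :: 'w S) = 3 * S_s1 * 0 + 3 * S_s2 * 0" "(0 :: 'w S) = 3 * 0" by simp_all
    thus ?case unfolding relK_def by (simp only: zero_fun_apply mem_Collect_eq split: if_split) blast
  next
    case (step c x y)
    have y: "y \<in> relK" by (rule step.IH)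
    have x: "\<exists>a b. x g = 3 * S_s1 * a + 3 * S_s2 * b" if "g \<in> {One, Cbar}" for g
    proof -
      have "(0 :: 'w S) = 3 * S_s1 * 0 + 3 * S_s2 * 0" "3 * S_s1 = 3 * S_s1 * 1 + 3 * S_s2 * (0 :: 'w S)" "3 * S_s2 = 3 * S_s1 * 0 + 3 * S_s2 * (1 :: 'w S)"
        by simp_all
      moreover have "x g = 0 \<or> x g = 3 * S_s1 \<or> x g = 3 * S_s2"
        using step(1) that unfolding relators_def gen_times_def by auto
      ultimately show ?thesis by metis
    qed
    have x': "\<exists>a. x g = 3 * a" for g
    proof -
      have "x g = 0 \<or> x g = 3 * S_s1 \<or> x g = 3 * S_s2 \<or> x g = 3"
        using step(1) unfolding relators_def gen_times_def by auto
      moreover have "(0 :: 'w S) = 3 * 0" "(3 :: 'w S) = 3 * 1" by simp_all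
      ultimately show ?thesis by metis
    qed
    show ?case unfolding relK_def
    proof (intro CollectI allI)
      fix g
      show "if g \<in> {One, Cbar} then \<exists>a b. (free_smult c x + y) g = 3 * S_s1 * a + 3 * S_s2 * b else \<exists>a. (free_smult c x + y) g = 3 * a"
      proof (cases "g \<in> {One, Cbar}")
        case True
        obtain a b where ab: "x g = 3 * S_s1 * a + 3 * S_s2 * b" using x[OF True] by blast
        obtain a' b' where ab': "y g = 3 * S_s1 * a' + 3 * S_s2 * b'" using relK_D(1)[OF y True] by blast
        have "(free_smult c x + y) g = 3 * S_s1 * (c * a + a') + 3 * S_s2 * (c * b + b')"
          unfolding plus_fun_apply free_smult_def ab ab' by (simp only: distrib_left mult_ac add_ac)
        thus ?thesis using True by (simp only: if_True) blast
      next
        case False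
        obtain a where a: "x g = 3 * a" using x' by blast
        obtain a' where a': "y g = 3 * a'" using relK_D(2)[OF y False] by blast
        have "(free_smult c x + y) g = 3 * (c * a + a')"
          unfolding plus_fun_apply free_smult_def a a' by (simp only: distrib_left mult_ac)
        thus ?thesis using False by (simp only: if_False) blast
      qed
    qed
  qed
next
  let ?S = "module.span free_smult (relators :: (gen \<Rightarrow> 'w S) set)"
  fix f :: "gen \<Rightarrow> 'w S" assume f: "f \<in> relK"
  have sc: "gen_times g (r * x) \<in> ?S" if "gen_times g r \<in> relators" for g r x
  proof -
    have "gen_times g (r * x) = free_smult x (gen_times g r)" by (rule ext) (simp add: gen_times_def free_smult_def mult.commute)
    thus ?thesis using module.span_scale[OF module_free module.span_base[OF module_free that], of x] by (simp only:)
  qed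
  have "gen_times g (f g) \<in> ?S" for g
  proof (cases "g \<in> {One, Cbar}")
    case True
    obtain x y where xy: "f g = 3 * S_s1 * x + 3 * S_s2 * y" using relK_D(1)[OF f True] by blast
    have "gen_times g (f g) = gen_times g (3 * S_s1 * x) + gen_times g (3 * S_s2 * y)"
      unfolding xy by (rule ext) (simp add: gen_times_def)
    moreover have "gen_times g (3 * S_s1) \<in> relators" "gen_times g (3 * S_s2) \<in> relators" unfolding relators_def by blast+
    ultimately show ?thesis using module.span_add[OF module_free sc sc] by (simp only:)
  next
    case False
    obtain x where x: "f g = 3 * x" using relK_D(2)[OF f False] by blast
    have "gen_times g 3 \<in> relators" unfolding relators_def using False by blast
    thus ?thesis unfolding x by (rule sc)
  qed
  hence "(\<Sum>g\<in>UNIV. gen_times g (f g)) \<in> ?S" by (intro module.span_sum[OF module_free])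
  moreover have "(\<Sum>g\<in>UNIV. gen_times g (f g)) = f"
  proof (rule ext)
    fix h
    have "(\<Sum>g\<in>A. gen_times g (f g)) h = (\<Sum>g\<in>A. gen_times g (f g) h)" for A
      by (induction A rule: infinite_finite_induct) simp_all
    thus "(\<Sum>g\<in>UNIV. gen_times g (f g)) h = f h"
      using sum.delta[OF finite_gen, of h f] by (simp add: gen_times_def eq_commute)
  qed
  ultimately show "f \<in> ?S" by (simp only:)
qed

lemma liftS_9:
  "\<exists>h. liftS (x + y) = liftS x + liftS y + 9 * h" "\<exists>h. liftS (x * y) = liftS x * liftS y + 9 * h" "\<exists>h. liftS (1 :: 'w::strict_3_ring S) = 1 + 9 * h"
  unfolding red_eq[symmetric] red_hom red_liftS collapse_hom by (rule refl)+

text \<open>The summand 9 a of an element of \<open>Jid\<close> dies over W/9, which leaves the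
  ideal of 3 s1 and 3 s2. The section \<open>unlift\<close> makes the two coefficients homogeneous
  in the shifted degrees.\<close>

lemma Jid_liftS:
  assumes x: "x \<in> S_deg p l"
  shows "Jid (liftS x) \<longleftrightarrow> (\<exists>y z. x = 3 * S_s1 * y + 3 * S_s2 * z)"
proof
  assume "Jid (liftS x)"
  then obtain a b c where e: "liftS x = 3 * (3 * a + t1 * b + t2 * c)" unfolding Jid_def by blast
  have e': "3 * (3 * a + t1 * b + t2 * c) = 9 * a + 3 * (t1 * b) + 3 * (t2 * c)" by (simp add: distrib_left)
  have "x = unlift p l (9 * a + 3 * (t1 * b) + 3 * (t2 * c))" using unlift_liftS[OF x] unfolding e e' ..
  also have "\<dots> = 3 * S_s1 * unlift p (l + 6) b + 3 * S_s2 * unlift p (l + 12) c"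
    by (simp only: unlift_add unlift_9 unlift_mult add_0_left mult.assoc)
  finally show "\<exists>y z. x = 3 * S_s1 * y + 3 * S_s2 * z" by blast
next
  assume "\<exists>y z. x = 3 * S_s1 * y + 3 * S_s2 * z"
  then obtain y z where e: "x = 3 * S_s1 * y + 3 * S_s2 * z" by blast
  have "red (liftS x) = red (3 * t1 * liftS y + 3 * t2 * liftS z)"
    unfolding red_liftS red_hom e collapse_hom ..
  then obtain h where "liftS x = 3 * t1 * liftS y + 3 * t2 * liftS z + 9 * h" unfolding red_eq by blast
  also have "\<dots> = 3 * (3 * h + t1 * liftS y + t2 * liftS z)" by (simp add: algebra_simps)
  finally show "Jid (liftS x)" unfolding Jid_def by blast
qed

lemma Tid_liftS:
  assumes x: "x \<in> S_deg p l"
  shows "Tid (liftS x) \<longleftrightarrow> (\<exists>y. x = 3 * y)"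
proof
  assume "Tid (liftS x)"
  then obtain a where e: "liftS x = 3 * a" unfolding Tid_def by blast
  have "x = 3 * unlift p l a" using unlift_liftS[OF x] unfolding e unlift_mult ..
  thus "\<exists>y. x = 3 * y" ..
next
  assume "\<exists>y. x = 3 * y"
  then obtain y where e: "x = 3 * y" by blast
  have "red (liftS x) = red (3 * liftS y)" unfolding red_liftS red_hom e collapse_hom ..
  then obtain h where "liftS x = 3 * liftS y + 9 * h" unfolding red_eq by blast
  also have "\<dots> = 3 * (liftS y + 3 * h)" by (simp add: algebra_simps)
  finally show "Tid (liftS x)" unfolding Tid_def by blast
qed

lemma crit_liftS:
  assumes "f \<in> Free_deg q n"
  shows "crit (\<lambda>g. liftS (f g)) \<longleftrightarrow> f \<in> Rel_deg q n"
proof -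
  have d: "f g \<in> S_deg (q - coh_deg g) (n - int_deg g)" for g using assms by (simp add: Free_deg_def)
  have "crit (\<lambda>g. liftS (f g)) \<longleftrightarrow> f \<in> relK"
    unfolding crit_def relK_def mem_Collect_eq Jid_liftS[OF d] Tid_liftS[OF d] ..
  thus ?thesis using assms by (simp only: Rel_deg_def span_relators Int_iff simp_thms)
qed

text \<open>Multiples of 9 satisfy the criterion, so another choice of lifts changes a combination
  of generators by a coboundary only.\<close>

lemma crit_9: "(\<And>g. \<exists>h. a g = 9 * h) \<Longrightarrow> crit a"
  unfolding crit_def using Jid_closed(4) Tid_closed(4) by metis

lemma subgrp_Free: "subgrp (Free_deg q n)"
proof -
  have "x - y \<in> S_deg p l" if "x \<in> S_deg p l" "y \<in> S_deg p l" for x y :: "'a S" and p l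
    using S_deg_closed(2)[OF that(1) S_deg_closed(3)[OF that(2)]] by simp
  thus ?thesis unfolding subgrp_def Free_deg_def by (simp add: S_deg_closed)
qed

lemma subgrp_Rel: "subgrp (Rel_deg q n)"
  unfolding subgrp_def Rel_deg_def
proof (intro conjI ballI IntI; (elim IntE)?)
  show "0 \<in> module.span free_smult relators" by (rule module.span_zero[OF module_free])
  show "0 \<in> Free_deg q n" by (rule subgrpD(1)[OF subgrp_Free])
  fix x y :: "gen \<Rightarrow> 'a S"
  assume s: "x \<in> module.span free_smult relators" "y \<in> module.span free_smult relators" and f: "x \<in> Free_deg q n" "y \<in> Free_deg q n"
  show "x + y \<in> module.span free_smult relators" by (rule module.span_add[OF module_free s])
  show "x - y \<in> module.span free_smult relators" by (rule module.span_diff[OF module_free s])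
  show "x + y \<in> Free_deg q n" by (rule subgrpD(2)[OF subgrp_Free f])
  show "x - y \<in> Free_deg q n" by (rule subgrpD(3)[OF subgrp_Free f])
qed

lemma subgrp_Mhat_deg: "subgrp (Mhat_deg n)"
  unfolding subgrp_def by (simp add: Mhat_deg_closed)

lemma add_map_tate_d': "add_map g \<Longrightarrow> add_map (tate_d k g q)"
proof -
  assume g: "add_map g"
  have "(g ^^ i) (x + y) = (g ^^ i) x + (g ^^ i) y" for i x y by (induction i) (simp_all add: add_map_add[OF g])
  thus ?thesis by (intro add_mapI) (simp add: tate_d_def sum.distrib add_map_add[OF g])
qed

lemma subgrp_image:
  assumes h: "add_map h" and A: "subgrp A"
  shows "subgrp (h ` A)"
  unfolding subgrp_def
proof (intro conjI ballI)
  show "0 \<in> h ` A" using imageI[OF subgrpD(1)[OF A], of h] unfolding add_map_0[OF h] .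
  fix x y assume "x \<in> h ` A" "y \<in> h ` A"
  then obtain x' y' where xy: "x = h x'" "y = h y'" "x' \<in> A" "y' \<in> A" by blast
  show "x + y \<in> h ` A" unfolding xy(1,2) add_map_add[OF h, symmetric] by (rule imageI[OF subgrpD(2)[OF A xy(3,4)]])
  show "x - y \<in> h ` A" unfolding xy(1,2) add_map_diff[OF h, symmetric] by (rule imageI[OF subgrpD(3)[OF A xy(3,4)]])
qed

lemma subgrp_tate_B: "add_map g \<Longrightarrow> subgrp A \<Longrightarrow> subgrp (tate_B k g A q)"
  unfolding tate_B_def by (intro subgrp_image add_map_tate_d')

lemma add_map_\<gamma>_hat3: "add_map (\<gamma>_hat ^^ 3)"
  by (rule add_mapI) (simp add: numeral_3_eq_3 \<gamma>_hat_add)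

subsection \<open>The isomorphism\<close>

locale detecting_cocycle =
  fixes c :: "'w::strict_3_ring M" and u v e m :: 'w
  assumes c: "c = M_const u * xM 0 + M_const v * xM 3" and unit: "e * (u + v) = 1 + 3 * m"
begin

definition z :: "gen \<Rightarrow> 'w Mhat" where "z g = hat_of_M (zM u v c g)"

lemma Lam_z: "Lam (z g) = zeta u v g"
  unfolding z_def Lam_hat_of_M by (rule RM_zM[OF c])

lemma z_deg: "z g \<in> Mhat_deg (int_deg g)"
  unfolding z_def by (intro Mhat_deg_closed(6) zM_deg c)

definition Xi :: "(gen \<Rightarrow> 'w S) \<Rightarrow> 'w Mhat" where "Xi f = (\<Sum>g\<in>UNIV. S_cochain (f g) * z g)"

lemma Lam_Xi: "Lam (Xi f) = Zs u v (\<lambda>g. liftS (f g))"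
  unfolding Xi_def Zs_def add_map_sum[OF add_map_Lam] Lam_S_cochain Lam_z ..

lemma Xi_deg: "f \<in> Free_deg q n \<Longrightarrow> Xi f \<in> Mhat_deg n"
  unfolding Xi_def
proof (rule Mhat_deg_sum)
  fix g assume "f \<in> Free_deg q n"
  hence "f g \<in> S_deg (q - coh_deg g) (n - int_deg g)" by (simp add: Free_deg_def)
  from Mhat_deg_closed(3)[OF S_cochain_deg[OF this] z_deg[of g]] show "S_cochain (f g) * z g \<in> Mhat_deg n" by simp
qed

lemma supp_liftS: "f \<in> Free_deg q n \<Longrightarrow> supp q (\<lambda>g. liftS (f g))"
  unfolding supp_def
proof (intro allI impI)
  fix g assume "f \<in> Free_deg q n" and o: "odd (q - coh_deg g)"
  hence "f g \<in> S_deg (q - coh_deg g) (n - int_deg g)" by (simp add: Free_deg_def)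
  hence "f g = 0" using S_deg_odd o by blast
  thus "liftS (f g) = 0" by (intro fps2_eqI) (simp add: liftS_def)
qed

abbreviation B :: "int \<Rightarrow> int \<Rightarrow> 'w Mhat set" where "B q n \<equiv> tate_B 9 \<gamma>_hat (Mhat_deg n) q"
abbreviation Z :: "int \<Rightarrow> int \<Rightarrow> 'w Mhat set" where "Z q n \<equiv> tate_Z 9 \<gamma>_hat (Mhat_deg n) q"

lemma subgrp_B: "subgrp (B q n)"
  by (intro subgrp_tate_B add_map_\<gamma>_hat subgrp_Mhat_deg)

lemma Xi_Z: "f \<in> Free_deg q n \<Longrightarrow> Xi f \<in> Z q n"
  unfolding tate_Z_iff[OF Xi_deg] Lam_Xi by (intro Zs_cocycle supp_liftS)

lemma Xi_B: "f \<in> Free_deg q n \<Longrightarrow> Xi f \<in> B q n \<longleftrightarrow> f \<in> Rel_deg q n"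
  unfolding tate_B_iff[OF Xi_deg] Lam_Xi Zs_cob[OF unit supp_liftS] crit_liftS ..

lemma cob_9: "supp q a \<Longrightarrow> (\<And>g. \<exists>h. a g = 9 * h) \<Longrightarrow> cob q (Zs u v a)"
  unfolding Zs_cob[OF unit] by (rule crit_9)

lemma Xi_add:
  assumes "f \<in> Free_deg q n" "g \<in> Free_deg q n"
  shows "Xi (f + g) - (Xi f + Xi g) \<in> B q n"
proof -
  note fg = subgrpD(2)[OF subgrp_Free assms]
  have "Xi (f + g) - (Xi f + Xi g) \<in> Mhat_deg n"
    by (intro Mhat_deg_closed(7) Mhat_deg_closed(2) Xi_deg[OF fg] Xi_deg[OF assms(1)] Xi_deg[OF assms(2)])
  moreover have "Lam (Xi (f + g) - (Xi f + Xi g)) = Zs u v (\<lambda>h. liftS ((f + g) h) - (liftS (f h) + liftS (g h)))"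
    by (simp only: add_map_diff[OF add_map_Lam] Lam_add Lam_Xi Zs_diff Zs_add)
  moreover have "cob q (Zs u v (\<lambda>h. liftS ((f + g) h) - (liftS (f h) + liftS (g h))))"
  proof (rule cob_9)
    show "supp q (\<lambda>h. liftS ((f + g) h) - (liftS (f h) + liftS (g h)))"
      using supp_liftS[OF fg] supp_liftS[OF assms(1)] supp_liftS[OF assms(2)] unfolding supp_def by simp
    fix h
    show "\<exists>k. liftS ((f + g) h) - (liftS (f h) + liftS (g h)) = 9 * k"
      using liftS_9(1)[of "f h" "g h"] by auto
  qed
  ultimately show ?thesis by (simp only: tate_B_iff)
qed

lemma Xi_surj:
  assumes x: "x \<in> Z q n"
  shows "\<exists>f\<in>Free_deg q n. x - Xi f \<in> B q n"
proof (cases "even n")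
  case False
  have xn: "x \<in> Mhat_deg n" using x by (simp add: tate_Z_def)
  have 0: "0 \<in> Free_deg q n" by (rule subgrpD(1)[OF subgrp_Free])
  have "x - Xi 0 = 0" using Mhat_deg_odd[OF Mhat_deg_closed(7)[OF xn Xi_deg[OF 0]] False] .
  thus ?thesis using 0 subgrpD(1)[OF subgrp_B] by metis
next
  case True
  then obtain k where n: "n = - 2 * (- k)" by (auto elim: evenE)
  define N where "N = - k"
  have n: "n = - 2 * N" by (simp add: n N_def)
  have xn: "x \<in> Mhat_deg n" using x by (simp add: tate_Z_def)
  have "tate_d 9 \<gamma>N q (Lam x) = 0" using x unfolding tate_Z_iff[OF xn] .
  from Zs_surj[OF unit this] obtain a where a: "supp q a" "cob q (Lam x - Zs u v a)" by blast
  define r where "r g = - (int_deg g div 2)" for g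
  have r: "int_deg g = - 2 * r g" for g by (cases g) (simp_all add: r_def)
  \<comment> \<open>The coefficients found in \<open>N\<close> may mix degrees; projecting the whole
    relation to the degree of \<open>x\<close> cuts each of them to the degree that its generator
    requires.\<close>
  define b where "b g = hpartU (N - r g) (a g)" for g
  have NGz: "NG (r g) (zeta u v g)" for g using NG_Lam[of "z g" "r g"] z_deg[of g] unfolding r Lam_z by blast
  have Zb: "hpart N (Zs u v a) = Zs u v b"
    unfolding Zs_def add_map_sum[OF add_map_hpart] hpart_nsc[OF NGz] b_def ..
  have Lx: "hpart N (Lam x) = Lam x" using xn unfolding n by (intro hpart_NG NG_Lam)
  from a(2) obtain y where y: "Lam x - Zs u v a = tate_d 9 \<gamma>N (q - 1) y" unfolding cob_def by blast
  have "Lam x - Zs u v b = tate_d 9 \<gamma>N (q - 1) (hpart N y)"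
    unfolding hpart_tate_d[symmetric] y[symmetric] add_map_diff[OF add_map_hpart] Zb Lx ..
  hence cb: "cob q (Lam x - Zs u v b)" unfolding cob_def by blast
  have b0: "b g = 0" if "odd (q - coh_deg g)" for g
    using a(1) that unfolding supp_def b_def by (intro fps2_eqI) (simp add: hpartU_def)
  define f where "f g = unlift (q - coh_deg g) (n - int_deg g) (b g)" for g
  have "f g \<in> S_deg (q - coh_deg g) (n - int_deg g)" for g
    using unlift_deg[of "q - coh_deg g"] b0[of g] S_deg_closed(1) unlift_zero unfolding f_def by metis
  hence f: "f \<in> Free_deg q n" by (simp add: Free_deg_def)
  have fb: "\<exists>h. liftS (f g) = b g + 9 * h" for g
    unfolding red_eq[symmetric] red_liftS f_def
  proof (rule collapse_unlift)
    fix i j assume "\<not> 18 dvd (- 6 * int i - 12 * int j - (n - int_deg g))"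
    moreover have "- 6 * int i - 12 * int j - (n - int_deg g) = 2 * (N - r g - 3 * int i - 6 * int j)" unfolding n r by simp
    moreover have "(18 :: int) = 2 * 9" by simp
    ultimately have "\<not> 9 dvd (N - r g - 3 * int i - 6 * int j)" by (metis mult_dvd_mono dvd_refl)
    thus "fps_nth (fps_nth (b g) i) j = 0" unfolding b_def hpartU_def by simp
  qed
  have "Lam (x - Xi f) = (Lam x - Zs u v b) - Zs u v (\<lambda>g. liftS (f g) - b g)"
    unfolding add_map_diff[OF add_map_Lam] Lam_Xi Zs_diff by simp
  moreover have "cob q (Zs u v (\<lambda>g. liftS (f g) - b g))"
  proof (rule cob_9)
    show "supp q (\<lambda>g. liftS (f g) - b g)" using supp_liftS[OF f] b0 unfolding supp_def by simp
    fix g show "\<exists>h. liftS (f g) - b g = 9 * h" using fb[of g] by auto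
  qed
  ultimately have "cob q (Lam (x - Xi f))" using cob_closed(3)[OF cb] by (simp only:)
  hence "x - Xi f \<in> B q n" by (simp only: tate_B_iff[OF Mhat_deg_closed(7)[OF xn Xi_deg[OF f]]])
  with f show ?thesis by blast
qed

definition \<phi> :: "int \<Rightarrow> int \<Rightarrow> (gen \<Rightarrow> 'w S) set \<Rightarrow> 'w Mhat set" where "\<phi> q n = induced (B q n) Xi"

lemma Rel_Free: "Rel_deg q n \<subseteq> Free_deg q n"
  by (simp add: Rel_deg_def)

lemmas iso = iso_induced[OF subgrp_Free subgrp_Rel subgrp_B Rel_Free Xi_Z Xi_add Xi_B Xi_surj]

lemma \<phi>_coset: "f \<in> Free_deg q n \<Longrightarrow> \<phi> q n (coset (Rel_deg q n) f) = coset (B q n) (Xi f)"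
  unfolding \<phi>_def by (rule iso(1))

lemma \<phi>_iso: "\<phi> q n \<in> iso (Pres q n) (HC9 q n)"
  unfolding \<phi>_def Pres_def HC9_def tate_H_def by (rule iso(2))

lemma free_smult_deg: "x \<in> S_deg p l \<Longrightarrow> f \<in> Free_deg q n \<Longrightarrow> free_smult x f \<in> Free_deg (q + p) (n + l)"
  unfolding Free_deg_def free_smult_def
proof (intro CollectI allI)
  fix g assume "x \<in> S_deg p l" "f \<in> {u. \<forall>g. u g \<in> S_deg (q - coh_deg g) (n - int_deg g)}"
  hence "x * f g \<in> S_deg (p + (q - coh_deg g)) (l + (n - int_deg g))" by (intro S_deg_closed(4)) blast+
  moreover have "p + (q - coh_deg g) = q + p - coh_deg g" "l + (n - int_deg g) = n + l - int_deg g" by simp_all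
  ultimately show "x * f g \<in> S_deg (q + p - coh_deg g) (n + l - int_deg g)" by (simp only:)
qed

text \<open>S lives in even cohomological degrees, where the cup product has no twist; in odd
  degrees both sides are 0.\<close>

lemma cup_S:
  assumes x: "(x :: 'w S) \<in> S_deg p l"
  shows "tate_cup 9 \<gamma>_hat p q (S_cochain x) \<alpha> = S_cochain x * \<alpha>"
proof (cases "even p")
  case False
  hence "x = 0" using S_deg_odd[OF x] by blast
  moreover have "(\<gamma>_hat ^^ i) 0 = (0 :: 'w Mhat)" for i by (induction i) (simp_all add: \<gamma>_hats)
  ultimately show ?thesis by (simp add: tate_cup_def S_cochain_0)
qed (simp add: tate_cup_def)

lemma \<phi>_act:
  assumes x: "x \<in> S_deg p l" and f: "f \<in> Free_deg q n"
  shows "\<phi> (q + p) (n + l) (Pres_act p l x q n (coset (Rel_deg q n) f)) = HC9_act p l x q n (\<phi> q n (coset (Rel_deg q n) f))"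
proof -
  have xf: "free_smult x f \<in> Free_deg (q + p) (n + l)" by (rule free_smult_deg[OF x f])
  have "Pres_act p l x q n (coset (Rel_deg q n) f) = coset (Rel_deg (q + p) (n + l)) (free_smult x f)"
    unfolding Pres_act_def
  proof (rule induced_coset[OF subgrp_Rel subgrp_Rel])
    fix y assume y: "y - f \<in> Rel_deg q n"
    have e: "free_smult x y - free_smult x f = free_smult x (y - f)"
      by (rule ext) (simp add: free_smult_def right_diff_distrib)
    show "free_smult x y - free_smult x f \<in> Rel_deg (q + p) (n + l)"
      using y free_smult_deg[OF x, of "y - f"] module.span_scale[OF module_free, of "y - f" relators x] unfolding e Rel_deg_def by blast
  qed
  hence L: "\<phi> (q + p) (n + l) (Pres_act p l x q n (coset (Rel_deg q n) f)) = coset (B (q + p) (n + l)) (Xi (free_smult x f))"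
    by (simp only: \<phi>_coset[OF xf])
  have ev: "even p \<or> x = 0" using S_deg_odd[OF x] by blast
  have cobs: "cob (q + p) (nsc (liftS x) w)" if "cob q w" for w
  proof (cases "even p")
    case True
    hence "tate_d 9 \<gamma>N (q + p - 1) y = tate_d 9 \<gamma>N (q - 1) y" for y :: "'w N" unfolding tate_d_N by simp
    thus ?thesis using cob_closed(4)[OF that, of "liftS x"] unfolding cob_def by simp
  next
    case False
    hence "x = 0" using ev by blast
    hence "liftS x = 0" by (intro fps2_eqI) (simp add: liftS_def)
    thus ?thesis by (simp only: nsc_simps cob_closed)
  qed
  have "HC9_act p l x q n (coset (B q n) (Xi f)) = coset (B (q + p) (n + l)) (Xi (free_smult x f))"
    unfolding HC9_act_def
  proof (rule induced_coset[OF subgrp_B subgrp_B])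
    fix y assume y: "y - Xi f \<in> B q n"
    have "B q n \<subseteq> Mhat_deg n" unfolding tate_B_def using Mhat_deg_tate_d by blast
    hence yd: "y - Xi f \<in> Mhat_deg n" using y by blast
    from Mhat_deg_closed(2)[OF this Xi_deg[OF f]] have "y \<in> Mhat_deg n" by simp
    from Mhat_deg_closed(3)[OF S_cochain_deg[OF x] this] have "S_cochain x * y \<in> Mhat_deg (n + l)" by (simp only: add.commute)
    hence d: "S_cochain x * y - Xi (free_smult x f) \<in> Mhat_deg (n + l)" by (intro Mhat_deg_closed(7) Xi_deg[OF xf])
    have "Lam (S_cochain x * y - Xi (free_smult x f)) = nsc (liftS x) (Lam (y - Xi f)) - Zs u v (\<lambda>g. liftS (free_smult x f g) - liftS x * liftS (f g))"
      unfolding add_map_diff[OF add_map_Lam] Lam_S_cochain Lam_Xi Zs_diff nsc_diff nsc_Zs by simp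
    moreover have "cob (q + p) (nsc (liftS x) (Lam (y - Xi f)))"
      using y unfolding tate_B_iff[OF yd] by (rule cobs)
    moreover have "cob (q + p) (Zs u v (\<lambda>g. liftS (free_smult x f g) - liftS x * liftS (f g)))"
    proof (rule cob_9)
      have 0: "liftS (0 :: 'w S) = 0" by (intro fps2_eqI) (simp add: liftS_def)
      have "liftS x * liftS (f g) = 0" if "odd (q + p - coh_deg g)" for g
      proof (cases "even p")
        case True
        hence "odd (q - coh_deg g)" using that by simp
        thus ?thesis using supp_liftS[OF f] unfolding supp_def by simp
      next
        case False
        thus ?thesis using ev by (simp add: 0)
      qed
      thus "supp (q + p) (\<lambda>g. liftS (free_smult x f g) - liftS x * liftS (f g))"
        using supp_liftS[OF xf] unfolding supp_def by simp
      fix g show "\<exists>h. liftS (free_smult x f g) - liftS x * liftS (f g) = 9 * h"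
        using liftS_9(2)[of x "f g"] unfolding free_smult_def by auto
    qed
    ultimately show "tate_cup 9 \<gamma>_hat p q (S_cochain x) y - Xi (free_smult x f) \<in> B (q + p) (n + l)"
      unfolding cup_S[OF x] tate_B_iff[OF d] using cob_closed(3) by (simp only:)
  qed
  thus ?thesis unfolding L \<phi>_coset[OF f] by (simp only:)
qed

theorem \<phi>_S_iso: "is_S_iso \<phi>"
  unfolding is_S_iso_def
proof (intro conjI allI ballI)
  show "\<phi> q n \<in> iso (Pres q n) (HC9 q n)" for q n by (rule \<phi>_iso)
  fix p l q n and x :: "'w S" and U :: "(gen \<Rightarrow> 'w S) set" assume x: "x \<in> S_deg p l" and "U \<in> carrier (Pres q n)"
  then obtain f where "f \<in> Free_deg q n" "U = coset (Rel_deg q n) f" unfolding Pres_def carrier_Mod by blast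
  thus "\<phi> (q + p) (n + l) (Pres_act p l x q n U) = HC9_act p l x q n (\<phi> q n U)" using \<phi>_act[OF x] by blast
qed

lemma \<phi>_gen: "\<phi> (coh_deg g) (int_deg g) (Pres_gen g) = HC9_class (coh_deg g) (int_deg g) (z g)"
proof -
  have "(1 :: 'w S) \<in> S_deg 0 0"
    by (auto simp: S_deg_def fps_one_nth lookup_one when_def zero_prod_def split: if_splits)
  hence f: "gen_times g (1 :: 'w S) \<in> Free_deg (coh_deg g) (int_deg g)"
    unfolding Free_deg_def gen_times_def by (simp add: S_deg_closed)
  define a where "a h = (if h = g then 1 else 0 :: 'w U)" for h
  have "Zs u v a = (\<Sum>h\<in>UNIV. if h = g then zeta u v g else 0)"
    unfolding Zs_def a_def by (intro sum.cong refl) (auto simp: nsc_def usc_def fun_eq_iff)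
  also have "\<dots> = zeta u v g" by (subst sum.delta[OF finite_gen]) simp
  finally have za: "zeta u v g = Zs u v a" ..
  have d: "Xi (gen_times g 1) - z g \<in> Mhat_deg (int_deg g)" by (intro Mhat_deg_closed(7) Xi_deg[OF f] z_deg)
  have 0: "liftS (0 :: 'w S) = 0" by (intro fps2_eqI) (simp add: liftS_def)
  have "cob (coh_deg g) (Zs u v (\<lambda>h. liftS (gen_times g 1 h) - a h))"
  proof (rule cob_9)
    show "supp (coh_deg g) (\<lambda>h. liftS (gen_times g 1 h) - a h)"
      using supp_liftS[OF f] unfolding supp_def a_def by auto
    fix h show "\<exists>k. liftS (gen_times g 1 h) - a h = 9 * k"
    proof (cases "h = g")
      case True thus ?thesis using liftS_9(3)[where 'w = 'w] unfolding gen_times_def a_def by auto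
    next
      case False thus ?thesis unfolding gen_times_def a_def by (intro exI[of _ 0]) (simp add: 0)
    qed
  qed
  hence "cob (coh_deg g) (Lam (Xi (gen_times g 1) - z g))"
    unfolding add_map_diff[OF add_map_Lam] Lam_Xi Lam_z za Zs_diff .
  hence "Xi (gen_times g 1) - z g \<in> B (coh_deg g) (int_deg g)" unfolding tate_B_iff[OF d] .
  thus ?thesis unfolding Pres_gen_def \<phi>_coset[OF f] HC9_class_def coset_eq[OF subgrp_B] .
qed

lemma res_z: "HC9_res (coh_deg g) (int_deg g) (HC9_class (coh_deg g) (int_deg g) (z g))
    = HC3_class (coh_deg g) (int_deg g) (hat_of_M (detecting c g))"
  unfolding HC9_res_def HC9_class_def HC3_class_def
proof (rule induced_coset[OF subgrp_B])
  let ?q = "coh_deg g" and ?n = "int_deg g"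
  let ?B = "tate_B 3 (\<gamma>_hat ^^ 3) (Mhat_deg ?n) ?q"
  show B3: "subgrp ?B" by (intro subgrp_tate_B add_map_\<gamma>_hat3 subgrp_Mhat_deg)
  have s3: "(\<Sum>i<3. (\<gamma>_hat ^^ i) x) = x + \<gamma>_hat x + \<gamma>_hat (\<gamma>_hat x)" for x :: "'w Mhat"
    by (simp add: eval_nat_numeral)
  have g3: "(\<gamma>_hat ^^ 3) x = \<gamma>_hat (\<gamma>_hat (\<gamma>_hat x))" for x :: "'w Mhat" by (simp add: numeral_3_eq_3)
  have ad: "add_map (tate_res 3 \<gamma>_hat ?q :: 'w Mhat \<Rightarrow> _)"
    by (intro add_mapI) (simp add: tate_res_def s3 \<gamma>_hat_add algebra_simps)
  fix x assume "x - z g \<in> B ?q ?n"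
  then obtain y where y: "y \<in> Mhat_deg ?n" "x - z g = tate_d 9 \<gamma>_hat (?q - 1) y" unfolding tate_B_def by blast
  have 1: "tate_res 3 \<gamma>_hat ?q (x - z g) \<in> ?B"
  proof (cases "even ?q")
    case True
    \<comment> \<open>The norm of C9 is the norm of C3 applied to the trace of \<gamma>, so the
      restriction of a norm is again a norm.\<close>
    define y' where "y' = y + \<gamma>_hat y + \<gamma>_hat (\<gamma>_hat y)"
    have "tate_res 3 \<gamma>_hat ?q (x - z g) = (\<Sum>i<9. (\<gamma>_hat ^^ i) y)" unfolding y(2) tate_res_def tate_d_def using True by simp
    also have "\<dots> = y' + (\<gamma>_hat ^^ 3) y' + (\<gamma>_hat ^^ 3) ((\<gamma>_hat ^^ 3) y')"
      unfolding g3 y'_def sum_funpow_9 \<gamma>_hats by (simp only: add_ac)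
    also have "\<dots> = tate_d 3 (\<gamma>_hat ^^ 3) (?q - 1) y'" using True by (simp add: tate_d_def eval_nat_numeral)
    finally have f: "tate_res 3 \<gamma>_hat ?q (x - z g) = tate_d 3 (\<gamma>_hat ^^ 3) (?q - 1) y'" .
    have "y' \<in> Mhat_deg ?n" unfolding y'_def by (intro Mhat_deg_closed(2) Mhat_deg_closed(5) y(1))
    thus ?thesis unfolding f tate_B_def by (rule imageI)
  next
    case False
    have "tate_res 3 \<gamma>_hat ?q (x - z g) = (\<gamma>_hat ^^ 3) y - y"
      unfolding y(2) tate_res_def tate_d_def s3 g3 using False by (simp add: \<gamma>_hats)
    also have "\<dots> = tate_d 3 (\<gamma>_hat ^^ 3) (?q - 1) y" using False by (simp add: tate_d_def)
    finally show ?thesis unfolding tate_B_def using y(1) by blast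
  qed
  have 2: "tate_res 3 \<gamma>_hat ?q (z g) - hat_of_M (detecting c g) \<in> ?B"
  proof -
    obtain y where y: "y \<in> M_deg ?n" "(if even ?q then zM u v c g else tr (zM u v c g)) - detecting c g = (if even ?q then 0 else \<gamma> (\<gamma> (\<gamma> y)) - y)"
      using res_zM[OF c, of g] by blast
    have "tate_res 3 \<gamma>_hat ?q (z g) = hat_of_M (if even ?q then zM u v c g else tr (zM u v c g))"
      unfolding tate_res_def s3 z_def tr_def hat_of_M_hom by (simp only: hat_of_M_hom split: if_split) simp
    hence e: "tate_res 3 \<gamma>_hat ?q (z g) - hat_of_M (detecting c g) = hat_of_M (if even ?q then 0 else \<gamma> (\<gamma> (\<gamma> y)) - y)"
      unfolding y(2)[symmetric] hat_of_M_hom(5) by (simp only:)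
    show ?thesis
    proof (cases "even ?q")
      case True
      have "hat_of_M (0 :: 'w M) = 0" using hat_of_M_hom(5)[of 0 0] by simp
      thus ?thesis unfolding e using True subgrpD(1)[OF B3] by simp
    next
      case False
      hence "tate_res 3 \<gamma>_hat ?q (z g) - hat_of_M (detecting c g) = tate_d 3 (\<gamma>_hat ^^ 3) (?q - 1) (hat_of_M y)"
        unfolding e by (simp add: tate_d_def g3 hat_of_M_hom)
      thus ?thesis unfolding tate_B_def using Mhat_deg_closed(6)[OF y(1)] by blast
    qed
  qed
  have "tate_res 3 \<gamma>_hat ?q x - hat_of_M (detecting c g) = tate_res 3 \<gamma>_hat ?q (x - z g) + (tate_res 3 \<gamma>_hat ?q (z g) - hat_of_M (detecting c g))"
    unfolding add_map_diff[OF ad] by simp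
  thus "tate_res 3 \<gamma>_hat ?q x - hat_of_M (detecting c g) \<in> ?B" using subgrpD(2)[OF B3 1 2] by (simp only:)
qed

end

theorem theorem5p2:
  fixes \<pi> :: "'w::strict_3_ring \<Rightarrow> 'k::field" and c :: "'w M"
  assumes "CARD('k) = 3 ^ 6"
    and "is_residue_map \<pi>"
    and "generates_H1 c"
  shows "\<exists>\<phi> :: int \<Rightarrow> int \<Rightarrow> (gen \<Rightarrow> 'w S) set \<Rightarrow> 'w Mhat set.
    is_S_iso \<phi> \<and>
    \<phi> 0 0 (Pres_gen One) = HC9_class 0 0 1 \<and>
    (\<forall>g. HC9_res (coh_deg g) (int_deg g) (\<phi> (coh_deg g) (int_deg g) (Pres_gen g))
         = HC3_class (coh_deg g) (int_deg g) (hat_of_M (detecting c g)))"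
proof -
  obtain u v e m where "c = M_const u * xM 0 + M_const v * xM 3" "e * (u + v) = 1 + 3 * m"
    using generates_H1_unit[OF assms(3)] by blast
  then interpret detecting_cocycle c u v e m by unfold_locales
  have "\<phi> 0 0 (Pres_gen One) = HC9_class 0 0 1"
    using \<phi>_gen[of One] by (simp only: coh_deg.simps int_deg.simps z_def zM.simps hat_of_M_hom)
  moreover have "HC9_res (coh_deg g) (int_deg g) (\<phi> (coh_deg g) (int_deg g) (Pres_gen g))
         = HC3_class (coh_deg g) (int_deg g) (hat_of_M (detecting c g))" for g
    unfolding \<phi>_gen by (rule res_z)
  ultimately show ?thesis using \<phi>_S_iso by blast
qed

end
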